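(* Let $u_0(x)$ be real-valued, smooth, decaying sufficiently fast as $|x|\to\infty$, with $-u_{0xx}(x)+1>0$ for all $x$. Let $S_0(z)$ and $\{z_n,v_n^{jl}\}$ be the scattering matrix and the residue parameters determined by $u_0$ (see context). Suppose that the associated $3\times 3$ matrix Riemann--Hilbert problem (see context) has a unique solution $\hat M(y,t,z)$ and that this solution satisfies the structural condition at $z=0$ $$\hat M(y,t,0)=\begin{pmatrix}\alpha&\beta&\bar\beta\\ \bar\beta&\alpha&\beta\\ \beta&\bar\beta&\alpha\end{pmatrix},\qquad \alpha=\bar\alpha=\frac13\Bigl(\hat q+1+\frac1{\hat q}\Bigr),\quad \beta=\frac13\Bigl(\hat q+\omega+\frac{\omega^2}{\hat q}\Bigr),\quad \omega=e^{2\pi i/3},$$ with some $\hat q(y,t)>0$ such that $\hat q\to1$ as $y\to\infty$. Define $x=x(y,t)$ by $\partial x/\partial y=\hat q^{-1}(y,t)$ and $x-y\to0$ as $y\to+\infty$; let $y(x,t)$ be the inverse function; and set $u(x,t):=\frac{\partial x}{\partial t}(y,t)\big|_{y=y(x,t)}$ and $q(x,t):=\hat q(y(x,t),t)$. Then: (i) $\hat q(y,t)$ satisfies $\left(\dfrac{\hat q_y}{\hat q}\right)_t=\hat q^2-\dfrac1{\hat q}$. (ii) $u(x,t)$ and $q(x,t)$ satisfy the system $q_t=-(uq)_x$, $u_{xx}=1-q^3$, which is equivalent to $u_{txx}-3u_x+3u_xu_{xx}+uu_{xxx}=0$. (iii) $u(x,t)$ satisfies the initial condition $u(x,0)=u_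0(x)$.
   Context: Notation: $\omega=e^{2\pi i/3}$; $\lambda_j(z)=z\omega^j$, $j=1,2,3$; $\Lambda(z)=\mathrm{diag}(\lambda_1,\lambda_2,\lambda_3)=z\,\mathrm{diag}(\omega,\omega^2,1)$. Scattering data of $u_0$. Put $q_0=(1-u_{0xx})^{1/3}$, $y_0(x)=x-\int_x^\infty(q_0(\xi)-1)\,d\xi$ and $$U(x)=\frac{q_{0x}}{3q_0}\begin{pmatrix}0&1-\omega^2&1-\omega\\1-\omega&0&1-\omega^2\\1-\omega^2&1-\omega&0\end{pmatrix}.$$ Let $M(x,0,z)$ be the $3\times3$ matrix solution of $$M_{jl}(x,0,z)=\delta_{jl}+\int_{\infty_{jl}}^x e^{(\lambda_j(z)-\lambda_l(z))\int_\xi^x q_0(\zeta)d\zeta}\,(UM)_{jl}(\xi,0,z)\,d\xi,$$ where $\infty_{jl}=+\infty$ if $\operatorname{Re}\lambda_j(z)\ge\operatorname{Re}\lambda_l(z)$ and $\infty_{jl}=-\infty$ if $\operatorname{Re}\lambda_j(z)<\operatorname{Re}\lambda_l(z)$. Let $\Sigma=\mathbb R\cup\omega\mathbb R\cup\omega^2\mathbb R$, with $\mathbb R$ oriented from left to right and $\omega\mathbb R,\omega^2\mathbb R$ oriented as its images under rotation by $\omega,\omega^2$; subscripts $+$ and $-$ denote limits from the left and the right side. $M$ is piecewise meromorphic relative to $\Sigma$. The matrix $S_0(z)$, $z\in\Sigma$, is defined by $M_+(x,0,z)=M_-(x,0,z)e^{y_0(x)\Lambda(z)}S_0(z)e^{-y_0(x)\Lambda(z)}$.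 Generically $M(x,0,\cdot)$ has at most finitely many poles $z_n$ in $\mathbb C\setminus\Sigma$, all simple, distinct columns having distinct poles; if $z_n$ is a pole of the $l$-th column, then for some $j\ne l$ and a constant $v_n^{jl}$, $\operatorname{Res}_{z=z_n}M^{(l)}(x,0,z)=M^{(j)}(x,0,z_n)v_n^{jl}e^{y_0(x)(\lambda_j(z_n)-\lambda_l(z_n))}$ (superscripts denote columns). Riemann--Hilbert problem: for each $y\in\mathbb R$, $t\ge0$ find a piecewise (relative to $\Sigma$) meromorphic $3\times3$ matrix function $\hat M(y,t,z)$ such that: (1) $\hat M_+(y,t,z)=\hat M_-(y,t,z)\,e^{y\Lambda(z)+t\Lambda^{-1}(z)}S_0(z)e^{-y\Lambda(z)-t\Lambda^{-1}(z)}$, $z\in\Sigma$; (2) $\hat M(y,t,z)=I+O(1/z)$ as $z\to\infty$; (3) $\operatorname{Res}_{z=z_n}\hat M^{(l)}(y,t,z)=\hat M^{(j)}(y,t,z_n)\,v_n^{jl}\,e^{y(\lambda_j(z_n)-\lambda_l(z_n))+t(\lambda_j^{-1}(z_n)-\lambda_l^{-1}(z_n))}$. $\hat M(y,t,0)$ denotes the limit as $z\to0$. *)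

theory Defs
  imports "HOL-Complex_Analysis.Complex_Analysis" "HOL-Library.Landau_Symbols"
begin

section \<open>Initial data\<close>

text \<open>``Smooth and decaying sufficiently fast'' is read as: \<open>f\<close> is a Schwartz function.\<close>

definition schwartz :: "(real \<Rightarrow> real) \<Rightarrow> bool" where
  "schwartz f \<longleftrightarrow>
     (\<forall>n x. ((deriv ^^ n) f) differentiable (at x)) \<and>
     (\<forall>n k. bounded (range (\<lambda>x. x ^ k * (deriv ^^ n) f x)))"

definition q_init :: "(real \<Rightarrow> real) \<Rightarrow> real \<Rightarrow> real" where
  "q_init u0 x = (1 - deriv (deriv u0) x) powr (1 / 3)"

definition y_init :: "(real \<Rightarrow> real) \<Rightarrow> real \<Rightarrow> real" where
  "y_init u0 x = x - (LBINT \<xi>=ereal x..\<infinity>. q_init u0 \<xi> - 1)"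

section \<open>The spectral parameter, the contour and its two sides\<close>

definition \<omega> :: complex where
  "\<omega> = exp (2 * of_real pi * \<i> / 3)"

text \<open>The index type \<open>3\<close> is used with the names \<open>1, 2, 3\<close> for its elements (so \<open>3 = 0\<close> there).\<close>

definition lam :: "complex \<Rightarrow> complex ^ 3" where
  "lam z = vector [z * \<omega>, z * \<omega> ^ 2, z * \<omega> ^ 3]"

definition diag_mat :: "complex ^ 3 \<Rightarrow> complex ^ 3 ^ 3" where
  "diag_mat d = (\<chi> i j. if i = j then d $ i else 0)"

text \<open>The exponent \<open>y \<Lambda>(z) + t \<Lambda>\<^sup>-\<^sup>1(z)\<close>, as the vector of its diagonal entries.\<close>

definition phase :: "real \<Rightarrow> real \<Rightarrow> complex \<Rightarrow> complex ^ 3" where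
  "phase y t z = (\<chi> j. of_real y * lam z $ j + of_real t * inverse (lam z $ j))"

text \<open>\<open>exp (D) S exp (- D)\<close> for the diagonal matrix \<open>D\<close> with diagonal \<open>d\<close>.\<close>

definition exp_conj :: "complex ^ 3 \<Rightarrow> complex ^ 3 ^ 3 \<Rightarrow> complex ^ 3 ^ 3" where
  "exp_conj d S = diag_mat (\<chi> j. exp (d $ j)) ** S ** diag_mat (\<chi> j. exp (- d $ j))"

text \<open>\<open>\<Sigma>\<close> is the union of the three lines through \<open>0\<close> with directions \<open>1, \<omega>, \<omega>\<^sup>2\<close>, each line
  oriented by its direction.\<close>

definition directions :: "complex set" where
  "directions = {1, \<omega>, \<omega> ^ 2}"

definition Sigma_contour :: "complex set" where
  "Sigma_contour = (\<Union>d\<in>directions. range (\<lambda>r. d * complex_of_real r))"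

definition left_side :: "complex \<Rightarrow> complex set" where
  "left_side d = {z. Im (z / d) > 0}"

definition right_side :: "complex \<Rightarrow> complex set" where
  "right_side d = {z. Im (z / d) < 0}"

text \<open>The three lines meet at \<open>0\<close>, where there is no left or right side: one-sided
  boundary values are taken on \<open>\<Sigma> - {0}\<close> only, and at \<open>0\<close> a limit from \<open>\<complex> - \<Sigma>\<close> is
  required instead. (Without a condition at \<open>0\<close>, multiplication from the left by
  \<open>I + A / z\<close> would preserve all conditions of the Riemann--Hilbert problem.)
  The values of \<open>M\<close> on \<open>\<Sigma>\<close> and on the exceptional set \<open>Z\<close> are irrelevant.\<close>

definition piecewise_holomorphic_off :: "complex set \<Rightarrow> (complex \<Rightarrow> complex ^ 3 ^ 3) \<Rightarrow> bool" where
  "piecewise_holomorphic_off Z M \<longleftrightarrow>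
     (\<forall>i k. (\<lambda>z. M z $ i $ k) holomorphic_on - (Sigma_contour \<union> Z)) \<and>
     (\<forall>d\<in>directions. \<forall>r::real. r \<noteq> 0 \<longrightarrow>
        (\<exists>L. (M \<longlongrightarrow> L) (at (d * of_real r) within left_side d)) \<and>
        (\<exists>L. (M \<longlongrightarrow> L) (at (d * of_real r) within right_side d))) \<and>
     (\<exists>L. (M \<longlongrightarrow> L) (at 0 within - Sigma_contour))"

definition jump_condition ::
    "(complex \<Rightarrow> complex ^ 3 ^ 3) \<Rightarrow> (complex \<Rightarrow> complex ^ 3 ^ 3) \<Rightarrow> bool" where
  "jump_condition M V \<longleftrightarrow>
     (\<forall>d\<in>directions. \<forall>r::real. r \<noteq> 0 \<longrightarrow>
        (\<exists>Mp Mm. (M \<longlongrightarrow> Mp) (at (d * of_real r) within left_side d) \<and>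
                 (M \<longlongrightarrow> Mm) (at (d * of_real r) within right_side d) \<and>
                 Mp = Mm ** V (d * of_real r)))"

text \<open>At the point \<open>p\<close> only the \<open>l\<close>-th column of \<open>M\<close> may be singular, with at most a simple
  pole, and its residue there is \<open>c\<close> times the value of the \<open>j\<close>-th column.\<close>

definition residue_condition ::
    "(complex \<Rightarrow> complex ^ 3 ^ 3) \<Rightarrow> complex \<Rightarrow> 3 \<Rightarrow> 3 \<Rightarrow> complex \<Rightarrow> bool" where
  "residue_condition M p l j c \<longleftrightarrow>
     (\<forall>i k. k \<noteq> l \<longrightarrow> (\<exists>L. (\<lambda>z. M z $ i $ k) \<midarrow>p\<rightarrow> L)) \<and>
     (\<forall>i. \<exists>L. (\<lambda>z. (z - p) * M z $ i $ l) \<midarrow>p\<rightarrow> L) \<and>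
     (\<forall>i. residue (\<lambda>z. M z $ i $ l) p = Lim (at p) (\<lambda>z. M z $ i $ j) * c)"

section \<open>Scattering data of the initial condition\<close>

definition U_mat :: "(real \<Rightarrow> real) \<Rightarrow> real \<Rightarrow> complex ^ 3 ^ 3" where
  "U_mat u0 x = (deriv (q_init u0) x / (3 * q_init u0 x)) *\<^sub>R
     vector [vector [0, 1 - \<omega> ^ 2, 1 - \<omega>],
             vector [1 - \<omega>, 0, 1 - \<omega> ^ 2],
             vector [1 - \<omega> ^ 2, 1 - \<omega>, 0]]"

definition infty_end :: "complex \<Rightarrow> 3 \<Rightarrow> 3 \<Rightarrow> ereal" where
  "infty_end z j l = (if Re (lam z $ j) \<ge> Re (lam z $ l) then \<infinity> else -\<infinity>)"

text \<open>The solution of the integral equation is sought among the bounded continuous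
  functions of \<open>x\<close>, for which all the integrals converge absolutely.\<close>

definition direct_solution ::
    "(real \<Rightarrow> real) \<Rightarrow> complex \<Rightarrow> (real \<Rightarrow> complex ^ 3 ^ 3) \<Rightarrow> bool" where
  "direct_solution u0 z m \<longleftrightarrow>
     continuous_on UNIV m \<and> bounded (range m) \<and>
     (\<forall>x j l. m x $ j $ l = (if j = l then 1 else 0) +
        (LBINT \<xi>=infty_end z j l..ereal x.
           exp ((lam z $ j - lam z $ l) * of_real (LBINT \<zeta>=ereal \<xi>..ereal x. q_init u0 \<zeta>))
             * (U_mat u0 \<xi> ** m \<xi>) $ j $ l))"

text \<open>\<open>M\<close> is the eigenfunction matrix of \<open>u0\<close> at time \<open>0\<close>, \<open>S0\<close> its scattering matrix, \<open>Z\<close> the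
  finite set of its poles off \<open>\<Sigma>\<close>; at a pole \<open>p\<close> the singular column is \<open>lc p\<close> and the
  residue is proportional to the column \<open>jc p\<close> with constant \<open>v p\<close>.
  Each pole belonging to one column only is part of the generic situation considered.\<close>

definition scattering_data ::
    "(real \<Rightarrow> real) \<Rightarrow> (real \<Rightarrow> complex \<Rightarrow> complex ^ 3 ^ 3) \<Rightarrow> (complex \<Rightarrow> complex ^ 3 ^ 3) \<Rightarrow>
     complex set \<Rightarrow> (complex \<Rightarrow> 3) \<Rightarrow> (complex \<Rightarrow> 3) \<Rightarrow> (complex \<Rightarrow> complex) \<Rightarrow> bool" where
  "scattering_data u0 M S0 Z lc jc v \<longleftrightarrow>
     finite Z \<and> Z \<inter> Sigma_contour = {} \<and>
     (\<forall>z. z \<notin> Sigma_contour \<union> Z \<longrightarrow> direct_solution u0 z (\<lambda>x. M x z)) \<and>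
     (\<forall>x. piecewise_holomorphic_off Z (M x)) \<and>
     (\<forall>x. jump_condition (M x) (\<lambda>z. exp_conj (of_real (y_init u0 x) *s lam z) (S0 z))) \<and>
     (\<forall>p\<in>Z. jc p \<noteq> lc p \<and>
        (\<exists>x i. is_pole (\<lambda>z. M x z $ i $ lc p) p) \<and>
        (\<forall>x. residue_condition (M x) p (lc p) (jc p)
               (v p * exp (of_real (y_init u0 x) * (lam p $ jc p - lam p $ lc p)))))"

section \<open>The Riemann--Hilbert problem\<close>

definition rhp_solution ::
    "(complex \<Rightarrow> complex ^ 3 ^ 3) \<Rightarrow> complex set \<Rightarrow> (complex \<Rightarrow> 3) \<Rightarrow> (complex \<Rightarrow> 3) \<Rightarrow>
     (complex \<Rightarrow> complex) \<Rightarrow> real \<Rightarrow> real \<Rightarrow> (complex \<Rightarrow> complex ^ 3 ^ 3) \<Rightarrow> bool" where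
  "rhp_solution S0 Z lc jc v y t N \<longleftrightarrow>
     piecewise_holomorphic_off Z N \<and>
     jump_condition N (\<lambda>z. exp_conj (phase y t z) (S0 z)) \<and>
     (\<forall>i k. (\<lambda>z. N z $ i $ k - mat 1 $ i $ k)
              \<in> O[inf at_infinity (principal (- Sigma_contour))](\<lambda>z. 1 / z)) \<and>
     (\<forall>p\<in>Z. residue_condition N p (lc p) (jc p)
               (v p * exp (of_real y * (lam p $ jc p - lam p $ lc p)
                         + of_real t * (inverse (lam p $ jc p) - inverse (lam p $ lc p)))))"

definition is_unique_rhp_solution ::
    "(complex \<Rightarrow> complex ^ 3 ^ 3) \<Rightarrow> complex set \<Rightarrow> (complex \<Rightarrow> 3) \<Rightarrow> (complex \<Rightarrow> 3) \<Rightarrow>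
     (complex \<Rightarrow> complex) \<Rightarrow> real \<Rightarrow> real \<Rightarrow> (complex \<Rightarrow> complex ^ 3 ^ 3) \<Rightarrow> bool" where
  "is_unique_rhp_solution S0 Z lc jc v y t N \<longleftrightarrow>
     rhp_solution S0 Z lc jc v y t N \<and>
     (\<forall>N'. rhp_solution S0 Z lc jc v y t N' \<longrightarrow>
           (\<forall>z. z \<notin> Sigma_contour \<union> Z \<longrightarrow> N' z = N z))"

definition structure_mat :: "real \<Rightarrow> complex ^ 3 ^ 3" where
  "structure_mat q =
     (let \<alpha> = complex_of_real ((q + 1 + 1 / q) / 3);
          \<beta> = (of_real q + \<omega> + \<omega> ^ 2 / of_real q) / 3
      in vector [vector [\<alpha>, \<beta>, cnj \<beta>],
                 vector [cnj \<beta>, \<alpha>, \<beta>],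
                 vector [\<beta>, cnj \<beta>, \<alpha>]])"

section \<open>The differential equations\<close>

text \<open>Time runs over \<open>t \<ge> 0\<close>; all time derivatives are taken within \<open>{0..}\<close>, hence are
  one-sided at \<open>t = 0\<close>. Each predicate asserts the existence of the derivatives occurring in it.\<close>

definition q_hat_equation :: "(real \<Rightarrow> real \<Rightarrow> real) \<Rightarrow> bool" where
  "q_hat_equation qh \<longleftrightarrow>
     (\<exists>qy. \<forall>y. \<forall>t\<ge>0.
        ((\<lambda>y. qh y t) has_real_derivative qy y t) (at y) \<and>
        ((\<lambda>t. qy y t / qh y t) has_real_derivative ((qh y t)\<^sup>2 - 1 / qh y t)) (at t within {0..}))"

definition xx_relation :: "(real \<Rightarrow> real \<Rightarrow> real) \<Rightarrow> (real \<Rightarrow> real \<Rightarrow> real) \<Rightarrow> bool" where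
  "xx_relation u q \<longleftrightarrow>
     (\<exists>ux. \<forall>x. \<forall>t\<ge>0.
        ((\<lambda>x. u x t) has_real_derivative ux x t) (at x) \<and>
        ((\<lambda>x. ux x t) has_real_derivative (1 - q x t ^ 3)) (at x))"

definition transport_equation :: "(real \<Rightarrow> real \<Rightarrow> real) \<Rightarrow> (real \<Rightarrow> real \<Rightarrow> real) \<Rightarrow> bool" where
  "transport_equation u q \<longleftrightarrow>
     (\<exists>qt. \<forall>x. \<forall>t\<ge>0.
        (\<lambda>x. q x t) differentiable (at x) \<and>
        ((\<lambda>t. q x t) has_real_derivative qt x t) (at t within {0..}) \<and>
        ((\<lambda>x. u x t * q x t) has_real_derivative - qt x t) (at x))"

text \<open>The mixed derivative is read as the time derivative of the second space derivative.\<close>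

definition short_wave_DP_equation :: "(real \<Rightarrow> real \<Rightarrow> real) \<Rightarrow> bool" where
  "short_wave_DP_equation u \<longleftrightarrow>
     (\<exists>ux uxx uxxx utxx. \<forall>x. \<forall>t\<ge>0.
        ((\<lambda>x. u x t) has_real_derivative ux x t) (at x) \<and>
        ((\<lambda>x. ux x t) has_real_derivative uxx x t) (at x) \<and>
        ((\<lambda>x. uxx x t) has_real_derivative uxxx x t) (at x) \<and>
        ((\<lambda>t. uxx x t) has_real_derivative utxx x t) (at t within {0..}) \<and>
        utxx x t - 3 * ux x t + 3 * ux x t * uxx x t + u x t * uxxx x t = 0)"

end

theory Submission
  imports Defs
begin

text \<open>No theory of Riemann--Hilbert problems is needed: a solution is exhibited, and the assumed
  uniqueness identifies it with \<open>Mhat\<close>. Writing \<open>qhat = exp w\<close>, equation (i) becomes the Goursat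
  problem \<open>w_yt = exp (2 w) - exp (- w)\<close> with \<open>w = ln q_init\<close> at time \<open>0\<close> (in the variable
  \<open>y = y_init x\<close>) and \<open>w\<close> vanishing at \<open>y = +\<infinity>\<close>; an energy estimate solves it on every strip
  \<open>y \<ge> a\<close>, \<open>0 \<le> t \<le> T\<close>. It is the compatibility condition of
  \<open>\<Phi>_y = (z dmat + w_y cmat0) \<Phi>\<close> and \<open>\<Phi>_t = z\<^sup>-\<^sup>1 Bmat w \<Phi>\<close>. Let \<open>F\<close> solve the second equation
  with \<open>F = 1\<close> at \<open>t = 0\<close>; it is entire in \<open>1 / z\<close>, and equal to \<open>1\<close> at \<open>1 / z = 0\<close>. Then
  \<open>F M exp (- t \<Lambda>\<^sup>-\<^sup>1)\<close> has the jumps, the residues and the normalization required at time \<open>t\<close>.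
  The delicate point is \<open>z = 0\<close>, where \<open>F\<close> has an essential singularity: after multiplication by
  \<open>Gmat (- w)\<close> the dressed matrix satisfies differential equations in \<open>y\<close> and \<open>t\<close> from which it is
  \<open>1 + O(z)\<close>, so that \<open>Mhat\<close> tends to \<open>Gmat w\<close>, the structure matrix of \<open>exp w\<close>. Hence
  \<open>qhat = exp w\<close>, and the rest is calculus in the variables \<open>x\<close> and \<open>y\<close>.\<close>

section \<open>Matrices of the Lax pair\<close>

text \<open>Uniqueness for the Riemann-Hilbert problem also replaces uniqueness for the nonlinear
  equation. Each strip solution equals \<open>ln qhat\<close>, so strips with different a and T
  agree, and \<open>qhat\<close> inherits its differentiability in y and t from them. The
  nonlinearity has slope at least 1, so its potential is coercive and the energy bounds w pointwise
  for all times; this excludes blow-up. At positive times there is no decay to rely on as y tends to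
  -infinity, because w_t is a one-sided tail integral. This decides the treatment of z = 0: at time
  0 the eigenfunctions are controlled on the whole line, but afterwards the entries that would have
  to be integrated from y = -infinity are followed in t instead. The exponents of the t-equation
  blow up like 1/|z|, which helps: their exponentials only decay, and a source of order one, divided
  by such an exponent, becomes O(z).\<close>

no_notation fps_nth (infixl "$" 75)

type_synonym cmat = "complex ^ 3 ^ 3"

lemma mat_scaleR_left: "(r *\<^sub>R A) ** B = r *\<^sub>R (A ** B)" for A B :: cmat
  by (simp add: vec_eq_iff matrix_matrix_mult_def scaleR_sum_right)

lemma mat_scaleR_right: "A ** (r *\<^sub>R B) = r *\<^sub>R (A ** B)" for A B :: cmat
  by (simp add: vec_eq_iff matrix_matrix_mult_def scaleR_sum_right)

lemma matrix_add_rdistrib': "(A + B) ** C = A ** C + B ** C" for A B :: cmat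
  by (simp add: vec_eq_iff matrix_matrix_mult_def sum.distrib ring_distribs)

text \<open>A bilinear map between finite-dimensional spaces is bounded. With this instance the
  product rule, limits, continuity and norm bounds for matrix products are special cases of general
  facts.\<close>

interpretation mm: bounded_bilinear "(**) :: cmat \<Rightarrow> cmat \<Rightarrow> cmat"
proof -
  have "bilinear ((**) :: cmat \<Rightarrow> cmat \<Rightarrow> cmat)"
    unfolding bilinear_def
    by (auto intro!: linearI simp: mat_scaleR_left mat_scaleR_right matrix_add_ldistrib matrix_add_rdistrib')
  then show "bounded_bilinear ((**) :: cmat \<Rightarrow> cmat \<Rightarrow> cmat)"
    by (simp add: bilinear_conv_bounded_bilinear)
qed

lemmas mat_distribs = mm.add_left mm.add_right mm.diff_left mm.diff_right mm.minus_left mm.minus_right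
  mm.scaleR_left mm.scaleR_right matrix_mul_assoc

definition dmat :: cmat where "dmat = diag_mat (lam 1)"
definition dinv :: cmat where "dinv = diag_mat (\<chi> j. inverse (lam 1 $ j))"
text \<open>\<open>P0\<close>, \<open>P1\<close>, \<open>P2\<close> project onto the three Fourier
  vectors of Z/3, the common eigenvectors of all circulant matrices; the structure matrix is
  circulant.\<close>

definition P0 :: cmat where
  "P0 = (\<chi> i j. 1 / 3)"
definition P1 :: cmat where
  "P1 = vector [vector [1 / 3, \<omega>\<^sup>2 / 3, \<omega> / 3], vector [\<omega> / 3, 1 / 3, \<omega>\<^sup>2 / 3], vector [\<omega>\<^sup>2 / 3, \<omega> / 3, 1 / 3]]"
definition P2 :: cmat where
  "P2 = vector [vector [1 / 3, \<omega> / 3, \<omega>\<^sup>2 / 3], vector [\<omega>\<^sup>2 / 3, 1 / 3, \<omega> / 3], vector [\<omega> / 3, \<omega>\<^sup>2 / 3, 1 / 3]]"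

section \<open>Arithmetic of omega and of the circulant projections\<close>

lemma omega_cube: "\<omega> ^ 3 = 1"
proof -
  have "\<omega> ^ 3 = exp (of_nat 3 * (2 * of_real pi * \<i> / 3))" unfolding \<omega>_def by (simp only: exp_of_nat_mult)
  also have "of_nat 3 * (2 * of_real pi * \<i> / 3) = 2 * of_real pi * \<i>" by simp
  finally show ?thesis by (simp only: exp_two_pi_i)
qed

lemma omega_ne_1: "\<omega> \<noteq> 1"
proof
  assume "\<omega> = 1"
  then obtain n :: int where n: "2 * complex_of_real pi * \<i> / 3 = of_int (2 * n) * of_real pi * \<i>"
    unfolding \<omega>_def exp_eq_1 by (auto simp: complex_eq_iff)
  then have "2 * complex_of_real pi * \<i> * (1 - of_int (3 * n)) = 0" by (simp add: field_simps)
  then have "1 = (of_int (3 * n) :: complex)" by simp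
  then have "(1::int) = 3 * n" by (metis of_int_1 of_int_eq_iff)
  then show False by presburger
qed

lemma omega_sq: "\<omega>\<^sup>2 = - 1 - \<omega>"
proof -
  have "(\<omega> - 1) * (\<omega>\<^sup>2 + \<omega> + 1) = \<omega> ^ 3 - 1" by (simp add: power2_eq_square power3_eq_cube algebra_simps)
  then have "\<omega>\<^sup>2 + \<omega> + 1 = 0" using omega_cube omega_ne_1 by simp
  then show ?thesis by (simp add: algebra_simps eq_neg_iff_add_eq_0)
qed

text \<open>Rewrite rules that bring polynomials in omega to the form a + b omega; the second one
  reaches products nested to the right.\<close>

lemma omega_mult: "\<omega> * \<omega> = - 1 - \<omega>" "\<omega> * (\<omega> * x) = - x - \<omega> * x"
proof -
  show *: "\<omega> * \<omega> = - 1 - \<omega>" using omega_sq by (simp add: power2_eq_square)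
  have "\<omega> * (\<omega> * x) = (\<omega> * \<omega>) * x" by (rule mult.assoc[symmetric])
  then show "\<omega> * (\<omega> * x) = - x - \<omega> * x" by (simp add: * ring_distribs)
qed

lemma omega_inverse: "inverse \<omega> = \<omega>\<^sup>2" "inverse (\<omega>\<^sup>2) = \<omega>"
proof -
  have *: "\<omega> * \<omega>\<^sup>2 = 1" using omega_cube by (simp only: power2_eq_square power3_eq_cube mult.assoc)
  show "inverse \<omega> = \<omega>\<^sup>2" by (rule inverse_unique[OF *])
  show "inverse (\<omega>\<^sup>2) = \<omega>" using * by (intro inverse_unique) (simp only: mult.commute)
qed

lemma Im_omega: "Im \<omega> = sqrt 3 / 2" and Re_omega: "Re \<omega> = - 1 / 2"
proof -
  have "Im \<omega> = sin (2 * pi / 3)" "Re \<omega> = cos (2 * pi / 3)"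
    unfolding \<omega>_def by (simp_all add: Im_exp Re_exp)
  then show "Im \<omega> = sqrt 3 / 2" "Re \<omega> = - 1 / 2"
    by (simp_all add: sin_120 cos_120)
qed

lemma lam_1: "lam z $ 1 = z * \<omega>" and lam_2: "lam z $ 2 = z * \<omega>\<^sup>2" and lam_3: "lam z $ 3 = z"
  by (simp_all add: lam_def omega_cube)

lemma lam_scale: "lam z $ j = z * lam 1 $ j"
  using exhaust_3[of j] by (auto simp: lam_1 lam_2 lam_3)

lemma lam_1_nonzero: "lam 1 $ j \<noteq> 0"
  using exhaust_3[of j] by (auto simp: lam_1 lam_2 lam_3 \<omega>_def)

lemma norm_lam_1: "norm (lam 1 $ j) = 1"
  using exhaust_3[of j] by (auto simp: lam_1 lam_2 lam_3 \<omega>_def norm_power)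

lemma diag_mat_mult_left: "(diag_mat a ** A) $ i $ j = a $ i * A $ i $ j"
proof -
  have "(\<Sum>k\<in>UNIV. (if i = k then a $ i else 0) * A $ k $ j) = (\<Sum>k\<in>UNIV. if k = i then a $ i * A $ k $ j else 0)"
    by (rule sum.cong) auto
  then show ?thesis by (simp add: diag_mat_def matrix_matrix_mult_def)
qed

lemma diag_mat_mult_right: "(A ** diag_mat a) $ i $ j = A $ i $ j * a $ j"
proof -
  have "(\<Sum>k\<in>UNIV. A $ i $ k * (if k = j then a $ k else 0)) = (\<Sum>k\<in>UNIV. if k = j then A $ i $ j * a $ j else 0)"
    by (rule sum.cong) auto
  then show ?thesis by (simp add: diag_mat_def matrix_matrix_mult_def)
qed

lemma mat_mult_left: "(mat k ** A) $ i $ j = k * A $ i $ j" for A :: cmat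
proof -
  have "mat k = diag_mat (\<chi> _. k)" by (simp add: diag_mat_def mat_def cong: if_cong)
  then show ?thesis by (simp only: diag_mat_mult_left vec_lambda_beta)
qed

lemma mat_mult_right: "(A ** mat k) $ i $ j = A $ i $ j * k" for A :: cmat
proof -
  have "mat k = diag_mat (\<chi> _. k)" by (simp add: diag_mat_def mat_def cong: if_cong)
  then show ?thesis by (simp only: diag_mat_mult_right vec_lambda_beta)
qed

lemma mat_commute: "A ** mat k = mat k ** A" for A :: cmat
  by (simp add: vec_eq_iff mat_mult_left mat_mult_right)

lemmas mat_entries = matrix_matrix_mult_def vec_eq_iff forall_3 sum_3 diag_mat_def mat_def
  lam_1 lam_2 lam_3 omega_inverse omega_sq omega_mult

lemma proj_mult:
  "P0 ** P0 = P0" "P0 ** P1 = 0" "P0 ** P2 = 0" "P1 ** P0 = 0" "P1 ** P1 = P1" "P1 ** P2 = 0"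
  "P2 ** P0 = 0" "P2 ** P1 = 0" "P2 ** P2 = P2"
  by (simp_all add: mat_entries P0_def P1_def P2_def; simp add: omega_mult field_simps)+

lemma proj_sum: "P0 + P1 + P2 = mat 1"
  by (simp add: mat_entries P0_def P1_def P2_def, simp add: field_simps)

lemma dmat_eq: "dmat = diag_mat (vector [\<omega>, - 1 - \<omega>, 1])"
  by (simp add: dmat_def diag_mat_def vec_eq_iff forall_3 lam_1 lam_2 lam_3 omega_sq)

lemma dinv_eq: "dinv = diag_mat (vector [- 1 - \<omega>, \<omega>, 1])"
  using omega_inverse
  by (simp add: dinv_def diag_mat_def vec_eq_iff forall_3 lam_1 lam_2 lam_3 omega_sq)

text \<open>The diagonal of \<open>dmat\<close> is a character of Z/3, and multiplication by a
  character shifts the Fourier modes cyclically. Projections can therefore be moved to the left,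
  where their products collapse.\<close>

lemma dmat_proj: "dmat ** P0 = P1 ** dmat" "dmat ** P1 = P2 ** dmat" "dmat ** P2 = P0 ** dmat"
  by (simp_all add: mat_entries dmat_eq P0_def P1_def P2_def; simp add: omega_mult field_simps)+

lemma dinv_proj: "dinv ** P1 = P0 ** dinv" "dinv ** P2 = P1 ** dinv" "dinv ** P0 = P2 ** dinv"
  by (simp_all add: mat_entries dinv_eq P0_def P1_def P2_def; simp add: omega_mult field_simps)+

lemma dmat_dinv: "dmat ** dinv = mat 1" "dinv ** dmat = mat 1"
  by (simp_all add: mat_entries dmat_eq dinv_eq; simp add: omega_mult field_simps)+

text \<open>Products are normalized to the left, so a rule for a product of two matrices must also
  fire behind a prefix.\<close>

lemma mult_rule_assoc: "X ** Y = Z \<Longrightarrow> A ** X ** Y = A ** Z" for A X Y Z :: cmat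
  by (metis matrix_mul_assoc)

lemmas proj_simps = proj_mult proj_mult[THEN mult_rule_assoc] dmat_proj dmat_proj[THEN mult_rule_assoc]
  dinv_proj dinv_proj[THEN mult_rule_assoc] dmat_dinv dmat_dinv[THEN mult_rule_assoc]
  mat_distribs matrix_mul_lid matrix_mul_rid

text \<open>The structure matrix of \<open>exp w\<close> has the spectral projections \<open>P0\<close>, \<open>P1\<close>, \<open>P2\<close> and the eigenvalues
  \<open>exp w\<close>, \<open>exp (- w)\<close>, \<open>1\<close>; \<open>cmat0\<close> generates this one-parameter group. Conjugation by \<open>Gmat (- w)\<close>
  turns \<open>Bmat w\<close> into \<open>dinv\<close> and \<open>dmat\<close> into \<open>dmat + Rmat w\<close>.\<close>

definition cmat0 :: cmat where "cmat0 = P0 - P1"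
definition fpot :: "real \<Rightarrow> real" where "fpot w = exp (2 * w) - exp (- w)"
definition Gmat :: "real \<Rightarrow> cmat" where "Gmat w = exp w *\<^sub>R P0 + exp (- w) *\<^sub>R P1 + P2"
definition Bmat :: "real \<Rightarrow> cmat" where "Bmat w = exp (- w) *\<^sub>R dinv + fpot w *\<^sub>R (P0 ** dinv)"
definition Rmat :: "real \<Rightarrow> cmat" where "Rmat w = (exp (- w) - 1) *\<^sub>R dmat + fpot w *\<^sub>R (P1 ** dmat)"
definition bmat :: cmat where
  "bmat = (\<chi> i j. if i = j then 0 else - cmat0 $ i $ j / (lam 1 $ i - lam 1 $ j))"

lemma Gmat_inverse: "Gmat w ** Gmat (- w) = mat 1"
  unfolding Gmat_def by (simp add: proj_simps flip: proj_sum exp_add)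

lemma Gmat_cmat0: "cmat0 ** Gmat w = Gmat w ** cmat0"
  unfolding Gmat_def cmat0_def by (simp add: proj_simps)

lemma Gmat_structure: "structure_mat (exp w) = Gmat w"
proof -
  have cnj: "cnj \<omega> = - 1 - \<omega>" using Im_omega Re_omega by (simp add: complex_eq_iff)
  show ?thesis
    unfolding structure_mat_def Gmat_def Let_def P0_def P1_def P2_def
    by (simp add: vec_eq_iff forall_3 exp_minus cnj omega_sq del: of_real_add, simp add: scaleR_conv_of_real field_simps)
qed

text \<open>The sum of the first row is the eigenvalue on the constant vector, which is q because 1
  + omega + omega^2 = 0; so q can be read off the matrix.\<close>

lemma structure_mat_inj:
  assumes "structure_mat a = structure_mat b" shows "a = b"
proof -
  have cnj: "cnj \<omega> = - 1 - \<omega>" using Im_omega Re_omega by (simp add: complex_eq_iff)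
  have *: "structure_mat q $ 1 $ 1 + structure_mat q $ 1 $ 2 + structure_mat q $ 1 $ 3 = of_real q" for q
  proof -
    define r where "r = complex_of_real (1 / q)"
    have "structure_mat q $ 1 $ 1 = (of_real q + 1 + r) / 3"
      "structure_mat q $ 1 $ 2 = (of_real q + \<omega> + (- 1 - \<omega>) * r) / 3"
      "structure_mat q $ 1 $ 3 = (of_real q + (- 1 - \<omega>) + \<omega> * r) / 3"
      unfolding structure_mat_def Let_def r_def
      by (simp_all add: cnj omega_sq)
    then show ?thesis by (simp only:) (simp add: field_simps)
  qed
  have "complex_of_real a = of_real b" unfolding *[symmetric] assms ..
  then show ?thesis by simp
qed

text \<open>The part of the zero-curvature condition in which z and 1/z cancel: it forces w_yt =
  \<open>fpot w\<close>. The part with the factor 1/z is \<open>Bmat_deriv\<close>.\<close>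

lemma Bmat_dmat: "Bmat w ** dmat - dmat ** Bmat w = fpot w *\<^sub>R cmat0"
  unfolding Bmat_def cmat0_def by (simp add: proj_simps scaleR_diff_right)

lemma fpot_exp: "fpot w = exp w * exp w - exp (- w)"
  unfolding fpot_def by (simp flip: exp_add)

lemma Gmat_Bmat: "Gmat (- w) ** Bmat w = dinv ** Gmat (- w)"
  unfolding Gmat_def Bmat_def fpot_exp
  by (simp add: proj_simps, simp add: vec_eq_iff, simp add: exp_minus scaleR_conv_of_real field_simps)

lemma Gmat_dmat: "Gmat (- w) ** dmat = (dmat + Rmat w) ** Gmat (- w)"
  unfolding Gmat_def Rmat_def fpot_exp
  by (simp add: proj_simps, simp add: vec_eq_iff, simp add: exp_minus scaleR_conv_of_real field_simps)

lemma cmat0_diag: "cmat0 $ i $ i = 0"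
  using exhaust_3[of i] by (auto simp: cmat0_def P0_def P1_def)

lemma lam_1_diff: "i \<noteq> j \<Longrightarrow> lam 1 $ i - lam 1 $ j \<noteq> 0"
proof -
  have "\<omega>\<^sup>2 \<noteq> 1" "\<omega>\<^sup>2 \<noteq> \<omega>" using Im_omega by (auto simp: omega_sq complex_eq_iff)
  then show "i \<noteq> j \<Longrightarrow> ?thesis"
    using exhaust_3[of i] exhaust_3[of j] omega_ne_1 by (auto simp: lam_1 lam_2 lam_3)
qed

text \<open>A commutator equation with a diagonal matrix of distinct entries is solved entry by
  entry as soon as the right side has zero diagonal, which \<open>cmat0_diag\<close>
  provides.\<close>

lemma bmat_comm: "dmat ** bmat - bmat ** dmat = - cmat0"
proof -
  have "lam 1 $ i * x - x * lam 1 $ j = (lam 1 $ i - lam 1 $ j) * x" for i j x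
    by (simp add: algebra_simps)
  then show ?thesis
    using lam_1_diff cmat0_diag
    by (auto simp: vec_eq_iff dmat_def diag_mat_mult_left diag_mat_mult_right bmat_def)
qed

lemma fpot_deriv: "(fpot has_real_derivative 2 * exp (2 * w) + exp (- w)) (at w)"
  unfolding fpot_def by (auto intro!: derivative_eq_intros)

lemma Gmat_deriv: "(Gmat has_vector_derivative Gmat w ** cmat0) (at w)"
proof -
  have "(Gmat has_vector_derivative exp w *\<^sub>R P0 - exp (- w) *\<^sub>R P1) (at w)"
    unfolding Gmat_def by (auto intro!: derivative_eq_intros has_vector_derivative_add
      simp: has_real_derivative_iff_has_vector_derivative[symmetric])
  also have "exp w *\<^sub>R P0 - exp (- w) *\<^sub>R P1 = Gmat w ** cmat0"
    unfolding Gmat_def cmat0_def by (simp add: proj_simps)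
  finally show ?thesis .
qed

text \<open>By \<open>Gmat_Bmat\<close>, \<open>Bmat w\<close> is the constant \<open>dinv\<close>
  conjugated by the group with generator \<open>cmat0\<close>, so its derivative is the commutator
  with that generator.\<close>

lemma Bmat_deriv: "(Bmat has_vector_derivative cmat0 ** Bmat w - Bmat w ** cmat0) (at w)"
proof -
  have "(Bmat has_vector_derivative (- exp (- w)) *\<^sub>R dinv + (2 * exp (2 * w) + exp (- w)) *\<^sub>R (P0 ** dinv)) (at w)"
    unfolding Bmat_def by (auto intro!: derivative_eq_intros fpot_deriv has_vector_derivative_add
      simp: has_real_derivative_iff_has_vector_derivative[symmetric])
  also have "(- exp (- w)) *\<^sub>R dinv + (2 * exp (2 * w) + exp (- w)) *\<^sub>R (P0 ** dinv) = cmat0 ** Bmat w - Bmat w ** cmat0"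
  proof -
    \<comment> \<open>Moving \<open>P0\<close> to the left of \<open>dinv\<close> produces
      \<open>P2\<close>; once \<open>P2\<close> is eliminated, only multiples of
      \<open>dinv\<close>, \<open>P0 ** dinv\<close> and \<open>P1 ** dinv\<close> remain to be
      compared.\<close>
    have P2: "P2 = mat 1 - P0 - P1" using proj_sum by (simp add: algebra_simps)
    show ?thesis
      unfolding Bmat_def cmat0_def fpot_def
      by (simp add: proj_simps P2, simp add: vec_eq_iff, simp add: scaleR_conv_of_real algebra_simps)
  qed
  finally show ?thesis .
qed

lemma Rmat_deriv: "(Rmat has_vector_derivative (- exp (- w)) *\<^sub>R dmat + (2 * exp (2 * w) + exp (- w)) *\<^sub>R (P1 ** dmat)) (at w)"
    unfolding Rmat_def by (auto intro!: derivative_eq_intros fpot_deriv has_vector_derivative_add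
      simp: has_real_derivative_iff_has_vector_derivative[symmetric])

section \<open>The Goursat problem\<close>

lemma continuous_on_integral_upper:
  fixes g :: "'a::topological_space \<Rightarrow> real \<Rightarrow> 'b::banach"
  assumes g: "continuous_on (U \<times> {a..b}) (\<lambda>(u, s). g u s)"
  shows "continuous_on (U \<times> {a..b}) (\<lambda>(u, t). integral {a..t} (g u))"
proof -
  have g': "continuous_on (V) (\<lambda>x. g (p x) (r x))" if "continuous_on V p" "continuous_on V r" "p ` V \<subseteq> U" "r ` V \<subseteq> {a..b}"
    for p :: "'c::topological_space \<Rightarrow> 'a" and r :: "'c \<Rightarrow> real" and V
    using continuous_on_compose2[OF g continuous_on_Pair[OF that(1,2)]] that(3,4) by (auto simp: image_subset_iff)
  have "continuous_on ((U \<times> {a..b}) \<times> cbox a b) (\<lambda>(p, s). g (fst p) (min s (snd p)))"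
    unfolding split_def by (rule g') (auto intro!: continuous_intros)
  then have c: "continuous_on (U \<times> {a..b}) (\<lambda>p. integral (cbox a b) (\<lambda>s. g (fst p) (min s (snd p))))"
    by (rule integral_continuous_on_param)
  have "continuous_on (U \<times> {a..b}) (\<lambda>p. integral (cbox a b) (\<lambda>s. g (fst p) (min s (snd p))) - (b - snd p) *\<^sub>R g (fst p) (snd p))"
    by (intro continuous_on_diff c continuous_on_scaleR g' continuous_intros) auto
  then show ?thesis
  proof (rule continuous_on_eq)
    fix p assume "p \<in> U \<times> {a..b}"
    then have u: "fst p \<in> U" and t: "a \<le> snd p" "snd p \<le> b" by auto
    have i: "(\<lambda>s. g (fst p) (min s (snd p))) integrable_on {a..b}"
      by (intro integrable_continuous_interval g') (use u t in \<open>auto intro!: continuous_intros\<close>)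
    have "integral {a..b} (\<lambda>s. g (fst p) (min s (snd p))) =
      integral {a..snd p} (\<lambda>s. g (fst p) (min s (snd p))) + integral {snd p..b} (\<lambda>s. g (fst p) (min s (snd p)))"
      using Henstock_Kurzweil_Integration.integral_combine[OF t i] by simp
    also have "integral {snd p..b} (\<lambda>s. g (fst p) (min s (snd p))) = integral {snd p..b} (\<lambda>s. g (fst p) (snd p))"
      by (rule integral_cong) auto
    also have "integral {a..snd p} (\<lambda>s. g (fst p) (min s (snd p))) = integral {a..snd p} (g (fst p))"
      by (rule integral_cong) auto
    finally show "integral (cbox a b) (\<lambda>s. g (fst p) (min s (snd p))) - (b - snd p) *\<^sub>R g (fst p) (snd p) = (case p of (u, t) \<Rightarrow> integral {a..t} (g u))"
      using t by (simp add: split_def)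
  qed
qed

lemma continuous_on_integral_lower:
  fixes g :: "'a::topological_space \<Rightarrow> real \<Rightarrow> 'b::banach"
  assumes g: "continuous_on (U \<times> {a..b}) (\<lambda>(u, s). g u s)"
  shows "continuous_on (U \<times> {a..b}) (\<lambda>(u, t). integral {t..b} (g u))"
proof -
  have "continuous_on (U \<times> {a..b}) (\<lambda>p. integral (cbox a b) (g (fst p)) - (case p of (u, t) \<Rightarrow> integral {a..t} (g u)))"
  proof (intro continuous_on_diff continuous_on_integral_upper[OF g])
    have "continuous_on U (\<lambda>u. integral (cbox a b) (g u))" by (rule integral_continuous_on_param) (use g in simp)
    then show "continuous_on (U \<times> {a..b}) (\<lambda>p. integral (cbox a b) (g (fst p)))"
      by (rule continuous_on_compose2) (auto intro!: continuous_intros)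
  qed
  then show ?thesis
  proof (rule continuous_on_eq)
    fix p assume "p \<in> U \<times> {a..b}"
    then have u: "fst p \<in> U" and t: "a \<le> snd p" "snd p \<le> b" by auto
    have "continuous_on {a..b} (\<lambda>s. (\<lambda>(u, s). g u s) (fst p, s))"
      by (rule continuous_on_compose2[OF g]) (use u in \<open>auto intro!: continuous_intros\<close>)
    then have i: "g (fst p) integrable_on {a..b}"
      by (intro integrable_continuous_interval) simp
    show "integral (cbox a b) (g (fst p)) - (case p of (u, t) \<Rightarrow> integral {a..t} (g u)) = (case p of (u, t) \<Rightarrow> integral {t..b} (g u))"
      using Henstock_Kurzweil_Integration.integral_combine[OF t i] by (simp add: split_def algebra_simps)
  qed
qed

text \<open>The double integral can be differentiated in t as it stands, in y only after its order
  has been exchanged. Both single integrals are recorded, since up to sign and initial data they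
  become w_t and w_y of a Goursat solution.\<close>

lemma goursat_operator:
  fixes h :: "real \<Rightarrow> real \<Rightarrow> real"
  assumes h: "continuous_on ({a..b} \<times> {0..T}) (\<lambda>(y, s). h y s)"
  defines "J \<equiv> \<lambda>y t. integral {0..t} (\<lambda>s. integral {y..b} (\<lambda>\<eta>. h \<eta> s))"
  shows "continuous_on ({a..b} \<times> {0..T}) (\<lambda>(y, s). integral {y..b} (\<lambda>\<eta>. h \<eta> s))"
    and "continuous_on ({a..b} \<times> {0..T}) (\<lambda>(y, t). integral {0..t} (h y))"
    and "continuous_on ({a..b} \<times> {0..T}) (\<lambda>(y, t). J y t)"
    and "y \<in> {a..b} \<Longrightarrow> t \<in> {0..T} \<Longrightarrow>
      (J y has_real_derivative integral {y..b} (\<lambda>\<eta>. h \<eta> t)) (at t within {0..T})"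
    and "y \<in> {a..b} \<Longrightarrow> t \<in> {0..T} \<Longrightarrow>
      ((\<lambda>y. J y t) has_real_derivative - integral {0..t} (h y)) (at y within {a..b})"
proof -
  have h': "continuous_on ({0..T} \<times> {a..b}) (\<lambda>(s, y). h y s)"
    unfolding split_def by (rule continuous_on_compose2[OF h, where f="\<lambda>p. (snd p, fst p)", unfolded split_def fst_conv snd_conv]) (auto intro!: continuous_intros)
  have "continuous_on ({0..T} \<times> {a..b}) (\<lambda>(s, y). integral {y..b} (\<lambda>\<eta>. h \<eta> s))"
    using continuous_on_integral_lower[OF h'] by simp
  then show K: "continuous_on ({a..b} \<times> {0..T}) (\<lambda>(y, s). integral {y..b} (\<lambda>\<eta>. h \<eta> s))"
    by (rule continuous_on_swap_args)
  show H: "continuous_on ({a..b} \<times> {0..T}) (\<lambda>(y, t). integral {0..t} (h y))"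
    by (rule continuous_on_integral_upper[OF h])
  show "continuous_on ({a..b} \<times> {0..T}) (\<lambda>(y, t). J y t)"
    unfolding J_def by (rule continuous_on_integral_upper[OF K])
  show "(J y has_real_derivative integral {y..b} (\<lambda>\<eta>. h \<eta> t)) (at t within {0..T})"
    if "y \<in> {a..b}" "t \<in> {0..T}"
  proof -
    have "continuous_on {0..T} (\<lambda>s. (\<lambda>(y, s). integral {y..b} (\<lambda>\<eta>. h \<eta> s)) (y, s))"
      by (rule continuous_on_compose2[OF K]) (use that in \<open>auto intro!: continuous_intros\<close>)
    then show ?thesis unfolding J_def using that by (intro integral_has_real_derivative) auto
  qed
  show "((\<lambda>y. J y t) has_real_derivative - integral {0..t} (h y)) (at y within {a..b})"
    if "y \<in> {a..b}" "t \<in> {0..T}"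
  proof -
    have "continuous_on {a..b} (\<lambda>y. (\<lambda>(y, t). integral {0..t} (h y)) (y, t))"
      by (rule continuous_on_compose2[OF H]) (use that in \<open>auto intro!: continuous_intros\<close>)
    then have "((\<lambda>y. integral {y..b} (\<lambda>\<eta>. integral {0..t} (h \<eta>))) has_real_derivative - integral {0..t} (h y)) (at y within {a..b})"
      using that by (intro integral_has_real_derivative') auto
    then show ?thesis
    proof (rule has_field_derivative_transform_within[OF _ zero_less_one])
      show "integral {x..b} (\<lambda>\<eta>. integral {0..t} (h \<eta>)) = J x t" if "x \<in> {a..b}" for x
      proof -
        have "continuous_on (cbox (0, x) (t, b)) (\<lambda>(s, y). h y s)"
          by (rule continuous_on_subset[OF h']) (use that \<open>t \<in> _\<close> in auto)
        from integral_swap_continuous[OF this] show ?thesis by (simp add: J_def)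
      qed
    qed (use that in auto)
  qed
qed

lemma continuous_on_slices:
  assumes "continuous_on (A \<times> B) (\<lambda>(x, y). f x y)"
  shows "x \<in> A \<Longrightarrow> continuous_on B (f x)" and "y \<in> B \<Longrightarrow> continuous_on A (\<lambda>x. f x y)"
proof -
  show "continuous_on B (f x)" if "x \<in> A"
    using continuous_on_compose2[OF assms, of B "\<lambda>y. (x, y)"] that by (force intro!: continuous_intros)
  show "continuous_on A (\<lambda>x. f x y)" if "y \<in> B"
    using continuous_on_compose2[OF assms, of A "\<lambda>x. (x, y)"] that by (force intro!: continuous_intros)
qed

text \<open>Banach's fixed point theorem in a norm weighted by \<open>exp (- \<mu> * t)\<close>:
  integration over time then gains a factor \<open>1 / \<mu>\<close>, so the rectangle can have any
  size.\<close>

lemma lipschitz_goursat_exists: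
  fixes g w0 :: "real \<Rightarrow> real" and a b T L :: real
  assumes ab: "a \<le> b" and T: "0 \<le> T" and L: "0 \<le> L" and lip: "\<And>u v. \<bar>g u - g v\<bar> \<le> L * \<bar>u - v\<bar>"
    and w0: "continuous_on {a..b} w0"
  shows "\<exists>w. continuous_on ({a..b} \<times> {0..T}) (\<lambda>(y, t). w y t) \<and>
    (\<forall>y\<in>{a..b}. \<forall>t\<in>{0..T}. w y t = w0 y - integral {0..t} (\<lambda>s. integral {y..b} (\<lambda>\<eta>. g (w \<eta> s))))"
proof -
  define K where "K = L * (b - a)"
  have K: "0 \<le> K" using L ab by (simp add: K_def)
  \<comment> \<open>This size makes the contraction factor \<open>K / \<mu>\<close> at most 1/2 and
    stays positive when K = 0.\<close>
  define \<mu> where "\<mu> = 2 * K + 1"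
  have \<mu>: "\<mu> > 0" "K / \<mu> \<le> 1 / 2"
    unfolding \<mu>_def using K by (auto simp: field_simps)
  define box where "box = cbox (a, 0) (b, T)"
  have box: "box = {a..b} \<times> {0..T}" by (auto simp: box_def)
  \<comment> \<open>The unknown v is the weighted function; w is recovered from it by the factor
    \<open>exp (\<mu> * s)\<close>.\<close>
  define h where "h v \<eta> s = g (exp (\<mu> * s) * apply_bcontfun v (\<eta>, s))" for v :: "(real \<times> real) \<Rightarrow>\<^sub>C real" and \<eta> s
  have g: "continuous_on UNIV g"
    by (rule lipschitz_on_continuous_on[of L]) (use lip L in \<open>auto intro!: lipschitz_onI simp: dist_real_def\<close>)
  have h: "continuous_on ({a..b} \<times> {0..T}) (\<lambda>(y, s). h v y s)" for v
    unfolding h_def split_def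
    by (rule continuous_on_compose2[OF g])
      (auto intro!: continuous_intros continuous_on_compose2[OF continuous_on_apply_bcontfun[of UNIV v]])
  define J where "J v y t = integral {0..t} (\<lambda>s. integral {y..b} (\<lambda>\<eta>. h v \<eta> s))" for v y t
  note go = goursat_operator[OF h, folded J_def]
  define \<phi> where "\<phi> v p = exp (- \<mu> * snd p) * (w0 (fst p) - J v (fst p) (snd p))" for v p
  have \<phi>: "continuous_on box (\<phi> v)" for v
    unfolding \<phi>_def box using go(3)[of v] 
    by (auto intro!: continuous_intros continuous_on_compose2[OF w0] simp: split_def)
  \<comment> \<open>The iteration runs in the complete space of bounded continuous functions on the
    whole plane, so each iterate is extended from the box by clamping its argument to the
    box.\<close>
  have "\<exists>g :: (real \<times> real) \<Rightarrow>\<^sub>C real. (\<forall>x\<in>box. apply_bcontfun g x = \<phi> v x) \<and> (\<forall>x. apply_bcontfun g x = \<phi> v (clamp (a, 0) (b, T) x))" for v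
    using continuous_on_cbox_bcontfunE[OF \<phi>[of v, unfolded box_def]] unfolding box_def by metis
  then obtain \<Psi> :: "((real \<times> real) \<Rightarrow>\<^sub>C real) \<Rightarrow> (real \<times> real) \<Rightarrow>\<^sub>C real"
    where \<Psi>: "\<And>v x. x \<in> box \<Longrightarrow> apply_bcontfun (\<Psi> v) x = \<phi> v x"
      "\<And>v x. apply_bcontfun (\<Psi> v) x = \<phi> v (clamp (a, 0) (b, T) x)" by metis
  have "dist (\<Psi> v) (\<Psi> v') \<le> 1 / 2 * dist v v'" for v v'
  proof (rule dist_bound)
    fix x :: "real \<times> real"
    define D where "D = dist v v'"
    have D: "D \<ge> 0" by (simp add: D_def)
    obtain y t where yt: "clamp (a, 0) (b, T) x = (y, t)" by fastforce
    have "clamp (a, 0) (b, T) x \<in> box" unfolding box_def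
      by (rule clamp_in_interval) (use ab T in \<open>auto simp: Basis_prod_def\<close>)
    then have y: "y \<in> {a..b}" and t: "t \<in> {0..T}" by (auto simp: yt box)
    have inner: "norm (integral {y..b} (\<lambda>\<eta>. h v \<eta> s) - integral {y..b} (\<lambda>\<eta>. h v' \<eta> s)) \<le> K * D * exp (\<mu> * s)"
      if s: "s \<in> {0..t}" for s
    proof -
      have sT: "s \<in> {0..T}" using s t by auto
      have i: "(\<lambda>\<eta>. h v \<eta> s) integrable_on {y..b}" for v
        by (intro integrable_continuous_interval continuous_on_subset[OF continuous_on_slices(2)[OF h sT]]) (use y in auto)
      have "norm (h v \<eta> s - h v' \<eta> s) \<le> L * (exp (\<mu> * s) * D)" for \<eta>
      proof -
        have "norm (h v \<eta> s - h v' \<eta> s) \<le> L * (exp (\<mu> * s) * \<bar>apply_bcontfun v (\<eta>, s) - apply_bcontfun v' (\<eta>, s)\<bar>)"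
          unfolding h_def real_norm_def by (rule order_trans[OF lip]) (simp add: abs_mult flip: right_diff_distrib)
        also have "\<dots> \<le> L * (exp (\<mu> * s) * D)"
          using dist_bounded[of v "(\<eta>, s)" v'] L by (intro mult_left_mono) (auto simp: dist_real_def D_def)
        finally show ?thesis .
      qed
      then have "norm (integral (cbox y b) (\<lambda>\<eta>. h v \<eta> s - h v' \<eta> s)) \<le> (L * (exp (\<mu> * s) * D)) * measure lborel (cbox y b)"
        by (intro integrable_bound) (use L D i in \<open>auto intro!: integrable_diff\<close>)
      also have "\<dots> = L * (b - y) * (exp (\<mu> * s) * D)" using y by simp
      also have "\<dots> \<le> K * (exp (\<mu> * s) * D)"
        unfolding K_def using y L D by (intro mult_right_mono mult_left_mono) auto
      finally show ?thesis using i by (simp add: Henstock_Kurzweil_Integration.integral_diff mult_ac)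
    qed
    have i: "(\<lambda>s. integral {y..b} (\<lambda>\<eta>. h v \<eta> s)) integrable_on {0..t}" for v
      by (intro integrable_continuous_interval continuous_on_subset[OF continuous_on_slices(1)[OF go(1) y]]) (use t in auto)
    have e: "((\<lambda>s. K * D * exp (\<mu> * s)) has_integral (K * D * exp (\<mu> * t) / \<mu> - K * D * exp (\<mu> * 0) / \<mu>)) {0..t}"
      by (rule fundamental_theorem_of_calculus)
        (use t \<mu> in \<open>auto intro!: derivative_eq_intros simp flip: has_real_derivative_iff_has_vector_derivative\<close>)
    have "norm (J v y t - J v' y t) \<le> integral {0..t} (\<lambda>s. K * D * exp (\<mu> * s))"
      unfolding J_def Henstock_Kurzweil_Integration.integral_diff[OF i i, symmetric]
      by (rule integral_norm_bound_integral) (use inner e in \<open>auto intro!: integrable_diff i\<close>)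
    also have "\<dots> \<le> K * D * exp (\<mu> * t) / \<mu>"
      using integral_unique[OF e] K D \<mu> by simp
    also have "\<dots> = (K / \<mu>) * D * exp (\<mu> * t)" by simp
    also have "\<dots> \<le> 1 / 2 * D * exp (\<mu> * t)"
      using D \<mu>(2) by (intro mult_right_mono) auto
    finally have *: "norm (J v y t - J v' y t) \<le> 1 / 2 * D * exp (\<mu> * t)" .
    have "dist (apply_bcontfun (\<Psi> v) x) (apply_bcontfun (\<Psi> v') x) = exp (- \<mu> * t) * norm (J v y t - J v' y t)"
      unfolding \<Psi>(2) yt \<phi>_def dist_real_def
      by (simp add: abs_mult abs_minus_commute flip: right_diff_distrib)
    also have "\<dots> \<le> exp (- \<mu> * t) * (1 / 2 * D * exp (\<mu> * t))"
      using * by (rule mult_left_mono) simp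
    also have "\<dots> = 1 / 2 * D" by (simp add: exp_minus field_simps)
    finally show "dist (apply_bcontfun (\<Psi> v) x) (apply_bcontfun (\<Psi> v') x) \<le> 1 / 2 * dist v v'" by (simp add: D_def)
  qed
  then have "\<exists>!v. \<Psi> v = v" by (intro banach_fix_type[of "1/2"]) auto
  then obtain v where v: "\<Psi> v = v" by auto
  define w where "w y t = exp (\<mu> * t) * apply_bcontfun v (y, t)" for y t
  have "continuous_on ({a..b} \<times> {0..T}) (\<lambda>(y, t). w y t)"
    unfolding w_def split_def
    by (auto intro!: continuous_intros continuous_on_compose2[OF continuous_on_apply_bcontfun[of UNIV v]])
  moreover have "w y t = w0 y - integral {0..t} (\<lambda>s. integral {y..b} (\<lambda>\<eta>. g (w \<eta> s)))"
    if "y \<in> {a..b}" "t \<in> {0..T}" for y t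
  proof -
    have "w y t = exp (\<mu> * t) * \<phi> v (y, t)"
      unfolding w_def by (subst v[symmetric], subst \<Psi>(1)) (use that in \<open>auto simp: box\<close>)
    also have "\<dots> = w0 y - J v y t" by (simp add: \<phi>_def exp_minus)
    finally show ?thesis unfolding J_def h_def w_def .
  qed
  ultimately show ?thesis by (intro exI[of _ w]) blast
qed

section \<open>The equation \<open>w_yt = exp (2 w) - exp (- w)\<close>\<close>

lemma norm_diff_le_antiderivative:
  fixes f :: "real \<Rightarrow> 'a::real_normed_vector" and \<phi> :: "real \<Rightarrow> real"
  assumes "a \<le> b"
    and f: "\<And>x. x \<in> {a..b} \<Longrightarrow> (f has_vector_derivative f' x) (at x within {a..b})"
    and \<phi>: "\<And>x. x \<in> {a..b} \<Longrightarrow> (\<phi> has_real_derivative \<phi>' x) (at x within {a..b})"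
    and le: "\<And>x. x \<in> {a..b} \<Longrightarrow> norm (f' x) \<le> \<phi>' x"
  shows "norm (f b - f a) \<le> \<phi> b - \<phi> a"
proof (cases "a = b")
  case False
  then have "a < b" using \<open>a \<le> b\<close> by simp
  then show ?thesis
  proof (rule differentiable_bound_general[where f'=f' and \<phi>'=\<phi>'])
    show "continuous_on {a..b} f" "continuous_on {a..b} \<phi>"
      unfolding continuous_on_eq_continuous_within
      by (blast intro: has_vector_derivative_continuous f DERIV_continuous \<phi>)+
    fix x assume x: "a < x" "x < b"
    then have "at x within {a..b} = at x" by (rule at_within_Icc_at)
    then show "(f has_vector_derivative f' x) (at x)" "(\<phi> has_vector_derivative \<phi>' x) (at x)"
      using f[of x] \<phi>[of x] x by (auto simp: has_real_derivative_iff_has_vector_derivative)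
    show "norm (f' x) \<le> \<phi>' x" using le x by auto
  qed
qed simp

lemma diff_le_antiderivative:
  fixes f \<phi> :: "real \<Rightarrow> real"
  assumes "a \<le> b"
    and f: "\<And>x. x \<in> {a..b} \<Longrightarrow> (f has_real_derivative f' x) (at x within {a..b})"
    and \<phi>: "\<And>x. x \<in> {a..b} \<Longrightarrow> (\<phi> has_real_derivative \<phi>' x) (at x within {a..b})"
    and le: "\<And>x. x \<in> {a..b} \<Longrightarrow> f' x \<le> \<phi>' x"
  shows "f b - f a \<le> \<phi> b - \<phi> a"
proof -
  have "\<exists>x\<in>{a..b}. (\<phi> b - f b) - (\<phi> a - f a) = (\<lambda>h. (\<phi>' x - f' x) * h) (b - a)"
  proof (rule mvt_very_simple[OF \<open>a \<le> b\<close>, of "\<lambda>x. \<phi> x - f x"])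
    fix x assume "a \<le> x" "x \<le> b"
    then show "((\<lambda>x. \<phi> x - f x) has_derivative (\<lambda>h. (\<phi>' x - f' x) * h)) (at x within {a..b})"
      using DERIV_diff[OF \<phi> f, of x] by (auto simp: has_field_derivative_def)
  qed
  then obtain x where x: "x \<in> {a..b}" "(\<phi> b - f b) - (\<phi> a - f a) = (\<phi>' x - f' x) * (b - a)" by auto
  have "(\<phi>' x - f' x) * (b - a) \<ge> 0" using le[OF x(1)] \<open>a \<le> b\<close> by (intro mult_nonneg_nonneg) auto
  then show ?thesis using x(2) by linarith
qed

section \<open>The nonlinearity, its potential, and the problem truncated at y = R\<close>

definition Vpot :: "real \<Rightarrow> real" where "Vpot w = exp (2 * w) / 2 + exp (- w) - 3 / 2"

lemma Vpot_deriv: "(Vpot has_real_derivative fpot w) (at w within S)"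
  unfolding Vpot_def fpot_def by (auto intro!: derivative_eq_intros)

lemma fpot_0 [simp]: "fpot 0 = 0" by (simp add: fpot_def)
lemma Vpot_0 [simp]: "Vpot 0 = 0" by (simp add: Vpot_def)

lemma fpot_deriv_within: "(fpot has_real_derivative 2 * exp (2 * w) + exp (- w)) (at w within S)"
  unfolding fpot_def by (auto intro!: derivative_eq_intros)

lemma continuous_on_fpot [continuous_intros]: "continuous_on S g \<Longrightarrow> continuous_on S (\<lambda>x. fpot (g x))"
  unfolding fpot_def by (intro continuous_intros)

text \<open>One of the two exponentials is at least 1. This lower bound on the slope makes the
  potential dominate \<open>w^2 / 2\<close>, which is how the energy controls w itself.\<close>

lemma fpot_slope_ge_1: "2 * exp (2 * w) + exp (- w) \<ge> (1 :: real)"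
proof (cases "w \<ge> 0")
  case True
  then have "exp (2 * w) \<ge> 1" by simp
  moreover have "exp (- w) > 0" by simp
  ultimately show ?thesis by linarith
next
  case False
  then have "exp (- w) \<ge> 1" by simp
  moreover have "exp (2 * w) > 0" by simp
  ultimately show ?thesis by linarith
qed

lemma fpot_mono_slope:
  assumes "u \<le> v" shows "v - u \<le> fpot v - fpot u"
  by (rule diff_le_antiderivative[OF assms, of "\<lambda>x. x" "\<lambda>_. 1" fpot "\<lambda>w. 2 * exp (2 * w) + exp (- w)"])
    (auto intro!: derivative_eq_intros fpot_deriv_within fpot_slope_ge_1)

lemma fpot_lipschitz:
  assumes "\<bar>u\<bar> \<le> B" "\<bar>v\<bar> \<le> B"
  shows "\<bar>fpot u - fpot v\<bar> \<le> (2 * exp (2 * B) + exp B) * \<bar>u - v\<bar>"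
  using assms
proof (induction u v rule: linorder_wlog)
  case (le u v)
  have "fpot v - fpot u \<le> (2 * exp (2 * B) + exp B) * v - (2 * exp (2 * B) + exp B) * u"
    by (rule diff_le_antiderivative[OF le(1), of fpot "\<lambda>w. 2 * exp (2 * w) + exp (- w)" "\<lambda>x. (2 * exp (2 * B) + exp B) * x" "\<lambda>_. 2 * exp (2 * B) + exp B"])
      (use le in \<open>auto intro!: derivative_eq_intros fpot_deriv_within add_mono\<close>)
  then show ?case using fpot_mono_slope[OF le(1)] le(1) by (simp add: algebra_simps)
qed (simp add: abs_minus_commute)

lemma Vpot_ge: "w\<^sup>2 / 2 \<le> Vpot w"
proof (cases "0 \<le> w")
  case True
  have "w\<^sup>2 / 2 - 0\<^sup>2 / 2 \<le> Vpot w - Vpot 0"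
    by (rule diff_le_antiderivative[OF True, of _ "\<lambda>x. x" _ fpot])
      (use fpot_mono_slope[of 0] in \<open>auto intro!: derivative_eq_intros Vpot_deriv\<close>)
  then show ?thesis by simp
next
  case False
  then have "w \<le> 0" by simp
  have "Vpot 0 - Vpot w \<le> 0\<^sup>2 / 2 - w\<^sup>2 / 2"
    by (rule diff_le_antiderivative[OF \<open>w \<le> 0\<close>, of _ fpot _ "\<lambda>x. x"])
      (use fpot_mono_slope[of _ 0] in \<open>auto intro!: derivative_eq_intros Vpot_deriv\<close>)
  then show ?thesis by simp
qed

lemma fpot_abs_le: "\<bar>w\<bar> \<le> B \<Longrightarrow> \<bar>fpot w\<bar> \<le> (2 * exp (2 * B) + exp B) * \<bar>w\<bar>"
  using fpot_lipschitz[of w B 0] by auto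

lemma Vpot_le:
  assumes "\<bar>w\<bar> \<le> B" shows "Vpot w \<le> (2 * exp (2 * B) + exp B) * w\<^sup>2 / 2"
proof (cases "0 \<le> w")
  case True
  have le: "fpot x \<le> (2 * exp (2 * B) + exp B) * x" if "x \<in> {0..w}" for x
    using fpot_abs_le[of x B] that assms by auto
  have "Vpot w - Vpot 0 \<le> (2 * exp (2 * B) + exp B) * w\<^sup>2 / 2 - (2 * exp (2 * B) + exp B) * 0\<^sup>2 / 2"
    by (rule diff_le_antiderivative[OF True, of _ fpot _ "\<lambda>x. (2 * exp (2 * B) + exp B) * x"])
      (auto intro!: derivative_eq_intros Vpot_deriv le)
  then show ?thesis by simp
next
  case False
  then have "w \<le> 0" by simp
  have le: "(2 * exp (2 * B) + exp B) * x \<le> fpot x" if "x \<in> {w..0}" for x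
    using fpot_abs_le[of x B] that assms by auto
  have "(2 * exp (2 * B) + exp B) * 0\<^sup>2 / 2 - (2 * exp (2 * B) + exp B) * w\<^sup>2 / 2 \<le> Vpot 0 - Vpot w"
    by (rule diff_le_antiderivative[OF \<open>w \<le> 0\<close>, of _ "\<lambda>x. (2 * exp (2 * B) + exp B) * x" _ fpot])
      (auto intro!: derivative_eq_intros Vpot_deriv le)
  then show ?thesis by simp
qed

text \<open>Clamping makes the nonlinearity globally Lipschitz; the energy bound below shows that the clamp is
  never reached.\<close>

definition fclamp :: "real \<Rightarrow> real \<Rightarrow> real" where "fclamp B w = fpot (max (- B) (min B w))"

lemma fclamp_props:
  assumes "B \<ge> 0"
  shows "\<bar>fclamp B u - fclamp B v\<bar> \<le> (2 * exp (2 * B) + exp B) * \<bar>u - v\<bar>"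
    and "continuous_on S (fclamp B)" and "0 \<le> u \<Longrightarrow> 0 \<le> fclamp B u" and "u \<le> 0 \<Longrightarrow> fclamp B u \<le> 0"
    and "\<bar>u\<bar> \<le> B \<Longrightarrow> fclamp B u = fpot u"
proof -
  have "\<bar>fclamp B u - fclamp B v\<bar> \<le> (2 * exp (2 * B) + exp B) * \<bar>max (- B) (min B u) - max (- B) (min B v)\<bar>"
    unfolding fclamp_def by (rule fpot_lipschitz) (use assms in auto)
  also have "\<dots> \<le> (2 * exp (2 * B) + exp B) * \<bar>u - v\<bar>"
    by (intro mult_left_mono) auto
  finally show "\<bar>fclamp B u - fclamp B v\<bar> \<le> (2 * exp (2 * B) + exp B) * \<bar>u - v\<bar>" .
  show "continuous_on S (fclamp B)" unfolding fclamp_def by (intro continuous_intros)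
  show "0 \<le> u \<Longrightarrow> 0 \<le> fclamp B u" "u \<le> 0 \<Longrightarrow> fclamp B u \<le> 0"
    unfolding fclamp_def using fpot_mono_slope[of 0 "max (- B) (min B u)"] fpot_mono_slope[of "max (- B) (min B u)" 0] assms by auto
  show "\<bar>u\<bar> \<le> B \<Longrightarrow> fclamp B u = fpot u"
    unfolding fclamp_def by (rule arg_cong[of _ _ fpot]) auto
qed

text \<open>The energy argument for the clamped equation needs a potential of the clamped
  nonlinearity: non-negative, because the nonlinearity has the sign of its argument, and equal to
  \<open>Vpot\<close> where the clamp is inactive. A will exceed all values of the solution on its
  compact rectangle.\<close>

lemma fclamp_potential_exists:
  assumes B: "B \<ge> 0" "B < A"
  shows "\<exists>VB. (\<forall>w. \<bar>w\<bar> < A \<longrightarrow> (VB has_real_derivative fclamp B w) (at w) \<and> VB w \<ge> 0) \<and> (\<forall>w. \<bar>w\<bar> \<le> B \<longrightarrow> VB w = Vpot w)"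
proof -
  define VB where "VB w = integral {-A..w} (fclamp B) - integral {-A..0} (fclamp B)" for w
  have d: "(VB has_real_derivative fclamp B w) (at w)" if "\<bar>w\<bar> < A" for w
  proof -
    have "(VB has_real_derivative fclamp B w - 0) (at w within {-A..A})"
      unfolding VB_def by (intro derivative_intros integral_has_real_derivative fclamp_props B) (use that in auto)
    moreover have "at w within {-A..A} = at w" by (rule at_within_Icc_at) (use that in auto)
    ultimately show ?thesis by simp
  qed
  have VB0: "VB 0 = 0" by (simp add: VB_def)
  have pos: "VB w \<ge> 0" if "\<bar>w\<bar> < A" for w
  proof (cases "0 \<le> w")
    case True
    have "0 - 0 \<le> VB w - VB 0"
      by (rule diff_le_antiderivative[OF True, of "\<lambda>_. 0" "\<lambda>_. 0" VB "fclamp B"])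
        (use that B in \<open>auto intro!: has_field_derivative_at_within[OF d] fclamp_props\<close>)
    then show ?thesis by (simp add: VB0)
  next
    case False
    then have "w \<le> 0" by simp
    have "VB 0 - VB w \<le> 0 - 0"
      by (rule diff_le_antiderivative[OF \<open>w \<le> 0\<close>, of VB "fclamp B" "\<lambda>_. 0" "\<lambda>_. 0"])
        (use that B in \<open>auto intro!: has_field_derivative_at_within[OF d] fclamp_props\<close>)
    then show ?thesis by (simp add: VB0)
  qed
  have eq: "VB w = Vpot w" if "\<bar>w\<bar> \<le> B" for w
  proof -
    have 1: "VB v - VB u \<le> Vpot v - Vpot u" "Vpot v - Vpot u \<le> VB v - VB u" if "u \<le> v" "\<bar>u\<bar> \<le> B" "\<bar>v\<bar> \<le> B" for u v
    proof -
      have eq: "fclamp B x = fpot x" if "x \<in> {u..v}" for x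
        using that \<open>\<bar>u\<bar> \<le> B\<close> \<open>\<bar>v\<bar> \<le> B\<close> by (intro fclamp_props B) auto
      have d': "(VB has_real_derivative fpot x) (at x within {u..v})" if "x \<in> {u..v}" for x
        using has_field_derivative_at_within[OF d, of x "{u..v}"] eq[OF that] that \<open>\<bar>u\<bar> \<le> B\<close> \<open>\<bar>v\<bar> \<le> B\<close> B by auto
      show "VB v - VB u \<le> Vpot v - Vpot u"
        by (rule diff_le_antiderivative[OF \<open>u \<le> v\<close>, of VB fpot Vpot fpot])
          (auto intro!: d' Vpot_deriv)
      show "Vpot v - Vpot u \<le> VB v - VB u"
        by (rule diff_le_antiderivative[OF \<open>u \<le> v\<close>, of Vpot fpot VB fpot])
          (auto intro!: d' Vpot_deriv)
    qed
    show ?thesis using 1[of 0 w] 1[of w 0] that by (cases "0 \<le> w") (auto simp: VB0)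
  qed
  show ?thesis using d pos eq by blast
qed

text \<open>The bound on \<open>w\<^sup>2\<close> comes from the conservation law \<open>(w_y\<^sup>2 / 2)_t = (Vpot w)_y\<close>.\<close>

lemma truncated_tzitzeica:
  fixes W W' :: "real \<Rightarrow> real" and a R T :: real
  assumes aR: "a \<le> R" and T: "0 \<le> T"
    and W: "\<And>y. y \<in> {a..R} \<Longrightarrow> (W has_real_derivative W' y) (at y within {a..R})"
    and W': "continuous_on {a..R} W'"
  defines "Q \<equiv> \<lambda>y. integral {y..R} (\<lambda>\<eta>. Vpot (W \<eta>) + (W' \<eta>)\<^sup>2 / 2)"
  shows "\<exists>w. continuous_on ({a..R} \<times> {0..T}) (\<lambda>(y, t). w y t) \<and>
    (\<forall>y\<in>{a..R}. \<forall>t\<in>{0..T}. w y t = W y - integral {0..t} (\<lambda>s. integral {y..R} (\<lambda>\<eta>. fpot (w \<eta> s)))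
       \<and> (w y t)\<^sup>2 \<le> (W R)\<^sup>2 + 2 * (T * Vpot (W R) + Q y))"
proof -
  have Wc: "continuous_on {a..R} W"
    unfolding continuous_on_eq_continuous_within by (blast intro: DERIV_continuous W)
  define q where "q \<eta> = Vpot (W \<eta>) + (W' \<eta>)\<^sup>2 / 2" for \<eta>
  have qc: "continuous_on {a..R} q"
    unfolding q_def Vpot_def by (intro continuous_intros Wc W') auto
  have V0: "Vpot x \<ge> 0" for x using Vpot_ge[of x] by (rule order_trans[rotated]) simp
  have q0: "q \<eta> \<ge> 0" for \<eta>
    unfolding q_def by (intro add_nonneg_nonneg V0) simp
  have Q: "Q y = integral {y..R} q" for y unfolding Q_def q_def ..
  have qi: "q integrable_on {y..R}" if "y \<in> {a..R}" for y
    using that by (intro integrable_continuous_interval continuous_on_subset[OF qc]) auto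
  have Qmono: "Q y \<le> Q a" if "y \<in> {a..R}" for y
    unfolding Q using that q0 by (intro integral_subset_le qi) auto
  define E where "E y = (W R)\<^sup>2 + 2 * (T * Vpot (W R) + Q y)" for y
  obtain m where m: "\<And>y. y \<in> {a..R} \<Longrightarrow> \<bar>W y\<bar> \<le> m"
    using compact_continuous_image[OF Wc compact_Icc, THEN compact_imp_bounded] unfolding bounded_iff image_iff real_norm_def by blast
  \<comment> \<open>B exceeds the initial data, and since B is at least 1 and exceeds
    \<open>E a\<close>, also \<open>E y < B\<^sup>2\<close> for all y. The a priori bound on the
    square of w is thus strictly inside the clamp.\<close>
  define B where "B = \<bar>m\<bar> + \<bar>E a\<bar> + 1"
  have B: "B \<ge> 0" "B > 0" by (auto simp: B_def)
  have mB: "\<bar>W y\<bar> < B" if "y \<in> {a..R}" for y using m[OF that] by (simp add: B_def)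
  have EB: "E y < B\<^sup>2" if "y \<in> {a..R}" for y
  proof -
    have "E y \<le> E a" using Qmono[OF that] by (simp add: E_def)
    also have "\<dots> < B" by (auto simp: B_def)
    also have "\<dots> = B * 1" by simp
    also have "\<dots> \<le> B * B" by (intro mult_left_mono) (auto simp: B_def)
    finally show ?thesis by (simp add: power2_eq_square)
  qed
  obtain w where wc: "continuous_on ({a..R} \<times> {0..T}) (\<lambda>(y, t). w y t)"
    and w: "\<And>y t. y \<in> {a..R} \<Longrightarrow> t \<in> {0..T} \<Longrightarrow>
      w y t = W y - integral {0..t} (\<lambda>s. integral {y..R} (\<lambda>\<eta>. fclamp B (w \<eta> s)))"
    using lipschitz_goursat_exists[OF aR T _ fclamp_props(1)[OF B(1)] Wc] by auto
  have "compact ((\<lambda>(y, t). w y t) ` ({a..R} \<times> {0..T}))"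
    by (intro compact_continuous_image wc compact_Times compact_Icc)
  then have "bounded ((\<lambda>(y, t). w y t) ` ({a..R} \<times> {0..T}))" by (rule compact_imp_bounded)
  then obtain m' where "\<forall>x\<in>(\<lambda>(y, t). w y t) ` ({a..R} \<times> {0..T}). norm x \<le> m'" unfolding bounded_iff by blast
  then have m': "\<And>y t. y \<in> {a..R} \<Longrightarrow> t \<in> {0..T} \<Longrightarrow> \<bar>w y t\<bar> \<le> m'" by force
  define A where "A = B + \<bar>m'\<bar> + 1"
  have A: "B < A" by (simp add: A_def)
  have wA: "\<bar>w y t\<bar> < A" if "y \<in> {a..R}" "t \<in> {0..T}" for y t using m'[OF that] B by (simp add: A_def)
  obtain VB where VB: "\<And>x. \<bar>x\<bar> < A \<Longrightarrow> (VB has_real_derivative fclamp B x) (at x)" "\<And>x. \<bar>x\<bar> < A \<Longrightarrow> VB x \<ge> 0"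
    "\<And>x. \<bar>x\<bar> \<le> B \<Longrightarrow> VB x = Vpot x"
    using fclamp_potential_exists[OF B(1) A] by metis
  define g where "g y t = fclamp B (w y t)" for y t
  have gc: "continuous_on ({a..R} \<times> {0..T}) (\<lambda>(y, t). g y t)"
    using continuous_on_compose2[OF fclamp_props(2)[OF B(1)] wc, of UNIV] by (auto simp: g_def split_def)
  note go = goursat_operator[OF gc]
  define P where "P y t = - integral {y..R} (\<lambda>\<eta>. g \<eta> t)" for y t
  define wy where "wy y t = W' y + integral {0..t} (g y)" for y t
  have Pc: "continuous_on ({a..R} \<times> {0..T}) (\<lambda>(y, t). P y t)"
    using continuous_on_minus[OF go(1)] by (simp add: P_def split_def)
  have wyc: "continuous_on ({a..R} \<times> {0..T}) (\<lambda>(y, t). wy y t)"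
    using go(2) unfolding wy_def split_def
    by (intro continuous_on_add continuous_on_compose2[OF W'] continuous_intros) auto
  have w_t: "(w y has_real_derivative P y t) (at t within {0..T})" if "y \<in> {a..R}" "t \<in> {0..T}" for y t
  proof (rule has_field_derivative_transform_within[OF _ zero_less_one])
    show "((\<lambda>t. W y - integral {0..t} (\<lambda>s. integral {y..R} (\<lambda>\<eta>. g \<eta> s))) has_real_derivative P y t) (at t within {0..T})"
      using DERIV_diff[OF DERIV_const go(4)[OF that]] by (simp add: P_def)
  qed (use that w in \<open>auto simp: g_def\<close>)
  have w_y: "((\<lambda>y. w y t) has_real_derivative wy y t) (at y within {a..R})" if "y \<in> {a..R}" "t \<in> {0..T}" for y t
  proof (rule has_field_derivative_transform_within[OF _ zero_less_one])
    show "((\<lambda>y. W y - integral {0..t} (\<lambda>s. integral {y..R} (\<lambda>\<eta>. g \<eta> s))) has_real_derivative wy y t) (at y within {a..R})"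
      using DERIV_diff[OF W go(5)[OF that]] that by (simp add: wy_def)
  qed (use that w in \<open>auto simp: g_def\<close>)
  have P_y: "((\<lambda>y. P y t) has_real_derivative g y t) (at y within {a..R})" if "y \<in> {a..R}" "t \<in> {0..T}" for y t
    using DERIV_minus[OF integral_has_real_derivative'[OF continuous_on_slices(2)[OF gc that(2)] that(1)]] by (simp add: P_def)
  have wy_t: "(wy y has_real_derivative g y t) (at t within {0..T})" if "y \<in> {a..R}" "t \<in> {0..T}" for y t
    using DERIV_add[OF DERIV_const[of "W' y"] integral_has_real_derivative[OF continuous_on_slices(1)[OF gc that(1)] that(2)]] by (simp add: wy_def[abs_def])
  have w0: "w y 0 = W y" "wy y 0 = W' y" if "y \<in> {a..R}" for y
    using w[OF that, of 0] T by (auto simp: wy_def)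
  have VBc: "continuous_on ({a..R} \<times> {0..T}) (\<lambda>(y, t). VB (w y t))"
  proof -
    have "continuous_on {-A<..<A} VB"
      by (intro continuous_at_imp_continuous_on ballI DERIV_isCont[OF VB(1)]) auto
    from continuous_on_compose2[OF this wc] show ?thesis using wA by (fastforce simp: split_def abs_less_iff)
  qed
  have wR: "w R t = W R" if "t \<in> {0..T}" for t using w[of R t] that aR by simp
  \<comment> \<open>The density contains the potential as well. As \<open>P_y = g\<close>, the time
    derivative g P of the potential is the y-derivative of half the square of P, so e obeys a
    conservation law with the flux \<open>P^2 / 2 + VB w\<close>.\<close>
  define e where "e y t = VB (w y t) + (wy y t)\<^sup>2 / 2" for y t
  define et where "et y t = g y t * P y t + wy y t * g y t" for y t
  have ec: "continuous_on ({a..R} \<times> {0..T}) (\<lambda>(y, t). e y t)"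
    using VBc wyc unfolding e_def split_def by (intro continuous_intros) auto
  have etc: "continuous_on ({a..R} \<times> {0..T}) (\<lambda>(y, t). et y t)"
    using gc Pc wyc unfolding et_def split_def by (intro continuous_intros) auto
  have energy: "integral {y..R} (\<lambda>\<eta>. e \<eta> t) \<le> Q y + T * Vpot (W R)" if y: "y \<in> {a..R}" and t: "t \<in> {0..T}" for y t
  proof -
    have yR: "y \<le> R" using y by simp
    have d: "((\<lambda>t. integral (cbox y R) (\<lambda>\<eta>. e \<eta> t)) has_real_derivative integral (cbox y R) (\<lambda>\<eta>. et \<eta> s)) (at s within {0..T})"
      if s: "s \<in> {0..T}" for s
    proof (rule leibniz_rule_field_derivative[OF _ _ _ s])
      fix s \<eta> assume "s \<in> {0..T}" "\<eta> \<in> cbox y R"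
      then have s: "s \<in> {0..T}" and \<eta>: "\<eta> \<in> {a..R}" using y by auto
      have "((\<lambda>t. VB (w \<eta> t)) has_real_derivative g \<eta> s * P \<eta> s) (at s within {0..T})"
        unfolding g_def by (rule DERIV_chain2[OF VB(1)[OF wA[OF \<eta> s]] w_t[OF \<eta> s]])
      moreover have "((\<lambda>t. (wy \<eta> t)\<^sup>2 / 2) has_real_derivative wy \<eta> s * g \<eta> s) (at s within {0..T})"
        by (auto intro!: derivative_eq_intros wy_t[OF \<eta> s])
      ultimately show "((\<lambda>t. e \<eta> t) has_real_derivative et \<eta> s) (at s within {0..T})"
        unfolding e_def et_def by (rule DERIV_add)
    next
      fix s assume "s \<in> {0..T}"
      then show "(\<lambda>\<eta>. e \<eta> s) integrable_on cbox y R"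
        using y by (auto intro!: integrable_continuous_interval continuous_on_subset[OF continuous_on_slices(2)[OF ec]])
    next
      show "continuous_on ({0..T} \<times> cbox y R) (\<lambda>(s, \<eta>). et \<eta> s)"
        by (rule continuous_on_subset[OF continuous_on_swap_args[OF etc]]) (use y in auto)
    qed simp
    \<comment> \<open>At R the flux is the constant \<open>Vpot (W R)\<close>, because P vanishes
      there and w keeps its initial value. The flux at y is non-negative and is subtracted.\<close>
    have b: "integral (cbox y R) (\<lambda>\<eta>. et \<eta> s) \<le> Vpot (W R)" if s: "s \<in> {0..T}" for s
    proof -
      have "((\<lambda>\<eta>. et \<eta> s) has_integral ((P R s)\<^sup>2 / 2 + VB (w R s) - ((P y s)\<^sup>2 / 2 + VB (w y s)))) {y..R}"
      proof (rule fundamental_theorem_of_calculus[OF yR])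
        fix \<eta> assume "\<eta> \<in> {y..R}"
        then have \<eta>: "\<eta> \<in> {a..R}" using y by auto
        have "((\<lambda>y. VB (w y s)) has_real_derivative g \<eta> s * wy \<eta> s) (at \<eta> within {a..R})"
          unfolding g_def by (rule DERIV_chain2[OF VB(1)[OF wA[OF \<eta> s]] w_y[OF \<eta> s]])
        then have "((\<lambda>y. (P y s)\<^sup>2 / 2 + VB (w y s)) has_real_derivative et \<eta> s) (at \<eta> within {a..R})"
          by (auto intro!: derivative_eq_intros P_y[OF \<eta> s] simp: et_def)
        then show "((\<lambda>y. (P y s)\<^sup>2 / 2 + VB (w y s)) has_vector_derivative et \<eta> s) (at \<eta> within {y..R})"
          using y by (auto simp: has_real_derivative_iff_has_vector_derivative intro: has_vector_derivative_within_subset)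
      qed
      then have "integral {y..R} (\<lambda>\<eta>. et \<eta> s) = (P R s)\<^sup>2 / 2 + VB (w R s) - ((P y s)\<^sup>2 / 2 + VB (w y s))"
        by (rule integral_unique)
      moreover have "(P R s)\<^sup>2 / 2 = 0" by (simp add: P_def)
      moreover have "VB (w R s) = Vpot (W R)" using mB[of R] aR wR[OF s] VB(3)[of "W R"] by simp
      moreover have "VB (w y s) \<ge> 0" by (rule VB(2)[OF wA[OF y s]])
      moreover have "(P y s)\<^sup>2 / 2 \<ge> 0" by simp
      ultimately have "integral {y..R} (\<lambda>\<eta>. et \<eta> s) \<le> Vpot (W R)" by linarith
      then show ?thesis by simp
    qed
    have "integral (cbox y R) (\<lambda>\<eta>. e \<eta> t) - integral (cbox y R) (\<lambda>\<eta>. e \<eta> 0) \<le> Vpot (W R) * t - Vpot (W R) * 0"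
    proof (rule diff_le_antiderivative)
      fix s assume "s \<in> {0..t}"
      then have s: "s \<in> {0..T}" using t by auto
      show "((\<lambda>t. integral (cbox y R) (\<lambda>\<eta>. e \<eta> t)) has_real_derivative integral (cbox y R) (\<lambda>\<eta>. et \<eta> s)) (at s within {0..t})"
        by (rule DERIV_subset[OF d[OF s]]) (use t in auto)
      show "integral (cbox y R) (\<lambda>\<eta>. et \<eta> s) \<le> Vpot (W R)" by (rule b[OF s])
      show "((\<lambda>x. Vpot (W R) * x) has_real_derivative Vpot (W R)) (at s within {0..t})"
        by (auto intro!: derivative_eq_intros)
    qed (use t in auto)
    also have "integral (cbox y R) (\<lambda>\<eta>. e \<eta> 0) = Q y"
      unfolding Q cbox_interval
      by (rule integral_cong) (use y w0 mB VB(3) in \<open>auto simp: e_def q_def less_imp_le\<close>)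
    finally have "integral {y..R} (\<lambda>\<eta>. e \<eta> t) \<le> Q y + t * Vpot (W R)" by (simp add: mult.commute)
    also have "t * Vpot (W R) \<le> T * Vpot (W R)" using t V0 by (intro mult_right_mono) auto
    finally show ?thesis by simp
  qed
  \<comment> \<open>From (w^2)_y \<ge> - (w^2 + (w_y)^2) \<ge> - 2 e. The second inequality compares
    w^2 / 2 with \<open>VB w\<close> and is available where the clamp is inactive, hence the extra
    hypothesis.\<close>
  have square: "(w y t)\<^sup>2 \<le> E y" if y: "y \<in> {a..R}" and t: "t \<in> {0..T}" and wB: "\<And>\<eta>. \<eta> \<in> {y..R} \<Longrightarrow> \<bar>w \<eta> t\<bar> \<le> B" for y t
  proof -
    have yR: "y \<le> R" using y by simp
    have "((\<lambda>\<eta>. 2 * w \<eta> t * wy \<eta> t) has_integral ((w R t)\<^sup>2 - (w y t)\<^sup>2)) {y..R}"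
    proof (rule fundamental_theorem_of_calculus[OF yR])
      fix \<eta> assume "\<eta> \<in> {y..R}"
      then have \<eta>: "\<eta> \<in> {a..R}" using y by auto
      have "((\<lambda>y. (w y t)\<^sup>2) has_real_derivative 2 * w \<eta> t * wy \<eta> t) (at \<eta> within {a..R})"
        by (auto intro!: derivative_eq_intros w_y[OF \<eta> t])
      then show "((\<lambda>y. (w y t)\<^sup>2) has_vector_derivative 2 * w \<eta> t * wy \<eta> t) (at \<eta> within {y..R})"
        using y by (auto simp: has_real_derivative_iff_has_vector_derivative intro: has_vector_derivative_within_subset)
    qed
    moreover have "(\<lambda>\<eta>. - (2 * e \<eta> t)) integrable_on {y..R}"
      using y t by (intro integrable_continuous_interval continuous_intros continuous_on_subset[OF continuous_on_slices(2)[OF ec]]) auto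
    moreover have "- (2 * e \<eta> t) \<le> 2 * w \<eta> t * wy \<eta> t" if "\<eta> \<in> {y..R}" for \<eta>
    proof -
      have "0 \<le> (w \<eta> t + wy \<eta> t)\<^sup>2" by simp
      then have "- ((w \<eta> t)\<^sup>2 + (wy \<eta> t)\<^sup>2) \<le> 2 * w \<eta> t * wy \<eta> t" by (simp add: power2_sum)
      moreover have "(w \<eta> t)\<^sup>2 / 2 \<le> VB (w \<eta> t)" using VB(3)[OF wB[OF that]] Vpot_ge by simp
      moreover have "2 * e \<eta> t = 2 * VB (w \<eta> t) + (wy \<eta> t)\<^sup>2" by (simp add: e_def)
      ultimately show ?thesis by linarith
    qed
    ultimately have "integral {y..R} (\<lambda>\<eta>. - (2 * e \<eta> t)) \<le> (w R t)\<^sup>2 - (w y t)\<^sup>2"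
      by (intro has_integral_le[OF integrable_integral])
    moreover have "integral {y..R} (\<lambda>\<eta>. - (2 * e \<eta> t)) = - 2 * integral {y..R} (\<lambda>\<eta>. e \<eta> t)"
      using integral_mult_right[of "{y..R}" "-2" "\<lambda>\<eta>. e \<eta> t"] by simp
    ultimately show ?thesis using energy[OF y t] wR[OF t] unfolding E_def by simp
  qed
  have wB: "\<bar>w y t\<bar> \<le> B" if y: "y \<in> {a..R}" and t: "t \<in> {0..T}" for y t
  proof (rule ccontr)
    assume neg: "\<not> \<bar>w y t\<bar> \<le> B"
    have c: "continuous_on {x..R} (\<lambda>\<eta>. \<bar>w \<eta> t\<bar>)" if "x \<in> {a..R}" for x
      by (rule continuous_on_subset[OF continuous_on_rabs[OF continuous_on_slices(2)[OF wc t]]]) (use that in auto)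
    have end_lt: "\<bar>w R t\<bar> < B" using wR[OF t] mB[of R] aR by simp
    have cross: "\<exists>z\<in>{x..R}. \<bar>w z t\<bar> = B" if "x \<in> {a..R}" "B < \<bar>w x t\<bar>" for x
      using IVT2'[of "\<lambda>\<eta>. \<bar>w \<eta> t\<bar>" R B x] c[OF that(1)] that end_lt by auto
    \<comment> \<open>For fixed t, take the rightmost point at which the bound B is attained. To its
      right the clamp is inactive, so \<open>square\<close> applies there and gives a value strictly
      below B, a contradiction. At R the value is below B to begin with.\<close>
    define S where "S = {\<eta> \<in> {y..R}. \<bar>w \<eta> t\<bar> = B}"
    have "closed S" unfolding S_def
      using continuous_closed_preimage_constant[OF c[OF y] closed_atLeastAtMost] by simp
    moreover have "bounded S" by (rule bounded_subset[of "{y..R}"]) (auto simp: S_def)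
    ultimately have "compact S" by (simp add: compact_eq_bounded_closed)
    moreover have "S \<noteq> {}" using cross[OF y] neg by (auto simp: S_def)
    ultimately have "\<exists>s\<in>S. \<forall>t\<in>S. t \<le> s" by (rule compact_attains_sup)
    then obtain z where z: "z \<in> S" "\<And>x. x \<in> S \<Longrightarrow> x \<le> z" by auto
    have zR: "z \<in> {a..R}" using z(1) y by (auto simp: S_def)
    have "\<bar>w \<eta> t\<bar> \<le> B" if "\<eta> \<in> {z..R}" for \<eta>
    proof (rule ccontr)
      assume "\<not> \<bar>w \<eta> t\<bar> \<le> B"
      moreover have "\<eta> \<in> {a..R}" using that zR by auto
      ultimately obtain x where x: "x \<in> {\<eta>..R}" "\<bar>w x t\<bar> = B" using cross[of \<eta>] by force
      then have "x \<in> S" using that z(1) by (auto simp: S_def)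
      then have "x \<le> \<eta>" using z(2) that by force
      then have "x = \<eta>" using x(1) by simp
      then show False using x(2) \<open>\<not> \<bar>w \<eta> t\<bar> \<le> B\<close> by simp
    qed
    then have "(w z t)\<^sup>2 \<le> E z" by (rule square[OF zR t])
    also have "\<dots> < B\<^sup>2" by (rule EB[OF zR])
    also have "B\<^sup>2 = (w z t)\<^sup>2" using z(1) power2_abs[of "w z t"] by (simp add: S_def)
    finally show False by simp
  qed
  have "w y t = W y - integral {0..t} (\<lambda>s. integral {y..R} (\<lambda>\<eta>. fpot (w \<eta> s)))" if "y \<in> {a..R}" "t \<in> {0..T}" for y t
  proof -
    have "integral {0..t} (\<lambda>s. integral {y..R} (\<lambda>\<eta>. fclamp B (w \<eta> s))) = integral {0..t} (\<lambda>s. integral {y..R} (\<lambda>\<eta>. fpot (w \<eta> s)))"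
      by (intro integral_cong fclamp_props B wB) (use that in auto)
    then show ?thesis using w[OF that] by simp
  qed
  moreover have "(w y t)\<^sup>2 \<le> (W R)\<^sup>2 + 2 * (T * Vpot (W R) + Q y)" if "y \<in> {a..R}" "t \<in> {0..T}" for y t
    using square[OF that wB] that unfolding E_def by auto
  ultimately show ?thesis using wc by blast
qed

section \<open>Integrals over half lines under power bounds\<close>

lemma inverse_power_tail:
  fixes y :: real assumes "y \<ge> 1"
  shows "((\<lambda>\<eta>. 1 / \<eta> ^ (m + 2)) has_integral 1 / (real (m + 1) * y ^ (m + 1))) {y..}"
  using has_integral_inverse_power_to_inf[of "m + 2" y] assms by simp

context
  fixes g :: "real \<Rightarrow> real" and C :: real and m :: nat
  assumes g: "continuous_on {1..} g" and gC: "\<And>\<eta>. \<eta> \<ge> 1 \<Longrightarrow> \<bar>g \<eta>\<bar> \<le> C / \<eta> ^ (m + 2)"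
begin

lemma tail_integrable: assumes "y \<ge> 1" shows "g integrable_on {y..}"
proof (rule measurable_bounded_by_integrable_imp_integrable)
  show "g \<in> borel_measurable (lebesgue_on {y..})"
    by (intro continuous_imp_measurable_on_sets_lebesgue continuous_on_subset[OF g]) (use assms in auto)
  show "(\<lambda>\<eta>. C * (1 / \<eta> ^ (m + 2))) integrable_on {y..}"
    using has_integral_mult_right[OF inverse_power_tail[OF assms, of m], of C] by blast
qed (use gC assms in auto)

lemma tail_bound: assumes "y \<ge> 1" shows "\<bar>integral {y..} g\<bar> \<le> C / y ^ (m + 1)"
proof -
  have C: "C \<ge> 0" using gC[of 1] by simp
  have "norm (integral {y..} g) \<le> integral {y..} (\<lambda>\<eta>. C * (1 / \<eta> ^ (m + 2)))"
  proof (rule integral_norm_bound_integral[OF tail_integrable[OF assms]])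
    show "(\<lambda>\<eta>. C * (1 / \<eta> ^ (m + 2))) integrable_on {y..}"
      using has_integral_mult_right[OF inverse_power_tail[OF assms, of m], of C] by blast
  qed (use gC assms in auto)
  also have "\<dots> = C * (1 / (real (m + 1) * y ^ (m + 1)))"
    by (rule integral_unique[OF has_integral_mult_right[OF inverse_power_tail[OF assms]]])
  also have "\<dots> \<le> C * (1 / (1 * y ^ (m + 1)))"
    using assms C by (intro mult_left_mono divide_left_mono mult_right_mono mult_pos_pos) auto
  finally show ?thesis by simp
qed

lemma tail_split: assumes "1 \<le> y" "y \<le> b" shows "integral {y..} g = integral {y..b} g + integral {b..} g"
proof -
  have "integral ({y..b} \<union> {b..}) g = integral {y..b} g + integral {b..} g"
  proof (rule integral_Un)
    show "g integrable_on {y..b}"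
      by (intro integrable_continuous_interval continuous_on_subset[OF g]) (use assms in auto)
    show "g integrable_on {b..}" by (rule tail_integrable) (use assms in auto)
    have "{y..b} \<inter> {b..} = {b}" using assms by auto
    then show "negligible ({y..b} \<inter> {b..})" by simp
  qed
  moreover have "{y..b} \<union> {b..} = {y..}" using assms by auto
  ultimately show ?thesis by simp
qed

lemma tail_has_real_derivative:
  assumes "1 \<le> y" shows "((\<lambda>y. integral {y..} g) has_real_derivative - g y) (at y within {1..})"
proof -
  have "continuous_on {1..y+1} g" by (rule continuous_on_subset[OF g]) auto
  then have "((\<lambda>y. integral {y..y'+1} g) has_real_derivative - g y) (at y within {1..y+1})" if "y' = y" for y'
    using integral_has_real_derivative'[of 1 "y+1" g y] assms that by auto
  then have "((\<lambda>x. integral {x..y+1} g + integral {y+1..} g) has_real_derivative - g y) (at y within {1..y+1})"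
    by (auto intro!: derivative_eq_intros)
  then have "((\<lambda>x. integral {x..} g) has_real_derivative - g y) (at y within {1..y+1})"
    by (rule has_field_derivative_transform_within[OF _ zero_less_one]) (use assms in \<open>auto intro!: tail_split[symmetric]\<close>)
  moreover have "at y within {1..y+1} = at y within {1..}"
    by (rule at_within_nhd[of y "{y-1<..<y+1}"]) auto
  ultimately show ?thesis by simp
qed

end

text \<open>The truncated integrals can be differentiated under the integral sign, and the tails of
  their derivatives are small uniformly in t. Uniform convergence of the derivatives carries the
  formula to the limit.\<close>

lemma tail_param_derivative:
  fixes g gt :: "real \<Rightarrow> real \<Rightarrow> real"
  assumes d: "\<And>\<eta> t. \<eta> \<ge> 1 \<Longrightarrow> t \<in> {0..T} \<Longrightarrow> (g \<eta> has_real_derivative gt \<eta> t) (at t within {0..T})"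
    and gc: "continuous_on ({1..} \<times> {0..T}) (\<lambda>(\<eta>, t). g \<eta> t)"
    and gtc: "continuous_on ({1..} \<times> {0..T}) (\<lambda>(\<eta>, t). gt \<eta> t)"
    and gb: "\<And>\<eta> t. \<eta> \<ge> 1 \<Longrightarrow> t \<in> {0..T} \<Longrightarrow> \<bar>g \<eta> t\<bar> \<le> C / \<eta> ^ 2"
    and gtb: "\<And>\<eta> t. \<eta> \<ge> 1 \<Longrightarrow> t \<in> {0..T} \<Longrightarrow> \<bar>gt \<eta> t\<bar> \<le> C / \<eta> ^ 2"
    and y: "y \<ge> 1" and t: "t \<in> {0..T}"
  shows "((\<lambda>t. integral {y..} (\<lambda>\<eta>. g \<eta> t)) has_real_derivative integral {y..} (\<lambda>\<eta>. gt \<eta> t)) (at t within {0..T})"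
proof -
  have C: "C \<ge> 0" using gb[of 1 t] t by simp
  have gs: "continuous_on {1..} (\<lambda>\<eta>. g \<eta> s)" and gts: "continuous_on {1..} (\<lambda>\<eta>. gt \<eta> s)" if "s \<in> {0..T}" for s
    using continuous_on_slices(2)[OF gc that] continuous_on_slices(2)[OF gtc that] .
  have gb': "\<bar>g \<eta> s\<bar> \<le> C / \<eta> ^ (0 + 2)" "\<bar>gt \<eta> s\<bar> \<le> C / \<eta> ^ (0 + 2)" if "\<eta> \<ge> 1" "s \<in> {0..T}" for \<eta> s
    using gb[OF that] gtb[OF that] by (simp_all only: add_0)
  have split: "integral {y..} (\<lambda>\<eta>. g \<eta> s) = integral {y..y + real n} (\<lambda>\<eta>. g \<eta> s) + integral {y + real n..} (\<lambda>\<eta>. g \<eta> s)"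
    "integral {y..} (\<lambda>\<eta>. gt \<eta> s) = integral {y..y + real n} (\<lambda>\<eta>. gt \<eta> s) + integral {y + real n..} (\<lambda>\<eta>. gt \<eta> s)"
    if s: "s \<in> {0..T}" for s n
    by (rule tail_split[OF gs[OF s] gb'(1)[OF _ s]] tail_split[OF gts[OF s] gb'(2)[OF _ s]]; use y in simp)+
  have tb: "\<bar>integral {y + real n..} (\<lambda>\<eta>. g \<eta> s)\<bar> \<le> C / (y + real n)"
    "\<bar>integral {y + real n..} (\<lambda>\<eta>. gt \<eta> s)\<bar> \<le> C / (y + real n)" if s: "s \<in> {0..T}" for s n
    using tail_bound[OF gs[OF s] gb'(1)[OF _ s], of "y + real n"] tail_bound[OF gts[OF s] gb'(2)[OF _ s], of "y + real n"] y by simp_all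
  have lim0: "(\<lambda>n. C / (y + real n)) \<longlonglongrightarrow> 0"
    by (rule tendsto_divide_0[OF tendsto_const])
      (rule filterlim_at_top_imp_at_infinity[OF filterlim_tendsto_add_at_top[OF tendsto_const filterlim_real_sequentially]])
  have conv: "(\<lambda>n. integral {y..y + real n} (\<lambda>\<eta>. g \<eta> s)) \<longlonglongrightarrow> integral {y..} (\<lambda>\<eta>. g \<eta> s)" if s: "s \<in> {0..T}" for s
  proof (rule LIM_zero_cancel, rule Lim_null_comparison[OF _ lim0])
    show "\<forall>\<^sub>F n in sequentially. norm (integral {y..y + real n} (\<lambda>\<eta>. g \<eta> s) - integral {y..} (\<lambda>\<eta>. g \<eta> s)) \<le> C / (y + real n)"
    proof (intro always_eventually allI)
      fix n
      show "norm (integral {y..y + real n} (\<lambda>\<eta>. g \<eta> s) - integral {y..} (\<lambda>\<eta>. g \<eta> s)) \<le> C / (y + real n)"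
        using tb(1)[OF s, of n] split(1)[OF s, of n] unfolding real_norm_def by linarith
    qed
  qed
  have "\<exists>G. \<forall>s\<in>{0..T}. (\<lambda>n. integral {y..y + real n} (\<lambda>\<eta>. g \<eta> s)) \<longlonglongrightarrow> G s \<and>
    (G has_derivative (\<lambda>h. integral {y..} (\<lambda>\<eta>. gt \<eta> s) * h)) (at s within {0..T})"
  proof (rule has_derivative_sequence)
    fix n s assume s: "s \<in> {0..T}"
    have "((\<lambda>s. integral (cbox y (y + real n)) (\<lambda>\<eta>. g \<eta> s)) has_real_derivative integral (cbox y (y + real n)) (\<lambda>\<eta>. gt \<eta> s)) (at s within {0..T})"
    proof (rule leibniz_rule_field_derivative)
      show "(\<lambda>\<eta>. g \<eta> x) integrable_on cbox y (y + real n)" if "x \<in> {0..T}" for x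
        using y by (auto intro!: integrable_continuous_interval continuous_on_subset[OF gs[OF that]])
      show "continuous_on ({0..T} \<times> cbox y (y + real n)) (\<lambda>(x, t). gt t x)"
        by (rule continuous_on_subset[OF continuous_on_swap_args[OF gtc]]) (use y in auto)
    qed (use d y s in auto)
    then show "((\<lambda>s. integral {y..y + real n} (\<lambda>\<eta>. g \<eta> s)) has_derivative (\<lambda>h. integral {y..y + real n} (\<lambda>\<eta>. gt \<eta> s) * h)) (at s within {0..T})"
      by (simp add: has_field_derivative_def)
  next
    fix e :: real assume "e > 0"
    have "\<forall>\<^sub>F n in sequentially. C / (y + real n) < e" using order_tendstoD(2)[OF lim0 \<open>e > 0\<close>] .
    then show "\<forall>\<^sub>F n in sequentially. \<forall>s\<in>{0..T}. \<forall>h. norm (integral {y..y + real n} (\<lambda>\<eta>. gt \<eta> s) * h - integral {y..} (\<lambda>\<eta>. gt \<eta> s) * h) \<le> e * norm h"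
    proof (rule eventually_mono, intro ballI allI)
      fix n s h assume n: "C / (y + real n) < e" and s: "s \<in> {0..T}"
      have "\<bar>integral {y..y + real n} (\<lambda>\<eta>. gt \<eta> s) - integral {y..} (\<lambda>\<eta>. gt \<eta> s)\<bar> \<le> e"
        using tb(2)[OF s, of n] split(2)[OF s, of n] n by linarith
      then show "norm (integral {y..y + real n} (\<lambda>\<eta>. gt \<eta> s) * h - integral {y..} (\<lambda>\<eta>. gt \<eta> s) * h) \<le> e * norm h"
        by (simp add: abs_mult mult_right_mono flip: left_diff_distrib)
    qed
  next
    show "(\<lambda>n. integral {y..y + real n} (\<lambda>\<eta>. g \<eta> t)) \<longlonglongrightarrow> integral {y..} (\<lambda>\<eta>. g \<eta> t)" by (rule conv[OF t])
  qed (use t in auto)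
  then obtain G where G: "\<And>s. s \<in> {0..T} \<Longrightarrow> (\<lambda>n. integral {y..y + real n} (\<lambda>\<eta>. g \<eta> s)) \<longlonglongrightarrow> G s"
    "\<And>s. s \<in> {0..T} \<Longrightarrow> (G has_derivative (\<lambda>h. integral {y..} (\<lambda>\<eta>. gt \<eta> s) * h)) (at s within {0..T})" by blast
  have "G s = integral {y..} (\<lambda>\<eta>. g \<eta> s)" if "s \<in> {0..T}" for s
    using LIMSEQ_unique[OF G(1)[OF that] conv[OF that]] .
  then show ?thesis
    using has_derivative_transform_within[OF G(2)[OF t] zero_less_one t] by (simp add: has_field_derivative_def)
qed

text \<open>The diagonal argument of Arzela and Ascoli: convergence on a countable dense set extends
  to every point by the common Lipschitz constant.\<close>

lemma lipschitz_pointwise_subsequence: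
  fixes u :: "nat \<Rightarrow> real \<times> real \<Rightarrow> real"
  assumes M: "\<And>n p. \<bar>u n p\<bar> \<le> M" and D: "D > 0" "\<And>n p q. \<bar>u n p - u n q\<bar> \<le> D * dist p q"
  shows "\<exists>k v. strict_mono k \<and> (\<forall>p. (\<lambda>n. u (k n) p) \<longlonglongrightarrow> v p)"
proof -
  obtain S :: "(real \<times> real) set" where S: "countable S" "\<And>X. open X \<Longrightarrow> X \<noteq> {} \<Longrightarrow> \<exists>d\<in>S. d \<in> X"
    using countable_dense_exists by blast
  obtain k where k: "strict_mono k" "\<And>x. x \<in> S \<Longrightarrow> \<exists>l. (\<lambda>n. u (k n) x) \<longlonglongrightarrow> l"
    using function_convergent_subsequence[OF S(1), of u M] M by auto
  have "Cauchy (\<lambda>n. u (k n) p)" for p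
  proof (rule metric_CauchyI)
    fix e :: real assume e: "e > 0"
    obtain d where d: "d \<in> S" "dist p d < e / (3 * D)"
    proof -
      have "e / (3 * D) > 0" using e D(1) by simp
      then have "\<exists>d\<in>S. d \<in> ball p (e / (3 * D))" by (intro S(2)) auto
      then show ?thesis using that by auto
    qed
    have "Cauchy (\<lambda>n. u (k n) d)" using k(2)[OF d(1)] by (auto intro: LIMSEQ_imp_Cauchy)
    then obtain N where N: "\<And>m n. m \<ge> N \<Longrightarrow> n \<ge> N \<Longrightarrow> dist (u (k m) d) (u (k n) d) < e / 3"
      using e by (metis metric_CauchyD divide_pos_pos zero_less_numeral)
    have "dist (u (k m) p) (u (k n) p) < e" if "m \<ge> N" "n \<ge> N" for m n
    proof -
      have "D * dist p d < e / 3" using d(2) D(1) by (simp add: field_simps)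
      then have "\<bar>u (k m) p - u (k m) d\<bar> < e / 3" "\<bar>u (k n) p - u (k n) d\<bar> < e / 3"
        using D(2)[of "k m" p d] D(2)[of "k n" p d] by linarith+
      then show ?thesis using N[OF that] unfolding dist_real_def by linarith
    qed
    then show "\<exists>M. \<forall>m\<ge>M. \<forall>n\<ge>M. dist (u (k m) p) (u (k n) p) < e" by blast
  qed
  then have "\<forall>p. \<exists>l. (\<lambda>n. u (k n) p) \<longlonglongrightarrow> l" using Cauchy_convergent_iff convergent_def by blast
  then show ?thesis using k(1) by metis
qed

text \<open>\<open>P\<close> is w_t and \<open>Pt\<close> is its time derivative; the bound on
  \<open>Pt\<close> is used in the estimate near z = 0, where a term containing \<open>P\<close> is
  split off and differentiated in t. The exponent 3 is one less than 4 because \<open>P\<close>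
  arises as a tail integral of the nonlinearity.\<close>

locale tzitzeica_strip =
  fixes a T K :: real and w wy P Pt :: "real \<Rightarrow> real \<Rightarrow> real"
  assumes T: "0 \<le> T"
    and w_cont: "continuous_on ({a..} \<times> {0..T}) (\<lambda>(y, t). w y t)"
    and wy_cont: "continuous_on ({a..} \<times> {0..T}) (\<lambda>(y, t). wy y t)"
    and P_cont: "continuous_on ({a..} \<times> {0..T}) (\<lambda>(y, t). P y t)"
    and w_y: "\<And>y t. y \<ge> a \<Longrightarrow> t \<in> {0..T} \<Longrightarrow> ((\<lambda>y. w y t) has_real_derivative wy y t) (at y within {a..})"
    and w_t: "\<And>y t. y \<ge> a \<Longrightarrow> t \<in> {0..T} \<Longrightarrow> (w y has_real_derivative P y t) (at t within {0..T})"
    and P_y: "\<And>y t. y \<ge> a \<Longrightarrow> t \<in> {0..T} \<Longrightarrow> ((\<lambda>y. P y t) has_real_derivative fpot (w y t)) (at y within {a..})"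
    and wy_t: "\<And>y t. y \<ge> a \<Longrightarrow> t \<in> {0..T} \<Longrightarrow> (wy y has_real_derivative fpot (w y t)) (at t within {0..T})"
    and P_t: "\<And>y t. y \<ge> a \<Longrightarrow> t \<in> {0..T} \<Longrightarrow> (P y has_real_derivative Pt y t) (at t within {0..T})"
    and w_bound: "\<And>y t. y \<ge> a \<Longrightarrow> t \<in> {0..T} \<Longrightarrow> \<bar>w y t\<bar> \<le> K / (1 + y - a) ^ 4"
    and P_bound: "\<And>y t. y \<ge> a \<Longrightarrow> t \<in> {0..T} \<Longrightarrow> \<bar>P y t\<bar> \<le> K / (1 + y - a) ^ 3"
    and Pt_bound: "\<And>y t. y \<ge> a \<Longrightarrow> t \<in> {0..T} \<Longrightarrow> \<bar>Pt y t\<bar> \<le> K"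

lemma abs_diff_le_of_deriv_bound:
  fixes f :: "real \<Rightarrow> real"
  assumes f: "\<And>x. x \<in> {a..b} \<Longrightarrow> (f has_real_derivative f' x) (at x within {a..b})"
    and D: "\<And>x. x \<in> {a..b} \<Longrightarrow> \<bar>f' x\<bar> \<le> D" and uv: "u \<in> {a..b}" "v \<in> {a..b}"
  shows "\<bar>f u - f v\<bar> \<le> D * \<bar>u - v\<bar>"
  using uv
proof (induction u v rule: linorder_wlog)
  case (le u v)
  have "norm (f v - f u) \<le> D * v - D * u"
  proof (rule norm_diff_le_antiderivative[OF le(1)])
    fix x assume "x \<in> {u..v}"
    then have x: "x \<in> {a..b}" using le by auto
    show "(f has_vector_derivative f' x) (at x within {u..v})"
      using DERIV_subset[OF f[OF x], of "{u..v}"] le by (simp add: has_real_derivative_iff_has_vector_derivative)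
    show "((\<lambda>x. D * x) has_real_derivative D) (at x within {u..v})" by (auto intro!: derivative_eq_intros)
    show "norm (f' x) \<le> D" using D[OF x] by simp
  qed
  then show ?case using le by (simp add: abs_minus_commute right_diff_distrib)
qed (simp add: abs_minus_commute)

lemma continuous_on_lipschitz2:
  fixes g :: "real \<Rightarrow> real \<Rightarrow> real"
  assumes D: "\<And>y y' t. y \<in> A \<Longrightarrow> y' \<in> A \<Longrightarrow> t \<in> B \<Longrightarrow> \<bar>g y t - g y' t\<bar> \<le> D * \<bar>y - y'\<bar>"
    "\<And>y t t'. y \<in> A \<Longrightarrow> t \<in> B \<Longrightarrow> t' \<in> B \<Longrightarrow> \<bar>g y t - g y t'\<bar> \<le> D * \<bar>t - t'\<bar>"
  shows "continuous_on (A \<times> B) (\<lambda>(y, t). g y t)"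
proof (rule lipschitz_on_continuous_on[of "2 * \<bar>D\<bar>"], rule lipschitz_onI)
  fix p q assume p: "p \<in> A \<times> B" and q: "q \<in> A \<times> B"
  obtain y t y' t' where pq: "p = (y, t)" "q = (y', t')" by (cases p, cases q)
  have "\<bar>g y t - g y' t'\<bar> \<le> D * \<bar>y - y'\<bar> + D * \<bar>t - t'\<bar>"
    using D(1)[of y y' t] D(2)[of y' t t'] p q pq by auto
  also have "\<dots> \<le> \<bar>D\<bar> * \<bar>y - y'\<bar> + \<bar>D\<bar> * \<bar>t - t'\<bar>" by (intro add_mono mult_right_mono) auto
  also have "\<dots> \<le> \<bar>D\<bar> * dist p q + \<bar>D\<bar> * dist p q"
    using dist_fst_le[of p q] dist_snd_le[of p q] by (intro add_mono mult_left_mono) (auto simp: pq dist_real_def)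
  finally show "dist (case p of (y, t) \<Rightarrow> g y t) (case q of (y, t) \<Rightarrow> g y t) \<le> 2 * \<bar>D\<bar> * dist p q"
    by (simp add: pq dist_real_def)
qed simp

text \<open>The solutions truncated at \<open>R n\<close> satisfy bounds whose constants do not
  depend on n. A pointwise convergent subsequence is passed to the limit in the integral equation by
  dominated convergence.\<close>

lemma tzitzeica_exists:
  fixes W W' :: "real \<Rightarrow> real" and T C :: real
  assumes T: "0 \<le> T"
    and W: "\<And>y. y \<ge> 1 \<Longrightarrow> (W has_real_derivative W' y) (at y within {1..})"
    and W': "continuous_on {1..} W'"
    and WC: "\<And>y. y \<ge> 1 \<Longrightarrow> \<bar>W y\<bar> \<le> C / y ^ 5" "\<And>y. y \<ge> 1 \<Longrightarrow> \<bar>W' y\<bar> \<le> C / y ^ 5"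
  shows "\<exists>w wy P Pt K. tzitzeica_strip 1 T K w wy P Pt \<and> (\<forall>y\<ge>1. w y 0 = W y \<and> wy y 0 = W' y)"
proof -
  have C: "C \<ge> 0" using WC(1)[of 1] by simp
  define L1 where "L1 = 2 * exp (2 * C) + exp C"
  have L1: "L1 \<ge> 0" by (simp add: L1_def)
  \<comment> \<open>The summands under the root collect the boundary value at \<open>R n\<close>,
    the flux \<open>T * Vpot (W (R n))\<close> and the initial energy to the right of y, all
    relative to the square of C.\<close>
  define K0 where "K0 = C * sqrt (2 + T * L1 + L1)"
  have K0: "K0 \<ge> 0" "K0\<^sup>2 = C\<^sup>2 * (2 + T * L1 + L1)"
    using C T L1 by (auto simp: K0_def power_mult_distrib)
  define L where "L = 2 * exp (2 * K0) + exp K0"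
  have L: "L \<ge> 0" by (simp add: L_def)
  define F where "F = L * K0"
  have F: "F \<ge> 0" using L K0 by (simp add: F_def)
  \<comment> \<open>A common Lipschitz constant of all truncated solutions: \<open>C + T * F\<close>
    suffices in y and F in t; the summand 1 makes it positive.\<close>
  define D where "D = C + T * F + F + 1"
  have D: "D > 0" using C T F by (simp add: D_def add_nonneg_pos)
  have ffb: "\<bar>fpot x\<bar> \<le> F / y ^ 4" if "\<bar>x\<bar> \<le> K0 / y ^ 4" "y \<ge> 1" for x y
  proof -
    have "K0 / y ^ 4 \<le> K0 / 1" using that(2) K0 by (intro divide_left_mono) auto
    then have "\<bar>fpot x\<bar> \<le> L * \<bar>x\<bar>" unfolding L_def using that by (intro fpot_abs_le) auto
    also have "\<dots> \<le> L * (K0 / y ^ 4)" using that L by (intro mult_left_mono) auto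
    finally show ?thesis by (simp add: F_def)
  qed
  have F4: "F / y ^ 4 \<le> F" if "y \<ge> 1" for y using that F by (simp add: divide_le_eq_1 field_simps mult_le_cancel_left1)
  define R where "R n = 1 + real n" for n :: nat
  have "\<exists>w. continuous_on ({1..R n} \<times> {0..T}) (\<lambda>(y, t). w y t) \<and>
    (\<forall>y\<in>{1..R n}. \<forall>t\<in>{0..T}. w y t = W y - integral {0..t} (\<lambda>s. integral {y..R n} (\<lambda>\<eta>. fpot (w \<eta> s)))
       \<and> \<bar>w y t\<bar> \<le> K0 / y ^ 4)" for n
  proof -
    have R1: "1 \<le> R n" by (simp add: R_def)
    have Wn: "(W has_real_derivative W' y) (at y within {1..R n})" if "y \<in> {1..R n}" for y
      using DERIV_subset[OF W[of y], of "{1..R n}"] that by auto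
    have Wn': "continuous_on {1..R n} W'" by (rule continuous_on_subset[OF W']) auto
    have Wc: "continuous_on {1..R n} W"
      unfolding continuous_on_eq_continuous_within by (blast intro: DERIV_continuous Wn)
    define Q where "Q y = integral {y..R n} (\<lambda>\<eta>. Vpot (W \<eta>) + (W' \<eta>)\<^sup>2 / 2)" for y
    obtain w where wc: "continuous_on ({1..R n} \<times> {0..T}) (\<lambda>(y, t). w y t)"
      and w: "\<And>y t. y \<in> {1..R n} \<Longrightarrow> t \<in> {0..T} \<Longrightarrow> w y t = W y - integral {0..t} (\<lambda>s. integral {y..R n} (\<lambda>\<eta>. fpot (w \<eta> s)))"
      and w2: "\<And>y t. y \<in> {1..R n} \<Longrightarrow> t \<in> {0..T} \<Longrightarrow> (w y t)\<^sup>2 \<le> (W (R n))\<^sup>2 + 2 * (T * Vpot (W (R n)) + Q y)"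
      using truncated_tzitzeica[OF R1 T Wn Wn'] unfolding Q_def by blast
    have sq: "x\<^sup>2 \<le> C\<^sup>2 / y ^ 10" if "\<bar>x\<bar> \<le> C / y ^ 5" "y \<ge> 1" for x y :: real
    proof -
      have "x\<^sup>2 \<le> (C / y ^ 5)\<^sup>2" using that(1) by (metis abs_ge_zero power2_abs power_mono)
      then show ?thesis by (simp add: power_divide flip: power_mult)
    qed
    have V: "Vpot (W y) \<le> L1 / 2 * (C\<^sup>2 / y ^ 10)" if "y \<ge> 1" for y
    proof -
      have "C / y ^ 5 \<le> C / 1" using that C by (intro divide_left_mono) auto
      then have "Vpot (W y) \<le> L1 * (W y)\<^sup>2 / 2" unfolding L1_def using WC(1)[OF that] by (intro Vpot_le) auto
      also have "\<dots> \<le> L1 * (C\<^sup>2 / y ^ 10) / 2" using sq[OF WC(1)[OF that] that] L1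
        by (intro divide_right_mono mult_left_mono) auto
      finally show ?thesis by simp
    qed
    have "\<bar>w y t\<bar> \<le> K0 / y ^ 4" if y: "y \<in> {1..R n}" and t: "t \<in> {0..T}" for y t
    proof -
      have y1: "1 \<le> y" "y \<le> R n" using y by auto
      \<comment> \<open>The squared data decay with exponent 10, and integration over the tail
        leaves 9. All contributions are weakened to the even exponent 8, so that the square root is
        a power again.\<close>
      have p1: "C\<^sup>2 / (R n) ^ 10 \<le> C\<^sup>2 / y ^ 8"
      proof -
        have "y ^ 8 \<le> y ^ 10" using y1 by (intro power_increasing) auto
        also have "\<dots> \<le> (R n) ^ 10" using y1 by (intro power_mono) auto
        finally show ?thesis using y1 by (intro divide_left_mono mult_pos_pos zero_less_power) auto
      qed
      have p2: "C\<^sup>2 / y ^ 9 \<le> C\<^sup>2 / y ^ 8"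
        using y1 by (intro divide_left_mono mult_pos_pos zero_less_power power_increasing) auto
      have "Q y \<le> (L1 + 1) / 2 * C\<^sup>2 / y ^ 9"
      proof -
        have h: "((\<lambda>\<eta>. (L1 + 1) / 2 * C\<^sup>2 * (1 / \<eta> ^ 10)) has_integral (L1 + 1) / 2 * C\<^sup>2 * (1 / (9 * y ^ 9))) {y..}"
          using has_integral_mult_right[OF inverse_power_tail[OF y1(1), of 8], of "(L1 + 1) / 2 * C\<^sup>2"] by simp
        have h2: "(\<lambda>\<eta>. (L1 + 1) / 2 * C\<^sup>2 * (1 / \<eta> ^ 10)) integrable_on {y..R n}"
          by (intro integrable_continuous_interval continuous_intros) (use y1 in auto)
        have "Q y \<le> integral {y..R n} (\<lambda>\<eta>. (L1 + 1) / 2 * C\<^sup>2 * (1 / \<eta> ^ 10))"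
          unfolding Q_def
        proof (rule integral_le[OF _ h2])
          show "(\<lambda>\<eta>. Vpot (W \<eta>) + (W' \<eta>)\<^sup>2 / 2) integrable_on {y..R n}"
            unfolding Vpot_def
            by (intro integrable_continuous_interval continuous_intros continuous_on_subset[OF Wc] continuous_on_subset[OF Wn']) (use y1 in auto)
          fix \<eta> assume "\<eta> \<in> {y..R n}"
          then have "\<eta> \<ge> 1" using y1 by auto
          then show "Vpot (W \<eta>) + (W' \<eta>)\<^sup>2 / 2 \<le> (L1 + 1) / 2 * C\<^sup>2 * (1 / \<eta> ^ 10)"
            using V[of \<eta>] sq[OF WC(2)[of \<eta>]] by (simp add: algebra_simps add_divide_distrib)
        qed
        also have "\<dots> \<le> integral {y..} (\<lambda>\<eta>. (L1 + 1) / 2 * C\<^sup>2 * (1 / \<eta> ^ 10))"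
          using h h2 L1 y1 by (intro integral_subset_le) auto
        also have "\<dots> = (L1 + 1) / 2 * C\<^sup>2 * (1 / (9 * y ^ 9))" using h by (rule integral_unique)
        also have "\<dots> \<le> (L1 + 1) / 2 * C\<^sup>2 * (1 / (1 * y ^ 9))"
          using y1 L1 by (intro mult_left_mono divide_left_mono mult_right_mono mult_pos_pos) auto
        finally show ?thesis by simp
      qed
      also have "\<dots> = (L1 + 1) / 2 * (C\<^sup>2 / y ^ 9)" by simp
      also have "\<dots> \<le> (L1 + 1) / 2 * (C\<^sup>2 / y ^ 8)" using p2 L1 by (intro mult_left_mono) auto
      finally have Qy: "Q y \<le> (L1 + 1) / 2 * (C\<^sup>2 / y ^ 8)" .
      have WR: "(W (R n))\<^sup>2 \<le> C\<^sup>2 / y ^ 8" using sq[OF WC(1)[OF R1] R1] p1 by linarith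
      have "Vpot (W (R n)) \<le> L1 / 2 * (C\<^sup>2 / y ^ 8)"
        using V[OF R1] mult_left_mono[OF p1, of "L1 / 2"] L1 by linarith
      then have VR: "T * Vpot (W (R n)) \<le> T * (L1 / 2 * (C\<^sup>2 / y ^ 8))" using T by (intro mult_left_mono) auto
      note w2[OF y t]
      also have "(W (R n))\<^sup>2 + 2 * (T * Vpot (W (R n)) + Q y) \<le> C\<^sup>2 / y ^ 8 + 2 * (T * (L1 / 2 * (C\<^sup>2 / y ^ 8)) + (L1 + 1) / 2 * (C\<^sup>2 / y ^ 8))"
        by (intro add_mono mult_left_mono[of _ _ 2] WR VR Qy) simp
      also have "\<dots> = K0\<^sup>2 / y ^ 8" unfolding K0(2) using y1 by (simp add: field_simps)
      also have "\<dots> = (K0 / y ^ 4)\<^sup>2" by (simp add: power_divide flip: power_mult)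
      finally show ?thesis using K0(1) y1 by (simp add: abs_le_square_iff[symmetric])
    qed
    then show ?thesis using wc w by blast
  qed
  then obtain W0 where W0c: "\<And>n. continuous_on ({1..R n} \<times> {0..T}) (\<lambda>(y, t). W0 n y t)"
    and W0: "\<And>n y t. y \<in> {1..R n} \<Longrightarrow> t \<in> {0..T} \<Longrightarrow> W0 n y t = W y - integral {0..t} (\<lambda>s. integral {y..R n} (\<lambda>\<eta>. fpot (W0 n \<eta> s)))"
    and W0b: "\<And>n y t. y \<in> {1..R n} \<Longrightarrow> t \<in> {0..T} \<Longrightarrow> \<bar>W0 n y t\<bar> \<le> K0 / y ^ 4"
    by metis
  have W0f: "\<bar>fpot (W0 n y t)\<bar> \<le> F / y ^ 4" if "y \<in> {1..R n}" "t \<in> {0..T}" for n y t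
    using ffb[OF W0b[OF that]] that by auto
  have fc: "continuous_on ({1..R n} \<times> {0..T}) (\<lambda>(y, t). fpot (W0 n y t))" for n
    using continuous_on_fpot[OF W0c[of n]] by (simp add: split_def)
  note go = goursat_operator[OF fc]
  define P0 where "P0 n y t = - integral {y..R n} (\<lambda>\<eta>. fpot (W0 n \<eta> t))" for n y t
  have P0b: "\<bar>P0 n y t\<bar> \<le> F / y ^ 3" if y: "y \<in> {1..R n}" and t: "t \<in> {0..T}" for n y t
  proof -
    have y1: "y \<ge> 1" using y by auto
    have h: "((\<lambda>\<eta>. F * (1 / \<eta> ^ 4)) has_integral F * (1 / (3 * y ^ 3))) {y..}"
      using has_integral_mult_right[OF inverse_power_tail[OF y1, of 2], of F] by simp
    have h2: "(\<lambda>\<eta>. F * (1 / \<eta> ^ 4)) integrable_on {y..R n}"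
      by (intro integrable_continuous_interval continuous_intros) (use y1 in auto)
    have "norm (integral {y..R n} (\<lambda>\<eta>. fpot (W0 n \<eta> t))) \<le> integral {y..R n} (\<lambda>\<eta>. F * (1 / \<eta> ^ 4))"
    proof (rule integral_norm_bound_integral[OF _ h2])
      show "(\<lambda>\<eta>. fpot (W0 n \<eta> t)) integrable_on {y..R n}"
        by (intro integrable_continuous_interval continuous_on_subset[OF continuous_on_slices(2)[OF fc t]]) (use y in auto)
    qed (use W0f[of _ n t] y t in auto)
    also have "\<dots> \<le> integral {y..} (\<lambda>\<eta>. F * (1 / \<eta> ^ 4))"
      using h h2 F y1 by (intro integral_subset_le) auto
    also have "\<dots> = F * (1 / (3 * y ^ 3))" using h by (rule integral_unique)
    also have "\<dots> \<le> F * (1 / (1 * y ^ 3))"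
      using y1 F by (intro mult_left_mono divide_left_mono mult_right_mono mult_pos_pos) auto
    finally show ?thesis by (simp add: P0_def)
  qed
  have F3: "F / y ^ 3 \<le> D" if "y \<ge> 1" for y
  proof -
    have "F / y ^ 3 \<le> F / 1" using that F by (intro divide_left_mono) auto
    then show ?thesis using C F mult_nonneg_nonneg[OF T F] unfolding D_def by linarith
  qed
  have lip_t: "\<bar>W0 n y t - W0 n y t'\<bar> \<le> D * \<bar>t - t'\<bar>" if y: "y \<in> {1..R n}" and "t \<in> {0..T}" "t' \<in> {0..T}" for n y t t'
  proof (rule abs_diff_le_of_deriv_bound[OF _ _ that(2,3)])
    fix s assume s: "s \<in> {0..T}"
    have "((\<lambda>t. W y - integral {0..t} (\<lambda>s. integral {y..R n} (\<lambda>\<eta>. fpot (W0 n \<eta> s)))) has_real_derivative P0 n y s) (at s within {0..T})"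
      using DERIV_diff[OF DERIV_const go(4)[OF y s]] by (simp add: P0_def)
    then show "(W0 n y has_real_derivative P0 n y s) (at s within {0..T})"
      by (rule has_field_derivative_transform_within[OF _ zero_less_one s]) (use W0[OF y] in auto)
    show "\<bar>P0 n y s\<bar> \<le> D" using P0b[OF y s] F3[of y] y by auto
  qed
  have lip_y: "\<bar>W0 n y t - W0 n y' t\<bar> \<le> D * \<bar>y - y'\<bar>" if "y \<in> {1..R n}" "y' \<in> {1..R n}" and t: "t \<in> {0..T}" for n y y' t
  proof (rule abs_diff_le_of_deriv_bound[OF _ _ that(1,2)])
    fix z assume z: "z \<in> {1..R n}"
    have "((\<lambda>y. W y - integral {0..t} (\<lambda>s. integral {y..R n} (\<lambda>\<eta>. fpot (W0 n \<eta> s)))) has_real_derivative W' z + integral {0..t} (\<lambda>s. fpot (W0 n z s))) (at z within {1..R n})"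
      using DERIV_diff[OF DERIV_subset[OF W[of z]] go(5)[OF z t]] z by auto
    then show "((\<lambda>y. W0 n y t) has_real_derivative W' z + integral {0..t} (\<lambda>s. fpot (W0 n z s))) (at z within {1..R n})"
      by (rule has_field_derivative_transform_within[OF _ zero_less_one z]) (use W0[OF _ t] in auto)
    have "norm (integral {0..t} (\<lambda>s. fpot (W0 n z s))) \<le> F * (t - 0)"
    proof (rule integral_bound)
      show "continuous_on {0..t} (\<lambda>s. fpot (W0 n z s))"
        by (rule continuous_on_subset[OF continuous_on_slices(1)[OF fc z]]) (use t in auto)
      show "norm (fpot (W0 n z s)) \<le> F" if "s \<in> {0..t}" for s
        using W0f[OF z, of s] F4[of z] that t z by auto
    qed (use t in auto)
    also have "F * (t - 0) \<le> T * F" using t F by (simp add: mult.commute mult_left_mono)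
    moreover have "\<bar>W' z\<bar> \<le> C"
    proof -
      have "C / z ^ 5 \<le> C / 1" using z C by (intro divide_left_mono) auto
      then show ?thesis using WC(2)[of z] z by auto
    qed
    ultimately show "\<bar>W' z + integral {0..t} (\<lambda>s. fpot (W0 n z s))\<bar> \<le> D"
      using F unfolding D_def real_norm_def by linarith
  qed
  \<comment> \<open>Clamping both arguments gives functions on the whole plane with the same bounds,
    so that one subsequence can be chosen although the domains grow with n.\<close>
  define u where "u n p = W0 n (max 1 (min (fst p) (R n))) (max 0 (min (snd p) T))" for n and p :: "real \<times> real"
  have in_R: "max 1 (min y (R n)) \<in> {1..R n}" for y n by (auto simp: R_def)
  have in_T: "max 0 (min t T) \<in> {0..T}" for t using T by auto
  have "\<exists>k v. strict_mono k \<and> (\<forall>p. (\<lambda>n. u (k n) p) \<longlonglongrightarrow> v p)"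
  proof (rule lipschitz_pointwise_subsequence)
    show "\<bar>u n p\<bar> \<le> K0" for n p
    proof -
      define y where "y = max 1 (min (fst p) (R n))"
      have y: "y \<in> {1..R n}" unfolding y_def by (rule in_R)
      have "K0 / y ^ 4 \<le> K0 / 1" using y K0 by (intro divide_left_mono) auto
      then show ?thesis using W0b[OF y in_T[of "snd p"]] by (simp add: u_def y_def)
    qed
    show "0 < 2 * D" using D by simp
    show "\<bar>u n p - u n q\<bar> \<le> 2 * D * dist p q" for n p q
    proof -
      have "\<bar>u n p - u n q\<bar> \<le> D * \<bar>max 1 (min (fst p) (R n)) - max 1 (min (fst q) (R n))\<bar> + D * \<bar>max 0 (min (snd p) T) - max 0 (min (snd q) T)\<bar>"
      proof -
        define y1 y2 t1 t2 where "y1 = max 1 (min (fst p) (R n))" and "y2 = max 1 (min (fst q) (R n))"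
          and "t1 = max 0 (min (snd p) T)" and "t2 = max 0 (min (snd q) T)"
        have "\<bar>W0 n y1 t1 - W0 n y2 t1\<bar> \<le> D * \<bar>y1 - y2\<bar>" "\<bar>W0 n y2 t1 - W0 n y2 t2\<bar> \<le> D * \<bar>t1 - t2\<bar>"
          unfolding y1_def y2_def t1_def t2_def by (rule lip_y[OF in_R in_R in_T] lip_t[OF in_R in_T in_T])+
        then have "\<bar>W0 n y1 t1 - W0 n y2 t2\<bar> \<le> D * \<bar>y1 - y2\<bar> + D * \<bar>t1 - t2\<bar>" by linarith
        then show ?thesis unfolding u_def y1_def y2_def t1_def t2_def .
      qed
      also have "\<dots> \<le> D * \<bar>fst p - fst q\<bar> + D * \<bar>snd p - snd q\<bar>"
        using D by (intro add_mono mult_left_mono) auto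
      also have "\<dots> \<le> D * dist p q + D * dist p q"
        using dist_fst_le[of p q] dist_snd_le[of p q] D by (intro add_mono mult_left_mono) (auto simp: dist_real_def)
      finally show ?thesis by simp
    qed
  qed
  then obtain k v where k: "strict_mono k" and v: "\<And>p. (\<lambda>n. u (k n) p) \<longlonglongrightarrow> v p" by blast
  define w where "w y t = v (y, t)" for y t
  have Rk: "y \<le> R (k n)" if "y \<le> real n" for n y
    using seq_suble[OF k, of n] that by (simp add: R_def)
  have lim: "(\<lambda>n. W0 (k n) y t) \<longlonglongrightarrow> w y t" if "y \<ge> 1" "t \<in> {0..T}" for y t
  proof (rule Lim_transform_eventually[OF v[of "(y, t)", folded w_def]])
    obtain N :: nat where "y \<le> real N" using real_arch_simple by blast
    then have "u (k n) (y, t) = W0 (k n) y t" if "n \<ge> N" for n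
      using Rk[of y n] that \<open>y \<ge> 1\<close> \<open>t \<in> {0..T}\<close> by (simp add: u_def min_absorb1 max_absorb2)
    then show "\<forall>\<^sub>F n in sequentially. u (k n) (y, t) = W0 (k n) y t" by (auto simp: eventually_sequentially)
  qed
  have ev: "\<exists>N. \<forall>n\<ge>N. y \<le> R (k n)" for y
  proof -
    obtain N :: nat where "y \<le> real N" using real_arch_simple by blast
    then have "\<forall>n\<ge>N. y \<le> R (k n)" by (auto intro!: Rk)
    then show ?thesis by blast
  qed
  have wb: "\<bar>w y t\<bar> \<le> K0 / y ^ 4" if "y \<ge> 1" "t \<in> {0..T}" for y t
  proof (rule tendsto_upperbound[OF tendsto_rabs[OF lim[OF that]]])
    obtain N where "\<forall>n\<ge>N. y \<le> R (k n)" using ev by blast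
    then show "\<forall>\<^sub>F n in sequentially. \<bar>W0 (k n) y t\<bar> \<le> K0 / y ^ 4"
      unfolding eventually_sequentially by (intro exI[of _ N]) (use W0b[of y "k _" t] that in auto)
  qed simp
  have wl: "\<bar>w y t - w y' t\<bar> \<le> D * \<bar>y - y'\<bar>" if "y \<ge> 1" "y' \<ge> 1" "t \<in> {0..T}" for y y' t
  proof (rule tendsto_upperbound[OF tendsto_rabs[OF tendsto_diff[OF lim[OF that(1,3)] lim[OF that(2,3)]]]])
    obtain N where "\<forall>n\<ge>N. max y y' \<le> R (k n)" using ev by blast
    then show "\<forall>\<^sub>F n in sequentially. \<bar>W0 (k n) y t - W0 (k n) y' t\<bar> \<le> D * \<bar>y - y'\<bar>"
      unfolding eventually_sequentially by (intro exI[of _ N]) (use lip_y[of y "k _" y' t] that in auto)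
  qed simp
  have wlt: "\<bar>w y t - w y t'\<bar> \<le> D * \<bar>t - t'\<bar>" if "y \<ge> 1" "t \<in> {0..T}" "t' \<in> {0..T}" for y t t'
  proof (rule tendsto_upperbound[OF tendsto_rabs[OF tendsto_diff[OF lim[OF that(1,2)] lim[OF that(1,3)]]]])
    obtain N where "\<forall>n\<ge>N. y \<le> R (k n)" using ev by blast
    then show "\<forall>\<^sub>F n in sequentially. \<bar>W0 (k n) y t - W0 (k n) y t'\<bar> \<le> D * \<bar>t - t'\<bar>"
      unfolding eventually_sequentially by (intro exI[of _ N]) (use lip_t[of y "k _" t t'] that in auto)
  qed simp
  have wc: "continuous_on ({1..} \<times> {0..T}) (\<lambda>(y, t). w y t)"
    by (rule continuous_on_lipschitz2[of _ _ _ D]) (use wl wlt in auto)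
  have wfc: "continuous_on ({1..} \<times> {0..T}) (\<lambda>(y, t). fpot (w y t))"
    using continuous_on_fpot[OF wc] by (simp add: split_def)
  have wfb: "\<bar>fpot (w y t)\<bar> \<le> F / y ^ 4" if "y \<ge> 1" "t \<in> {0..T}" for y t
    using ffb[OF wb[OF that] that(1)] .
  define P where "P y t = - integral {y..} (\<lambda>\<eta>. fpot (w \<eta> t))" for y t
  have Plim: "(\<lambda>n. P0 (k n) y t) \<longlonglongrightarrow> P y t" if y: "y \<ge> 1" and t: "t \<in> {0..T}" for y t
  proof -
    define g where "g n \<eta> = (if \<eta> \<in> {y..R (k n)} then fpot (W0 (k n) \<eta> t) else 0)" for n \<eta>
    have gi: "integral {y..} (g n) = integral {y..R (k n)} (\<lambda>\<eta>. fpot (W0 (k n) \<eta> t))" for n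
      unfolding g_def using integral_restrict_Int[of "{y..}" "{y..R (k n)}" "\<lambda>\<eta>. fpot (W0 (k n) \<eta> t)"] by (simp add: Int_absorb2)
    have "(\<lambda>n. integral {y..} (g n)) \<longlonglongrightarrow> integral {y..} (\<lambda>\<eta>. fpot (w \<eta> t))"
    proof (rule dominated_convergence)
      show "(\<lambda>\<eta>. F * (1 / \<eta> ^ (2 + 2))) integrable_on {y..}"
        using has_integral_mult_right[OF inverse_power_tail[OF y, of 2], of F] by blast
      show "g n integrable_on {y..}" for n
      proof -
        have "(\<lambda>\<eta>. fpot (W0 (k n) \<eta> t)) integrable_on {y..R (k n)}"
          by (intro integrable_continuous_interval continuous_on_subset[OF continuous_on_slices(2)[OF fc t]]) (use y in auto)
        then show ?thesis unfolding g_def by (subst integrable_restrict_Int) (simp add: Int_absorb2)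
      qed
      show "norm (g n \<eta>) \<le> F * (1 / \<eta> ^ (2 + 2))" if "\<eta> \<in> {y..}" for n \<eta>
        using W0f[of \<eta> "k n" t] that y t F by (auto simp: g_def)
      show "(\<lambda>n. g n \<eta>) \<longlonglongrightarrow> fpot (w \<eta> t)" if "\<eta> \<in> {y..}" for \<eta>
      proof -
        have "\<eta> \<ge> 1" using that y by auto
        have "isCont fpot (w \<eta> t)" by (rule DERIV_isCont[OF fpot_deriv])
        then have l: "(\<lambda>n. fpot (W0 (k n) \<eta> t)) \<longlonglongrightarrow> fpot (w \<eta> t)"
          using lim[OF \<open>\<eta> \<ge> 1\<close> t] by (rule isCont_tendsto_compose)
        obtain N where "\<forall>n\<ge>N. \<eta> \<le> R (k n)" using ev by blast
        then have "\<forall>\<^sub>F n in sequentially. fpot (W0 (k n) \<eta> t) = g n \<eta>"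
          unfolding eventually_sequentially using that by (intro exI[of _ N]) (auto simp: g_def)
        then show ?thesis by (rule Lim_transform_eventually[OF l])
      qed
    qed
    then show ?thesis unfolding gi P_def P0_def by (rule tendsto_minus)
  qed
  have wfb': "\<bar>fpot (w y t)\<bar> \<le> F / y ^ (2 + 2)" if "y \<ge> 1" "t \<in> {0..T}" for y t using wfb[OF that] by simp
  have wfs: "continuous_on {1..} (\<lambda>\<eta>. fpot (w \<eta> t))" if "t \<in> {0..T}" for t
    using continuous_on_slices(2)[OF wfc that] by simp
  have Pb: "\<bar>P y t\<bar> \<le> F / y ^ 3" if "y \<ge> 1" "t \<in> {0..T}" for y t
    using tail_bound[OF wfs[OF that(2)] wfb' that(1)] that(2) by (simp add: P_def)
  \<comment> \<open>Continuity of \<open>P\<close> in t is not known yet: its integrability is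
    itself a product of dominated convergence, and its continuity is derived below from the
    Lipschitz bound that this identity gives for w.\<close>
  have wP: "P y integrable_on {0..t}" "w y t = W y + integral {0..t} (P y)" if y: "y \<ge> 1" and t: "t \<in> {0..T}" for y t
  proof -
    obtain N where N: "\<And>n. n \<ge> N \<Longrightarrow> y \<le> R (k n)" using ev by blast
    have yR: "y \<in> {1..R (k (n + N))}" for n using N[of "n + N"] y by simp
    have i: "P0 (k (n + N)) y integrable_on {0..t}" for n
      using continuous_on_minus[OF continuous_on_slices(1)[OF go(1) yR[of n]]] t unfolding P0_def
      by (intro integrable_continuous_interval) (auto intro: continuous_on_subset)
    have pl: "(\<lambda>n. P0 (k (n + N)) y s) \<longlonglongrightarrow> P y s" if "s \<in> {0..t}" for s
      using LIMSEQ_ignore_initial_segment[OF Plim[OF y, of s], of N] that t by auto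
    have pb: "norm (P0 (k (n + N)) y s) \<le> F / y ^ 3" if "s \<in> {0..t}" for n s
      using P0b[OF yR[of n], of s] that t by auto
    have hc: "(\<lambda>_. F / y ^ 3) integrable_on {0..t}" by (rule integrable_const_ivl)
    note dc = dominated_convergence[OF i hc pb pl]
    show "P y integrable_on {0..t}" by (rule dc)
    have "W0 (k (n + N)) y t = W y + integral {0..t} (P0 (k (n + N)) y)" for n
    proof -
      have "P0 (k (n + N)) y = (\<lambda>s. - integral {y..R (k (n + N))} (\<lambda>\<eta>. fpot (W0 (k (n + N)) \<eta> s)))"
        by (simp add: P0_def fun_eq_iff)
      then show ?thesis using W0[OF yR[of n] t] by simp
    qed
    then have "(\<lambda>n. W0 (k (n + N)) y t) \<longlonglongrightarrow> W y + integral {0..t} (P y)"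
      using tendsto_add[OF tendsto_const dc(2)] by simp
    then show "w y t = W y + integral {0..t} (P y)"
      using LIMSEQ_unique LIMSEQ_ignore_initial_segment[OF lim[OF y t]] by blast
  qed
  have P_y: "((\<lambda>y. P y t) has_real_derivative fpot (w y t)) (at y within {1..})" if y: "y \<ge> 1" and t: "t \<in> {0..T}" for y t
    unfolding P_def using DERIV_minus[OF tail_has_real_derivative[OF wfs[OF t] wfb'[OF _ t] y]] by simp
  \<comment> \<open>The Lipschitz constant in t has to decay in y, because these differences are
    integrated over a half line to obtain continuity of \<open>P\<close> in t.\<close>
  have wl3: "\<bar>w y t - w y t'\<bar> \<le> F / y ^ 3 * \<bar>t - t'\<bar>" if y: "y \<ge> 1" and "t \<in> {0..T}" "t' \<in> {0..T}" for y t t'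
    using that(2,3)
  proof (induction t t' rule: linorder_wlog)
    case (le t t')
    have "integral {0..t} (P y) + integral {t..t'} (P y) = integral {0..t'} (P y)"
      by (rule Henstock_Kurzweil_Integration.integral_combine) (use le wP(1)[OF y] in auto)
    then have "w y t' - w y t = integral {t..t'} (P y)" using wP(2)[OF y] le by simp
    moreover have "norm (integral (cbox t t') (P y)) \<le> F / y ^ 3 * measure lborel (cbox t t')"
    proof (rule integrable_bound)
      show "P y integrable_on cbox t t'"
        using integrable_subinterval_real[OF wP(1)[OF y, of t'], of t t'] le by auto
    qed (use Pb[OF y] le F y in auto)
    ultimately show ?case using le by (simp add: abs_minus_commute)
  qed (simp add: abs_minus_commute)
  have Pl: "\<bar>P y t - P y' t\<bar> \<le> D * \<bar>y - y'\<bar>" if "y \<ge> 1" "y' \<ge> 1" and t: "t \<in> {0..T}" for y y' t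
  proof (rule abs_diff_le_of_deriv_bound[of 1 "max y y'"])
    fix x assume "x \<in> {1..max y y'}"
    then have x: "x \<ge> 1" by auto
    show "((\<lambda>y. P y t) has_real_derivative fpot (w x t)) (at x within {1..max y y'})"
      by (rule DERIV_subset[OF P_y[OF x t]]) auto
    have "F \<le> D" using C T F by (simp add: D_def add_increasing)
    then show "\<bar>fpot (w x t)\<bar> \<le> D" using wfb[OF x t] F4[OF x] by linarith
  qed (use that in auto)
  have LF: "\<bar>fpot (w y t) - fpot (w y t')\<bar> \<le> L * F * \<bar>t - t'\<bar> / y ^ (1 + 2)" if y: "y \<ge> 1" and t: "t \<in> {0..T}" "t' \<in> {0..T}" for y t t'
  proof -
    have "K0 / y ^ 4 \<le> K0 / 1" using y K0 by (intro divide_left_mono) auto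
    then have "\<bar>fpot (w y t) - fpot (w y t')\<bar> \<le> L * \<bar>w y t - w y t'\<bar>"
      unfolding L_def using wb[OF y t(1)] wb[OF y t(2)] by (intro fpot_lipschitz) auto
    also have "\<dots> \<le> L * (F / y ^ 3 * \<bar>t - t'\<bar>)" using wl3[OF y t] L by (intro mult_left_mono)
    finally show ?thesis by (simp add: power3_eq_cube mult_ac)
  qed
  have Plt: "\<bar>P y t - P y t'\<bar> \<le> L * F * \<bar>t - t'\<bar>" if y: "y \<ge> 1" and t: "t \<in> {0..T}" "t' \<in> {0..T}" for y t t'
  proof -
    have i: "(\<lambda>\<eta>. fpot (w \<eta> s)) integrable_on {y..}" if "s \<in> {0..T}" for s
      by (rule tail_integrable[OF wfs[OF that] wfb'[OF _ that] y])
    have "\<bar>integral {y..} (\<lambda>\<eta>. fpot (w \<eta> t) - fpot (w \<eta> t'))\<bar> \<le> L * F * \<bar>t - t'\<bar> / y ^ (1 + 1)"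
      by (rule tail_bound[OF continuous_on_diff[OF wfs[OF t(1)] wfs[OF t(2)]] LF[OF _ t] y])
    also have "\<dots> \<le> L * F * \<bar>t - t'\<bar> / 1"
      by (intro divide_left_mono mult_nonneg_nonneg one_le_power L F y abs_ge_zero) (use y in auto)
    finally show ?thesis
      unfolding P_def using Henstock_Kurzweil_Integration.integral_diff[OF i[OF t(1)] i[OF t(2)]] by (simp add: abs_minus_commute)
  qed
  have Pc: "continuous_on ({1..} \<times> {0..T}) (\<lambda>(y, t). P y t)"
  proof (rule continuous_on_lipschitz2[of _ _ _ "D + L * F"])
    have "0 \<le> L * F" using L F by simp
    then show "\<bar>P y t - P y' t\<bar> \<le> (D + L * F) * \<bar>y - y'\<bar>" if "y \<in> {1..}" "y' \<in> {1..}" "t \<in> {0..T}" for y y' t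
      using Pl[of y y' t] that by (simp add: distrib_right add_increasing2)
    show "\<bar>P y t - P y t'\<bar> \<le> (D + L * F) * \<bar>t - t'\<bar>" if "y \<in> {1..}" "t \<in> {0..T}" "t' \<in> {0..T}" for y t t'
      using Plt[of y t t'] that D by (simp add: distrib_right add_increasing)
  qed
  have w_t: "(w y has_real_derivative P y t) (at t within {0..T})" if y: "y \<ge> 1" and t: "t \<in> {0..T}" for y t
  proof (rule has_field_derivative_transform_within[OF _ zero_less_one t])
    have "continuous_on {0..T} (P y)" using continuous_on_slices(1)[OF Pc] y by auto
    from integral_has_real_derivative[OF this t]
    show "((\<lambda>t. W y + integral {0..t} (P y)) has_real_derivative P y t) (at t within {0..T})"
      by (auto intro!: derivative_eq_intros)
  qed (use wP(2)[OF y] in auto)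
  define wy where "wy y t = W' y + integral {0..t} (\<lambda>s. fpot (w y s))" for y t
  have wyc: "continuous_on ({1..} \<times> {0..T}) (\<lambda>(y, t). wy y t)"
    using continuous_on_integral_upper[OF wfc] unfolding wy_def split_def
    by (intro continuous_on_add continuous_on_compose2[OF W'] continuous_intros) auto
  have w_y: "((\<lambda>y. w y t) has_real_derivative wy y t) (at y within {1..})" if y: "y \<ge> 1" and t: "t \<in> {0..T}" for y t
  proof (rule has_field_derivative_transform_within[OF _ zero_less_one])
    have "((\<lambda>y. integral (cbox 0 t) (P y)) has_real_derivative integral (cbox 0 t) (\<lambda>s. fpot (w y s))) (at y within {1..})"
    proof (rule leibniz_rule_field_derivative)
      show "continuous_on ({1..} \<times> cbox 0 t) (\<lambda>(y, s). fpot (w y s))"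
        by (rule continuous_on_subset[OF wfc]) (use t in auto)
    qed (use P_y wP(1)[OF _ t] t y in auto)
    then show "((\<lambda>y. W y + integral {0..t} (P y)) has_real_derivative wy y t) (at y within {1..})"
      using DERIV_add[OF W[OF y]] by (simp add: wy_def)
  qed (use wP(2)[OF _ t] y in auto)
  have wy_t: "(wy y has_real_derivative fpot (w y t)) (at t within {0..T})" if y: "y \<ge> 1" and t: "t \<in> {0..T}" for y t
  proof -
    have "continuous_on {0..T} (\<lambda>s. fpot (w y s))" using continuous_on_slices(1)[OF wfc] y by auto
    from DERIV_add[OF DERIV_const[of "W' y"] integral_has_real_derivative[OF this t]]
    show ?thesis by (simp add: wy_def[abs_def])
  qed
  define fw where "fw y t = (2 * exp (2 * w y t) + exp (- w y t)) * P y t" for y t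
  have fwc: "continuous_on ({1..} \<times> {0..T}) (\<lambda>(y, t). fw y t)"
    using wc Pc unfolding fw_def split_def by (intro continuous_intros) auto
  have fwb: "\<bar>fw y t\<bar> \<le> L * F / y ^ 3" if "y \<ge> 1" "t \<in> {0..T}" for y t
  proof -
    have "K0 / y ^ 4 \<le> K0 / 1" using that K0 by (intro divide_left_mono) auto
    then have "\<bar>w y t\<bar> \<le> K0" using wb[OF that] by simp
    then have "2 * exp (2 * w y t) + exp (- w y t) \<le> L" unfolding L_def by (intro add_mono mult_left_mono) auto
    then have "\<bar>fw y t\<bar> \<le> L * \<bar>P y t\<bar>" unfolding fw_def abs_mult
      by (intro mult_right_mono) (auto simp: abs_of_nonneg add_nonneg_nonneg)
    also have "\<dots> \<le> L * (F / y ^ 3)" using Pb[OF that] L by (intro mult_left_mono)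
    finally show ?thesis by simp
  qed
  define Pt where "Pt y t = - integral {y..} (\<lambda>\<eta>. fw \<eta> t)" for y t
  define K2 where "K2 = F + L * F"
  have K2: "F \<le> K2" "L * F \<le> K2" "0 \<le> K2" using F L by (auto simp: K2_def)
  have P_t: "(P y has_real_derivative Pt y t) (at t within {0..T})" if y: "y \<ge> 1" and t: "t \<in> {0..T}" for y t
    unfolding P_def Pt_def
  proof (rule DERIV_minus, rule tail_param_derivative[OF _ wfc fwc _ _ y t, of K2])
    fix \<eta> s assume \<eta>: "(\<eta>::real) \<ge> 1" and s: "s \<in> {0..T}"
    show "((\<lambda>s. fpot (w \<eta> s)) has_real_derivative fw \<eta> s) (at s within {0..T})"
      unfolding fw_def by (rule DERIV_chain2[OF fpot_deriv w_t[OF \<eta> s]])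
    have "F / \<eta> ^ 4 \<le> K2 / \<eta> ^ 2" "L * F / \<eta> ^ 3 \<le> K2 / \<eta> ^ 2"
      using K2 \<eta> L F by (intro frac_le power_increasing zero_less_power; auto)+
    then show "\<bar>fpot (w \<eta> s)\<bar> \<le> K2 / \<eta> ^ 2" "\<bar>fw \<eta> s\<bar> \<le> K2 / \<eta> ^ 2"
      using wfb[OF \<eta> s] fwb[OF \<eta> s] by linarith+
  qed
  have Ptb: "\<bar>Pt y t\<bar> \<le> L * F" if y: "y \<ge> 1" and t: "t \<in> {0..T}" for y t
  proof -
    have "\<bar>integral {y..} (\<lambda>\<eta>. fw \<eta> t)\<bar> \<le> L * F / y ^ (1 + 1)"
    proof (rule tail_bound[OF _ _ y])
      show "continuous_on {1..} (\<lambda>\<eta>. fw \<eta> t)" by (rule continuous_on_slices(2)[OF fwc t])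
      show "\<bar>fw \<eta> t\<bar> \<le> L * F / \<eta> ^ (1 + 2)" if "1 \<le> \<eta>" for \<eta> using fwb[OF that t] by (simp add: power3_eq_cube mult_ac)
    qed
    also have "\<dots> \<le> L * F / 1"
      by (intro divide_left_mono mult_nonneg_nonneg one_le_power L F y) (use y in auto)
    finally show ?thesis by (simp add: Pt_def)
  qed
  define K where "K = K0 + K2"
  have init: "w y 0 = W y \<and> wy y 0 = W' y" if "y \<ge> 1" for y
    using wP(2)[OF that, of 0] T by (simp add: wy_def)
  have "tzitzeica_strip 1 T K w wy P Pt"
  proof
    fix y t :: real assume y: "1 \<le> y" and t: "t \<in> {0..T}"
    have "K0 / y ^ 4 \<le> K / y ^ 4" "F / y ^ 3 \<le> K / y ^ 3" "L * F \<le> K"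
      using K2 K0 y by (auto simp: K_def intro!: divide_right_mono)
    then have "\<bar>w y t\<bar> \<le> K / y ^ 4" "\<bar>P y t\<bar> \<le> K / y ^ 3" "\<bar>Pt y t\<bar> \<le> K"
      using wb[OF y t] Pb[OF y t] Ptb[OF y t] by linarith+
    then show "\<bar>w y t\<bar> \<le> K / (1 + y - 1) ^ 4" "\<bar>P y t\<bar> \<le> K / (1 + y - 1) ^ 3" "\<bar>Pt y t\<bar> \<le> K"
      by (simp_all only: add_diff_cancel_left')
  qed (rule T wc wyc Pc w_y w_t P_y wy_t P_t; assumption)+
  then show ?thesis using init by blast
qed

text \<open>A translation by \<open>1 - a\<close>; the normalization a = 1 made the weights pure
  powers of y.\<close>

lemma tzitzeica_strip_exists:
  fixes W W' :: "real \<Rightarrow> real" and a T C :: real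
  assumes T: "0 \<le> T"
    and W: "\<And>y. y \<ge> a \<Longrightarrow> (W has_real_derivative W' y) (at y within {a..})"
    and W': "continuous_on {a..} W'"
    and WC: "\<And>y. y \<ge> a \<Longrightarrow> \<bar>W y\<bar> \<le> C / (1 + y - a) ^ 5" "\<And>y. y \<ge> a \<Longrightarrow> \<bar>W' y\<bar> \<le> C / (1 + y - a) ^ 5"
  shows "\<exists>w wy P Pt K. tzitzeica_strip a T K w wy P Pt \<and> (\<forall>y\<ge>a. w y 0 = W y \<and> wy y 0 = W' y)"
proof -
  define c where "c = 1 - a"
  have shift: "((\<lambda>x. f (z + x)) has_real_derivative D) (at x within {b..})"
    if "(f has_real_derivative D) (at (z + x) within {z + b..})" for f D z x b
    using that DERIV_at_within_shift[of f D z x "{b..}"] by (simp only: image_add_atLeast)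
  have "\<exists>w wy P Pt K. tzitzeica_strip 1 T K w wy P Pt \<and> (\<forall>y\<ge>1. w y 0 = W (- c + y) \<and> wy y 0 = W' (- c + y))"
  proof (rule tzitzeica_exists[OF T])
    fix y :: real assume y: "y \<ge> 1"
    show "((\<lambda>y. W (- c + y)) has_real_derivative W' (- c + y)) (at y within {1..})"
      by (rule shift) (use W[of "- c + y"] y in \<open>simp add: c_def\<close>)
    show "\<bar>W (- c + y)\<bar> \<le> C / y ^ 5" "\<bar>W' (- c + y)\<bar> \<le> C / y ^ 5"
      using WC[of "- c + y"] y by (simp_all add: c_def)
  next
    show "continuous_on {1..} (\<lambda>y. W' (- c + y))"
      by (rule continuous_on_compose2[OF W']) (auto simp: c_def intro!: continuous_intros)
  qed
  then obtain w wy P Pt K where S: "tzitzeica_strip 1 T K w wy P Pt"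
    and init: "\<forall>y\<ge>1. w y 0 = W (- c + y) \<and> wy y 0 = W' (- c + y)" by blast
  interpret S: tzitzeica_strip 1 T K w wy P Pt by (rule S)
  have cs: "continuous_on ({a..} \<times> {0..T}) (\<lambda>(y, t). f (c + y) t)"
    if "continuous_on ({1..} \<times> {0..T}) (\<lambda>(y, t). f y t)" for f :: "real \<Rightarrow> real \<Rightarrow> real"
    using continuous_on_compose2[OF that, of "{a..} \<times> {0..T}" "\<lambda>p. (c + fst p, snd p)"]
    by (force simp: split_def c_def intro!: continuous_intros)
  have "tzitzeica_strip a T K (\<lambda>y. w (c + y)) (\<lambda>y. wy (c + y)) (\<lambda>y. P (c + y)) (\<lambda>y. Pt (c + y))"
  proof
    fix y t :: real assume "a \<le> y" and t: "t \<in> {0..T}"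
    then have y: "1 \<le> c + y" and ca: "c + a = 1" and s: "1 + y - a = 1 + (c + y) - 1" by (auto simp: c_def)
    show "((\<lambda>y. w (c + y) t) has_real_derivative wy (c + y) t) (at y within {a..})"
      "((\<lambda>y. P (c + y) t) has_real_derivative fpot (w (c + y) t)) (at y within {a..})"
      by (rule shift, unfold ca, rule S.w_y[OF y t] S.P_y[OF y t])+
    show "(w (c + y) has_real_derivative P (c + y) t) (at t within {0..T})"
      "(wy (c + y) has_real_derivative fpot (w (c + y) t)) (at t within {0..T})"
      "(P (c + y) has_real_derivative Pt (c + y) t) (at t within {0..T})"
      "\<bar>w (c + y) t\<bar> \<le> K / (1 + y - a) ^ 4" "\<bar>P (c + y) t\<bar> \<le> K / (1 + y - a) ^ 3" "\<bar>Pt (c + y) t\<bar> \<le> K"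
      unfolding s by (rule S.w_t[OF y t] S.wy_t[OF y t] S.P_t[OF y t] S.w_bound[OF y t] S.P_bound[OF y t] S.Pt_bound[OF y t])+
  qed (rule T cs S.w_cont S.wy_cont S.P_cont)+
  moreover have "\<forall>y\<ge>a. w (c + y) 0 = W y \<and> wy (c + y) 0 = W' y"
    using init by (auto simp: c_def)
  ultimately show ?thesis by blast
qed

section \<open>Linear differential equations\<close>

text \<open>At the maximum of \<open>exp (- 2 * L * t) * norm (f t)\<close> the integral of
  \<open>L * norm f\<close> is at most half of the term to be bounded, so it can be absorbed; this
  is the origin of both factors 2.\<close>

lemma gronwall:
  fixes f :: "real \<Rightarrow> 'a::real_normed_vector"
  assumes L: "L > 0" and e: "e \<ge> 0" and T: "T \<ge> 0"
    and f: "\<And>t. t \<in> {0..T} \<Longrightarrow> (f has_vector_derivative f' t) (at t within {0..T})"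
    and le: "\<And>t. t \<in> {0..T} \<Longrightarrow> norm (f' t) \<le> L * norm (f t) + e"
    and t: "t \<in> {0..T}"
  shows "norm (f t) \<le> 2 * (norm (f 0) + e * T) * exp (2 * L * T)"
proof -
  define g where "g t = exp (- 2 * L * t) * norm (f t)" for t
  have "continuous_on {0..T} f"
    unfolding continuous_on_eq_continuous_within by (blast intro: has_vector_derivative_continuous f)
  then have "continuous_on {0..T} g" unfolding g_def by (intro continuous_intros)
  then obtain s where s: "s \<in> {0..T}" "\<And>t. t \<in> {0..T} \<Longrightarrow> g t \<le> g s"
    using continuous_attains_sup[of "{0..T}" g] T by auto
  define M where "M = g s"
  have M: "M \<ge> 0" by (simp add: M_def g_def)
  have fM: "norm (f t) \<le> M * exp (2 * L * t)" if "t \<in> {0..T}" for t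
    using s(2)[OF that] by (simp add: g_def M_def exp_minus field_simps)
  have "norm (f s - f 0) \<le> (M / 2 * exp (2 * L * s) + e * s) - (M / 2 * exp (2 * L * 0) + e * 0)"
  proof (rule norm_diff_le_antiderivative)
    fix x assume x: "x \<in> {0..s}"
    then have xT: "x \<in> {0..T}" using s(1) by auto
    show "(f has_vector_derivative f' x) (at x within {0..s})"
      by (rule has_vector_derivative_within_subset[OF f[OF xT]]) (use s(1) in auto)
    show "((\<lambda>x. M / 2 * exp (2 * L * x) + e * x) has_real_derivative L * (M * exp (2 * L * x)) + e) (at x within {0..s})"
      by (auto intro!: derivative_eq_intros)
    show "norm (f' x) \<le> L * (M * exp (2 * L * x)) + e"
      using le[OF xT] mult_left_mono[OF fM[OF xT], of L] L by linarith
  qed (use s in auto)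
  moreover have "norm (f s) = M * exp (2 * L * s)" by (simp add: M_def g_def exp_minus)
  moreover have "norm (f s) \<le> norm (f s - f 0) + norm (f 0)" using norm_triangle_sub[of "f s" "f 0"] by simp
  ultimately have "M * exp (2 * L * s) \<le> norm (f 0) + M / 2 * exp (2 * L * s) + e * s" using M by simp
  then have "M * exp (2 * L * s) \<le> 2 * (norm (f 0) + e * s)" by simp
  moreover have "M * 1 \<le> M * exp (2 * L * s)" using M L s(1) by (intro mult_left_mono) auto
  moreover have "2 * (norm (f 0) + e * s) \<le> 2 * (norm (f 0) + e * T)" using s(1) e by (intro mult_left_mono add_left_mono) auto
  ultimately have MM: "M \<le> 2 * (norm (f 0) + e * T)" by (metis mult.right_neutral order_trans)
  have "norm (f t) \<le> M * exp (2 * L * t)" by (rule fM[OF t])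
  also have "\<dots> \<le> 2 * (norm (f 0) + e * T) * exp (2 * L * T)"
    using MM M L t e T by (intro mult_mono) (auto intro!: mult_nonneg_nonneg add_nonneg_nonneg)
  finally show ?thesis .
qed

definition mmK :: real where "mmK = (SOME c. 0 < c \<and> (\<forall>(A::cmat) (B::cmat). norm (A ** B) \<le> norm A * norm B * c))"

lemma mmK: "mmK > 0" "norm (A ** B) \<le> mmK * norm A * norm B" for A B :: cmat
proof -
  have "0 < mmK \<and> (\<forall>(A::cmat) (B::cmat). norm (A ** B) \<le> norm A * norm B * mmK)"
    unfolding mmK_def by (rule someI_ex) (rule mm.pos_bounded)
  then show "mmK > 0" "norm (A ** B) \<le> mmK * norm A * norm B" by (auto simp: mult_ac)
qed

lemma norm_mat_mult: "norm (mat k ** A) = norm k * norm A" for A :: cmat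
proof -
  have "mat k ** A = (\<chi> i. \<chi> j. k * A $ i $ j)" by (simp add: vec_eq_iff mat_mult_left)
  then show ?thesis
    by (simp add: norm_vec_def L2_set_def norm_mult power_mult_distrib sum_distrib_left[symmetric] real_sqrt_mult sum_nonneg)
qed

lemma norm_entry_le: "norm (A $ i $ j) \<le> norm A" for A :: cmat
  by (rule order_trans[OF Finite_Cartesian_Product.norm_nth_le Finite_Cartesian_Product.norm_nth_le])

text \<open>Picard iteration read as a power series in k. The n-th coefficient is at most a constant
  times (d t)^n / n!, so the series converges uniformly in t and locally uniformly in k, which makes
  the solution entire.\<close>

lemma linear_ode_entire:
  fixes B :: "real \<Rightarrow> cmat"
  assumes T: "T \<ge> 0" and B: "continuous_on {0..T} B"
  shows "\<exists>F. (\<forall>k. F 0 k = mat 1) \<and> (\<forall>t\<in>{0..T}. F t 0 = mat 1) \<and>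
    (\<forall>k. \<forall>t\<in>{0..T}. ((\<lambda>t. F t k) has_vector_derivative mat k ** (B t ** F t k)) (at t within {0..T})) \<and>
    (\<forall>t\<in>{0..T}. \<forall>i j. (\<lambda>k. F t k $ i $ j) holomorphic_on UNIV)"
proof -
  have "bounded (B ` {0..T})" by (intro compact_imp_bounded compact_continuous_image B compact_Icc)
  then obtain b where b: "b > 0" "\<And>t. t \<in> {0..T} \<Longrightarrow> norm (B t) \<le> b" unfolding bounded_pos by auto
  define F0 where "F0 = rec_nat (\<lambda>t. mat 1) (\<lambda>n G t. integral {0..t} (\<lambda>s. B s ** G s))"
  have F0_0: "F0 0 t = mat 1" and F0_Suc: "F0 (Suc n) t = integral {0..t} (\<lambda>s. B s ** F0 n s)" for n t
    by (simp_all add: F0_def)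
  have F0c: "continuous_on {0..T} (F0 n)" for n
  proof (induction n)
    case (Suc n)
    have "continuous_on {0..T} (\<lambda>t. integral {0..t} (\<lambda>s. B s ** F0 n s))"
      by (intro indefinite_integral_continuous_1 integrable_continuous_interval mm.continuous_on B Suc)
    then show ?case by (simp add: F0_Suc[abs_def])
  qed (simp add: F0_0[abs_def])
  have F0d: "(F0 (Suc n) has_vector_derivative B t ** F0 n t) (at t within {0..T})" if "t \<in> {0..T}" for n t
    unfolding F0_Suc[abs_def] using that by (intro integral_has_vector_derivative mm.continuous_on B F0c)
  define c where "c = norm (mat 1 :: cmat)"
  define d where "d = mmK * b"
  have cd: "c \<ge> 0" "d \<ge> 0" using mmK(1) b(1) by (auto simp: c_def d_def)
  have F0b: "norm (F0 n t) \<le> c * (d * t) ^ n / fact n" if "t \<in> {0..T}" for n t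
    using that
  proof (induction n arbitrary: t)
    case (Suc n)
    have "norm (F0 (Suc n) t - F0 (Suc n) 0) \<le> c * (d * t) ^ Suc n / fact (Suc n) - c * (d * 0) ^ Suc n / fact (Suc n)"
    proof (rule norm_diff_le_antiderivative)
      fix x assume x: "x \<in> {0..t}"
      then have xT: "x \<in> {0..T}" using Suc.prems by auto
      show "(F0 (Suc n) has_vector_derivative B x ** F0 n x) (at x within {0..t})"
        by (rule has_vector_derivative_within_subset[OF F0d[OF xT]]) (use Suc.prems in auto)
      show "((\<lambda>x. c * (d * x) ^ Suc n / fact (Suc n)) has_real_derivative d * (c * (d * x) ^ n / fact n)) (at x within {0..t})"
      proof (rule DERIV_cong[OF DERIV_cdivide[OF DERIV_cmult[OF DERIV_power]]])
        show "((*) d has_real_derivative d) (at x within {0..t})" by (auto intro!: derivative_eq_intros)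
        have "c * (real (Suc n) * (d * (d * x) ^ n)) / (real (Suc n) * fact n) = c * (d * (d * x) ^ n) / fact n"
          by (simp del: of_nat_Suc)
        then show "c * (of_nat (Suc n) * (d * (d * x) ^ (Suc n - Suc 0))) / fact (Suc n) = d * (c * (d * x) ^ n / fact n)"
          by (simp add: mult_ac del: of_nat_Suc)
      qed
      have "norm (B x ** F0 n x) \<le> mmK * norm (B x) * norm (F0 n x)" by (rule mmK)
      also have "\<dots> \<le> mmK * b * (c * (d * x) ^ n / fact n)"
        using b(2)[OF xT] Suc.IH[OF xT] mmK(1) b(1) by (intro mult_mono) auto
      finally show "norm (B x ** F0 n x) \<le> d * (c * (d * x) ^ n / fact n)" by (simp add: d_def)
    qed (use Suc.prems in auto)
    then show ?case by (simp add: F0_Suc)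
  qed (simp add: F0_0 c_def)
  have bound: "norm (mat (k ^ n) ** F0 n t) \<le> c * ((r * d * T) ^ n / fact n)" if "t \<in> {0..T}" "norm k \<le> r" for n t k r
  proof -
    have "norm (mat (k ^ n) ** F0 n t) = norm k ^ n * norm (F0 n t)" by (simp add: norm_mat_mult norm_power)
    also have "\<dots> \<le> r ^ n * (c * (d * T) ^ n / fact n)"
    proof (intro mult_mono power_mono that)
      have "c * (d * t) ^ n / fact n \<le> c * (d * T) ^ n / fact n"
        using that cd by (intro divide_right_mono mult_left_mono power_mono mult_nonneg_nonneg) auto
      then show "norm (F0 n t) \<le> c * (d * T) ^ n / fact n" using F0b[OF that(1), of n] by simp
      show "0 \<le> r ^ n" using that(2) norm_ge_zero[of k] by (intro zero_le_power) linarith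
    qed auto
    finally show ?thesis by (simp add: power_mult_distrib mult_ac)
  qed
  have summ: "summable (\<lambda>n. c * ((r * d * T) ^ n / fact n))" for r
    using summable_exp_generic[of "r * d * T"] by (intro summable_mult) (simp add: divide_inverse mult.commute)
  define F where "F t k = (\<Sum>n. mat (k ^ n) ** F0 n t)" for t k
  define S where "S N t k = (\<Sum>n<N. mat (k ^ n) ** F0 n t)" for N t k
  have ul: "uniform_limit {0..T} (\<lambda>N t. S N t k) (\<lambda>t. F t k) sequentially" for k
    unfolding S_def F_def by (rule Weierstrass_m_test[OF bound[where k=k and r="norm k"] summ]) auto
  have ulk: "uniform_limit (cball 0 r) (\<lambda>N k. S N t k) (\<lambda>k. F t k) sequentially" if "t \<in> {0..T}" for t r
    unfolding S_def F_def by (rule Weierstrass_m_test[OF bound[OF that, where r=r] summ]) auto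
  have lim: "(\<lambda>N. S N t k) \<longlonglongrightarrow> F t k" if "t \<in> {0..T}" for t k
    using tendsto_uniform_limitI[OF ul that] .
  have Sc: "continuous_on {0..T} (\<lambda>t. S N t k)" for N k
    unfolding S_def by (intro continuous_on_sum mm.continuous_on F0c continuous_on_const)
  have Fc: "continuous_on {0..T} (\<lambda>t. F t k)" for k
    by (rule uniform_limit_theorem[OF _ ul]) (auto intro!: always_eventually Sc)
  have zero: "F t 0 = mat 1" if "t \<in> {0..T}" for t
  proof -
    have "S (Suc N) t 0 = mat 1" for N
      unfolding S_def by (subst sum.lessThan_Suc_shift) (simp add: F0_0 power_0_left)
    then have "(\<lambda>N. S (Suc N) t 0) \<longlonglongrightarrow> mat 1" by simp
    then show ?thesis using LIMSEQ_unique[OF LIMSEQ_Suc[OF lim[OF that]]] by blast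
  qed
  have S_Suc: "S (Suc N) t k = mat 1 + mat k ** integral {0..t} (\<lambda>s. B s ** S N s k)" if t: "t \<in> {0..T}" for N t k
  proof -
    have "integral {0..t} (\<lambda>s. B s ** S N s k) = integral {0..t} (\<lambda>s. \<Sum>n<N. mat (k ^ n) ** (B s ** F0 n s))"
      unfolding S_def mm.sum_right
      by (intro integral_cong sum.cong refl) (metis mat_commute matrix_mul_assoc)
    also have "\<dots> = (\<Sum>n<N. integral {0..t} (\<lambda>s. mat (k ^ n) ** (B s ** F0 n s)))"
      by (rule integral_sum) (use t in \<open>auto intro!: integrable_continuous_interval mm.continuous_on continuous_on_subset[OF B] continuous_on_subset[OF F0c]\<close>)
    also have "\<dots> = (\<Sum>n<N. mat (k ^ n) ** F0 (Suc n) t)"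
    proof (intro sum.cong refl)
      fix n
      have "(\<lambda>s. B s ** F0 n s) integrable_on {0..t}"
        using t by (auto intro!: integrable_continuous_interval mm.continuous_on continuous_on_subset[OF B] continuous_on_subset[OF F0c])
      from integral_linear[OF this mm.bounded_linear_right[of "mat (k ^ n)"]]
      show "integral {0..t} (\<lambda>s. mat (k ^ n) ** (B s ** F0 n s)) = mat (k ^ n) ** F0 (Suc n) t" by (simp add: F0_Suc o_def)
    qed
    finally have "mat k ** integral {0..t} (\<lambda>s. B s ** S N s k) = (\<Sum>n<N. mat k ** (mat (k ^ n) ** F0 (Suc n) t))"
      by (simp add: mm.sum_right)
    also have "\<dots> = (\<Sum>n<N. mat (k ^ Suc n) ** F0 (Suc n) t)"
      by (intro sum.cong refl) (simp add: vec_eq_iff mat_mult_left)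
    finally show ?thesis unfolding S_def by (subst sum.lessThan_Suc_shift) (simp add: F0_0)
  qed
  have int_eq: "F t k = mat 1 + mat k ** integral {0..t} (\<lambda>s. B s ** F s k)" if t: "t \<in> {0..T}" for t k
  proof -
    have "(\<lambda>N. integral {0..t} (\<lambda>s. B s ** S N s k)) \<longlonglongrightarrow> integral {0..t} (\<lambda>s. B s ** F s k)"
    proof (rule dominated_convergence(2))
      show "(\<lambda>s. B s ** S N s k) integrable_on {0..t}" for N
        using t by (auto intro!: integrable_continuous_interval mm.continuous_on continuous_on_subset[OF B] continuous_on_subset[OF Sc])
      show "(\<lambda>s. mmK * b * (\<Sum>n. c * ((norm k * d * T) ^ n / fact n))) integrable_on {0..t}"
        by (rule integrable_const_ivl)
      show "norm (B s ** S N s k) \<le> mmK * b * (\<Sum>n. c * ((norm k * d * T) ^ n / fact n))" if "s \<in> {0..t}" for N s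
      proof -
        have s: "s \<in> {0..T}" using that t by auto
        have "norm (S N s k) \<le> (\<Sum>n<N. c * ((norm k * d * T) ^ n / fact n))"
          unfolding S_def by (intro sum_norm_le bound s) auto
        also have "\<dots> \<le> (\<Sum>n. c * ((norm k * d * T) ^ n / fact n))"
          by (rule sum_le_suminf[OF summ]) (use cd T in \<open>auto intro!: mult_nonneg_nonneg divide_nonneg_nonneg zero_le_power\<close>)
        finally have "mmK * norm (B s) * norm (S N s k) \<le> mmK * b * (\<Sum>n. c * ((norm k * d * T) ^ n / fact n))"
          using b(2)[OF s] mmK(1) b(1) by (intro mult_mono) auto
        then show ?thesis using mmK(2) order_trans by blast
      qed
      show "(\<lambda>N. B s ** S N s k) \<longlonglongrightarrow> B s ** F s k" if "s \<in> {0..t}" for s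
        using lim[of s k] that t by (intro mm.tendsto tendsto_const) auto
    qed
    then have "(\<lambda>N. mat 1 + mat k ** integral {0..t} (\<lambda>s. B s ** S N s k)) \<longlonglongrightarrow> mat 1 + mat k ** integral {0..t} (\<lambda>s. B s ** F s k)"
      by (intro tendsto_add mm.tendsto tendsto_const)
    then show ?thesis
      using LIMSEQ_unique[OF LIMSEQ_Suc[OF lim[OF t]]] S_Suc[OF t] by simp
  qed
  have F_init: "F 0 k = mat 1" for k using int_eq[of 0 k] T by simp
  have Fd: "((\<lambda>t. F t k) has_vector_derivative mat k ** (B t ** F t k)) (at t within {0..T})" if t: "t \<in> {0..T}" for t k
  proof (rule has_vector_derivative_transform[OF t])
    have "((\<lambda>t. integral {0..t} (\<lambda>s. B s ** F s k)) has_vector_derivative B t ** F t k) (at t within {0..T})"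
      by (rule integral_has_vector_derivative[OF _ t]) (intro mm.continuous_on B Fc)
    from has_vector_derivative_add[OF has_vector_derivative_const bounded_linear.has_vector_derivative[OF mm.bounded_linear_right this]]
    show "((\<lambda>t. mat 1 + mat k ** integral {0..t} (\<lambda>s. B s ** F s k)) has_vector_derivative mat k ** (B t ** F t k)) (at t within {0..T})"
      by simp
  qed (use int_eq in auto)
  have hol: "(\<lambda>k. F t k $ i $ j) holomorphic_on UNIV" if t: "t \<in> {0..T}" for t i j
  proof (rule holomorphic_uniform_sequence[where f="\<lambda>N k. S N t k $ i $ j"])
    show "(\<lambda>k. S N t k $ i $ j) holomorphic_on UNIV" for N
      unfolding S_def by (simp add: mat_mult_left) (intro holomorphic_intros)
    show "\<exists>d>0. cball x d \<subseteq> UNIV \<and> uniform_limit (cball x d) (\<lambda>N k. S N t k $ i $ j) (\<lambda>k. F t k $ i $ j) sequentially" for x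
    proof (intro exI conjI)
      have "uniform_limit (cball x 1) (\<lambda>N k. S N t k) (\<lambda>k. F t k) sequentially"
        by (rule uniform_limit_on_subset[OF ulk[OF t, of "norm x + 1"]]) (auto simp: dist_norm norm_minus_commute intro!: order_trans[OF norm_triangle_sub[of _ x]])
      then show "uniform_limit (cball x 1) (\<lambda>N k. S N t k $ i $ j) (\<lambda>k. F t k $ i $ j) sequentially"
        by (intro bounded_linear.uniform_limit[OF bounded_linear_vec_nth])
    qed auto
  qed auto
  show ?thesis by (intro exI[of _ F] conjI allI ballI F_init zero Fd hol)
qed

text \<open>With the integrating factor \<open>exp (\<kappa> * (c - x))\<close> only the source r is
  left in the derivative. The base point c is the end of the interval for which this factor has
  modulus at most 1.\<close>

lemma growth_two_point:
  fixes f r :: "real \<Rightarrow> complex" and D :: "real \<Rightarrow> real"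
  assumes ab: "a \<le> b"
    and f: "\<And>x. x \<in> {a..b} \<Longrightarrow> (f has_vector_derivative \<kappa> * f x + r x) (at x within {a..b})"
    and D: "\<And>x. x \<in> {a..b} \<Longrightarrow> (D has_real_derivative \<rho> x) (at x within {a..b})"
    and r: "\<And>x. x \<in> {a..b} \<Longrightarrow> norm (r x) \<le> \<rho> x"
  shows "Re \<kappa> \<ge> 0 \<Longrightarrow> norm (f a - exp (\<kappa> * of_real (a - b)) * f b) \<le> D b - D a"
    and "Re \<kappa> \<le> 0 \<Longrightarrow> norm (f b - exp (\<kappa> * of_real (b - a)) * f a) \<le> D b - D a"
proof -
  have gen: "norm (exp (\<kappa> * of_real (c - b)) * f b - exp (\<kappa> * of_real (c - a)) * f a) \<le> D b - D a"
    if "\<And>x. x \<in> {a..b} \<Longrightarrow> Re \<kappa> * (c - x) \<le> 0" for c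
  proof (rule norm_diff_le_antiderivative[OF ab _ D])
    fix x assume x: "x \<in> {a..b}"
    have "((\<lambda>x. exp (\<kappa> * of_real (c - x))) has_vector_derivative - (\<kappa> * exp (\<kappa> * of_real (c - x)))) (at x within {a..b})"
    proof -
      have "((\<lambda>u. exp (\<kappa> * (of_real c - u))) has_field_derivative - (\<kappa> * exp (\<kappa> * (of_real c - of_real x)))) (at (of_real x))"
        by (auto intro!: derivative_eq_intros)
      from has_vector_derivative_real_field[OF this, of "{a..b}"] show ?thesis by simp
    qed
    from has_vector_derivative_mult[OF this f[OF x]]
    show "((\<lambda>x. exp (\<kappa> * of_real (c - x)) * f x) has_vector_derivative exp (\<kappa> * of_real (c - x)) * r x) (at x within {a..b})"
      by (simp add: algebra_simps)
    have "norm (exp (\<kappa> * of_real (c - x)) * r x) \<le> 1 * norm (r x)"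
      unfolding norm_mult using that[OF x] by (intro mult_right_mono) auto
    then show "norm (exp (\<kappa> * of_real (c - x)) * r x) \<le> \<rho> x" using r[OF x] by simp
  qed
  show "norm (f a - exp (\<kappa> * of_real (a - b)) * f b) \<le> D b - D a" if "Re \<kappa> \<ge> 0"
    using gen[of a] that by (simp add: norm_minus_commute mult_nonneg_nonpos)
  show "norm (f b - exp (\<kappa> * of_real (b - a)) * f a) \<le> D b - D a" if "Re \<kappa> \<le> 0"
    using gen[of b] that by (simp add: mult_nonpos_nonneg)
qed

lemma exp_decay_tendsto:
  assumes "Re \<kappa> > 0" and B: "\<And>x. x \<ge> y \<Longrightarrow> norm (f x) \<le> B"
  shows "((\<lambda>b. exp (\<kappa> * of_real (y - b)) * f b) \<longlongrightarrow> 0) at_top"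
proof (rule Lim_null_comparison)
  show "\<forall>\<^sub>F b in at_top. norm (exp (\<kappa> * of_real (y - b)) * f b) \<le> exp (Re \<kappa> * (y - b)) * B"
    using eventually_ge_at_top[of y] by eventually_elim (auto simp: norm_mult intro!: mult_left_mono B)
  have "((\<lambda>b. exp (Re \<kappa> * (y - b))) \<longlongrightarrow> 0) at_top"
  proof (rule filterlim_compose[OF exp_at_bot])
    have "filterlim (\<lambda>b. Re \<kappa> * (b - y)) at_top at_top"
      using filterlim_tendsto_pos_mult_at_top[OF tendsto_const assms(1) filterlim_tendsto_add_at_top[OF tendsto_const filterlim_ident], of "- y"]
      by simp
    then show "filterlim (\<lambda>b. Re \<kappa> * (y - b)) at_bot at_top"
      unfolding filterlim_uminus_at_top by (simp add: algebra_simps)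
  qed
  then show "((\<lambda>b. exp (Re \<kappa> * (y - b)) * B) \<longlongrightarrow> 0) at_top" by (rule tendsto_mult_left_zero)
qed

text \<open>A bounded solution with Re \<kappa> > 0 is determined by its source to the right: the
  value at b enters with a factor that tends to 0. On the diagonal, where \<kappa> = 0, the limit l
  takes its place. The bound B only removes the boundary term and does not enter the
  estimate.\<close>

lemma backward_estimate:
  fixes f r :: "real \<Rightarrow> complex" and D :: "real \<Rightarrow> real"
  assumes f: "\<And>x. x \<ge> y \<Longrightarrow> (f has_vector_derivative \<kappa> * f x + r x) (at x within {y..})"
    and D: "\<And>x. x \<ge> y \<Longrightarrow> (D has_real_derivative \<rho> x) (at x within {y..})" "\<And>x. x \<ge> y \<Longrightarrow> D x \<le> M"
    and r: "\<And>x. x \<ge> y \<Longrightarrow> norm (r x) \<le> \<rho> x"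
    and B: "\<And>x. x \<ge> y \<Longrightarrow> norm (f x) \<le> B"
    and lim: "Re \<kappa> > 0 \<and> l = 0 \<or> \<kappa> = 0 \<and> (f \<longlongrightarrow> l) at_top"
  shows "norm (f y - l) \<le> M - D y"
proof -
  have "((\<lambda>b. exp (\<kappa> * of_real (y - b)) * f b) \<longlongrightarrow> l) at_top"
    using lim exp_decay_tendsto[OF _ B, of \<kappa> y] by auto
  then have "((\<lambda>b. norm (f y - exp (\<kappa> * of_real (y - b)) * f b)) \<longlongrightarrow> norm (f y - l)) at_top"
    by (intro tendsto_intros)
  moreover have "\<forall>\<^sub>F b in at_top. norm (f y - exp (\<kappa> * of_real (y - b)) * f b) \<le> M - D y"
    using eventually_ge_at_top[of y]
  proof eventually_elim
    case (elim b)
    have "norm (f y - exp (\<kappa> * of_real (y - b)) * f b) \<le> D b - D y"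
    proof (rule growth_two_point(1)[OF elim])
      fix x assume x: "x \<in> {y..b}"
      show "(f has_vector_derivative \<kappa> * f x + r x) (at x within {y..b})"
        by (rule has_vector_derivative_within_subset[OF f]) (use x in auto)
      show "(D has_real_derivative \<rho> x) (at x within {y..b})" by (rule DERIV_subset[OF D(1)]) (use x in auto)
      show "norm (r x) \<le> \<rho> x" using r x by auto
    qed (use lim in auto)
    then show ?case using D(2)[OF elim] by simp
  qed
  ultimately show ?thesis by (intro tendsto_upperbound) auto
qed

lemma forward_estimate:
  fixes f r :: "real \<Rightarrow> complex" and D :: "real \<Rightarrow> real"
  assumes f: "\<And>x. (f has_vector_derivative \<kappa> * f x + r x) (at x)"
    and D: "\<And>x. (D has_real_derivative \<rho> x) (at x)" "\<And>x. M \<le> D x"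
    and r: "\<And>x. norm (r x) \<le> \<rho> x"
    and B: "\<And>x. norm (f x) \<le> B" and \<kappa>: "Re \<kappa> < 0"
  shows "norm (f y) \<le> D y - M"
proof -
  have "((\<lambda>b. exp (- \<kappa> * of_real (- y - b)) * f (- b)) \<longlongrightarrow> 0) at_top"
    by (rule exp_decay_tendsto[of _ "- y" "\<lambda>b. f (- b)" B]) (use \<kappa> B in auto)
  then have "((\<lambda>b. norm (f y - exp (- \<kappa> * of_real (- y - b)) * f (- b))) \<longlongrightarrow> norm (f y - 0)) at_top"
    by (intro tendsto_intros)
  moreover have "\<forall>\<^sub>F b in at_top. norm (f y - exp (- \<kappa> * of_real (- y - b)) * f (- b)) \<le> D y - M"
    using eventually_ge_at_top[of "- y"]
  proof eventually_elim
    case (elim b)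
    then have "- b \<le> y" by simp
    have "norm (f y - exp (\<kappa> * of_real (y - (- b))) * f (- b)) \<le> D y - D (- b)"
      by (rule growth_two_point(2)[OF \<open>- b \<le> y\<close>])
        (use \<kappa> r in \<open>auto intro: has_vector_derivative_at_within[OF f] has_field_derivative_at_within[OF D(1)]\<close>)
    then show ?case using D(2)[of "- b"] by (simp add: algebra_simps)
  qed
  ultimately have "norm (f y - 0) \<le> D y - M" by (rule tendsto_upperbound) simp
  then show ?thesis by simp
qed

section \<open>The contour, the signs of the exponents, and estimates along the line\<close>

lemma real_mult_in_Sigma:
  assumes "Im (z / d) = 0" "d \<in> directions" "d \<noteq> 0" shows "z \<in> Sigma_contour"
proof -
  have "z / d = of_real (Re (z / d))" using assms(1) by (simp add: complex_eq_iff)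
  then have "z = d * of_real (Re (z / d))" using assms(3) by (simp add: field_simps)
  then show ?thesis using assms(2) unfolding Sigma_contour_def by blast
qed

lemma omega_nonzero: "\<omega> \<noteq> 0" by (simp add: \<omega>_def)

lemma zero_in_Sigma: "0 \<in> Sigma_contour"
  by (rule real_mult_in_Sigma[of 0 1]) (auto simp: directions_def)

text \<open>The three differences have real parts proportional to the imaginary parts of z, z omega
  and z omega^2; each of these vanishes on one line of the contour only.\<close>

lemma Re_lam_diff_nonzero:
  assumes z: "z \<notin> Sigma_contour" and "i \<noteq> j"
  shows "Re (lam z $ i - lam z $ j) \<noteq> 0"
proof -
  have nz: "Im z \<noteq> 0" "Im (z * \<omega>\<^sup>2) \<noteq> 0" "Im (z * \<omega>) \<noteq> 0"
  proof -
    show "Im z \<noteq> 0" using real_mult_in_Sigma[of z 1] z by (auto simp: directions_def)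
    have "z * \<omega>\<^sup>2 = z / \<omega>" using omega_inverse(1) by (simp add: divide_inverse)
    then show "Im (z * \<omega>\<^sup>2) \<noteq> 0" using real_mult_in_Sigma[of z \<omega>] z omega_nonzero by (auto simp: directions_def)
    have "z * \<omega> = z / \<omega>\<^sup>2" using omega_inverse(2) by (simp add: divide_inverse)
    then show "Im (z * \<omega>) \<noteq> 0" using real_mult_in_Sigma[of z "\<omega>\<^sup>2"] z omega_nonzero by (auto simp: directions_def)
  qed
  have "Re (z * \<omega> - z * \<omega>\<^sup>2) = - sqrt 3 * Im z" "Re (z * \<omega> - z) = sqrt 3 * Im (z * \<omega>\<^sup>2)"
    "Re (z * \<omega>\<^sup>2 - z) = - sqrt 3 * Im (z * \<omega>)"
    by (simp_all add: omega_sq Im_omega Re_omega algebra_simps)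
  then have "Re (z * \<omega> - z * \<omega>\<^sup>2) \<noteq> 0" "Re (z * \<omega> - z) \<noteq> 0" "Re (z * \<omega>\<^sup>2 - z) \<noteq> 0"
    using nz by auto
  then show ?thesis using exhaust_3[of i] exhaust_3[of j] \<open>i \<noteq> j\<close> by (auto simp: lam_1 lam_2 lam_3)
qed

lemma norm_lam: "norm (lam z $ j) = norm z"
  by (subst lam_scale) (simp add: norm_mult norm_lam_1)

text \<open>The inverse is the conjugate divided by the squared modulus, and all three numbers have
  modulus |z|. Hence differences of inverses have real parts of the same sign as the differences
  themselves.\<close>

lemma Re_inverse_lam: "Re (inverse (lam z $ j)) = Re (lam z $ j) / (norm z)\<^sup>2"
  by (simp add: norm_lam[of z j, symmetric] cmod_power2)

lemma commutator_entry:
  "(mat z ** (dmat ** A - A ** dmat)) $ i $ j = (lam z $ i - lam z $ j) * A $ i $ j"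
  "(mat k ** (dinv ** A - A ** dinv)) $ i $ j = (k * inverse (lam 1 $ i) - k * inverse (lam 1 $ j)) * A $ i $ j" for A :: cmat
  unfolding lam_scale[of z i] lam_scale[of z j]
  by (simp_all add: mat_mult_left dmat_def dinv_def diag_mat_mult_left diag_mat_mult_right algebra_simps)

lemma has_vector_derivative_entry:
  fixes m :: "real \<Rightarrow> cmat"
  assumes "(m has_vector_derivative D) F"
  shows "((\<lambda>y. m y $ i $ j) has_vector_derivative D $ i $ j) F"
proof -
  have "bounded_linear (\<lambda>A :: cmat. A $ i $ j)"
    by (rule bounded_linear_compose[OF bounded_linear_vec_nth bounded_linear_vec_nth])
  from bounded_linear.has_vector_derivative[OF this assms] show ?thesis .
qed

text \<open>Each entry is integrated from the end of the line at which its homogeneous solution is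
  suppressed; the bound B only justifies dropping the boundary term. The factor pi is the total
  increase of arctan, an antiderivative of \<open>1 / (1 + y\<^sup>2)\<close>.\<close>

lemma line_estimate:
  fixes m r :: "real \<Rightarrow> cmat"
  assumes z: "z \<notin> Sigma_contour"
    and m: "\<And>y. (m has_vector_derivative mat z ** (dmat ** m y - m y ** dmat) + r y) (at y)"
    and r: "\<And>y. norm (r y) \<le> C / (1 + y\<^sup>2)"
    and B: "\<And>y. norm (m y) \<le> B"
    and lim: "\<And>l. ((\<lambda>y. m y $ l $ l) \<longlongrightarrow> 1) at_top"
  shows "norm (m y $ i $ j - mat 1 $ i $ j) \<le> C * pi"
proof -
  have C: "C \<ge> 0" using order_trans[OF norm_ge_zero r[of 0]] by simp
  define \<kappa> where "\<kappa> = lam z $ i - lam z $ j"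
  have d: "((\<lambda>y. m y $ i $ j) has_vector_derivative \<kappa> * m y $ i $ j + r y $ i $ j) (at y)" for y
    using has_vector_derivative_entry[OF m, of i j y] by (simp add: commutator_entry \<kappa>_def)
  have rb: "norm (r y $ i $ j) \<le> C / (1 + y\<^sup>2)" for y using order_trans[OF norm_entry_le r] .
  have mb: "norm (m y $ i $ j) \<le> B" for y using order_trans[OF norm_entry_le B] .
  have D: "((\<lambda>y. C * arctan y) has_real_derivative C / (1 + y\<^sup>2)) (at y within S)" for y S
    by (auto intro!: derivative_eq_intros simp: divide_inverse)
  have bd: "C * arctan y \<le> C * (pi / 2)" "C * (- pi / 2) \<le> C * arctan y" for y
    by (intro mult_left_mono C less_imp_le; use arctan_bounded[of y] in simp)+
  consider "i = j" | "i \<noteq> j" "Re \<kappa> > 0" | "i \<noteq> j" "Re \<kappa> < 0"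
    using Re_lam_diff_nonzero[OF z, of i j] unfolding \<kappa>_def by fastforce
  then show ?thesis
  proof cases
    case 1
    have "norm (m y $ i $ j - 1) \<le> C * (pi / 2) - C * arctan y"
      by (rule backward_estimate[where \<kappa>=\<kappa> and f="\<lambda>y. m y $ i $ j" and r="\<lambda>y. r y $ i $ j", OF has_vector_derivative_at_within[OF d] D bd(1) rb mb])
        (use lim[of i] 1 in \<open>auto simp: \<kappa>_def\<close>)
    also have "\<dots> \<le> C * pi" using bd(2)[of y] by simp
    finally show ?thesis using 1 by (simp add: mat_def)
  next
    case 2
    have "norm (m y $ i $ j - 0) \<le> C * (pi / 2) - C * arctan y"
      by (rule backward_estimate[where \<kappa>=\<kappa> and f="\<lambda>y. m y $ i $ j" and r="\<lambda>y. r y $ i $ j", OF has_vector_derivative_at_within[OF d] D bd(1) rb mb])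
        (use 2 in auto)
    also have "\<dots> \<le> C * pi" using bd(2)[of y] by simp
    finally show ?thesis using 2 by (simp add: mat_def)
  next
    case 3
    have "norm (m y $ i $ j) \<le> C * arctan y - C * (- pi / 2)"
      by (rule forward_estimate[where \<kappa>=\<kappa> and f="\<lambda>y. m y $ i $ j" and r="\<lambda>y. r y $ i $ j", OF d D bd(2) rb mb])
        (use 3 in auto)
    also have "\<dots> \<le> C * pi" using bd(1)[of y] by simp
    finally show ?thesis using 3 by (simp add: mat_def)
  qed
qed

text \<open>Uniform continuity of the y-derivative on a compact rectangle makes the first-order
  remainder small uniformly in t, as a Gronwall argument over the whole time interval
  requires.\<close>

lemma uniform_derivative_remainder:
  fixes g gy :: "real \<Rightarrow> real \<Rightarrow> 'a::real_normed_vector"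
  assumes d: "\<And>y t. y \<ge> a \<Longrightarrow> t \<in> {0..T} \<Longrightarrow> ((\<lambda>y. g y t) has_vector_derivative gy y t) (at y within {a..})"
    and c: "continuous_on ({a..} \<times> {0..T}) (\<lambda>(y, t). gy y t)"
    and y: "y \<ge> a" and e: "e > 0"
  shows "\<exists>\<delta>>0. \<forall>y'\<ge>a. \<bar>y' - y\<bar> < \<delta> \<longrightarrow> (\<forall>t\<in>{0..T}. norm (g y' t - g y t - (y' - y) *\<^sub>R gy y t) \<le> e * \<bar>y' - y\<bar>)"
proof -
  have "uniformly_continuous_on ({a..y+1} \<times> {0..T}) (\<lambda>(y, t). gy y t)"
    by (rule compact_uniformly_continuous[OF continuous_on_subset[OF c]]) (auto intro!: compact_Times)
  then obtain \<delta> where \<delta>: "\<delta> > 0" "\<And>p q. p \<in> {a..y+1} \<times> {0..T} \<Longrightarrow> q \<in> {a..y+1} \<times> {0..T} \<Longrightarrow> dist q p < \<delta> \<Longrightarrow>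
      dist (case q of (y, t) \<Rightarrow> gy y t) (case p of (y, t) \<Rightarrow> gy y t) < e"
    unfolding uniformly_continuous_on_def using e by metis
  show ?thesis
  proof (intro exI[of _ "min \<delta> 1"] conjI allI impI ballI)
    fix y' t assume y': "y' \<ge> a" "\<bar>y' - y\<bar> < min \<delta> 1" and t: "t \<in> {0..T}"
    define S where "S = {min y y'..max y y'}"
    have S: "x \<ge> a" "x \<le> y + 1" "\<bar>x - y\<bar> < \<delta>" if "x \<in> S" for x
      using that y y' by (auto simp: S_def)
    have "norm ((g y' t - y' *\<^sub>R gy y t) - (g y t - y *\<^sub>R gy y t)) \<le> e * norm (y' - y)"
    proof (rule differentiable_bound[of S])
      fix x assume x: "x \<in> S"
      have "((\<lambda>x. g x t - x *\<^sub>R gy y t) has_vector_derivative gy x t - gy y t) (at x within S)"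
        by (auto intro!: derivative_eq_intros has_vector_derivative_diff has_vector_derivative_within_subset[OF d[OF S(1)[OF x] t]] S)
      then show "((\<lambda>x. g x t - x *\<^sub>R gy y t) has_derivative (\<lambda>h. h *\<^sub>R (gy x t - gy y t))) (at x within S)"
        by (simp add: has_vector_derivative_def)
      have "dist (gy x t) (gy y t) < e"
        using \<delta>(2)[of "(y, t)" "(x, t)"] S[OF x] t y by (auto simp: dist_Pair_Pair dist_real_def)
      then show "onorm (\<lambda>h. h *\<^sub>R (gy x t - gy y t)) \<le> e"
        by (intro onorm_le) (auto simp: dist_norm mult.commute[of e] intro!: mult_left_mono)
    qed (auto simp: S_def)
    then show "norm (g y' t - g y t - (y' - y) *\<^sub>R gy y t) \<le> e * \<bar>y' - y\<bar>"
      by (simp add: algebra_simps)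
  qed (use \<delta> in auto)
qed

lemma mat_pull: "A ** (mat k ** B) = mat k ** (A ** B)" "(mat k ** A) ** B = mat k ** (A ** B)" for A B :: cmat
  by (simp_all add: matrix_mul_assoc mat_commute)

lemma mat_cancel: "z * k = 1 \<Longrightarrow> mat z ** (mat k ** A) = A" for A :: cmat
  by (simp add: vec_eq_iff mat_mult_left flip: mult.assoc)

lemma Gmat_0: "Gmat 0 = mat 1" by (simp add: Gmat_def proj_sum)

lemma isCont_Gmat: "isCont Gmat x" and isCont_Bmat: "isCont Bmat x" and isCont_Rmat: "isCont Rmat x"
  by (rule has_vector_derivative_continuous[OF Gmat_deriv] has_vector_derivative_continuous[OF Bmat_deriv]
      has_vector_derivative_continuous[OF Rmat_deriv])+

lemma isCont_bounded_Icc: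
  fixes g :: "real \<Rightarrow> 'a::real_normed_vector"
  assumes "\<And>x. isCont g x" shows "\<exists>b>0. \<forall>x. \<bar>x\<bar> \<le> c \<longrightarrow> norm (g x) \<le> b"
proof -
  have "bounded (g ` {-c..c})"
    by (intro compact_imp_bounded compact_continuous_image continuous_at_imp_continuous_on ballI assms compact_Icc)
  then show ?thesis unfolding bounded_pos by (fastforce simp: abs_le_iff)
qed

lemma Rmat_lipschitz: "\<exists>b>0. \<forall>x. \<bar>x\<bar> \<le> c \<longrightarrow> norm (Rmat x) \<le> b * \<bar>x\<bar>"
proof -
  define R' where "R' x = (- exp (- x)) *\<^sub>R dmat + (2 * exp (2 * x) + exp (- x)) *\<^sub>R (P1 ** dmat)" for x :: real
  have "isCont R' x" for x unfolding R'_def by (intro continuous_intros)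
  then obtain b where b: "b > 0" "\<And>x. \<bar>x\<bar> \<le> c \<Longrightarrow> norm (R' x) \<le> b" using isCont_bounded_Icc by blast
  have "norm (Rmat x) \<le> b * \<bar>x\<bar>" if "\<bar>x\<bar> \<le> c" for x
  proof -
    have "norm (Rmat x - Rmat 0) \<le> b * norm (x - 0)"
    proof (rule differentiable_bound[of "{- \<bar>x\<bar>..\<bar>x\<bar>}"])
      fix u assume u: "u \<in> {- \<bar>x\<bar>..\<bar>x\<bar>}"
      show "(Rmat has_derivative (\<lambda>h. h *\<^sub>R R' u)) (at u within {- \<bar>x\<bar>..\<bar>x\<bar>})"
        using has_vector_derivative_at_within[OF Rmat_deriv] unfolding has_vector_derivative_def R'_def by blast
      have "norm (R' u) \<le> b" using u that by (intro b) auto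
      then show "onorm (\<lambda>h. h *\<^sub>R R' u) \<le> b"
        by (intro onorm_le) (auto simp: mult.commute[of b] intro!: mult_left_mono)
    qed auto
    moreover have "Rmat 0 = 0" by (simp add: Rmat_def)
    ultimately show ?thesis by simp
  qed
  then show ?thesis using b(1) by blast
qed

section \<open>Dressing by the time evolution\<close>

definition Emat :: "real \<Rightarrow> complex \<Rightarrow> cmat" where
  "Emat t z = diag_mat (\<chi> j. exp (- (of_real t * inverse (lam z $ j))))"

lemma vec_has_vector_derivativeI:
  fixes m :: "real \<Rightarrow> cmat"
  assumes "\<And>i j. ((\<lambda>y. m y $ i $ j) has_vector_derivative D $ i $ j) (at x within S)"
  shows "(m has_vector_derivative D) (at x within S)"
  unfolding has_vector_derivative_def
proof (subst has_derivative_componentwise_within, rule ballI)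
  fix b :: cmat assume "b \<in> Basis"
  then obtain i j c where b: "b = axis i (axis j c)" "c \<in> Basis" by (auto simp: Basis_vec_def)
  have "((\<lambda>y. m y $ i $ j) has_derivative (\<lambda>h. h *\<^sub>R D $ i $ j)) (at x within S)"
    using assms by (simp add: has_vector_derivative_def)
  from has_derivative_inner_left[OF this, of c]
  show "((\<lambda>y. m y \<bullet> b) has_derivative (\<lambda>h. h *\<^sub>R D \<bullet> b)) (at x within S)"
    by (simp add: b inner_axis)
qed

lemma Emat_deriv:
  assumes "k = inverse z"
  shows "((\<lambda>t. Emat t z) has_vector_derivative - (mat k ** (Emat t z ** dinv))) (at t within S)"
proof (rule vec_has_vector_derivativeI)
  fix i j
  have "((\<lambda>u. exp (- (u * inverse (lam z $ i)))) has_field_derivative - (inverse (lam z $ i)) * exp (- (of_real t * inverse (lam z $ i)))) (at (of_real t))"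
    by (auto intro!: derivative_eq_intros)
  from has_vector_derivative_real_field[OF this]
  have "((\<lambda>t. exp (- (of_real t * inverse (lam z $ i)))) has_vector_derivative - (inverse (lam z $ i)) * exp (- (of_real t * inverse (lam z $ i)))) (at t within S)" .
  moreover have "inverse (lam z $ i) = k * inverse (lam 1 $ i)" by (subst lam_scale) (simp add: assms)
  ultimately show "((\<lambda>t. Emat t z $ i $ j) has_vector_derivative (- (mat k ** (Emat t z ** dinv))) $ i $ j) (at t within S)"
    by (cases "i = j") (simp_all add: mat_mult_left dinv_def diag_mat_mult_right, simp_all add: Emat_def diag_mat_def mult_ac)
qed

lemma Emat_0: "Emat 0 z = mat 1"
  by (simp add: Emat_def diag_mat_def mat_def cong: if_cong)

lemma norm_le_sum_entries: "norm A \<le> 9 * e" if "\<And>i j. norm (A $ i $ j) \<le> e" for A :: cmat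
proof -
  have "norm A \<le> (\<Sum>i\<in>UNIV. norm (A $ i))" by (simp add: norm_vec_def L2_set_le_sum)
  also have "\<dots> \<le> (\<Sum>i\<in>(UNIV::3 set). 3 * e)"
  proof (rule sum_mono)
    fix i
    have "norm (A $ i) \<le> (\<Sum>j\<in>UNIV. norm (A $ i $ j))" by (simp add: norm_vec_def L2_set_le_sum)
    also have "\<dots> \<le> (\<Sum>j\<in>(UNIV::3 set). e)" by (intro sum_mono that)
    finally show "norm (A $ i) \<le> 3 * e" by simp
  qed
  finally show ?thesis by simp
qed

context tzitzeica_strip begin

lemma K_nonneg: "0 \<le> K"
  using order_trans[OF abs_ge_zero Pt_bound[of a 0]] T by simp

lemma w_le_K: "y \<ge> a \<Longrightarrow> t \<in> {0..T} \<Longrightarrow> \<bar>w y t\<bar> \<le> K"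
  and P_le_K: "y \<ge> a \<Longrightarrow> t \<in> {0..T} \<Longrightarrow> \<bar>P y t\<bar> \<le> K"
proof -
  assume y: "y \<ge> a" and t: "t \<in> {0..T}"
  have "K / (1 + y - a) ^ 4 \<le> K / 1" "K / (1 + y - a) ^ 3 \<le> K / 1"
    using y K_nonneg by (intro divide_left_mono one_le_power; simp)+
  then show "\<bar>w y t\<bar> \<le> K" "\<bar>P y t\<bar> \<le> K" using w_bound[OF y t] P_bound[OF y t] by linarith+
qed

text \<open>The fundamental solution in time, with k = 1/z. It is chosen for every y separately, so
  its dependence on y is not part of the choice and has to be derived, in
  \<open>F_y\<close>.\<close>

definition F :: "real \<Rightarrow> real \<Rightarrow> complex \<Rightarrow> cmat" where
  "F y = (SOME F. (\<forall>k. F 0 k = mat 1) \<and> (\<forall>t\<in>{0..T}. F t 0 = mat 1) \<and>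
    (\<forall>k. \<forall>t\<in>{0..T}. ((\<lambda>t. F t k) has_vector_derivative mat k ** (Bmat (w y t) ** F t k)) (at t within {0..T})) \<and>
    (\<forall>t\<in>{0..T}. \<forall>i j. (\<lambda>k. F t k $ i $ j) holomorphic_on UNIV))"

lemma F_props:
  assumes y: "y \<ge> a"
  shows "F y 0 k = mat 1" and "t \<in> {0..T} \<Longrightarrow> F y t 0 = mat 1"
    and "t \<in> {0..T} \<Longrightarrow> ((\<lambda>t. F y t k) has_vector_derivative mat k ** (Bmat (w y t) ** F y t k)) (at t within {0..T})"
    and "t \<in> {0..T} \<Longrightarrow> (\<lambda>k. F y t k $ i $ j) holomorphic_on UNIV"
proof -
  have "continuous_on {0..T} (\<lambda>t. w y t)" using continuous_on_slices(1)[OF w_cont] y by auto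
  then have "continuous_on {0..T} (\<lambda>t. Bmat (w y t))"
    by (intro continuous_on_compose2[OF continuous_at_imp_continuous_on[of UNIV Bmat]]) (auto simp: isCont_Bmat)
  note someI_ex[OF linear_ode_entire[OF T this], folded F_def]
  then show "F y 0 k = mat 1" "t \<in> {0..T} \<Longrightarrow> F y t 0 = mat 1"
    "t \<in> {0..T} \<Longrightarrow> ((\<lambda>t. F y t k) has_vector_derivative mat k ** (Bmat (w y t) ** F y t k)) (at t within {0..T})"
    "t \<in> {0..T} \<Longrightarrow> (\<lambda>k. F y t k $ i $ j) holomorphic_on UNIV" by blast+
qed

text \<open>Uniform in y because w is bounded on the strip. The bound depends on k; it serves to
  make the dressed matrix bounded in y for each fixed z.\<close>

lemma F_bound: "\<exists>c. \<forall>y\<ge>a. \<forall>t\<in>{0..T}. norm (F y t k) \<le> c"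
proof -
  obtain b where b: "b > 0" "\<And>x. \<bar>x\<bar> \<le> K \<Longrightarrow> norm (Bmat x) \<le> b" using isCont_bounded_Icc[OF isCont_Bmat] by blast
  define L where "L = norm k * mmK * b + 1"
  have L: "L > 0" using mmK(1) b(1) by (auto simp: L_def intro!: add_nonneg_pos mult_nonneg_nonneg)
  have "norm (F y t k) \<le> 2 * (norm (F y 0 k) + 0 * T) * exp (2 * L * T)" if y: "y \<ge> a" and t: "t \<in> {0..T}" for y t
  proof (rule gronwall[OF L _ T F_props(3)[OF y] _ t])
    fix s assume s: "s \<in> {0..T}"
    have "norm (mat k ** (Bmat (w y s) ** F y s k)) \<le> norm k * (mmK * norm (Bmat (w y s)) * norm (F y s k))"
      unfolding norm_mat_mult by (intro mult_left_mono mmK) auto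
    also have "\<dots> \<le> norm k * (mmK * b * norm (F y s k))"
      using b(2)[OF w_le_K[OF y s]] mmK(1) by (intro mult_left_mono mult_right_mono) auto
    also have "\<dots> \<le> L * norm (F y s k)" by (simp add: L_def distrib_right)
    finally show "norm (mat k ** (Bmat (w y s) ** F y s k)) \<le> L * norm (F y s k) + 0" by simp
  qed auto
  then have "\<forall>y\<ge>a. \<forall>t\<in>{0..T}. norm (F y t k) \<le> 2 * (norm (mat 1 :: cmat) + 0 * T) * exp (2 * L * T)"
    using F_props(1) by simp
  then show ?thesis by blast
qed

lemma F_cont: "y \<ge> a \<Longrightarrow> continuous_on {0..T} (\<lambda>t. F y t k)"
  unfolding continuous_on_eq_continuous_within by (blast intro: has_vector_derivative_continuous F_props(3))

lemma Bmat_w_y: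
  assumes y: "y \<ge> a" and t: "t \<in> {0..T}"
  shows "((\<lambda>y. Bmat (w y t)) has_vector_derivative wy y t *\<^sub>R (cmat0 ** Bmat (w y t) - Bmat (w y t) ** cmat0)) (at y within {a..})"
  using vector_diff_chain_within[OF w_y[OF y t, unfolded has_real_derivative_iff_has_vector_derivative] has_vector_derivative_at_within[OF Bmat_deriv]]
  by (simp add: o_def)

text \<open>The zero-curvature condition: \<open>F\<close> transports the \<open>y\<close>-equation with the data at time \<open>0\<close>
  into the one with the data at time \<open>t\<close>.\<close>

lemma F_y:
  assumes z: "z \<noteq> 0" and k: "k = inverse z" and y: "y \<ge> a" and t: "t \<in> {0..T}"
  shows "((\<lambda>y. F y t k) has_vector_derivative
    mat z ** (dmat ** F y t k - F y t k ** dmat) + wy y t *\<^sub>R (cmat0 ** F y t k) - wy y 0 *\<^sub>R (F y t k ** cmat0)) (at y within {a..})"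
proof -
  have zk: "z * k = 1" using z k by simp
  \<comment> \<open>The claimed y-derivative. It will be shown to satisfy the equation of F
    differentiated in y, with value 0 at time 0; \<open>Bmat_dmat\<close> accounts for the terms in
    which z and 1/z cancel.\<close>
  define A where "A t = mat z ** (dmat ** F y t k - F y t k ** dmat) + wy y t *\<^sub>R (cmat0 ** F y t k) - wy y 0 *\<^sub>R (F y t k ** cmat0)" for t
  define By where "By y t = wy y t *\<^sub>R (cmat0 ** Bmat (w y t) - Bmat (w y t) ** cmat0)" for y t
  have A_t: "(A has_vector_derivative mat k ** (By y t ** F y t k + Bmat (w y t) ** A t)) (at t within {0..T})" if t: "t \<in> {0..T}" for t
  proof -
    note Ft = F_props(3)[OF y t, of k]
    have "(A has_vector_derivative
      mat z ** (dmat ** (mat k ** (Bmat (w y t) ** F y t k)) - (mat k ** (Bmat (w y t) ** F y t k)) ** dmat)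
      + (wy y t *\<^sub>R (cmat0 ** (mat k ** (Bmat (w y t) ** F y t k))) + fpot (w y t) *\<^sub>R (cmat0 ** F y t k))
      - wy y 0 *\<^sub>R ((mat k ** (Bmat (w y t) ** F y t k)) ** cmat0)) (at t within {0..T})"
      unfolding A_def
      by (intro has_vector_derivative_add has_vector_derivative_diff has_vector_derivative_scaleR wy_t[OF y t]
          bounded_linear.has_vector_derivative[OF mm.bounded_linear_right] bounded_linear.has_vector_derivative[OF mm.bounded_linear_left]
          bounded_linear.has_vector_derivative[OF bounded_linear_scaleR_right] Ft)
    also have "mat z ** (dmat ** (mat k ** (Bmat (w y t) ** F y t k)) - (mat k ** (Bmat (w y t) ** F y t k)) ** dmat)
      + (wy y t *\<^sub>R (cmat0 ** (mat k ** (Bmat (w y t) ** F y t k))) + fpot (w y t) *\<^sub>R (cmat0 ** F y t k))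
      - wy y 0 *\<^sub>R ((mat k ** (Bmat (w y t) ** F y t k)) ** cmat0)
      = mat k ** (By y t ** F y t k + Bmat (w y t) ** A t)"
    proof -
      define B G where "B = Bmat (w y t)" and "G = F y t k"
      have f: "fpot (w y t) *\<^sub>R (cmat0 ** G) = B ** dmat ** G - dmat ** B ** G"
        using Bmat_dmat[of "w y t"] by (simp add: B_def flip: mm.scaleR_left mm.diff_left)
      have "mat z ** (dmat ** (mat k ** (B ** G)) - (mat k ** (B ** G)) ** dmat) = dmat ** B ** G - B ** G ** dmat"
        unfolding mat_pull(1)[of dmat] mat_pull(2)[of _ _ dmat] mm.diff_right[of "mat z"] mat_cancel[OF zk] by (simp add: matrix_mul_assoc)
      moreover have "mat k ** (B ** (mat z ** (dmat ** G - G ** dmat))) = B ** dmat ** G - B ** G ** dmat"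
      proof -
        have kz: "k * z = 1" using zk by (simp add: mult.commute)
        show ?thesis unfolding mat_pull(1)[of B z] mat_cancel[OF kz] mm.diff_right by (simp add: matrix_mul_assoc)
      qed
      ultimately show ?thesis
      proof -
        assume e: "mat z ** (dmat ** (mat k ** (B ** G)) - (mat k ** (B ** G)) ** dmat) = dmat ** B ** G - B ** G ** dmat"
          "mat k ** (B ** (mat z ** (dmat ** G - G ** dmat))) = B ** dmat ** G - B ** G ** dmat"
        have l: "cmat0 ** (mat k ** (B ** G)) = mat k ** (cmat0 ** B ** G)" "(mat k ** (B ** G)) ** cmat0 = mat k ** (B ** G ** cmat0)"
          unfolding mat_pull(1)[of cmat0] mat_pull(2)[of _ _ cmat0] by (simp_all add: matrix_mul_assoc)
        have r: "mat k ** ((u *\<^sub>R (cmat0 ** B - B ** cmat0)) ** G) = u *\<^sub>R (mat k ** (cmat0 ** B ** G)) - u *\<^sub>R (mat k ** (B ** cmat0 ** G))"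
          "mat k ** (B ** (u *\<^sub>R (cmat0 ** G))) = u *\<^sub>R (mat k ** (B ** cmat0 ** G))"
          "mat k ** (B ** (u *\<^sub>R (G ** cmat0))) = u *\<^sub>R (mat k ** (B ** G ** cmat0))" for u
          by (simp_all add: mat_distribs scaleR_diff_right)
        show ?thesis
          unfolding A_def By_def B_def[symmetric] G_def[symmetric] f mm.add_right mm.diff_right[of B] mm.diff_right[of "mat k"] r e(2)
          unfolding mm.diff_right[symmetric] e(1) l by (simp add: algebra_simps)
      qed
    qed
    finally show ?thesis .
  qed
  have A0: "A 0 = 0" using F_props(1)[OF y] by (simp add: A_def)
  have Ac: "continuous_on {0..T} A"
    unfolding continuous_on_eq_continuous_within by (blast intro: has_vector_derivative_continuous A_t)
  obtain b where b: "b > 0" "\<And>x. \<bar>x\<bar> \<le> K \<Longrightarrow> norm (Bmat x) \<le> b" using isCont_bounded_Icc[OF isCont_Bmat] by blast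
  have "bounded (A ` {0..T})" "bounded ((\<lambda>t. F y t k) ` {0..T})"
    by (intro compact_imp_bounded compact_continuous_image Ac F_cont y compact_Icc)+
  then obtain cA cF where cA: "cA > 0" "\<And>t. t \<in> {0..T} \<Longrightarrow> norm (A t) \<le> cA" and cF: "cF > 0" "\<And>t. t \<in> {0..T} \<Longrightarrow> norm (F y t k) \<le> cF"
    unfolding bounded_pos by auto
  have Byc: "continuous_on ({a..} \<times> {0..T}) (\<lambda>(y, t). By y t)"
  proof -
    have B: "continuous_on ({a..} \<times> {0..T}) (\<lambda>p. Bmat (w (fst p) (snd p)))"
      using continuous_on_compose2[OF continuous_at_imp_continuous_on[of UNIV Bmat] w_cont] by (simp add: isCont_Bmat split_def)
    show ?thesis unfolding By_def split_def
      by (intro continuous_on_scaleR continuous_on_diff mm.continuous_on B continuous_on_const wy_cont[unfolded split_def])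
  qed
  define L where "L = norm k * mmK * b + 1"
  have L: "L > 0" using mmK(1) b(1) by (auto simp: L_def intro!: add_nonneg_pos mult_nonneg_nonneg)
  define c1 where "c1 = norm k * mmK * (cF + cA)"
  have c1: "c1 \<ge> 0" using mmK(1) cF(1) cA(1) by (auto simp: c1_def intro!: mult_nonneg_nonneg)
  define c2 where "c2 = 2 * c1 * T * exp (2 * L * T) + 1"
  have c2: "c2 > 0" using c1 T by (auto simp: c2_def intro!: add_nonneg_pos mult_nonneg_nonneg)
  have "\<exists>\<delta>>0. \<forall>y'\<in>{a..}. norm (y' - y) < \<delta> \<longrightarrow> norm (F y' t k - F y t k - (y' - y) *\<^sub>R A t) \<le> e * norm (y' - y)"
    if e: "e > 0" for e
  proof -
    define \<epsilon> where "\<epsilon> = e / c2"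
    have \<epsilon>: "\<epsilon> > 0" using e c2 by (simp add: \<epsilon>_def)
    obtain \<delta>1 where d1: "\<delta>1 > 0" "\<And>y' t. y' \<ge> a \<Longrightarrow> \<bar>y' - y\<bar> < \<delta>1 \<Longrightarrow> t \<in> {0..T} \<Longrightarrow>
        norm (Bmat (w y' t) - Bmat (w y t) - (y' - y) *\<^sub>R By y t) \<le> \<epsilon> * \<bar>y' - y\<bar>"
      using uniform_derivative_remainder[OF Bmat_w_y[folded By_def] Byc y \<epsilon>] by blast
    have "bounded ((\<lambda>t. By y t) ` {0..T})"
      using y continuous_on_slices(1)[OF Byc, of y] by (intro compact_imp_bounded compact_continuous_image) auto
    then obtain cB where cB: "cB > 0" "\<And>t. t \<in> {0..T} \<Longrightarrow> norm (By y t) \<le> cB" unfolding bounded_pos by auto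
    \<comment> \<open>The second bound yields
      \<open>\<bar>h\<bar> * (\<epsilon> + cB) \<le> \<epsilon>\<close>, so that \<open>Bmat\<close>
      itself changes by at most \<open>\<epsilon>\<close> between y and y'.\<close>
    define \<delta> where "\<delta> = min \<delta>1 (\<epsilon> / (\<epsilon> + cB))"
    have "norm (F y' t k - F y t k - (y' - y) *\<^sub>R A t) \<le> e * norm (y' - y)" if y': "y' \<in> {a..}" "norm (y' - y) < \<delta>" for y'
    proof -
      define h where "h = y' - y"
      have h: "\<bar>h\<bar> < \<delta>1" "\<bar>h\<bar> * (\<epsilon> + cB) \<le> \<epsilon>"
        using y'(2) \<epsilon> cB(1) by (auto simp: h_def \<delta>_def field_simps)
      have ya: "y' \<ge> a" using y' by simp
      \<comment> \<open>The first-order remainder of F. It vanishes at time 0 and obeys the equation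
        of F at y' with a source of size \<open>\<epsilon> * \<bar>h\<bar>\<close> up to constants,
        so \<open>gronwall\<close> bounds it.\<close>
      define \<Delta> where "\<Delta> t = F y' t k - F y t k - h *\<^sub>R A t" for t
      have r1: "norm (Bmat (w y' s) - Bmat (w y s) - h *\<^sub>R By y s) \<le> \<epsilon> * \<bar>h\<bar>" if "s \<in> {0..T}" for s
        using d1(2)[OF ya _ that] h(1) by (simp add: h_def)
      have r2: "norm (Bmat (w y' s) - Bmat (w y s)) \<le> \<epsilon>" if "s \<in> {0..T}" for s
      proof -
        have "norm (Bmat (w y' s) - Bmat (w y s)) \<le> \<epsilon> * \<bar>h\<bar> + \<bar>h\<bar> * cB"
          using norm_triangle_sub[of "Bmat (w y' s) - Bmat (w y s)" "h *\<^sub>R By y s"] r1[OF that]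
            mult_left_mono[OF cB(2)[OF that], of "\<bar>h\<bar>"] by simp
        then show ?thesis using h(2) by (simp add: algebra_simps)
      qed
      define \<Delta>' where "\<Delta>' s = mat k ** (Bmat (w y' s) ** F y' s k) - mat k ** (Bmat (w y s) ** F y s k)
          - h *\<^sub>R (mat k ** (By y s ** F y s k + Bmat (w y s) ** A s))" for s
      have "norm (\<Delta> t) \<le> 2 * (norm (\<Delta> 0) + c1 * (\<epsilon> * \<bar>h\<bar>) * T) * exp (2 * L * T)"
      proof (rule gronwall[OF L _ T _ _ t])
        fix s assume s: "s \<in> {0..T}"
        show "(\<Delta> has_vector_derivative \<Delta>' s) (at s within {0..T})"
          unfolding \<Delta>_def \<Delta>'_def
          by (intro has_vector_derivative_diff F_props(3) ya y s bounded_linear.has_vector_derivative[OF bounded_linear_scaleR_right] A_t)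
        have eq: "\<Delta>' s = mat k ** (Bmat (w y' s) ** \<Delta> s)
            + mat k ** ((Bmat (w y' s) - Bmat (w y s) - h *\<^sub>R By y s) ** F y s k + h *\<^sub>R ((Bmat (w y' s) - Bmat (w y s)) ** A s))"
          unfolding \<Delta>'_def \<Delta>_def by (simp add: mm.add_left mm.add_right mm.diff_left mm.diff_right mm.scaleR_left mm.scaleR_right algebra_simps)
        have n1: "norm (mat k ** (Bmat (w y' s) ** \<Delta> s)) \<le> norm k * (mmK * b * norm (\<Delta> s))"
          unfolding norm_mat_mult using b(2)[OF w_le_K[OF ya s]] mmK(1)
          by (intro mult_left_mono order_trans[OF mmK(2)] mult_right_mono) auto
        have n2: "norm ((Bmat (w y' s) - Bmat (w y s) - h *\<^sub>R By y s) ** F y s k) \<le> mmK * (\<epsilon> * \<bar>h\<bar>) * cF"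
          using r1[OF s] cF(2)[OF s] mmK(1) \<epsilon> by (intro order_trans[OF mmK(2)] mult_mono) auto
        have n3: "norm (h *\<^sub>R ((Bmat (w y' s) - Bmat (w y s)) ** A s)) \<le> \<bar>h\<bar> * (mmK * \<epsilon> * cA)"
          unfolding norm_scaleR using r2[OF s] cA(2)[OF s] mmK(1) \<epsilon>
          by (intro mult_left_mono order_trans[OF mmK(2)] mult_mono) auto
        have "norm (\<Delta>' s) \<le> norm k * (mmK * b * norm (\<Delta> s)) + norm k * (mmK * (\<epsilon> * \<bar>h\<bar>) * cF + \<bar>h\<bar> * (mmK * \<epsilon> * cA))"
          unfolding eq
          by (intro norm_triangle_mono n1) (unfold norm_mat_mult, intro mult_left_mono norm_triangle_mono n2 n3 norm_ge_zero)
        also have "\<dots> \<le> L * norm (\<Delta> s) + c1 * (\<epsilon> * \<bar>h\<bar>)"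
          by (simp add: L_def c1_def algebra_simps)
        finally show "norm (\<Delta>' s) \<le> L * norm (\<Delta> s) + c1 * (\<epsilon> * \<bar>h\<bar>)" .
      qed (use c1 \<epsilon> in auto)
      also have "\<Delta> 0 = 0" using F_props(1)[OF ya] F_props(1)[OF y] A0 by (simp add: \<Delta>_def)
      also have "2 * (norm (0::cmat) + c1 * (\<epsilon> * \<bar>h\<bar>) * T) * exp (2 * L * T) = (c2 - 1) * \<epsilon> * \<bar>h\<bar>"
        by (simp add: c2_def)
      also have "\<dots> \<le> c2 * \<epsilon> * \<bar>h\<bar>" using \<epsilon> by (intro mult_right_mono) auto
      also have "\<dots> = e * \<bar>h\<bar>" using c2 by (simp add: \<epsilon>_def)
      finally show ?thesis by (simp add: \<Delta>_def h_def)
    qed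
    moreover have "\<delta> > 0" using d1(1) \<epsilon> cB(1) by (simp add: \<delta>_def)
    ultimately show ?thesis by blast
  qed
  then show ?thesis
    unfolding has_vector_derivative_def has_derivative_within_alt A_def[symmetric]
    by (intro conjI bounded_linear_scaleR_left allI impI) auto
qed

end

lemma Emat_dmat: "dmat ** Emat t z = Emat t z ** dmat" and Emat_dinv: "dinv ** Emat t z = Emat t z ** dinv"
  by (simp_all add: vec_eq_iff dmat_def dinv_def Emat_def diag_mat_mult_left diag_mat_mult_right)
    (simp_all add: diag_mat_def)

lemma norm_mult_le: "norm A \<le> a \<Longrightarrow> norm B \<le> b \<Longrightarrow> norm (A ** B) \<le> mmK * a * b" for A B :: cmat
  using mmK order_trans[OF norm_ge_zero, of A a] by (intro order_trans[OF mmK(2)] mult_mono) (auto simp: less_imp_le)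

lemma Gmat_inverse': "Gmat w ** (Gmat (- w) ** A) = A"
  by (simp add: matrix_mul_assoc Gmat_inverse)

context tzitzeica_strip begin

lemma Gmat_w_y:
  assumes "y \<ge> a" "t \<in> {0..T}"
  shows "((\<lambda>y. Gmat (- w y t)) has_vector_derivative (- wy y t) *\<^sub>R (Gmat (- w y t) ** cmat0)) (at y within {a..})"
  using vector_diff_chain_within[OF has_vector_derivative_minus[OF w_y[OF assms, unfolded has_real_derivative_iff_has_vector_derivative]]
    has_vector_derivative_at_within[OF Gmat_deriv]]
  by (simp add: o_def)

lemma Gmat_w_t:
  assumes "y \<ge> a" "t \<in> {0..T}"
  shows "((\<lambda>t. Gmat (- w y t)) has_vector_derivative (- P y t) *\<^sub>R (Gmat (- w y t) ** cmat0)) (at t within {0..T})"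
  using vector_diff_chain_within[OF has_vector_derivative_minus[OF w_t[OF assms, unfolded has_real_derivative_iff_has_vector_derivative]]
    has_vector_derivative_at_within[OF Gmat_deriv]]
  by (simp add: o_def)

text \<open>After the conjugation the singular coefficient 1/z multiplies a commutator with a
  constant matrix; the dependence on w survives only in the bounded term with
  \<open>P\<close>.\<close>

lemma dressed_t:
  fixes M :: cmat
  assumes k: "k = inverse z" and y: "y \<ge> a" and t: "t \<in> {0..T}"
  defines "N \<equiv> \<lambda>t. Gmat (- w y t) ** (F y t k ** (M ** Emat t z))"
  shows "(N has_vector_derivative mat k ** (dinv ** N t - N t ** dinv) - P y t *\<^sub>R (cmat0 ** N t)) (at t within {0..T})"
proof -
  define X where "X t = F y t k ** (M ** Emat t z)" for t
  have "(X has_vector_derivative F y t k ** (M ** (- (mat k ** (Emat t z ** dinv)))) + (mat k ** (Bmat (w y t) ** F y t k)) ** (M ** Emat t z)) (at t within {0..T})"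
    unfolding X_def
    by (rule mm.has_vector_derivative[OF F_props(3)[OF y t] bounded_linear.has_vector_derivative[OF mm.bounded_linear_right Emat_deriv[OF k]]])
  also have "F y t k ** (M ** (- (mat k ** (Emat t z ** dinv)))) + (mat k ** (Bmat (w y t) ** F y t k)) ** (M ** Emat t z)
      = mat k ** (Bmat (w y t) ** X t) - mat k ** (X t ** dinv)"
    unfolding X_def by (simp add: mat_distribs mat_commute)
  finally have X: "(X has_vector_derivative mat k ** (Bmat (w y t) ** X t) - mat k ** (X t ** dinv)) (at t within {0..T})" .
  have "(N has_vector_derivative Gmat (- w y t) ** (mat k ** (Bmat (w y t) ** X t) - mat k ** (X t ** dinv))
      + ((- P y t) *\<^sub>R (Gmat (- w y t) ** cmat0)) ** X t) (at t within {0..T})"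
    unfolding N_def X_def[symmetric] by (rule mm.has_vector_derivative[OF Gmat_w_t[OF y t] X])
  also have "Gmat (- w y t) ** (mat k ** (Bmat (w y t) ** X t) - mat k ** (X t ** dinv))
      + ((- P y t) *\<^sub>R (Gmat (- w y t) ** cmat0)) ** X t
      = mat k ** ((Gmat (- w y t) ** Bmat (w y t)) ** X t) - mat k ** ((Gmat (- w y t) ** X t) ** dinv) - P y t *\<^sub>R ((Gmat (- w y t) ** cmat0) ** X t)"
    by (simp add: mat_distribs mat_commute)
  also have "\<dots> = mat k ** (dinv ** N t - N t ** dinv) - P y t *\<^sub>R (cmat0 ** N t)"
    unfolding Gmat_Bmat Gmat_cmat0[symmetric] N_def X_def by (simp add: mm.diff_right matrix_mul_assoc)
  finally show ?thesis .
qed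

text \<open>The derivative of \<open>Gmat (- w)\<close> cancels the term w_y \<open>cmat0\<close>.
  What perturbs the free equation afterwards carries a factor z and decays in y together with
  w.\<close>

lemma dressed_y:
  fixes m :: "real \<Rightarrow> cmat"
  assumes z: "z \<noteq> 0" and k: "k = inverse z" and y: "y \<ge> a" and t: "t \<in> {0..T}"
    and m: "(m has_vector_derivative mat z ** (dmat ** m y - m y ** dmat) + wy y 0 *\<^sub>R (cmat0 ** m y)) (at y within {a..})"
  defines "N \<equiv> \<lambda>y. Gmat (- w y t) ** (F y t k ** (m y ** Emat t z))"
  shows "(N has_vector_derivative mat z ** (dmat ** N y - N y ** dmat) + mat z ** (Rmat (w y t) ** N y)) (at y within {a..})"
proof -
  define X where "X y = F y t k ** (m y ** Emat t z)" for y
  have "(X has_vector_derivative F y t k ** ((mat z ** (dmat ** m y - m y ** dmat) + wy y 0 *\<^sub>R (cmat0 ** m y)) ** Emat t z)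
     + (mat z ** (dmat ** F y t k - F y t k ** dmat) + wy y t *\<^sub>R (cmat0 ** F y t k) - wy y 0 *\<^sub>R (F y t k ** cmat0)) ** (m y ** Emat t z)) (at y within {a..})"
    unfolding X_def
    by (rule mm.has_vector_derivative[OF F_y[OF z k y t] bounded_linear.has_vector_derivative[OF mm.bounded_linear_left m]])
  also have "F y t k ** ((mat z ** (dmat ** m y - m y ** dmat) + wy y 0 *\<^sub>R (cmat0 ** m y)) ** Emat t z)
     + (mat z ** (dmat ** F y t k - F y t k ** dmat) + wy y t *\<^sub>R (cmat0 ** F y t k) - wy y 0 *\<^sub>R (F y t k ** cmat0)) ** (m y ** Emat t z)
     = mat z ** (dmat ** X y - X y ** dmat) + wy y t *\<^sub>R (cmat0 ** X y)"
    unfolding X_def by (simp add: mat_distribs mat_commute Emat_dmat Emat_dmat[THEN mult_rule_assoc])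
  finally have X: "(X has_vector_derivative mat z ** (dmat ** X y - X y ** dmat) + wy y t *\<^sub>R (cmat0 ** X y)) (at y within {a..})" .
  have "(N has_vector_derivative Gmat (- w y t) ** (mat z ** (dmat ** X y - X y ** dmat) + wy y t *\<^sub>R (cmat0 ** X y))
      + ((- wy y t) *\<^sub>R (Gmat (- w y t) ** cmat0)) ** X y) (at y within {a..})"
    unfolding N_def X_def[symmetric] by (rule mm.has_vector_derivative[OF Gmat_w_y[OF y t] X])
  also have "Gmat (- w y t) ** (mat z ** (dmat ** X y - X y ** dmat) + wy y t *\<^sub>R (cmat0 ** X y))
      + ((- wy y t) *\<^sub>R (Gmat (- w y t) ** cmat0)) ** X y
      = mat z ** ((Gmat (- w y t) ** dmat) ** X y) - mat z ** ((Gmat (- w y t) ** X y) ** dmat)"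
    by (simp add: mat_distribs mat_commute)
  also have "\<dots> = mat z ** (dmat ** N y - N y ** dmat) + mat z ** (Rmat (w y t) ** N y)"
    unfolding Gmat_dmat N_def X_def by (simp add: mm.diff_right mm.add_left mm.add_right matrix_mul_assoc)
  finally show ?thesis .
qed

text \<open>Each entry is integrated from the end at which its exponential decays: from \<open>y = +\<infinity>\<close> or from
  \<open>t = 0\<close>. One of the two is always available, because \<open>\<lambda>\<close> and \<open>1 / \<lambda>\<close> have real parts of the same
  sign.\<close>

lemma dressed_limit:
  fixes M0 :: "real \<Rightarrow> complex \<Rightarrow> cmat" and \<delta> C0 :: real
  assumes \<delta>: "\<delta> > 0"
    and M0_y: "\<And>y z. y \<ge> a \<Longrightarrow> z \<notin> Sigma_contour \<Longrightarrow> norm z < \<delta> \<Longrightarrow>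
      ((\<lambda>y. M0 y z) has_vector_derivative mat z ** (dmat ** M0 y z - M0 y z ** dmat) + wy y 0 *\<^sub>R (cmat0 ** M0 y z)) (at y within {a..})"
    and M0_bounded: "\<And>z. z \<notin> Sigma_contour \<Longrightarrow> norm z < \<delta> \<Longrightarrow> \<exists>B. \<forall>y\<ge>a. norm (M0 y z) \<le> B"
    and M0_diag: "\<And>z l. z \<notin> Sigma_contour \<Longrightarrow> norm z < \<delta> \<Longrightarrow> ((\<lambda>y. M0 y z $ l $ l) \<longlongrightarrow> 1) at_top"
    and M0_small: "\<And>y z. y \<ge> a \<Longrightarrow> z \<notin> Sigma_contour \<Longrightarrow> norm z < \<delta> \<Longrightarrow> norm (Gmat (- w y 0) ** M0 y z - mat 1) \<le> C0 * norm z"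
    and y0: "y0 \<ge> a" and t0: "t0 \<in> {0..T}"
  shows "((\<lambda>z. F y0 t0 (inverse z) ** (M0 y0 z ** Emat t0 z)) \<longlongrightarrow> Gmat (w y0 t0)) (at 0 within - Sigma_contour)"
proof -
  obtain bR where bR: "bR > 0" "\<And>x. \<bar>x\<bar> \<le> K \<Longrightarrow> norm (Rmat x) \<le> bR * \<bar>x\<bar>" using Rmat_lipschitz by blast
  obtain bG where bG: "bG > 0" "\<And>x. \<bar>x\<bar> \<le> K \<Longrightarrow> norm (Gmat x) \<le> bG" using isCont_bounded_Icc[OF isCont_Gmat] by blast
  have C0: "0 \<le> \<bar>C0\<bar>" "C0 \<le> \<bar>C0\<bar>" by auto
  \<comment> \<open>The smallest gap between the inverses of the eigenvalues at z = 1: the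
    off-diagonal exponents of the t-equation have modulus at least
    \<open>c0 / norm z\<close>.\<close>
  define c0 where "c0 = Min ((\<lambda>(i, j). norm (inverse (lam 1 $ i) - inverse (lam 1 $ j))) ` {(i, j). i \<noteq> j})"
  have c0_le: "c0 \<le> norm (inverse (lam 1 $ i) - inverse (lam 1 $ j))" if "i \<noteq> j" for i j
    unfolding c0_def using that by (intro Min_le) (auto intro!: image_eqI[of _ _ "(i, j)"])
  have c0: "c0 > 0"
  proof -
    have "(1::3, 2::3) \<in> {(i, j). i \<noteq> j}" by simp
    then have "{(i::3, j::3). i \<noteq> j} \<noteq> {}" by blast
    moreover have "inverse (lam 1 $ i) \<noteq> inverse (lam 1 $ j)" if "i \<noteq> j" for i j
      using lam_1_diff[OF that] by auto
    ultimately show ?thesis unfolding c0_def by (subst Min_gr_iff) auto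
  qed
  define n1 where "n1 = norm (mat 1 :: cmat)"
  define nc where "nc = norm cmat0"
  have nn: "n1 \<ge> 0" "nc \<ge> 0" by (auto simp: n1_def nc_def)
  define A where "A = K * (mmK * nc * 9) + 1"
  have A: "A \<ge> 1" "A > 0" using K_nonneg mmK(1) nn by (auto simp: A_def intro!: mult_nonneg_nonneg add_nonneg_pos)
  \<comment> \<open>The rate of an exponential weight in t, twice the strength A of the coupling:
    the coupling then contributes at most half of the weighted supremum.\<close>
  define \<mu> where "\<mu> = 2 * A"
  have \<mu>: "\<mu> > 0" using A by (simp add: \<mu>_def)
  define C1 where "C1 = mmK * (bR * K) * (n1 + 9 * exp (\<mu> * T))"
  \<comment> \<open>The summands stem from the data at time 0, from the subtracted term P q at times
    0 and t, and from the source \<open>Pt\<close> q over the time T.\<close>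
  define C2 where "C2 = \<bar>C0\<bar> + 2 * (nc * K / c0) + nc * K / c0 * T"
  have C12: "C1 \<ge> 0" "C2 \<ge> 0" using mmK(1) bR(1) K_nonneg nn c0 T by (auto simp: C1_def C2_def intro!: mult_nonneg_nonneg add_nonneg_nonneg divide_nonneg_nonneg)
  define C where "C = C1 + C2"
  have C: "C \<ge> 0" using C12 by (simp add: C_def)
  define N where "N z y t = Gmat (- w y t) ** (F y t (inverse z) ** (M0 y z ** Emat t z))" for z y t
  have main: "norm (N z y t - mat 1) \<le> 36 * exp (\<mu> * T) * C * norm z"
    if z: "z \<notin> Sigma_contour" "norm z < \<delta>" "norm z * C \<le> 1 / 4" and y: "y \<ge> a" and t: "t \<in> {0..T}" for z y t
  proof -
    have z0: "z \<noteq> 0" using z(1) zero_in_Sigma by auto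
    define k where "k = inverse z"
    have Nt: "(N z y has_vector_derivative mat k ** (dinv ** N z y t - N z y t ** dinv) - P y t *\<^sub>R (cmat0 ** N z y t)) (at t within {0..T})"
      if "y \<ge> a" "t \<in> {0..T}" for y t
      unfolding N_def k_def[symmetric] by (rule dressed_t[OF k_def that])
    have Ny: "((\<lambda>y. N z y t) has_vector_derivative mat z ** (dmat ** N z y t - N z y t ** dmat) + mat z ** (Rmat (w y t) ** N z y t)) (at y within {a..})"
      if "y \<ge> a" "t \<in> {0..T}" for y t
      unfolding N_def k_def[symmetric] by (rule dressed_y[OF z0 k_def that M0_y[OF that(1) z(1,2)]])
    obtain B0 where B0: "\<And>y. y \<ge> a \<Longrightarrow> norm (M0 y z) \<le> B0" using M0_bounded[OF z(1,2)] by blast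
    obtain BF where BF: "\<And>y t. y \<ge> a \<Longrightarrow> t \<in> {0..T} \<Longrightarrow> norm (F y t k) \<le> BF" using F_bound by blast
    have "continuous_on {0..T} (\<lambda>t. Emat t z)"
      unfolding continuous_on_eq_continuous_within by (blast intro: has_vector_derivative_continuous Emat_deriv[OF k_def])
    then have "bounded ((\<lambda>t. Emat t z) ` {0..T})" by (intro compact_imp_bounded compact_continuous_image compact_Icc)
    then obtain BE where "\<forall>x\<in>(\<lambda>t. Emat t z) ` {0..T}. norm x \<le> BE" unfolding bounded_iff by blast
    then have BE: "\<And>t. t \<in> {0..T} \<Longrightarrow> norm (Emat t z) \<le> BE" by auto
    define BN where "BN = mmK * bG * (mmK * BF * (mmK * B0 * BE))"
    \<comment> \<open>A bound for fixed z, without control as z tends to 0. It justifies the limits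
      at y = +infinity and the finiteness of the supremum below, and does not appear in the final
      estimate.\<close>
    have NB: "norm (N z y t) \<le> BN" if y: "y \<ge> a" and t: "t \<in> {0..T}" for y t
    proof -
      show ?thesis
        unfolding N_def BN_def k_def[symmetric]
        by (intro norm_mult_le bG(2) BF B0 BE y t) (use w_le_K[OF y t] in simp)
    qed
    have BN: "BN \<ge> 0" using NB[OF y t] norm_ge_zero order_trans by blast
    have N0: "N z y 0 = Gmat (- w y 0) ** M0 y z" if "y \<ge> a" for y
      by (simp add: N_def Emat_0 F_props(1)[OF that])
    have s_lim: "((\<lambda>y. c / (1 + y - a) ^ Suc n) \<longlongrightarrow> 0) at_top" for c n
    proof (rule tendsto_divide_0[OF tendsto_const], rule filterlim_at_top_imp_at_infinity, rule filterlim_pow_at_top)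
      show "filterlim (\<lambda>y. 1 + y - a) at_top at_top"
        using filterlim_tendsto_add_at_top[OF tendsto_const filterlim_ident, of "1 - a"] by (simp add: algebra_simps)
    qed simp
    \<comment> \<open>The commutator with \<open>dinv\<close> has no diagonal part, so a diagonal
      entry changes in time only through \<open>P\<close>, which decays in y. The limit known at
      time 0 therefore persists.\<close>
    have N_diag: "((\<lambda>y. N z y t $ l $ l) \<longlongrightarrow> 1) at_top" if t: "t \<in> {0..T}" for t l
    proof -
      have "((\<lambda>y. N z y 0 $ l $ l) \<longlongrightarrow> 1) at_top"
      proof -
        have w0: "((\<lambda>y. w y 0) \<longlongrightarrow> 0) at_top"
        proof (rule Lim_null_comparison)
          show "\<forall>\<^sub>F y in at_top. norm (w y 0) \<le> K / (1 + y - a) ^ 4"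
            using eventually_ge_at_top[of a] by eventually_elim (use w_bound[of _ 0] T in auto)
          show "((\<lambda>y. K / (1 + y - a) ^ 4) \<longlongrightarrow> 0) at_top" using s_lim[of K 3] by simp
        qed
        have G: "((\<lambda>y. Gmat (- w y 0)) \<longlongrightarrow> mat 1) at_top"
          using isCont_tendsto_compose[OF isCont_Gmat tendsto_minus[OF w0]] by (simp add: Gmat_0)
        have "((\<lambda>y. (Gmat (- w y 0) - mat 1) ** M0 y z) \<longlongrightarrow> 0) at_top"
        proof (rule Lim_null_comparison)
          show "\<forall>\<^sub>F y in at_top. norm ((Gmat (- w y 0) - mat 1) ** M0 y z) \<le> mmK * norm (Gmat (- w y 0) - mat 1) * B0"
            using eventually_ge_at_top[of a]
            by eventually_elim (use B0 mmK(1) in \<open>auto intro!: order_trans[OF mmK(2)] mult_mono\<close>)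
          show "((\<lambda>y. mmK * norm (Gmat (- w y 0) - mat 1) * B0) \<longlongrightarrow> 0) at_top"
            by (intro tendsto_mult_left_zero tendsto_mult_right_zero tendsto_norm_zero LIM_zero G)
        qed
        then have "((\<lambda>y. ((Gmat (- w y 0) - mat 1) ** M0 y z) $ l $ l + M0 y z $ l $ l) \<longlongrightarrow> 0 $ l $ l + 1) at_top"
          by (intro tendsto_add tendsto_vec_nth M0_diag z)
        then have lim: "((\<lambda>y. ((Gmat (- w y 0) - mat 1) ** M0 y z) $ l $ l + M0 y z $ l $ l) \<longlongrightarrow> 1) at_top" by simp
        have "\<forall>\<^sub>F y in at_top. ((Gmat (- w y 0) - mat 1) ** M0 y z) $ l $ l + M0 y z $ l $ l = N z y 0 $ l $ l"
          using eventually_ge_at_top[of a] by eventually_elim (simp add: N0 mm.diff_left)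
        then show ?thesis by (rule Lim_transform_eventually[OF lim])
      qed
      moreover have "((\<lambda>y. N z y t $ l $ l - N z y 0 $ l $ l) \<longlongrightarrow> 0) at_top"
      proof (rule Lim_null_comparison)
        show "\<forall>\<^sub>F y in at_top. norm (N z y t $ l $ l - N z y 0 $ l $ l) \<le> (mmK * nc * BN * T * K) / (1 + y - a) ^ 3"
          using eventually_ge_at_top[of a]
        proof eventually_elim
          case (elim y)
          define e where "e = K / (1 + y - a) ^ 3 * (mmK * nc * BN)"
          have "norm (N z y t $ l $ l - N z y 0 $ l $ l) \<le> e * t - e * 0"
          proof (rule norm_diff_le_antiderivative)
            fix s assume "s \<in> {0..t}"
            then have s: "s \<in> {0..T}" using t by auto
            have "((\<lambda>t. N z y t $ l $ l) has_vector_derivative - (P y s *\<^sub>R (cmat0 ** N z y s)) $ l $ l) (at s within {0..T})"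
              using has_vector_derivative_entry[OF Nt[OF elim s], of l l] by (simp add: commutator_entry)
            then show "((\<lambda>t. N z y t $ l $ l) has_vector_derivative - (P y s *\<^sub>R (cmat0 ** N z y s)) $ l $ l) (at s within {0..t})"
              by (rule has_vector_derivative_within_subset) (use t in auto)
            show "((\<lambda>x. e * x) has_real_derivative e) (at s within {0..t})" by (auto intro!: derivative_eq_intros)
            have "norm ((P y s *\<^sub>R (cmat0 ** N z y s)) $ l $ l) \<le> norm (P y s *\<^sub>R (cmat0 ** N z y s))" by (rule norm_entry_le)
            also have "\<dots> = \<bar>P y s\<bar> * norm (cmat0 ** N z y s)" by simp
            also have "\<dots> \<le> e" unfolding e_def
            proof (rule mult_mono[OF P_bound[OF elim s]])
              show "norm (cmat0 ** N z y s) \<le> mmK * nc * BN" unfolding nc_def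
                by (rule norm_mult_le[OF order_refl NB[OF elim s]])
              show "0 \<le> K / (1 + y - a) ^ 3" using K_nonneg elim by simp
            qed auto
            finally show "norm (- (P y s *\<^sub>R (cmat0 ** N z y s)) $ l $ l) \<le> e" by simp
          qed (use t in auto)
          also have "\<dots> \<le> e * T"
          proof -
            have "e \<ge> 0" unfolding e_def using K_nonneg elim mmK(1) nn BN by (intro mult_nonneg_nonneg divide_nonneg_nonneg) auto
            then show ?thesis using t by (simp add: mult_left_mono)
          qed
          finally show ?case by (simp add: e_def mult_ac)
        qed
        show "((\<lambda>y. (mmK * nc * BN * T * K) / (1 + y - a) ^ 3) \<longlongrightarrow> 0) at_top" using s_lim[of _ 2] by (simp add: numeral_3_eq_3)
      qed
      ultimately have "((\<lambda>y. (N z y t $ l $ l - N z y 0 $ l $ l) + N z y 0 $ l $ l) \<longlongrightarrow> 0 + 1) at_top" by (intro tendsto_add)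
      then show ?thesis by simp
    qed
    define g where "g y t i j = exp (- \<mu> * t) * norm (N z y t $ i $ j - mat 1 $ i $ j)" for y t i j
    have g_le: "g y t i j \<le> norm (N z y t $ i $ j - mat 1 $ i $ j)" if "t \<in> {0..T}" for y t i j
      unfolding g_def using that \<mu> by (intro mult_left_le_one_le) auto
    have g_norm: "norm (N z y t - mat 1) \<le> 9 * (exp (\<mu> * t) * n)" if "\<And>i j. g y t i j \<le> n" for y t n
    proof (rule norm_le_sum_entries)
      fix i j show "norm ((N z y t - mat 1) $ i $ j) \<le> exp (\<mu> * t) * n"
        using that[of i j] by (simp add: g_def exp_minus field_simps)
    qed
    \<comment> \<open>A self-improving inequality for the weighted supremum n: as
      \<open>C * norm z\<close> is at most 1/4, it gives
      \<open>n \<le> 4 * C * norm z\<close>.\<close>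
    have step: "g y t i j \<le> C * norm z * (1 + n) + n / 2"
      if n: "\<And>y t i j. y \<ge> a \<Longrightarrow> t \<in> {0..T} \<Longrightarrow> g y t i j \<le> n" and y: "y \<ge> a" and t: "t \<in> {0..T}" for n y t i j
    proof -
      have n0: "n \<ge> 0" using n[OF y t, of i j] by (rule order_trans[rotated]) (simp add: g_def)
      have nN: "norm (N z y t - mat 1) \<le> 9 * (exp (\<mu> * t) * n)" if "y \<ge> a" "t \<in> {0..T}" for y t
        by (rule g_norm) (rule n[OF that])
      define \<kappa> where "\<kappa> = lam z $ i - lam z $ j"
      consider "i = j \<or> Re \<kappa> > 0" | "i \<noteq> j" "Re \<kappa> < 0"
        using Re_lam_diff_nonzero[OF z(1), of i j] unfolding \<kappa>_def by fastforce
      then show ?thesis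
      proof cases
        case 1
        define r where "r x = (mat z ** (Rmat (w x t) ** N z x t)) $ i $ j" for x
        define c where "c = C1 * norm z * (1 + n)"
        have c: "c \<ge> 0" using C12 n0 by (simp add: c_def)
        have "norm (N z y t $ i $ j - mat 1 $ i $ j) \<le> 0 - (- c / (1 + y - a))"
        proof (rule backward_estimate[where f="\<lambda>y. N z y t $ i $ j" and D="\<lambda>x. - c / (1 + x - a)" and y=y and \<kappa>=\<kappa> and r=r and \<rho>="\<lambda>x. c / (1 + x - a)\<^sup>2" and B=BN])
          fix x assume "x \<ge> y"
          then have x: "x \<ge> a" using y by simp
          have "((\<lambda>y. N z y t $ i $ j) has_vector_derivative \<kappa> * N z x t $ i $ j + r x) (at x within {a..})"
            using has_vector_derivative_entry[OF Ny[OF x t], of i j] by (simp add: commutator_entry \<kappa>_def r_def)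
          then show "((\<lambda>y. N z y t $ i $ j) has_vector_derivative \<kappa> * N z x t $ i $ j + r x) (at x within {y..})"
            by (rule has_vector_derivative_within_subset) (use y in auto)
          show "((\<lambda>x. - c / (1 + x - a)) has_real_derivative c / (1 + x - a)\<^sup>2) (at x within {y..})"
            using x by (auto intro!: derivative_eq_intros simp: power2_eq_square)
          show "- c / (1 + x - a) \<le> 0" using c x by simp
          show "norm (N z x t $ i $ j) \<le> BN" using order_trans[OF norm_entry_le NB[OF x t]] .
          have "norm (r x) \<le> norm z * norm (Rmat (w x t) ** N z x t)"
            unfolding r_def by (rule order_trans[OF norm_entry_le]) (simp add: norm_mat_mult)
          also have "\<dots> \<le> norm z * (mmK * (bR * (K / (1 + x - a)\<^sup>2)) * (n1 + 9 * (exp (\<mu> * T) * n)))"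
          proof (intro mult_left_mono norm_mult_le norm_ge_zero)
            have "\<bar>w x t\<bar> \<le> K / (1 + x - a)\<^sup>2"
            proof -
              have "K / (1 + x - a) ^ 4 \<le> K / (1 + x - a)\<^sup>2"
                using x K_nonneg by (intro divide_left_mono power_increasing mult_pos_pos zero_less_power) auto
              then show ?thesis using w_bound[OF x t] by simp
            qed
            then show "norm (Rmat (w x t)) \<le> bR * (K / (1 + x - a)\<^sup>2)"
              using bR(2)[OF w_le_K[OF x t]] bR(1) mult_left_mono[of "\<bar>w x t\<bar>" _ bR] by (meson less_imp_le order_trans)
            have "9 * (exp (\<mu> * t) * n) \<le> 9 * (exp (\<mu> * T) * n)"
              using t \<mu> n0 by (intro mult_left_mono mult_right_mono) auto
            then show "norm (N z x t) \<le> n1 + 9 * (exp (\<mu> * T) * n)"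
              using nN[OF x t] norm_triangle_sub[of "N z x t" "mat 1"] unfolding n1_def by linarith
          qed
          also have "\<dots> = norm z * (mmK * (bR * K) * (n1 + 9 * exp (\<mu> * T) * n)) / (1 + x - a)\<^sup>2" by simp
          also have "\<dots> \<le> c / (1 + x - a)\<^sup>2"
          proof (rule divide_right_mono)
            have "n1 + 9 * exp (\<mu> * T) * n \<le> (n1 + 9 * exp (\<mu> * T)) * (1 + n)"
              using nn n0 by (simp add: algebra_simps)
            then have "norm z * (mmK * (bR * K) * (n1 + 9 * exp (\<mu> * T) * n)) \<le> norm z * (mmK * (bR * K) * ((n1 + 9 * exp (\<mu> * T)) * (1 + n)))"
              using mmK(1) bR(1) K_nonneg by (intro mult_left_mono) auto
            then show "norm z * (mmK * (bR * K) * (n1 + 9 * exp (\<mu> * T) * n)) \<le> c" by (simp add: c_def C1_def mult_ac)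
          qed simp
          finally show "norm (r x) \<le> c / (1 + x - a)\<^sup>2" .
        next
          show "0 < Re \<kappa> \<and> mat 1 $ i $ j = (0::complex) \<or> \<kappa> = 0 \<and> ((\<lambda>y. N z y t $ i $ j) \<longlongrightarrow> mat 1 $ i $ j) at_top"
            using 1 N_diag[OF t, of i] by (auto simp: \<kappa>_def mat_def)
        qed
        also have "\<dots> \<le> c" using c y by (simp add: divide_le_eq mult_le_cancel_left1)
        finally have "g y t i j \<le> c" using g_le[OF t, of y i j] by simp
        also have "c \<le> C * norm z * (1 + n) + n / 2"
        proof -
          have "C1 * norm z * (1 + n) \<le> C * norm z * (1 + n)" using C12 n0 by (intro mult_right_mono) (auto simp: C_def)
          then show ?thesis using n0 by (simp add: c_def)
        qed
        finally show ?thesis .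
      next
        case 2
        define \<tau> where "\<tau> = k * inverse (lam 1 $ i) - k * inverse (lam 1 $ j)"
        have \<tau>_eq: "\<tau> = inverse (lam z $ i) - inverse (lam z $ j)"
          unfolding \<tau>_def lam_scale[of z i] lam_scale[of z j] by (simp add: k_def)
        have "Re \<tau> = Re \<kappa> / (norm z)\<^sup>2"
          unfolding \<tau>_eq \<kappa>_def minus_complex.sel Re_inverse_lam by (simp add: diff_divide_distrib)
        then have \<tau>_neg: "Re \<tau> < 0" using 2(2) z0 by (simp add: divide_neg_pos)
        then have \<tau>0: "\<tau> \<noteq> 0" by auto
        have \<tau>_norm: "c0 / norm z \<le> norm \<tau>"
        proof -
          have "norm \<tau> = norm (inverse (lam 1 $ i) - inverse (lam 1 $ j)) / norm z"
            unfolding \<tau>_def by (simp add: k_def norm_mult norm_divide divide_inverse norm_inverse mult.commute flip: right_diff_distrib)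
          then show ?thesis using c0_le[OF 2(1)] by (simp add: divide_right_mono)
        qed
        \<comment> \<open>The source contains - P \<open>cmat0\<close>, which is not small even when
          N = 1. Since \<open>\<tau> * q\<close> is the entry of \<open>cmat0\<close>, subtracting P
          q replaces it by a term with N - 1 and a term \<open>Pt\<close> q; and q is O(z) because
          \<open>\<tau>\<close> has size at least \<open>c0 / norm z\<close>.\<close>
        define q where "q = cmat0 $ i $ j / \<tau>"
        have q: "norm q \<le> nc / c0 * norm z"
        proof -
          have "norm q = norm (cmat0 $ i $ j) / norm \<tau>" by (simp add: q_def norm_divide)
          also have "\<dots> \<le> nc / (c0 / norm z)"
            using \<tau>_norm c0 z0 norm_entry_le[of cmat0 i j] nn unfolding nc_def by (intro frac_le) auto
          finally show ?thesis by simp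
        qed
        define f where "f s = N z y s $ i $ j - of_real (P y s) * q" for s
        define r where "r s = - (P y s *\<^sub>R (cmat0 ** (N z y s - mat 1))) $ i $ j - of_real (Pt y s) * q" for s
        define D where "D s = A * n * exp (\<mu> * s) / \<mu> + nc * K / c0 * norm z * s" for s
        have qP: "norm (of_real (P y s) * q) \<le> nc * K / c0 * norm z" if "s \<in> {0..T}" for s
        proof -
          have "norm (of_real (P y s) * q) = \<bar>P y s\<bar> * norm q" by (simp add: norm_mult)
          also have "\<dots> \<le> K * (nc / c0 * norm z)" using P_le_K[OF y that] q K_nonneg by (intro mult_mono) auto
          finally show ?thesis by (simp add: mult_ac)
        qed
        have "norm (f t - exp (\<tau> * of_real (t - 0)) * f 0) \<le> D t - D 0"
        proof (rule growth_two_point(2)[where r=r and \<rho>="\<lambda>s. A * n * exp (\<mu> * s) + nc * K / c0 * norm z"])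
          fix s assume "s \<in> {0..t}"
          then have s: "s \<in> {0..T}" using t by auto
          have "((\<lambda>s. N z y s $ i $ j) has_vector_derivative \<tau> * N z y s $ i $ j - (P y s *\<^sub>R (cmat0 ** N z y s)) $ i $ j) (at s within {0..T})"
            using has_vector_derivative_entry[OF Nt[OF y s], of i j] by (simp add: commutator_entry \<tau>_def)
          moreover have "((\<lambda>s. of_real (P y s) * q) has_vector_derivative of_real (Pt y s) * q) (at s within {0..T})"
            by (intro has_vector_derivative_mult_left has_vector_derivative_of_real P_t[OF y s])
          ultimately have "(f has_vector_derivative \<tau> * N z y s $ i $ j - (P y s *\<^sub>R (cmat0 ** N z y s)) $ i $ j - of_real (Pt y s) * q) (at s within {0..T})"
            unfolding f_def by (rule has_vector_derivative_diff)
          also have "\<tau> * N z y s $ i $ j - (P y s *\<^sub>R (cmat0 ** N z y s)) $ i $ j - of_real (Pt y s) * q = \<tau> * f s + r s"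
            using \<tau>0 by (simp add: f_def r_def q_def mm.diff_right scaleR_diff_right) (simp add: scaleR_conv_of_real algebra_simps)
          finally show "(f has_vector_derivative \<tau> * f s + r s) (at s within {0..t})"
            by (rule has_vector_derivative_within_subset) (use t in auto)
          show "(D has_real_derivative A * n * exp (\<mu> * s) + nc * K / c0 * norm z) (at s within {0..t})"
            unfolding D_def using \<mu> c0 by (auto intro!: derivative_eq_intros)
          have "norm (r s) \<le> norm ((P y s *\<^sub>R (cmat0 ** (N z y s - mat 1))) $ i $ j) + norm (of_real (Pt y s) * q)"
            unfolding r_def by (rule order_trans[OF norm_triangle_ineq4]) simp
          also have "\<dots> \<le> A * n * exp (\<mu> * s) + nc * K / c0 * norm z"
          proof (rule add_mono)
            have "norm ((P y s *\<^sub>R (cmat0 ** (N z y s - mat 1))) $ i $ j) \<le> \<bar>P y s\<bar> * norm (cmat0 ** (N z y s - mat 1))"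
              by (rule order_trans[OF norm_entry_le]) simp
            also have "\<dots> \<le> K * (mmK * nc * (9 * (exp (\<mu> * s) * n)))"
              unfolding nc_def by (intro mult_mono norm_mult_le order_refl nN P_le_K y s K_nonneg norm_ge_zero)
            also have "\<dots> = (K * (mmK * nc * 9)) * (n * exp (\<mu> * s))" by simp
            also have "\<dots> \<le> A * (n * exp (\<mu> * s))" using n0 by (intro mult_right_mono) (auto simp: A_def)
            finally show "norm ((P y s *\<^sub>R (cmat0 ** (N z y s - mat 1))) $ i $ j) \<le> A * n * exp (\<mu> * s)" by simp
            have "norm (of_real (Pt y s) * q) = \<bar>Pt y s\<bar> * norm q" by (simp add: norm_mult)
            also have "\<dots> \<le> K * (nc / c0 * norm z)" using Pt_bound[OF y s] q K_nonneg by (intro mult_mono) auto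
            finally show "norm (of_real (Pt y s) * q) \<le> nc * K / c0 * norm z" by (simp add: mult_ac)
          qed
          finally show "norm (r s) \<le> A * n * exp (\<mu> * s) + nc * K / c0 * norm z" .
        qed (use t \<tau>_neg in auto)
        moreover have "norm (exp (\<tau> * of_real (t - 0)) * f 0) \<le> norm (f 0)"
          unfolding norm_mult using t \<tau>_neg by (intro mult_left_le_one_le) (auto simp: mult_nonpos_nonneg)
        moreover have "norm (f 0) \<le> \<bar>C0\<bar> * norm z + nc * K / c0 * norm z"
        proof -
          have "norm (N z y 0 $ i $ j) \<le> norm (N z y 0 - mat 1)"
            using norm_entry_le[of "N z y 0 - mat 1" i j] 2(1) by (simp add: mat_def)
          also have "\<dots> \<le> \<bar>C0\<bar> * norm z"
            unfolding N0[OF y] using M0_small[OF y z(1,2)] mult_right_mono[OF C0(2), of "norm z"] by simp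
          finally show ?thesis
            unfolding f_def using qP[of 0] T norm_triangle_ineq4[of "N z y 0 $ i $ j" "of_real (P y 0) * q"] by simp
        qed
        moreover have "norm (N z y t $ i $ j) \<le> norm (f t) + nc * K / c0 * norm z"
          unfolding f_def using qP[OF t] norm_triangle_sub[of "N z y t $ i $ j" "of_real (P y t) * q"] by simp
        moreover have "norm (f t) \<le> norm (f t - exp (\<tau> * of_real (t - 0)) * f 0) + norm (exp (\<tau> * of_real (t - 0)) * f 0)"
          using norm_triangle_sub[of "f t" "exp (\<tau> * of_real (t - 0)) * f 0"] by simp
        ultimately have "norm (N z y t $ i $ j) \<le> D t - D 0 + (\<bar>C0\<bar> * norm z + nc * K / c0 * norm z) + nc * K / c0 * norm z"
          by linarith
        also have "D t - D 0 \<le> A * n * exp (\<mu> * t) / \<mu> + nc * K / c0 * norm z * T"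
        proof -
          have "nc * K / c0 * norm z * t \<le> nc * K / c0 * norm z * T"
            using t nn K_nonneg c0 by (intro mult_left_mono) auto
          moreover have "D 0 \<ge> 0" using A \<mu> n0 by (simp add: D_def)
          ultimately show ?thesis by (simp add: D_def)
        qed
        also have "A * n * exp (\<mu> * t) / \<mu> = n / 2 * exp (\<mu> * t)" using A by (simp add: \<mu>_def)
        finally have "norm (N z y t $ i $ j) \<le> n / 2 * exp (\<mu> * t) + C2 * norm z"
          by (simp add: C2_def algebra_simps)
        then have "g y t i j \<le> exp (- \<mu> * t) * (n / 2 * exp (\<mu> * t) + C2 * norm z)"
          unfolding g_def using 2(1) by (intro mult_left_mono) (auto simp: mat_def)
        also have "\<dots> = n / 2 + exp (- \<mu> * t) * (C2 * norm z)" by (simp add: exp_minus field_simps)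
        also have "exp (- \<mu> * t) * (C2 * norm z) \<le> C2 * norm z"
          using C12 t \<mu> by (intro mult_left_le_one_le) auto
        also have "C2 * norm z \<le> C * norm z * (1 + n)"
        proof -
          have "C2 * norm z * 1 \<le> C * norm z * (1 + n)" using C12 n0 by (intro mult_mono) (auto simp: C_def)
          then show ?thesis by simp
        qed
        finally show ?thesis by simp
      qed
    qed
    define S where "S = (\<lambda>(y, t, i, j). g y t i j) ` ({a..} \<times> {0..T} \<times> UNIV \<times> UNIV)"
    have bdd: "bdd_above S"
    proof (rule bdd_aboveI)
      fix x assume "x \<in> S"
      then obtain y t i j where x: "x = g y t i j" "y \<ge> a" "t \<in> {0..T}" by (auto simp: S_def)
      have "norm (N z y t $ i $ j - mat 1 $ i $ j) \<le> norm (N z y t - mat 1)" using norm_entry_le[of "N z y t - mat 1" i j] by simp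
      also have "\<dots> \<le> BN + n1" unfolding n1_def using NB[OF x(2,3)] norm_triangle_ineq4[of "N z y t" "mat 1"] by linarith
      finally show "x \<le> BN + n1" using g_le[OF x(3), of y i j] x(1) by simp
    qed
    define n where "n = Sup S"
    have gn: "g y t i j \<le> n" if "y \<ge> a" "t \<in> {0..T}" for y t i j
      unfolding n_def by (rule cSup_upper[OF _ bdd]) (use that in \<open>auto simp: S_def intro!: image_eqI[of _ _ "(y, t, i, j)"]\<close>)
    have ne: "S \<noteq> {}" using y t by (auto simp: S_def)
    have "n \<le> C * norm z * (1 + n) + n / 2"
      unfolding n_def
    proof (rule cSup_least[OF ne])
      fix x assume "x \<in> S"
      then show "x \<le> C * norm z * (1 + Sup S) + Sup S / 2" using step[OF gn] unfolding n_def by (auto simp: S_def)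
    qed
    moreover have n0: "n \<ge> 0" using gn[OF y t, of 1 1] by (rule order_trans[rotated]) (simp add: g_def)
    moreover have "C * norm z * n \<le> n / 4" using mult_right_mono[OF z(3) n0] by (simp add: mult.commute)
    ultimately have "n \<le> 4 * (C * norm z)" by (simp add: distrib_left)
    then have "9 * (exp (\<mu> * t) * n) \<le> 9 * (exp (\<mu> * T) * (4 * (C * norm z)))"
      using t \<mu> n0 by (intro mult_left_mono mult_mono) auto
    then show ?thesis using g_norm[OF gn[OF y t]] by (simp add: mult_ac)
  qed
  have "((\<lambda>z. N z y0 t0 - mat 1) \<longlongrightarrow> 0) (at 0 within - Sigma_contour)"
  proof (rule Lim_null_comparison)
    have "((\<lambda>z. norm z * C) \<longlongrightarrow> norm (0::complex) * C) (at 0 within - Sigma_contour)" by (intro tendsto_intros)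
    then have "\<forall>\<^sub>F z in at 0 within - Sigma_contour. norm z * C < 1 / 4" by (intro order_tendstoD(2)) auto
    moreover have "((\<lambda>z. norm z) \<longlongrightarrow> norm (0::complex)) (at 0 within - Sigma_contour)" by (intro tendsto_intros)
    then have "\<forall>\<^sub>F z in at 0 within - Sigma_contour. norm z < \<delta>" using \<delta> by (intro order_tendstoD(2)) auto
    moreover have "\<forall>\<^sub>F z in at 0 within - Sigma_contour. z \<in> - Sigma_contour" by (simp add: eventually_at_filter)
    ultimately show "\<forall>\<^sub>F z in at 0 within - Sigma_contour. norm (N z y0 t0 - mat 1) \<le> 36 * exp (\<mu> * T) * C * norm z"
      by eventually_elim (intro main[OF _ _ _ y0 t0], auto)
    show "((\<lambda>z. 36 * exp (\<mu> * T) * C * norm z) \<longlongrightarrow> 0) (at 0 within - Sigma_contour)"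
      by (auto intro!: tendsto_eq_intros)
  qed
  then have "((\<lambda>z. Gmat (w y0 t0) ** N z y0 t0) \<longlongrightarrow> Gmat (w y0 t0) ** mat 1) (at 0 within - Sigma_contour)"
    by (intro mm.tendsto tendsto_const) (rule LIM_zero_cancel)
  then show ?thesis by (simp add: N_def Gmat_inverse')
qed

end

section \<open>The \<open>y\<close>-equation at time \<open>0\<close>\<close>

lemma norm_le_norm_diff_mat1: "norm A \<le> norm (mat 1 :: cmat) + norm (A - mat 1)" for A :: cmat
  using norm_triangle_sub[of A "mat 1"] by simp

text \<open>Conjugation by \<open>Gmat (- W)\<close> replaces the perturbation \<open>W' cmat0\<close> by \<open>z Rmat W\<close>, which is small with
  \<open>z\<close>.\<close>

lemma line_small_z:
  fixes W W' :: "real \<Rightarrow> real" and C :: real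
  assumes W: "\<And>y. (W has_real_derivative W' y) (at y)" and WC: "\<And>y. \<bar>W y\<bar> \<le> C / (1 + y\<^sup>2)"
  shows "\<exists>c>0. \<forall>z m B. z \<notin> Sigma_contour \<longrightarrow> c * norm z \<le> 1 \<longrightarrow>
    (\<forall>y. (m has_vector_derivative mat z ** (dmat ** m y - m y ** dmat) + W' y *\<^sub>R (cmat0 ** m y)) (at y)) \<longrightarrow>
    (\<forall>y. norm (m y) \<le> B) \<longrightarrow> (\<forall>l. ((\<lambda>y. m y $ l $ l) \<longlongrightarrow> 1) at_top) \<longrightarrow>
    (\<forall>y. norm (Gmat (- W y) ** m y - mat 1) \<le> c * norm z)"
proof -
  have C: "C \<ge> 0" using order_trans[OF abs_ge_zero WC[of 0]] by simp
  have WC': "\<bar>W y\<bar> \<le> C" for y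
  proof -
    have "C / (1 + y\<^sup>2) \<le> C / 1" using C by (intro divide_left_mono) (auto intro: add_pos_nonneg)
    then show ?thesis using WC[of y] by simp
  qed
  obtain bR where bR: "bR > 0" "\<And>x. \<bar>x\<bar> \<le> C \<Longrightarrow> norm (Rmat x) \<le> bR * \<bar>x\<bar>" using Rmat_lipschitz by blast
  obtain bG where bG: "bG > 0" "\<And>x. \<bar>x\<bar> \<le> C \<Longrightarrow> norm (Gmat x) \<le> bG" using isCont_bounded_Icc[OF isCont_Gmat] by blast
  define n1 where "n1 = norm (mat 1 :: cmat)"
  have n1: "n1 \<ge> 0" by (simp add: n1_def)
  define c1 where "c1 = 9 * (mmK * (bR * C) * pi)"
  have c1: "c1 \<ge> 0" using mmK(1) bR(1) C by (auto simp: c1_def intro!: mult_nonneg_nonneg)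
  define c where "c = 2 * c1 + 2 * n1 * c1 + 1"
  have c: "c > 0" "2 * c1 \<le> c" "2 * n1 * c1 \<le> c" using c1 n1 by (auto simp: c_def intro!: add_nonneg_pos)
  show ?thesis
  proof (intro exI[of _ c] conjI c allI impI)
    fix z m B y
    assume z: "z \<notin> Sigma_contour" "c * norm z \<le> 1"
      and m: "\<forall>y. (m has_vector_derivative mat z ** (dmat ** m y - m y ** dmat) + W' y *\<^sub>R (cmat0 ** m y)) (at y)"
      and B: "\<forall>y. norm (m y) \<le> B" and diag: "\<forall>l. ((\<lambda>y. m y $ l $ l) \<longlongrightarrow> 1) at_top"
    define N where "N y = Gmat (- W y) ** m y" for y
    have N': "(N has_vector_derivative mat z ** (dmat ** N y - N y ** dmat) + mat z ** (Rmat (W y) ** N y)) (at y)" for y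
    proof -
      have G: "((\<lambda>y. Gmat (- W y)) has_vector_derivative (- W' y) *\<^sub>R (Gmat (- W y) ** cmat0)) (at y)"
        using vector_diff_chain_at[OF has_vector_derivative_minus[OF W[unfolded has_real_derivative_iff_has_vector_derivative]] Gmat_deriv]
        by (simp add: o_def)
      have "(N has_vector_derivative Gmat (- W y) ** (mat z ** (dmat ** m y - m y ** dmat) + W' y *\<^sub>R (cmat0 ** m y))
          + ((- W' y) *\<^sub>R (Gmat (- W y) ** cmat0)) ** m y) (at y)"
        unfolding N_def using mm.has_vector_derivative[OF G m[rule_format]] .
      also have "Gmat (- W y) ** (mat z ** (dmat ** m y - m y ** dmat) + W' y *\<^sub>R (cmat0 ** m y))
          + ((- W' y) *\<^sub>R (Gmat (- W y) ** cmat0)) ** m y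
          = mat z ** ((Gmat (- W y) ** dmat) ** m y) - mat z ** ((Gmat (- W y) ** m y) ** dmat)"
        by (simp add: mat_distribs mat_commute)
      also have "\<dots> = mat z ** (dmat ** N y - N y ** dmat) + mat z ** (Rmat (W y) ** N y)"
        unfolding Gmat_dmat N_def by (simp add: mm.diff_right mm.add_left mm.add_right matrix_mul_assoc)
      finally show ?thesis .
    qed
    have NB0: "norm (N y) \<le> mmK * bG * B" for y
      unfolding N_def using B WC'[of y] by (intro norm_mult_le bG) auto
    define b where "b = Sup (range (\<lambda>y. norm (N y)))"
    have Nb: "norm (N y) \<le> b" for y
      unfolding b_def by (rule cSup_upper) (auto intro!: bdd_aboveI[of _ "mmK * bG * B"] NB0)
    have b: "b \<ge> 0" using Nb[of 0] norm_ge_zero order_trans by blast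
    have N_diag: "((\<lambda>y. N y $ l $ l) \<longlongrightarrow> 1) at_top" for l
    proof -
      have "((\<lambda>y. C / (1 + y\<^sup>2)) \<longlongrightarrow> 0) at_top"
        by (rule tendsto_divide_0[OF tendsto_const], rule filterlim_at_top_imp_at_infinity,
            rule filterlim_tendsto_add_at_top[OF tendsto_const filterlim_pow_at_top[OF _ filterlim_ident]]) simp
      then have w0: "(W \<longlongrightarrow> 0) at_top" by (rule Lim_null_comparison[rotated]) (use WC in auto)
      have G: "((\<lambda>y. Gmat (- W y)) \<longlongrightarrow> mat 1) at_top"
        using isCont_tendsto_compose[OF isCont_Gmat tendsto_minus[OF w0]] by (simp add: Gmat_0)
      have "((\<lambda>y. (Gmat (- W y) - mat 1) ** m y) \<longlongrightarrow> 0) at_top"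
      proof (rule Lim_null_comparison)
        show "\<forall>\<^sub>F y in at_top. norm ((Gmat (- W y) - mat 1) ** m y) \<le> mmK * norm (Gmat (- W y) - mat 1) * B"
          by (intro always_eventually allI norm_mult_le order_refl) (use B in auto)
        show "((\<lambda>y. mmK * norm (Gmat (- W y) - mat 1) * B) \<longlongrightarrow> 0) at_top"
          by (intro tendsto_mult_left_zero tendsto_mult_right_zero tendsto_norm_zero LIM_zero G)
      qed
      then have "((\<lambda>y. ((Gmat (- W y) - mat 1) ** m y) $ l $ l + m y $ l $ l) \<longlongrightarrow> 0 $ l $ l + 1) at_top"
        by (intro tendsto_add tendsto_vec_nth diag[rule_format])
      then show ?thesis by (simp add: N_def mm.diff_left)
    qed
    have rb: "norm (mat z ** (Rmat (W y) ** N y)) \<le> norm z * (mmK * (bR * C) * b) / (1 + y\<^sup>2)" for y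
    proof -
      have "norm (Rmat (W y)) \<le> bR * (C / (1 + y\<^sup>2))"
        using bR(2)[OF WC'] mult_left_mono[OF WC, of bR y] bR(1) by (meson less_imp_le order_trans)
      then have "norm (mat z ** (Rmat (W y) ** N y)) \<le> norm z * (mmK * (bR * (C / (1 + y\<^sup>2))) * b)"
        unfolding norm_mat_mult by (intro mult_left_mono norm_mult_le Nb) auto
      then show ?thesis by simp
    qed
    have est: "norm (N y - mat 1) \<le> c1 * norm z * b" for y
    proof -
      have "norm (N y - mat 1) \<le> 9 * (norm z * (mmK * (bR * C) * b) * pi)"
        by (rule norm_le_sum_entries, unfold vector_minus_component)
          (rule line_estimate[OF z(1) N' rb Nb N_diag])
      then show ?thesis by (simp add: c1_def mult_ac)
    qed
    \<comment> \<open>The given bound B may depend on z, so it only shows that the supremum b is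
      finite. For small z the last term is at most b/2, which bounds b by \<open>2 * n1\<close>
      independently of z and m.\<close>
    have "b \<le> n1 + c1 * norm z * b"
      unfolding b_def
    proof (rule cSup_least)
      fix x assume "x \<in> range (\<lambda>y. norm (N y))"
      then obtain y where "x = norm (N y)" by auto
      then show "x \<le> n1 + c1 * norm z * Sup (range (\<lambda>y. norm (N y)))"
        using norm_le_norm_diff_mat1[of "N y"] est[of y] unfolding b_def[symmetric] n1_def[symmetric] by linarith
    qed auto
    moreover have "c1 * norm z * b \<le> 1 / 2 * b"
    proof (rule mult_right_mono[OF _ b])
      have "2 * (c1 * norm z) \<le> c * norm z" using c(2) by (metis mult.assoc mult_right_mono norm_ge_zero)
      then show "c1 * norm z \<le> 1 / 2" using z(2) by linarith
    qed
    ultimately have "b \<le> 2 * n1" by linarith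
    then have "c1 * norm z * b \<le> c1 * norm z * (2 * n1)" using c1 by (intro mult_left_mono) auto
    also have "\<dots> \<le> c * norm z" using c(3) mult_right_mono[OF c(3), of "norm z"] by (simp add: mult_ac)
    finally show "norm (Gmat (- W y) ** m y - mat 1) \<le> c * norm z" using est[of y] unfolding N_def by linarith
  qed
qed

text \<open>As \<open>[dmat, bmat] = - cmat0\<close>, subtracting \<open>z\<^sup>-\<^sup>1 W' bmat m\<close> from \<open>m\<close> turns the perturbation
  \<open>W' cmat0\<close> into one of order \<open>1 / z\<close>.\<close>

lemma line_large_z:
  fixes W' W'' :: "real \<Rightarrow> real" and C :: real
  assumes W: "\<And>y. (W' has_real_derivative W'' y) (at y)"
    and WC: "\<And>y. \<bar>W' y\<bar> \<le> C / (1 + y\<^sup>2)" "\<And>y. \<bar>W'' y\<bar> \<le> C / (1 + y\<^sup>2)"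
  shows "\<exists>c>0. \<forall>z m B. z \<notin> Sigma_contour \<longrightarrow> c \<le> norm z \<longrightarrow>
    (\<forall>y. (m has_vector_derivative mat z ** (dmat ** m y - m y ** dmat) + W' y *\<^sub>R (cmat0 ** m y)) (at y)) \<longrightarrow>
    (\<forall>y. norm (m y) \<le> B) \<longrightarrow> (\<forall>l. ((\<lambda>y. m y $ l $ l) \<longlongrightarrow> 1) at_top) \<longrightarrow>
    (\<forall>y. norm (m y - mat 1) \<le> c / norm z)"
proof -
  have C: "C \<ge> 0" using order_trans[OF abs_ge_zero WC(1)[of 0]] by simp
  have WC': "\<bar>W' y\<bar> \<le> C" for y
  proof -
    have "C / (1 + y\<^sup>2) \<le> C / 1" using C by (intro divide_left_mono) (auto intro: add_pos_nonneg)
    then show ?thesis using WC(1)[of y] by simp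
  qed
  define n1 where "n1 = norm (mat 1 :: cmat)"
  define nb where "nb = norm bmat"
  define ncc where "ncc = norm (bmat ** cmat0)"
  have nn: "n1 \<ge> 0" "nb \<ge> 0" "ncc \<ge> 0" by (auto simp: n1_def nb_def ncc_def)
  define c1 where "c1 = mmK * (C * nb + C * C * ncc)"
  define c2 where "c2 = 9 * (c1 * pi) + C * (mmK * nb)"
  have c1: "c1 \<ge> 0" using mmK(1) C nn by (auto simp: c1_def intro!: mult_nonneg_nonneg add_nonneg_nonneg)
  have c2: "c2 \<ge> 0" using mmK(1) C nn c1 by (auto simp: c2_def intro!: mult_nonneg_nonneg add_nonneg_nonneg)
  define c where "c = 2 * c2 + 2 * n1 * c2 + 1"
  have c: "c > 0" "2 * c2 \<le> c" "2 * n1 * c2 \<le> c" using c2 nn by (auto simp: c_def intro!: add_nonneg_pos)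
  show ?thesis
  proof (intro exI[of _ c] conjI c allI impI)
    fix z m B y
    assume z: "z \<notin> Sigma_contour" "c \<le> norm z"
      and m: "\<forall>y. (m has_vector_derivative mat z ** (dmat ** m y - m y ** dmat) + W' y *\<^sub>R (cmat0 ** m y)) (at y)"
      and B: "\<forall>y. norm (m y) \<le> B" and diag: "\<forall>l. ((\<lambda>y. m y $ l $ l) \<longlongrightarrow> 1) at_top"
    have z0: "z \<noteq> 0" using z(1) zero_in_Sigma by auto
    define k where "k = inverse z"
    have zk: "z * k = 1" "norm k = 1 / norm z" using z0 by (auto simp: k_def norm_inverse divide_inverse)
    define b where "b = Sup (range (\<lambda>y. norm (m y)))"
    have mb: "norm (m y) \<le> b" for y
      unfolding b_def by (rule cSup_upper) (use B in \<open>auto intro!: bdd_aboveI[of _ B]\<close>)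
    have b: "b \<ge> 0" using mb[of 0] norm_ge_zero order_trans by blast
    define N where "N y = m y - mat k ** (W' y *\<^sub>R (bmat ** m y))" for y
    define r where "r y = - (mat k ** ((W'' y *\<^sub>R bmat + (W' y)\<^sup>2 *\<^sub>R (bmat ** cmat0)) ** m y))" for y
    have N': "(N has_vector_derivative mat z ** (dmat ** N y - N y ** dmat) + r y) (at y)" for y
    proof -
      define m' where "m' = mat z ** (dmat ** m y - m y ** dmat) + W' y *\<^sub>R (cmat0 ** m y)"
      have "(N has_vector_derivative m' - mat k ** (W' y *\<^sub>R (bmat ** m') + W'' y *\<^sub>R (bmat ** m y))) (at y)"
        unfolding N_def m'_def
        by (intro has_vector_derivative_diff has_vector_derivative_scaleR W m[rule_format]
            bounded_linear.has_vector_derivative[OF mm.bounded_linear_right])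
      also have "m' - mat k ** (W' y *\<^sub>R (bmat ** m') + W'' y *\<^sub>R (bmat ** m y)) = mat z ** (dmat ** N y - N y ** dmat) + r y"
      proof -
        have kz: "k * z = 1" using zk by (simp add: mult.commute)
        have c: "cmat0 ** m y = bmat ** dmat ** m y - dmat ** bmat ** m y"
        proof -
          have "cmat0 = bmat ** dmat - dmat ** bmat" using bmat_comm by (simp add: algebra_simps eq_neg_iff_add_eq_0)
          from arg_cong[OF this, of "\<lambda>X. X ** m y"] show ?thesis unfolding mm.diff_left .
        qed
        have 1: "mat k ** (bmat ** m') = bmat ** dmat ** m y - bmat ** m y ** dmat + W' y *\<^sub>R (mat k ** (bmat ** cmat0 ** m y))"
          unfolding m'_def mm.add_right mat_pull(1)[of bmat z] mat_cancel[OF kz]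
          by (simp add: mm.diff_right mm.scaleR_right matrix_mul_assoc)
        have 2: "mat z ** (dmat ** (mat k ** (W' y *\<^sub>R (bmat ** m y))) - (mat k ** (W' y *\<^sub>R (bmat ** m y))) ** dmat)
          = W' y *\<^sub>R (dmat ** bmat ** m y - bmat ** m y ** dmat)"
          unfolding mat_pull(1)[of dmat] mat_pull(2)[of _ _ dmat] mm.diff_right[of "mat z"] mat_cancel[OF zk(1)]
          by (simp add: mm.scaleR_left mm.scaleR_right matrix_mul_assoc scaleR_diff_right)
        have 3: "mat z ** (dmat ** N y - N y ** dmat) = mat z ** (dmat ** m y - m y ** dmat) - W' y *\<^sub>R (dmat ** bmat ** m y - bmat ** m y ** dmat)"
          unfolding N_def mm.diff_right[of dmat] mm.diff_left[of _ _ dmat] 2[symmetric] mm.diff_right[of "mat z", symmetric]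
          by (simp add: algebra_simps)
        show ?thesis
          unfolding 3 mm.add_right[of "mat k"] mm.scaleR_right[of "mat k"] 1 r_def
          unfolding m'_def c
          by (simp add: mm.add_left mm.add_right mm.scaleR_left mm.scaleR_right scaleR_diff_right scaleR_add_right power2_eq_square matrix_mul_assoc)
      qed
      finally show ?thesis .
    qed
    have rb: "norm (r y) \<le> norm k * (c1 * b) / (1 + y\<^sup>2)" for y
    proof -
      define s where "s = 1 + y\<^sup>2"
      have s: "s > 0" by (auto simp: s_def intro: add_pos_nonneg)
      have "(W' y)\<^sup>2 = \<bar>W' y\<bar> * \<bar>W' y\<bar>" by (simp add: power2_eq_square)
      also have "\<dots> \<le> C * (C / s)" unfolding s_def by (intro mult_mono WC' WC(1) C) simp
      finally have "norm ((W' y)\<^sup>2 *\<^sub>R (bmat ** cmat0)) \<le> (C * (C / s)) * norm (bmat ** cmat0)"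
        unfolding norm_scaleR by (intro mult_right_mono) auto
      moreover have "norm (W'' y *\<^sub>R bmat) \<le> (C / s) * norm bmat"
        unfolding norm_scaleR s_def by (intro mult_right_mono WC(2)) simp
      ultimately have "norm (W'' y *\<^sub>R bmat + (W' y)\<^sup>2 *\<^sub>R (bmat ** cmat0)) \<le> (C / s) * nb + (C * (C / s)) * ncc"
        unfolding nb_def ncc_def by (intro norm_triangle_mono)
      then have "norm (r y) \<le> norm k * (mmK * ((C / s) * nb + (C * (C / s)) * ncc) * b)"
        unfolding r_def norm_minus_cancel norm_mat_mult by (intro mult_left_mono norm_mult_le mb norm_ge_zero)
      also have "\<dots> = norm k * (c1 * b) / s" using s by (simp add: c1_def field_simps)
      finally show ?thesis by (simp add: s_def)
    qed
    have Nm: "norm (mat k ** (W' y *\<^sub>R (bmat ** m y))) \<le> norm k * (C * (mmK * nb) * b)" for y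
    proof -
      have "norm (bmat ** m y) \<le> mmK * nb * b" unfolding nb_def by (intro norm_mult_le mb order_refl)
      then have "\<bar>W' y\<bar> * norm (bmat ** m y) \<le> C * (mmK * nb * b)" using C by (intro mult_mono WC') auto
      then show ?thesis unfolding norm_mat_mult by (intro mult_left_mono) (auto simp: mult_ac)
    qed
    have NB: "norm (N y) \<le> b + norm k * (C * (mmK * nb) * b)" for y
      unfolding N_def by (intro order_trans[OF norm_triangle_ineq4] add_mono mb Nm)
    have N_diag: "((\<lambda>y. N y $ l $ l) \<longlongrightarrow> 1) at_top" for l
    proof -
      have "((\<lambda>y. C / (1 + y\<^sup>2)) \<longlongrightarrow> 0) at_top"
        by (rule tendsto_divide_0[OF tendsto_const], rule filterlim_at_top_imp_at_infinity,
            rule filterlim_tendsto_add_at_top[OF tendsto_const filterlim_pow_at_top[OF _ filterlim_ident]]) simp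
      then have w0: "(W' \<longlongrightarrow> 0) at_top" by (rule Lim_null_comparison[rotated]) (use WC in auto)
      have "((\<lambda>y. mat k ** (W' y *\<^sub>R (bmat ** m y))) \<longlongrightarrow> 0) at_top"
      proof (rule Lim_null_comparison)
        show "\<forall>\<^sub>F y in at_top. norm (mat k ** (W' y *\<^sub>R (bmat ** m y))) \<le> norm k * (\<bar>W' y\<bar> * (mmK * nb * b))"
          unfolding norm_mat_mult norm_scaleR nb_def
          by (intro always_eventually allI mult_left_mono norm_mult_le mb order_refl) auto
        show "((\<lambda>y. norm k * (\<bar>W' y\<bar> * (mmK * nb * b))) \<longlongrightarrow> 0) at_top"
          by (intro tendsto_mult_left_zero tendsto_mult_right_zero tendsto_rabs_zero w0)
      qed
      then have "((\<lambda>y. m y $ l $ l - (mat k ** (W' y *\<^sub>R (bmat ** m y))) $ l $ l) \<longlongrightarrow> 1 - 0 $ l $ l) at_top"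
        by (intro tendsto_diff tendsto_vec_nth diag[rule_format])
      then show ?thesis by (simp add: N_def)
    qed
    have est: "norm (m y - mat 1) \<le> c2 * norm k * b" for y
    proof -
      have "norm (N y - mat 1) \<le> 9 * (norm k * (c1 * b) * pi)"
        by (rule norm_le_sum_entries, unfold vector_minus_component)
          (rule line_estimate[OF z(1) N' rb NB N_diag])
      moreover have "m y - mat 1 = (N y - mat 1) + mat k ** (W' y *\<^sub>R (bmat ** m y))" by (simp add: N_def)
      ultimately have "norm (m y - mat 1) \<le> 9 * (norm k * (c1 * b) * pi) + norm k * (C * (mmK * nb) * b)"
        using Nm[of y] by (simp only: norm_triangle_mono)
      then show ?thesis by (simp add: c2_def algebra_simps)
    qed
    have "b \<le> n1 + c2 * norm k * b"
      unfolding b_def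
    proof (rule cSup_least)
      fix x assume "x \<in> range (\<lambda>y. norm (m y))"
      then obtain y where "x = norm (m y)" by auto
      then show "x \<le> n1 + c2 * norm k * Sup (range (\<lambda>y. norm (m y)))"
        using norm_le_norm_diff_mat1[of "m y"] est[of y] unfolding b_def[symmetric] n1_def[symmetric] by linarith
    qed auto
    moreover have "c2 * norm k * b \<le> 1 / 2 * b"
    proof (rule mult_right_mono[OF _ b])
      have "2 * c2 \<le> norm z" using c(2) z(2) by linarith
      then show "c2 * norm k \<le> 1 / 2" unfolding zk(2) using z0 by (simp add: field_simps)
    qed
    ultimately have "b \<le> 2 * n1" by linarith
    then have "c2 * norm k * b \<le> c2 * norm k * (2 * n1)" using c2 by (intro mult_left_mono) auto
    also have "\<dots> \<le> c * norm k" using mult_right_mono[OF c(3), of "norm k"] by (simp add: mult_ac)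
    also have "\<dots> = c / norm z" unfolding zk(2) by simp
    finally show "norm (m y - mat 1) \<le> c / norm z" using est[of y] by linarith
  qed
qed

section \<open>Direct scattering in the variable \<open>y\<close>\<close>

lemma integrable_inverse_1_plus_square:
  fixes C :: real
  assumes "C \<ge> 0"
  shows "set_integrable lborel UNIV (\<lambda>x. C / (1 + x\<^sup>2))"
    and "(LBINT \<xi>=ereal x..\<infinity>. C / (1 + \<xi>\<^sup>2)) = C * (pi / 2) - C * arctan x"
proof -
  have top: "((\<lambda>x. C * arctan x) \<longlongrightarrow> C * (pi / 2)) at_top"
    by (rule tendsto_mult[OF tendsto_const tendsto_arctan_at_top])
  have bot: "((\<lambda>x. C * arctan x) \<longlongrightarrow> C * (- (pi / 2))) at_bot"
    by (rule tendsto_mult[OF tendsto_const tendsto_arctan_at_bot])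
  have d: "((\<lambda>x. C * arctan x) has_real_derivative C / (1 + x\<^sup>2)) (at x)" for x
    by (auto intro!: derivative_eq_intros simp: divide_inverse)
  have nz: "1 + x\<^sup>2 \<noteq> 0" for x :: real by (rule order.strict_implies_not_eq[symmetric]) (auto intro: add_pos_nonneg)
  have c: "isCont (\<lambda>x. C / (1 + x\<^sup>2)) x" for x by (intro continuous_intros nz)
  have "set_integrable lborel (einterval (-\<infinity>) \<infinity>) (\<lambda>x. C / (1 + x\<^sup>2))"
    by (rule interval_integral_FTC_nonneg(1)[where F="\<lambda>x. C * arctan x" and A="C * (- (pi / 2))" and B="C * (pi / 2)"])
      (use assms d c top bot in \<open>auto simp: ereal_tendsto_simps\<close>)
  then show "set_integrable lborel UNIV (\<lambda>x. C / (1 + x\<^sup>2))" by (simp add: einterval_def)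
  have "isCont (\<lambda>x. C * arctan x) x" by (intro continuous_intros)
  then have "((\<lambda>x. C * arctan x) \<longlongrightarrow> C * arctan x) (at_right x)"
    unfolding isCont_def by (rule tendsto_mono[rotated]) (rule at_le, simp)
  then show "(LBINT \<xi>=ereal x..\<infinity>. C / (1 + \<xi>\<^sup>2)) = C * (pi / 2) - C * arctan x"
    by (intro interval_integral_FTC_nonneg(2)[where F="\<lambda>x. C * arctan x"])
      (use assms d c top in \<open>auto simp: ereal_tendsto_simps\<close>)
qed

lemma set_integrable_decay:
  fixes g :: "real \<Rightarrow> 'a::euclidean_space"
  assumes g: "continuous_on UNIV g" and A: "A \<in> sets borel" and C: "\<And>x. x \<in> A \<Longrightarrow> norm (g x) \<le> C / (1 + x\<^sup>2)"
  shows "set_integrable lborel A g"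
proof (rule set_integrable_bound)
  show "set_integrable lborel A (\<lambda>x. \<bar>C\<bar> / (1 + x\<^sup>2))"
    by (rule set_integrable_subset[OF integrable_inverse_1_plus_square(1)]) (use A in auto)
  show "set_borel_measurable lborel A g"
    using borel_measurable_continuous_onI[OF g] A unfolding set_borel_measurable_def by measurable
  show "AE x in lborel. x \<in> A \<longrightarrow> norm (g x) \<le> norm (\<bar>C\<bar> / (1 + x\<^sup>2))"
  proof (intro AE_I2 impI)
    fix x assume "x \<in> A"
    have "C / (1 + x\<^sup>2) \<le> \<bar>C\<bar> / (1 + x\<^sup>2)" by (intro divide_right_mono) auto
    then show "norm (g x) \<le> norm (\<bar>C\<bar> / (1 + x\<^sup>2))" using C[OF \<open>x \<in> A\<close>] by simp
  qed
qed

text \<open>Near x the improper integral differs from a proper one with fixed lower end by a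
  constant. The orientation of \<open>LBINT\<close> lets the end +infinity be treated like
  -infinity.\<close>

lemma improper_integral_has_vector_derivative:
  fixes g :: "real \<Rightarrow> 'a::euclidean_space" and e :: ereal
  assumes e: "e = \<infinity> \<or> e = - \<infinity>" and g: "continuous_on UNIV g"
    and int: "\<And>a. set_integrable lborel (if e = \<infinity> then {a<..} else {..<a}) g"
  shows "((\<lambda>x. LBINT \<xi>=e..ereal x. g \<xi>) has_vector_derivative g x) (at x)"
proof -
  define c d where "c = x - 1" and "d = x + 1"
  have split: "(LBINT \<xi>=e..ereal u. g \<xi>) = (LBINT \<xi>=e..ereal c. g \<xi>) + (LBINT \<xi>=ereal c..ereal u. g \<xi>)" if "u \<in> {c..d}" for u
  proof (rule interval_integral_sum[symmetric])
    have 1: "einterval (ereal c) \<infinity> = {c<..}" "einterval (- \<infinity>) (ereal u) = {..<u}" by (auto simp: einterval_def)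
    show "interval_lebesgue_integrable lborel (min e (min (ereal c) (ereal u))) (max e (max (ereal c) (ereal u))) g"
      using e int[of c] int[of u] that by (auto simp: interval_lebesgue_integrable_def 1 min_def max_def)
  qed
  have "((\<lambda>u. LBINT \<xi>=ereal c..ereal u. g \<xi>) has_vector_derivative g x) (at x within {c..d})"
    by (rule interval_integral_FTC2) (auto simp: c_def d_def intro: continuous_on_subset[OF g])
  from has_vector_derivative_add[OF has_vector_derivative_const this]
  have "((\<lambda>u. (LBINT \<xi>=e..ereal c. g \<xi>) + (LBINT \<xi>=ereal c..ereal u. g \<xi>)) has_vector_derivative g x) (at x within {c..d})" by simp
  then have "((\<lambda>u. LBINT \<xi>=e..ereal u. g \<xi>) has_vector_derivative g x) (at x within {c..d})"
    by (rule has_vector_derivative_transform[rotated 2]) (simp add: c_def d_def, erule split)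
  moreover have "at x within {c..d} = at x" by (rule at_within_Icc_at) (auto simp: c_def d_def)
  ultimately show ?thesis by simp
qed

lemma improper_integral_bound:
  fixes g :: "real \<Rightarrow> 'a::euclidean_space"
  assumes g: "continuous_on UNIV g" and C: "\<And>x. norm (g x) \<le> C / (1 + x\<^sup>2)"
  shows "norm (LBINT \<xi>=\<infinity>..ereal x. g \<xi>) \<le> C * (pi / 2) - C * arctan x"
proof -
  have C0: "C \<ge> 0" using order_trans[OF norm_ge_zero C[of 0]] by simp
  have e: "einterval (ereal x) \<infinity> = {x<..}" by (auto simp: einterval_def)
  have i1: "interval_lebesgue_integrable lborel (ereal x) \<infinity> g"
    unfolding interval_lebesgue_integrable_def using set_integrable_decay[OF g _ C, of "{x<..}"] by (simp add: e)
  have i2: "interval_lebesgue_integrable lborel (ereal x) \<infinity> (\<lambda>x. C / (1 + x\<^sup>2))"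
    unfolding interval_lebesgue_integrable_def
    using set_integrable_subset[OF integrable_inverse_1_plus_square(1)[OF C0], of "{x<..}"] by (simp add: e)
  have "norm (LBINT \<xi>=\<infinity>..ereal x. g \<xi>) = norm (LBINT \<xi>=ereal x..\<infinity>. g \<xi>)"
    by (subst interval_integral_endpoints_reverse) simp
  also have "\<dots> \<le> (LBINT \<xi>=ereal x..\<infinity>. norm (g \<xi>))" by (rule interval_integral_norm[OF i1]) simp
  also have "\<dots> \<le> (LBINT \<xi>=ereal x..\<infinity>. C / (1 + \<xi>\<^sup>2))"
  proof -
    have "set_integrable lborel {x<..} (\<lambda>x. norm (g x))"
      using set_integrable_norm[OF set_integrable_decay[OF g _ C, of "{x<..}"]] by simp
    moreover have "set_integrable lborel {x<..} (\<lambda>x. C / (1 + x\<^sup>2))" using i2 by (simp add: interval_lebesgue_integrable_def e)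
    ultimately have "(LINT \<xi>:{x<..}|lborel. norm (g \<xi>)) \<le> (LINT \<xi>:{x<..}|lborel. C / (1 + \<xi>\<^sup>2))"
      by (rule set_integral_mono) (rule C)
    then show ?thesis by (simp add: interval_lebesgue_integral_def e)
  qed
  also have "\<dots> = C * (pi / 2) - C * arctan x" by (rule integrable_inverse_1_plus_square(2)[OF C0])
  finally show ?thesis .
qed

section \<open>Regularity and decay of the initial data\<close>

locale schwartz_data =
  fixes u0 :: "real \<Rightarrow> real"
  assumes schwartz: "schwartz u0" and positive: "\<And>x. - deriv (deriv u0) x + 1 > 0"
begin

definition D :: "nat \<Rightarrow> real \<Rightarrow> real" where "D n = (deriv ^^ n) u0"
text \<open>\<open>p\<close> is the cube of \<open>q_init\<close>, so \<open>w0\<close> is its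
  logarithm; \<open>w1\<close> and \<open>w2\<close> are the first two derivatives of
  \<open>w0\<close>.\<close>

definition p :: "real \<Rightarrow> real" where "p x = 1 - D 2 x"
definition w0 :: "real \<Rightarrow> real" where "w0 x = ln (p x) / 3"
definition w1 :: "real \<Rightarrow> real" where "w1 x = - D 3 x / (3 * p x)"
definition w2 :: "real \<Rightarrow> real" where "w2 x = - (D 4 x * p x + (D 3 x)\<^sup>2) / (3 * (p x)\<^sup>2)"

lemma D_deriv: "(D n has_real_derivative D (Suc n) x) (at x)"
proof -
  have "((deriv ^^ n) u0) differentiable (at x)" using schwartz unfolding schwartz_def by blast
  then show ?thesis unfolding D_def by (simp add: DERIV_deriv_iff_real_differentiable)
qed

lemma deriv_deriv_u0: "deriv (deriv u0) = D 2" by (simp add: D_def numeral_2_eq_2)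

lemma p_pos: "p x > 0" using positive[of x] unfolding deriv_deriv_u0 p_def by simp

lemma D_decay: "\<exists>C\<ge>0. \<forall>x. \<bar>D n x\<bar> \<le> C / (1 + \<bar>x\<bar>) ^ m"
proof -
  have b: "bounded (range (\<lambda>x. x ^ k * D n x))" for k
    using schwartz unfolding schwartz_def D_def by blast
  have ex: "\<exists>B. \<forall>x. \<bar>x ^ k * D n x\<bar> \<le> B" for k
  proof -
    from b[of k] obtain B where "\<forall>v\<in>range (\<lambda>x. x ^ k * D n x). norm v \<le> B" unfolding bounded_iff by blast
    then have "\<forall>x. \<bar>x ^ k * D n x\<bar> \<le> B" by simp
    then show ?thesis by blast
  qed
  obtain B0 Bm where B0: "\<And>x. \<bar>x ^ 0 * D n x\<bar> \<le> B0" and Bm: "\<And>x. \<bar>x ^ m * D n x\<bar> \<le> Bm"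
    using ex[of 0] ex[of m] by blast
  have "\<bar>D n x\<bar> \<le> 2 ^ m * (\<bar>B0\<bar> + \<bar>Bm\<bar>) / (1 + \<bar>x\<bar>) ^ m" for x
  proof -
    have "(1 + \<bar>x\<bar>) ^ m \<le> 2 ^ m * (1 + \<bar>x\<bar> ^ m)"
    proof (cases "\<bar>x\<bar> \<le> 1")
      case True
      then have "(1 + \<bar>x\<bar>) ^ m \<le> 2 ^ m" by (intro power_mono) auto
      also have "\<dots> \<le> 2 ^ m * (1 + \<bar>x\<bar> ^ m)" by simp
      finally show ?thesis .
    next
      case False
      then have "(1 + \<bar>x\<bar>) ^ m \<le> (2 * \<bar>x\<bar>) ^ m" by (intro power_mono) auto
      also have "\<dots> \<le> 2 ^ m * (1 + \<bar>x\<bar> ^ m)" by (simp add: power_mult_distrib)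
      finally show ?thesis .
    qed
    then have "\<bar>D n x\<bar> * (1 + \<bar>x\<bar>) ^ m \<le> \<bar>D n x\<bar> * (2 ^ m * (1 + \<bar>x\<bar> ^ m))" by (intro mult_left_mono) auto
    also have "\<dots> = 2 ^ m * (\<bar>x ^ 0 * D n x\<bar> + \<bar>x ^ m * D n x\<bar>)" by (simp add: abs_mult power_abs algebra_simps)
    also have "\<dots> \<le> 2 ^ m * (\<bar>B0\<bar> + \<bar>Bm\<bar>)"
      using B0[of x] Bm[of x] by (intro mult_left_mono add_mono) auto
    finally show ?thesis by (simp add: field_simps)
  qed
  then show ?thesis by (intro exI[of _ "2 ^ m * (\<bar>B0\<bar> + \<bar>Bm\<bar>)"]) auto
qed

text \<open>Outside \<open>{-2*C..2*C}\<close> the second derivative of u0 is at most 1/2 in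
  modulus; inside, a positive continuous function attains its minimum.\<close>

lemma p_lower: "\<exists>c>0. \<forall>x. c \<le> p x"
proof -
  obtain C where C: "C \<ge> 0" "\<And>x. \<bar>D 2 x\<bar> \<le> C / (1 + \<bar>x\<bar>) ^ 1" using D_decay[of 2 1] by blast
  have pc: "continuous_on {-2*C..2*C} p"
    unfolding p_def by (intro continuous_intros continuous_at_imp_continuous_on ballI DERIV_isCont[OF D_deriv])
  obtain x0 where x0: "\<And>x. x \<in> {-2*C..2*C} \<Longrightarrow> p x0 \<le> p x"
  proof -
    have "{-2*C..2*C} \<noteq> {}" using C(1) by simp
    from continuous_attains_inf[OF compact_Icc this pc] show ?thesis using that by blast
  qed
  have "min (1/2) (p x0) \<le> p x" for x
  proof (cases "x \<in> {-2*C..2*C}")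
    case True then show ?thesis using x0[OF True] by simp
  next
    case False
    then have "C / (1 + \<bar>x\<bar>) \<le> 1 / 2" using C(1) by (auto simp: field_simps)
    then have "\<bar>D 2 x\<bar> \<le> 1 / 2" using order_trans[OF C(2)[of x]] unfolding power_one_right by blast
    then have "1 / 2 \<le> 1 - D 2 x" by linarith
    then show ?thesis unfolding p_def by linarith
  qed
  then show ?thesis using p_pos[of x0] by (intro exI[of _ "min (1/2) (p x0)"]) auto
qed

lemma p_deriv: "(p has_real_derivative - D 3 x) (at x)"
  unfolding p_def[abs_def] using D_deriv[of 2 x] by (auto intro!: derivative_eq_intros simp: numeral_3_eq_3 numeral_2_eq_2)

lemma w0_deriv: "(w0 has_real_derivative w1 x) (at x)"
  unfolding w0_def[abs_def] w1_def by (auto intro!: derivative_eq_intros p_deriv p_pos)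

lemma w1_deriv: "(w1 has_real_derivative w2 x) (at x)"
proof -
  have "(D 3 has_real_derivative D 4 x) (at x)" using D_deriv[of 3 x] by (simp add: eval_nat_numeral)
  then show ?thesis
    unfolding w1_def[abs_def] w2_def
    using p_pos[of x] by (auto intro!: derivative_eq_intros p_deriv simp: power2_eq_square) (simp add: field_simps)
qed

lemma exp_w0: "exp (w0 x) = q_init u0 x" "exp (w0 x) ^ 3 = p x"
proof -
  show "exp (w0 x) = q_init u0 x"
    unfolding q_init_def deriv_deriv_u0 using p_pos[of x] by (simp add: powr_def w0_def p_def)
  have "exp (w0 x) ^ 3 = exp (3 * w0 x)" by (simp flip: exp_of_nat_mult)
  then show "exp (w0 x) ^ 3 = p x" using p_pos[of x] by (simp add: w0_def)
qed

text \<open>The exponent 5 is the decay that the Goursat problem asks of its data. The lower bound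
  on \<open>p\<close> keeps the logarithm and the quotients under control.\<close>

lemma w_decay: "\<exists>C\<ge>0. \<forall>x. \<bar>w0 x\<bar> \<le> C / (1 + \<bar>x\<bar>) ^ 5 \<and> \<bar>w1 x\<bar> \<le> C / (1 + \<bar>x\<bar>) ^ 5 \<and> \<bar>w2 x\<bar> \<le> C / (1 + \<bar>x\<bar>) ^ 5"
proof -
  obtain c where c: "c > 0" "\<And>x. c \<le> p x" using p_lower by blast
  obtain C2 where C2: "C2 \<ge> 0" "\<And>x. \<bar>D 2 x\<bar> \<le> C2 / (1 + \<bar>x\<bar>) ^ 5" using D_decay by blast
  obtain C3 where C3: "C3 \<ge> 0" "\<And>x. \<bar>D 3 x\<bar> \<le> C3 / (1 + \<bar>x\<bar>) ^ 5" using D_decay by blast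
  obtain C4 where C4: "C4 \<ge> 0" "\<And>x. \<bar>D 4 x\<bar> \<le> C4 / (1 + \<bar>x\<bar>) ^ 5" using D_decay by blast
  have C3': "\<bar>D 3 x\<bar> \<le> C3" for x
  proof -
    have "C3 / (1 + \<bar>x\<bar>) ^ 5 \<le> C3 / 1" using C3(1) by (intro divide_left_mono one_le_power) auto
    then show ?thesis using C3(2)[of x] by simp
  qed
  define a where "a x = 1 / (1 + \<bar>x\<bar>) ^ 5" for x :: real
  have a: "a x \<ge> 0" for x by (simp add: a_def)
  have b0: "\<bar>w0 x\<bar> \<le> (1 + 1 / c) * C2 * a x" for x
  proof -
    have "ln (p x) \<le> p x - 1" using p_pos by (rule ln_le_minus_one)
    moreover have "- ln (p x) \<le> 1 / p x - 1"
      using ln_le_minus_one[of "1 / p x"] p_pos[of x] by (simp add: ln_div)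
    moreover have "1 / p x - 1 \<le> \<bar>D 2 x\<bar> * (1 / c)"
    proof -
      have "1 / p x - 1 = D 2 x / p x" using p_pos[of x] by (simp add: p_def field_simps)
      also have "\<dots> \<le> \<bar>D 2 x\<bar> / c" using c p_pos[of x] by (intro frac_le) auto
      finally show ?thesis by simp
    qed
    moreover have "p x - 1 \<le> \<bar>D 2 x\<bar>" by (simp add: p_def)
    moreover have "0 \<le> \<bar>D 2 x\<bar> * (1 / c)" using c(1) by simp
    ultimately have "\<bar>ln (p x)\<bar> \<le> \<bar>D 2 x\<bar> + \<bar>D 2 x\<bar> * (1 / c)" by linarith
    then have "\<bar>w0 x\<bar> \<le> (1 + 1 / c) * \<bar>D 2 x\<bar>" unfolding w0_def by (simp add: algebra_simps)
    also have "\<dots> \<le> (1 + 1 / c) * (C2 * a x)" using C2(2)[of x] c(1) by (intro mult_left_mono) (auto simp: a_def)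
    finally show ?thesis by simp
  qed
  have b1: "\<bar>w1 x\<bar> \<le> C3 / c * a x" for x
  proof -
    have "\<bar>w1 x\<bar> = \<bar>D 3 x\<bar> / (3 * p x)" using p_pos[of x] by (simp add: w1_def abs_mult)
    also have "\<dots> \<le> (C3 * a x) / c" using C3(2)[of x] c(2)[of x] c(1) C3(1) a[of x] by (intro frac_le) (auto simp: a_def)
    finally show ?thesis by simp
  qed
  have b2: "\<bar>w2 x\<bar> \<le> (C4 / c + C3 * C3 / (c * c)) * a x" for x
  proof -
    have "w2 x = - (D 4 x / (3 * p x)) - (D 3 x)\<^sup>2 / (3 * (p x)\<^sup>2)"
      unfolding w2_def using p_pos[of x] by (simp add: field_simps power2_eq_square)
    then have "\<bar>w2 x\<bar> \<le> \<bar>D 4 x\<bar> / (3 * p x) + (\<bar>D 3 x\<bar> * \<bar>D 3 x\<bar>) / (3 * (p x)\<^sup>2)"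
      using abs_triangle_ineq4[of "- (D 4 x / (3 * p x))" "(D 3 x)\<^sup>2 / (3 * (p x)\<^sup>2)"] p_pos[of x]
      by (simp add: abs_mult power2_eq_square)
    also have "\<dots> \<le> (C4 * a x) / c + (C3 * (C3 * a x)) / (c * c)"
    proof (rule add_mono)
      show "\<bar>D 4 x\<bar> / (3 * p x) \<le> (C4 * a x) / c"
        using C4(2)[of x] c(2)[of x] c(1) C4(1) a[of x] by (intro frac_le) (auto simp: a_def)
      have cc: "c * c \<le> 3 * (p x)\<^sup>2"
        using mult_mono[OF c(2) c(2), of x x] c(1) p_pos[of x] unfolding power2_eq_square by (smt (verit) mult_nonneg_nonneg)
      have m: "\<bar>D 3 x\<bar> * \<bar>D 3 x\<bar> \<le> C3 * (C3 * a x)"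
        using C3' C3(2)[of x] C3(1) by (intro mult_mono) (auto simp: a_def)
      show "(\<bar>D 3 x\<bar> * \<bar>D 3 x\<bar>) / (3 * (p x)\<^sup>2) \<le> (C3 * (C3 * a x)) / (c * c)"
        by (rule frac_le[OF _ m _ cc]) (use C3(1) a[of x] c(1) in auto)
    qed
    also have "\<dots> = (C4 / c + C3 * C3 / (c * c)) * a x" by (simp add: algebra_simps)
    finally show ?thesis .
  qed
  define C where "C = (1 + 1 / c) * C2 + C3 / c + (C4 / c + C3 * C3 / (c * c))"
  have nn: "0 \<le> (1 + 1 / c) * C2" "0 \<le> C3 / c" "0 \<le> C4 / c + C3 * C3 / (c * c)"
    using c(1) C2(1) C3(1) C4(1) by (auto intro!: add_nonneg_nonneg mult_nonneg_nonneg)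
  have "\<bar>w0 x\<bar> \<le> C * a x \<and> \<bar>w1 x\<bar> \<le> C * a x \<and> \<bar>w2 x\<bar> \<le> C * a x" for x
  proof -
    have le: "(1 + 1 / c) * C2 \<le> C" "C3 / c \<le> C" "C4 / c + C3 * C3 / (c * c) \<le> C"
      using nn unfolding C_def by linarith+
    show ?thesis
      using order_trans[OF b0[of x] mult_right_mono[OF le(1) a]] order_trans[OF b1[of x] mult_right_mono[OF le(2) a]]
        order_trans[OF b2[of x] mult_right_mono[OF le(3) a]] by simp
  qed
  then show ?thesis using nn by (intro exI[of _ C]) (auto simp: a_def C_def)
qed

text \<open>The coefficient of the direct problem is a third of the logarithmic derivative of
  \<open>q_init\<close>, and \<open>cmat0\<close> is a third of the constant matrix, so both thirds
  coincide.\<close>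

lemma U_mat_eq: "U_mat u0 x = w1 x *\<^sub>R cmat0"
proof -
  have "(q_init u0 has_real_derivative exp (w0 x) * w1 x) (at x)"
  proof -
    have "((\<lambda>x. exp (w0 x)) has_real_derivative exp (w0 x) * w1 x) (at x)" by (auto intro!: derivative_eq_intros w0_deriv)
    then show ?thesis by (simp add: exp_w0)
  qed
  then have "deriv (q_init u0) x = exp (w0 x) * w1 x" by (rule DERIV_imp_deriv)
  then have d: "deriv (q_init u0) x / (3 * q_init u0 x) = w1 x * (1 / 3)" unfolding exp_w0(1)[symmetric] by simp
  have c: "cmat0 = (1 / 3) *\<^sub>R vector [vector [0, 1 - \<omega> ^ 2, 1 - \<omega>], vector [1 - \<omega>, 0, 1 - \<omega> ^ 2], vector [1 - \<omega> ^ 2, 1 - \<omega>, 0]]"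
    by (simp add: vec_eq_iff forall_3 cmat0_def P0_def P1_def) (simp add: scaleR_conv_of_real diff_divide_distrib)
  show ?thesis unfolding U_mat_def c d scaleR_scaleR ..
qed

end

lemma one_plus_abs_power_le: "C / (1 + \<bar>x\<bar>) ^ (2 + n) \<le> C / (1 + x\<^sup>2)" if "C \<ge> 0" for C x :: real
proof (rule divide_left_mono)
  have "1 + x\<^sup>2 \<le> (1 + \<bar>x\<bar>)\<^sup>2" by (simp add: power2_eq_square algebra_simps)
  also have "\<dots> \<le> (1 + \<bar>x\<bar>) ^ (2 + n)" by (rule power_increasing) auto
  finally show "1 + x\<^sup>2 \<le> (1 + \<bar>x\<bar>) ^ (2 + n)" .
  have "0 < 1 + x\<^sup>2" by (intro add_pos_nonneg) auto
  then show "0 < (1 + \<bar>x\<bar>) ^ (2 + n) * (1 + x\<^sup>2)" by (intro mult_pos_pos) (auto intro: add_pos_nonneg)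
qed (use that in auto)

context schwartz_data begin

lemma q_init_pos: "q_init u0 x > 0" unfolding exp_w0(1)[symmetric] by simp

lemma isCont_q_init: "isCont (q_init u0) x"
proof -
  have "isCont (\<lambda>x. exp (w0 x)) x" by (intro continuous_intros DERIV_isCont[OF w0_deriv])
  then show ?thesis by (simp add: exp_w0(1))
qed

text \<open>In the factorization of q^3 - 1, which equals minus the second derivative of u0, the
  quadratic factor is at least 1.\<close>

lemma q_init_decay: "\<exists>C\<ge>0. \<forall>x. \<bar>q_init u0 x - 1\<bar> \<le> C / (1 + x\<^sup>2)"
proof -
  obtain C where C: "C \<ge> 0" "\<And>x. \<bar>D 2 x\<bar> \<le> C / (1 + \<bar>x\<bar>) ^ (2 + 0)" using D_decay[of 2 "2 + 0"] by blast
  have "\<bar>q_init u0 x - 1\<bar> \<le> C / (1 + x\<^sup>2)" for x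
  proof -
    let ?q = "q_init u0 x"
    have "?q ^ 3 - 1 = (?q - 1) * (?q\<^sup>2 + ?q + 1)" by (simp add: power2_eq_square power3_eq_cube algebra_simps)
    then have "\<bar>?q ^ 3 - 1\<bar> = \<bar>?q - 1\<bar> * (?q\<^sup>2 + ?q + 1)" using q_init_pos[of x] by (simp add: abs_mult)
    moreover have "\<bar>?q - 1\<bar> * 1 \<le> \<bar>?q - 1\<bar> * (?q\<^sup>2 + ?q + 1)" using q_init_pos[of x] by (intro mult_left_mono) auto
    moreover have "?q ^ 3 - 1 = - D 2 x" using exp_w0[of x] by (simp add: p_def)
    ultimately have "\<bar>?q - 1\<bar> \<le> \<bar>D 2 x\<bar>" by simp
    then show ?thesis using order_trans[OF C(2) one_plus_abs_power_le[OF C(1)]] by (rule order_trans)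
  qed
  then show ?thesis using C(1) by blast
qed

lemma y_init_eq: "y_init u0 x = x + (LBINT \<xi>=\<infinity>..ereal x. q_init u0 \<xi> - 1)"
  unfolding y_init_def by (subst interval_integral_endpoints_reverse) simp

lemma continuous_q_minus_1: "continuous_on UNIV (\<lambda>x. q_init u0 x - 1)"
  by (intro continuous_at_imp_continuous_on ballI continuous_intros isCont_q_init)

lemma y_init_deriv: "(y_init u0 has_real_derivative q_init u0 x) (at x)"
proof -
  obtain C where C: "C \<ge> 0" "\<And>x. \<bar>q_init u0 x - 1\<bar> \<le> C / (1 + x\<^sup>2)" using q_init_decay by blast
  have "((\<lambda>x. LBINT \<xi>=\<infinity>..ereal x. q_init u0 \<xi> - 1) has_vector_derivative (q_init u0 x - 1)) (at x)"
    using C(2) by (intro improper_integral_has_vector_derivative continuous_q_minus_1 set_integrable_decay[where C=C]) auto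
  then have "((\<lambda>x. LBINT \<xi>=\<infinity>..ereal x. q_init u0 \<xi> - 1) has_real_derivative (q_init u0 x - 1)) (at x)"
    by (simp add: has_real_derivative_iff_has_vector_derivative)
  from DERIV_add[OF DERIV_ident this] show ?thesis by (simp add: y_init_eq[abs_def])
qed

lemma y_init_bound:
  obtains C where "C \<ge> 0" "\<And>x. \<bar>y_init u0 x - x\<bar> \<le> C * (pi / 2) - C * arctan x" "\<And>x. \<bar>y_init u0 x - x\<bar> \<le> C * pi"
proof -
  obtain C where C: "C \<ge> 0" "\<And>x. \<bar>q_init u0 x - 1\<bar> \<le> C / (1 + x\<^sup>2)" using q_init_decay by blast
  have 1: "\<bar>y_init u0 x - x\<bar> \<le> C * (pi / 2) - C * arctan x" for x
    using improper_integral_bound[OF continuous_q_minus_1, of C x] C(2) by (simp add: y_init_eq)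
  have "C * (- pi / 2) \<le> C * arctan x" for x
    by (intro mult_left_mono C less_imp_le) (use arctan_bounded[of x] in simp)
  then have "\<bar>y_init u0 x - x\<bar> \<le> C * pi" for x using 1[of x] by (smt (verit) mult_minus_right field_sum_of_halves distrib_left minus_divide_left)
  with C(1) 1 show thesis by (rule that)
qed

lemma y_init_limit: "((\<lambda>x. y_init u0 x - x) \<longlongrightarrow> 0) at_top"
proof -
  obtain C where C: "C \<ge> 0" "\<And>x. \<bar>y_init u0 x - x\<bar> \<le> C * (pi / 2) - C * arctan x" by (rule y_init_bound) blast
  have "((\<lambda>x. C * (pi / 2) - C * arctan x) \<longlongrightarrow> C * (pi / 2) - C * (pi / 2)) at_top"
    by (intro tendsto_intros tendsto_mult[OF tendsto_const tendsto_arctan_at_top])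
  then have "((\<lambda>x. C * (pi / 2) - C * arctan x) \<longlongrightarrow> 0) at_top" unfolding diff_self .
  then show ?thesis by (rule tendsto_rabs_zero_cancel[OF tendsto_sandwich[rotated 2, OF tendsto_const]]) (use C(2) in auto)
qed

lemma y_init_strict_mono: "strict_mono (y_init u0)"
  unfolding strict_mono_def using DERIV_pos_imp_increasing[of _ _ "y_init u0"] y_init_deriv q_init_pos by blast

lemma y_init_diff: "(LBINT \<zeta>=ereal \<xi>..ereal x. q_init u0 \<zeta>) = y_init u0 x - y_init u0 \<xi>"
  by (rule interval_integral_FTC_finite)
    (auto intro!: continuous_at_imp_continuous_on isCont_q_init DERIV_subset[OF y_init_deriv]
      simp flip: has_real_derivative_iff_has_vector_derivative)

text \<open>The exponential kernel splits into a factor in x and a factor in \<xi>. The improper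
  integral that remains depends on x only through its finite end, so the integral equation can be
  differentiated.\<close>

lemma direct_solution_entry:
  assumes m: "direct_solution u0 z m"
  shows "((\<lambda>x. m x $ j $ l) has_vector_derivative
      (lam z $ j - lam z $ l) * of_real (q_init u0 x) * m x $ j $ l + (w1 x *\<^sub>R (cmat0 ** m x)) $ j $ l) (at x)"
    and "((\<lambda>x. m x $ l $ l) \<longlongrightarrow> 1) at_top"
proof -
  define q where "q = q_init u0"
  have mc: "continuous_on UNIV m" and "bounded (range m)"
    and eq: "\<And>x j l. m x $ j $ l = (if j = l then 1 else 0) +
        (LBINT \<xi>=infty_end z j l..ereal x.
           exp ((lam z $ j - lam z $ l) * of_real (y_init u0 x - y_init u0 \<xi>)) * (U_mat u0 \<xi> ** m \<xi>) $ j $ l)"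
    using m unfolding direct_solution_def y_init_diff by blast+
  then obtain B where B: "\<And>x. norm (m x) \<le> B" unfolding bounded_iff by auto
  obtain C where C: "C \<ge> 0" "\<And>x. \<bar>w1 x\<bar> \<le> C / (1 + \<bar>x\<bar>) ^ (2 + 3)" using w_decay by auto
  define C' where "C' = C * (mmK * norm cmat0 * B)"
  have Yc: "isCont (y_init u0) x" for x by (rule DERIV_isCont[OF y_init_deriv])
  define g where "g j l \<xi> = (U_mat u0 \<xi> ** m \<xi>) $ j $ l" for j l \<xi>
  have g_eq: "g j l \<xi> = (w1 \<xi> *\<^sub>R (cmat0 ** m \<xi>)) $ j $ l" for j l \<xi>
    unfolding g_def U_mat_eq by (simp add: mm.scaleR_left)
  have w1c: "continuous_on UNIV w1" by (intro continuous_at_imp_continuous_on ballI DERIV_isCont[OF w1_deriv])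
  have gc: "continuous_on UNIV (g j l)" for j l
    unfolding g_eq[abs_def] by (intro continuous_intros w1c mm.continuous_on mc)
  have gb: "norm (g j l \<xi>) \<le> C' / (1 + \<xi>\<^sup>2)" for j l \<xi>
  proof -
    have "norm (g j l \<xi>) \<le> norm (w1 \<xi> *\<^sub>R (cmat0 ** m \<xi>))" unfolding g_eq by (rule norm_entry_le)
    also have "\<dots> = \<bar>w1 \<xi>\<bar> * norm (cmat0 ** m \<xi>)" by simp
    also have "\<dots> \<le> C / (1 + \<xi>\<^sup>2) * (mmK * norm cmat0 * B)"
      using order_trans[OF C(2) one_plus_abs_power_le[OF C(1)]]
      by (intro mult_mono norm_mult_le B order_refl) (auto intro!: divide_nonneg_nonneg C(1))
    finally show ?thesis by (simp add: C'_def)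
  qed
  show "((\<lambda>x. m x $ j $ l) has_vector_derivative
      (lam z $ j - lam z $ l) * of_real (q_init u0 x) * m x $ j $ l + (w1 x *\<^sub>R (cmat0 ** m x)) $ j $ l) (at x)"
  proof -
    define \<kappa> where "\<kappa> = lam z $ j - lam z $ l"
    define e where "e = infty_end z j l"
    define \<delta> :: complex where "\<delta> = (if j = l then 1 else 0)"
    define E where "E x = exp (\<kappa> * of_real (y_init u0 x))" for x
    define h where "h \<xi> = exp (- (\<kappa> * of_real (y_init u0 \<xi>))) * g j l \<xi>" for \<xi>
    define J where "J x = (LBINT \<xi>=e..ereal x. h \<xi>)" for x
    have m_eq: "m x $ j $ l = \<delta> + E x * J x" for x
    proof -
      have "exp (\<kappa> * of_real (y_init u0 x - y_init u0 \<xi>)) * g j l \<xi> = E x * h \<xi>" for \<xi>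
        unfolding E_def h_def by (simp add: exp_minus exp_diff right_diff_distrib field_simps)
      then have "(LBINT \<xi>=e..ereal x. exp (\<kappa> * of_real (y_init u0 x - y_init u0 \<xi>)) * g j l \<xi>) = E x * J x"
        by (simp add: J_def)
      then show ?thesis using eq[of x j l] unfolding \<delta>_def \<kappa>_def e_def g_def by simp
    qed
    have hc: "continuous_on UNIV h"
      unfolding h_def by (intro continuous_intros gc continuous_at_imp_continuous_on ballI Yc)
    have J: "(J has_vector_derivative h x) (at x)" for x
      unfolding J_def
    proof (rule improper_integral_has_vector_derivative[OF _ hc])
      show "e = \<infinity> \<or> e = - \<infinity>" by (auto simp: e_def infty_end_def)
      show "set_integrable lborel (if e = \<infinity> then {b<..} else {..<b}) h" for b
      proof (rule set_integrable_decay[OF hc])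
        fix \<xi> assume \<xi>: "\<xi> \<in> (if e = \<infinity> then {b<..} else {..<b})"
        \<comment> \<open>Once the factor in x is split off, convergence has to be checked anew. The
          infinite end is the one towards which the exponential does not grow, as
          \<open>y_init\<close> is increasing.\<close>
        have "Re \<kappa> * (y_init u0 \<xi> - y_init u0 b) \<ge> 0"
        proof (cases "Re (lam z $ j) \<ge> Re (lam z $ l)")
          case True
          then have "\<xi> > b" "Re \<kappa> \<ge> 0" using \<xi> by (auto simp: e_def infty_end_def \<kappa>_def)
          then show ?thesis using strict_mono_less[OF y_init_strict_mono, of b \<xi>] by simp
        next
          case False
          then have "\<xi> < b" "Re \<kappa> \<le> 0" using \<xi> by (auto simp: e_def infty_end_def \<kappa>_def)
          then show ?thesis using strict_mono_less[OF y_init_strict_mono, of \<xi> b] by (intro mult_nonpos_nonpos) auto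
        qed
        then have "norm (exp (- (\<kappa> * of_real (y_init u0 \<xi>)))) \<le> exp (- (Re \<kappa> * y_init u0 b))"
          by (simp add: algebra_simps)
        then have "norm (h \<xi>) \<le> exp (- (Re \<kappa> * y_init u0 b)) * (C' / (1 + \<xi>\<^sup>2))"
          unfolding h_def norm_mult by (intro mult_mono gb) auto
        then show "norm (h \<xi>) \<le> (exp (- (Re \<kappa> * y_init u0 b)) * C') / (1 + \<xi>\<^sup>2)" by simp
      qed auto
    qed
    have "((\<lambda>v. exp (\<kappa> * v)) has_field_derivative \<kappa> * exp (\<kappa> * of_real (y_init u0 x))) (at (of_real (y_init u0 x)))"
      by (auto intro!: derivative_eq_intros)
    from field_vector_diff_chain_at[OF has_vector_derivative_of_real[OF y_init_deriv] this]
    have "(E has_vector_derivative of_real (q x) * (\<kappa> * E x)) (at x)"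
      by (simp add: E_def[abs_def] o_def q_def)
    from has_vector_derivative_add[OF has_vector_derivative_const has_vector_derivative_mult[OF this J]]
    have "((\<lambda>x. m x $ j $ l) has_vector_derivative E x * h x + of_real (q x) * (\<kappa> * E x) * J x) (at x)"
      by (simp add: m_eq)
    moreover have "E x * h x = g j l x" by (simp add: E_def h_def exp_minus field_simps)
    \<comment> \<open>The constant term of the integral equation sits on the diagonal, where the
      exponent vanishes, so it contributes nothing.\<close>
    moreover have "\<kappa> * \<delta> = 0" by (simp add: \<kappa>_def \<delta>_def)
    then have "of_real (q x) * (\<kappa> * E x) * J x = \<kappa> * of_real (q x) * m x $ j $ l"
      unfolding m_eq by (auto simp add: algebra_simps)
    ultimately show ?thesis unfolding g_eq \<kappa>_def q_def by (simp add: add.commute)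
  qed
  show "((\<lambda>x. m x $ l $ l) \<longlongrightarrow> 1) at_top"
  proof -
    have C0: "C' \<ge> 0" using order_trans[OF norm_ge_zero gb[of 1 1 0]] by simp
    \<comment> \<open>On the diagonal the kernel is 1 and the integral starts at +infinity, so the
      distance from 1 is a tail integral.\<close>
    have b: "norm (m x $ l $ l - 1) \<le> C' * (pi / 2) - C' * arctan x" for x
      using improper_integral_bound[OF gc[of l l] gb, of x] eq[of x l l] by (simp add: g_def infty_end_def)
    have "((\<lambda>x. C' * (pi / 2) - C' * arctan x) \<longlongrightarrow> C' * (pi / 2) - C' * (pi / 2)) at_top"
      by (intro tendsto_intros tendsto_mult[OF tendsto_const tendsto_arctan_at_top])
    then have "((\<lambda>x. C' * (pi / 2) - C' * arctan x) \<longlongrightarrow> 0) at_top" unfolding diff_self .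
    then have "((\<lambda>x. norm (m x $ l $ l - 1)) \<longlongrightarrow> 0) at_top"
      by (rule tendsto_sandwich[rotated 2, OF tendsto_const]) (use b in auto)
    then show ?thesis using LIM_zero_iff tendsto_norm_zero_iff by blast
  qed
qed

section \<open>Change of variables from x to y at time 0\<close>

definition xi :: "real \<Rightarrow> real" where "xi = inv (y_init u0)"

lemma y_init_surj: "\<exists>x. y_init u0 x = y"
proof -
  obtain C where C: "C \<ge> 0" "\<And>x. \<bar>y_init u0 x - x\<bar> \<le> C * pi" by (rule y_init_bound) blast
  have 1: "y_init u0 (y - C * pi) \<le> y" "y \<le> y_init u0 (y + C * pi)" 
    using C(2)[of "y - C * pi"] C(2)[of "y + C * pi"] by linarith+
  have "0 \<le> C * pi" using C(1) by simp
  then have 2: "y - C * pi \<le> y + C * pi" by linarith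
  have "\<exists>x. y - C * pi \<le> x \<and> x \<le> y + C * pi \<and> y_init u0 x = y"
    by (rule IVT[OF 1 2]) (blast intro: DERIV_isCont[OF y_init_deriv])
  then show ?thesis by blast
qed

lemma y_init_xi: "y_init u0 (xi y) = y"
  unfolding xi_def by (rule surj_f_inv_f) (use y_init_surj in \<open>metis surj_def\<close>)

lemma xi_y_init: "xi (y_init u0 x) = x"
  unfolding xi_def by (rule inv_f_f) (rule strict_mono_imp_inj_on[OF y_init_strict_mono])

lemma isCont_xi: "isCont xi y"
proof -
  have "isCont xi (y_init u0 (xi y))"
    by (rule isCont_inverse_function[of 1]) (auto simp: xi_y_init intro: DERIV_isCont[OF y_init_deriv])
  then show ?thesis by (simp add: y_init_xi)
qed

lemma xi_deriv: "(xi has_real_derivative exp (- w0 (xi y))) (at y)"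
proof -
  have "(xi has_real_derivative inverse (q_init u0 (xi y))) (at y)"
    by (rule DERIV_inverse_function[where a="y - 1" and b="y + 1", OF y_init_deriv])
      (use q_init_pos[of "xi y"] in \<open>auto simp: y_init_xi isCont_xi\<close>)
  then show ?thesis by (simp add: exp_w0(1)[symmetric] exp_minus)
qed

text \<open>The logarithm of \<open>q_init\<close> as a function of y. \<open>Wf1\<close> and
  \<open>Wf2\<close> are its derivatives in y; the factor \<open>exp (- w0)\<close> is
  dx/dy.\<close>

definition Wf :: "real \<Rightarrow> real" where "Wf y = w0 (xi y)"
definition Wf1 :: "real \<Rightarrow> real" where "Wf1 y = w1 (xi y) * exp (- w0 (xi y))"
definition Wf2 :: "real \<Rightarrow> real" where "Wf2 y = (w2 (xi y) - (w1 (xi y))\<^sup>2) * exp (- 2 * w0 (xi y))"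

lemma Wf_deriv: "(Wf has_real_derivative Wf1 y) (at y)"
  unfolding Wf_def[abs_def] Wf1_def by (rule DERIV_chain2[OF w0_deriv xi_deriv])

lemma Wf1_deriv: "(Wf1 has_real_derivative Wf2 y) (at y)"
  unfolding Wf1_def[abs_def] Wf2_def
  by (rule DERIV_cong[OF DERIV_mult[OF DERIV_chain2[OF w1_deriv xi_deriv] DERIV_chain2[OF DERIV_exp DERIV_minus[OF DERIV_chain2[OF w0_deriv xi_deriv]]]]])
    (simp add: power2_eq_square algebra_simps flip: exp_add)

text \<open>\<open>xi\<close> stays within bounded distance of the identity, so the weights in x and
  in y are comparable up to the factor b.\<close>

lemma Wf_decay:
  obtains C where "C \<ge> 0" "\<And>y. \<bar>Wf y\<bar> \<le> C / (1 + \<bar>y\<bar>) ^ 5" "\<And>y. \<bar>Wf1 y\<bar> \<le> C / (1 + \<bar>y\<bar>) ^ 5" "\<And>y. \<bar>Wf2 y\<bar> \<le> C / (1 + \<bar>y\<bar>) ^ 5"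
proof -
  obtain C where C: "C \<ge> 0" "\<And>x. \<bar>w0 x\<bar> \<le> C / (1 + \<bar>x\<bar>) ^ 5" "\<And>x. \<bar>w1 x\<bar> \<le> C / (1 + \<bar>x\<bar>) ^ 5" "\<And>x. \<bar>w2 x\<bar> \<le> C / (1 + \<bar>x\<bar>) ^ 5"
    using w_decay by blast
  have C_le: "C / (1 + \<bar>x\<bar>) ^ 5 \<le> C" for x
  proof -
    have "C / (1 + \<bar>x\<bar>) ^ 5 \<le> C / 1" using C(1) by (intro divide_left_mono one_le_power) auto
    then show ?thesis by simp
  qed
  obtain c where c: "c \<ge> 0" "\<And>x. \<bar>y_init u0 x - x\<bar> \<le> c * pi" by (rule y_init_bound) blast
  define b where "b = 1 + c * pi"
  have b: "b \<ge> 1" using c(1) by (simp add: b_def)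
  define C1 where "C1 = C * b ^ 5"
  have C1: "C1 \<ge> 0" using C(1) b by (simp add: C1_def)
  have xi_le: "C / (1 + \<bar>xi y\<bar>) ^ 5 \<le> C1 / (1 + \<bar>y\<bar>) ^ 5" for y
  proof -
    have "\<bar>y\<bar> \<le> \<bar>xi y\<bar> + (b - 1)" using c(2)[of "xi y"] unfolding y_init_xi b_def by linarith
    then have "1 + \<bar>y\<bar> \<le> b + \<bar>xi y\<bar>" by linarith
    also have "\<dots> \<le> b + b * \<bar>xi y\<bar>" using mult_right_mono[OF b, of "\<bar>xi y\<bar>"] by simp
    finally have "1 + \<bar>y\<bar> \<le> b * (1 + \<bar>xi y\<bar>)" by (simp add: algebra_simps)
    then have "(1 + \<bar>y\<bar>) ^ 5 \<le> (b * (1 + \<bar>xi y\<bar>)) ^ 5" by (intro power_mono) auto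
    then have "C * (1 + \<bar>y\<bar>) ^ 5 \<le> C * (b * (1 + \<bar>xi y\<bar>)) ^ 5" using C(1) by (rule mult_left_mono)
    moreover have "(1 + \<bar>y\<bar>) ^ 5 > 0" "(1 + \<bar>xi y\<bar>) ^ 5 > 0" by (auto intro!: zero_less_power)
    ultimately show ?thesis by (simp add: C1_def power_mult_distrib divide_le_eq pos_le_divide_eq mult_ac)
  qed
  define \<phi> where "\<phi> y = C1 / (1 + \<bar>y\<bar>) ^ 5" for y
  have \<phi>: "\<phi> y \<ge> 0" for y using C1 by (simp add: \<phi>_def)
  note d = C(2)[THEN order_trans, OF xi_le, folded \<phi>_def] C(3)[THEN order_trans, OF xi_le, folded \<phi>_def] C(4)[THEN order_trans, OF xi_le, folded \<phi>_def]
  have ew: "exp (- w0 x) \<le> exp (2 * C)" "exp (- 2 * w0 x) \<le> exp (2 * C)" for x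
    using order_trans[OF C(2) C_le, of x] C(1) by (auto simp: abs_le_iff)
  define C2 where "C2 = (1 + C) * exp (2 * C)"
  have e1: "1 \<le> exp (2 * C)" using C(1) by simp
  have C2: "C2 \<ge> 1" unfolding C2_def using mult_mono[of 1 "1 + C" 1 "exp (2 * C)"] C(1) e1 by simp
  have C2': "exp (2 * C) \<le> C2" unfolding C2_def using C(1) e1 by (simp add: distrib_right)
  have 0: "\<bar>Wf y\<bar> \<le> \<phi> y * C2" for y
    using order_trans[OF d(1), of y "\<phi> y * C2"] mult_left_mono[OF C2 \<phi>, of y] by (simp add: Wf_def)
  have 1: "\<bar>Wf1 y\<bar> \<le> \<phi> y * C2" for y
    unfolding Wf1_def abs_mult abs_exp_cancel by (intro mult_mono d(2) order_trans[OF ew(1) C2'] \<phi>) auto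
  have 2: "\<bar>Wf2 y\<bar> \<le> \<phi> y * C2" for y
  proof -
    have "\<bar>w2 (xi y) - (w1 (xi y))\<^sup>2\<bar> \<le> \<bar>w2 (xi y)\<bar> + \<bar>w1 (xi y)\<bar> * \<bar>w1 (xi y)\<bar>"
      using abs_triangle_ineq4[of "w2 (xi y)" "(w1 (xi y))\<^sup>2"] by (simp add: power2_eq_square abs_mult)
    also have "\<dots> \<le> \<phi> y + C * \<phi> y"
      by (intro add_mono mult_mono d order_trans[OF C(3) C_le] C(1) abs_ge_zero)
    finally have "\<bar>Wf2 y\<bar> \<le> (\<phi> y + C * \<phi> y) * exp (2 * C)"
      unfolding Wf2_def abs_mult abs_exp_cancel using \<phi>[of y] C(1) by (intro mult_mono ew(2)) auto
    then show ?thesis by (simp add: C2_def algebra_simps)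
  qed
  show thesis
    by (rule that[of "C1 * C2"]) (use 0 1 2 C1 C2 in \<open>auto simp: \<phi>_def mult.commute\<close>)
qed

lemma xi_limit: "((\<lambda>y. xi y - y) \<longlongrightarrow> 0) at_top" and xi_at_top: "filterlim xi at_top at_top"
proof -
  obtain C where C: "\<And>x. \<bar>y_init u0 x - x\<bar> \<le> C * pi" by (rule y_init_bound) blast
  show top: "filterlim xi at_top at_top"
  proof (rule filterlim_at_top_mono)
    show "filterlim (\<lambda>y. - (C * pi) + y) at_top at_top" by (rule filterlim_tendsto_add_at_top[OF tendsto_const filterlim_ident])
    show "\<forall>\<^sub>F y in at_top. - (C * pi) + y \<le> xi y"
    proof (rule always_eventually, rule allI)
      show "- (C * pi) + y \<le> xi y" for y using C[of "xi y"] unfolding y_init_xi by linarith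
    qed
  qed
  from tendsto_minus[OF filterlim_compose[OF y_init_limit top]]
  show "((\<lambda>y. xi y - y) \<longlongrightarrow> 0) at_top" by (simp add: y_init_xi)
qed

text \<open>In the variable y the factor \<open>q_init\<close> before the spectral term cancels
  against dx/dy. This leaves the y-equation of the Lax pair with the potential
  \<open>Wf1\<close>.\<close>

lemma direct_solution_xi:
  assumes m: "direct_solution u0 z m"
  shows "((\<lambda>y. m (xi y)) has_vector_derivative
      mat z ** (dmat ** m (xi y) - m (xi y) ** dmat) + Wf1 y *\<^sub>R (cmat0 ** m (xi y))) (at y)"
    and "\<exists>B. \<forall>y. norm (m (xi y)) \<le> B"
    and "((\<lambda>y. m (xi y) $ l $ l) \<longlongrightarrow> 1) at_top"
proof -
  have "(m has_vector_derivative q_init u0 (xi y) *\<^sub>R (mat z ** (dmat ** m (xi y) - m (xi y) ** dmat)) + w1 (xi y) *\<^sub>R (cmat0 ** m (xi y))) (at (xi y))"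
    by (rule vec_has_vector_derivativeI, rule has_vector_derivative_eq_rhs[OF direct_solution_entry(1)[OF m]])
      (simp add: commutator_entry, simp add: scaleR_conv_of_real)
  from vector_diff_chain_at[OF xi_deriv[unfolded has_real_derivative_iff_has_vector_derivative] this]
  show "((\<lambda>y. m (xi y)) has_vector_derivative
      mat z ** (dmat ** m (xi y) - m (xi y) ** dmat) + Wf1 y *\<^sub>R (cmat0 ** m (xi y))) (at y)"
    by (simp add: o_def scaleR_add_right exp_w0(1)[symmetric] Wf1_def mult.commute flip: exp_add)
  show "\<exists>B. \<forall>y. norm (m (xi y)) \<le> B" using m unfolding direct_solution_def bounded_iff by auto
  from filterlim_compose[OF direct_solution_entry(2)[OF m] xi_at_top]
  show "((\<lambda>y. m (xi y) $ l $ l) \<longlongrightarrow> 1) at_top" .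
qed

end

section \<open>The Riemann--Hilbert problem\<close>

lemma directions_nonzero: "d \<in> directions \<Longrightarrow> d \<noteq> 0"
  using omega_nonzero by (auto simp: directions_def)

lemma Sigma_contour_eq: "Sigma_contour = (\<Union>d\<in>directions. {z. Im (z / d) = 0})"
proof (intro set_eqI iffI)
  fix z assume "z \<in> Sigma_contour"
  then show "z \<in> (\<Union>d\<in>directions. {z. Im (z / d) = 0})"
    using directions_nonzero unfolding Sigma_contour_def by fastforce
next
  fix z assume "z \<in> (\<Union>d\<in>directions. {z. Im (z / d) = 0})"
  then show "z \<in> Sigma_contour" using real_mult_in_Sigma directions_nonzero by blast
qed

lemma closed_Sigma_contour: "closed Sigma_contour"
  unfolding Sigma_contour_eq
proof (intro closed_UN ballI)
  show "finite directions" by (simp add: directions_def)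
  show "closed {z. Im (z / d) = 0}" if "d \<in> directions" for d
    using directions_nonzero[OF that] by (intro closed_Collect_eq continuous_intros) auto
qed

text \<open>The positive imaginary axis avoids the contour and accumulates at 0; without this,
  limits at 0 off the contour would not be unique.\<close>

lemma at_0_off_Sigma_nontrivial: "at 0 within - Sigma_contour \<noteq> bot"
proof -
  have "\<i> * of_real e \<in> - Sigma_contour" if "e > 0" for e :: real
  proof -
    have "Im (\<i> * of_real e / d) \<noteq> 0" if "d \<in> directions" for d
      using that \<open>e > 0\<close> Re_omega Im_omega omega_cube omega_sq
      by (auto simp: directions_def Im_divide power2_eq_square)
    then show ?thesis by (simp add: Sigma_contour_eq)
  qed
  then have "0 islimpt - Sigma_contour"
    unfolding islimpt_approachable
  proof (intro allI impI)
    fix e :: real assume e: "0 < e"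
    show "\<exists>x'\<in>- Sigma_contour. x' \<noteq> 0 \<and> dist x' 0 < e"
    proof (rule bexI[of _ "\<i> * of_real (e / 2)"])
      show "\<i> * of_real (e / 2) \<in> - Sigma_contour" using e by (intro \<open>\<And>e. e > 0 \<Longrightarrow> \<i> * of_real e \<in> - Sigma_contour\<close>) simp
      show "\<i> * of_real (e / 2) \<noteq> 0 \<and> dist (\<i> * of_real (e / 2)) 0 < e" using e by (simp add: norm_mult norm_divide)
    qed
  qed
  then show ?thesis by (simp add: trivial_limit_within)
qed

lemma cmat_tendstoI: "(\<And>i j. ((\<lambda>z. A z $ i $ j) \<longlongrightarrow> L $ i $ j) G) \<Longrightarrow> (A \<longlongrightarrow> L) G" for A :: "'z \<Rightarrow> cmat"
  by (intro vec_tendstoI) auto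

lemma holomorphic_cmat_near_0:
  fixes g :: "complex \<Rightarrow> cmat"
  assumes g: "\<And>i j. (\<lambda>k. g k $ i $ j) holomorphic_on UNIV"
  shows "\<exists>c. \<forall>\<^sub>F k in at 0. norm (g k - g 0) \<le> c * norm k"
proof -
  have "\<exists>c. \<forall>\<^sub>F k in at 0. norm (g k $ i $ j - g 0 $ i $ j) \<le> c * norm k" for i j
  proof -
    obtain f' where f': "((\<lambda>k. g k $ i $ j) has_field_derivative f') (at 0)"
      using g[of i j] by (auto simp: holomorphic_on_def field_differentiable_def)
    then have "((\<lambda>k. (g k $ i $ j - g 0 $ i $ j) / k) \<longlongrightarrow> f') (at 0)" by (simp add: has_field_derivative_iff)
    from tendsto_norm[OF this]
    have "\<forall>\<^sub>F k in at 0. norm ((g k $ i $ j - g 0 $ i $ j) / k) < norm f' + 1"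
      by (rule order_tendstoD) simp
    moreover have "\<forall>\<^sub>F k::complex in at 0. k \<noteq> 0" by (simp add: eventually_at_filter)
    ultimately have "\<forall>\<^sub>F k in at 0. norm (g k $ i $ j - g 0 $ i $ j) \<le> (norm f' + 1) * norm k"
      by eventually_elim (simp add: norm_divide divide_less_eq less_imp_le)
    then show ?thesis by blast
  qed
  note ex = this
  define c where "c i j = (SOME c. \<forall>\<^sub>F k in at 0. norm (g k $ i $ j - g 0 $ i $ j) \<le> c * norm k)" for i j
  have c: "\<forall>\<^sub>F k in at 0. norm (g k $ i $ j - g 0 $ i $ j) \<le> c i j * norm k" for i j
    unfolding c_def by (rule someI_ex[OF ex])
  define b where "b = (\<Sum>i\<in>UNIV. \<Sum>j\<in>UNIV. \<bar>c i j\<bar>)"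
  have cb: "c i j \<le> b" for i j
  proof -
    have "\<bar>c i j\<bar> \<le> (\<Sum>j\<in>UNIV. \<bar>c i j\<bar>)" by (rule member_le_sum) auto
    also have "\<dots> \<le> b" unfolding b_def by (rule member_le_sum) (auto intro: sum_nonneg)
    finally show ?thesis by simp
  qed
  have "\<forall>\<^sub>F k in at 0. \<forall>i j. norm (g k $ i $ j - g 0 $ i $ j) \<le> c i j * norm k"
    by (intro eventually_all_finite c)
  then have "\<forall>\<^sub>F k in at 0. norm (g k - g 0) \<le> 9 * b * norm k"
  proof eventually_elim
    case (elim k)
    have "norm ((g k - g 0) $ i $ j) \<le> b * norm k" for i j
      using elim order_trans[OF _ mult_right_mono[OF cb norm_ge_zero]] by (metis vector_minus_component)
    then have "norm (g k - g 0) \<le> 9 * (b * norm k)" by (rule norm_le_sum_entries)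
    then show ?case by simp
  qed
  then show ?thesis by blast
qed

lemma holomorphic_cmat_at_infinity:
  fixes g :: "complex \<Rightarrow> cmat"
  assumes "\<And>i j. (\<lambda>k. g k $ i $ j) holomorphic_on UNIV" "g 0 = mat 1"
  shows "\<exists>c. \<forall>\<^sub>F z in at_infinity. norm (g (inverse z) - mat 1) \<le> c / norm z"
proof -
  obtain c where "\<forall>\<^sub>F k in at 0. norm (g k - g 0) \<le> c * norm k" using holomorphic_cmat_near_0[OF assms(1)] by blast
  moreover have "filterlim inverse (at 0) (at_infinity :: complex filter)" by (simp add: filterlim_inverse_at_iff filterlim_ident)
  ultimately have "\<forall>\<^sub>F z in at_infinity. norm (g (inverse z) - g 0) \<le> c * norm (inverse z)"
    by (rule eventually_compose_filterlim)
  then show ?thesis unfolding assms(2) by (auto simp: norm_inverse divide_inverse)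
qed

text \<open>\<open>Emat\<close> as a function of k = 1/z, in which it is entire. This makes its
  behaviour at z = infinity a statement about a Taylor expansion at 0.\<close>

definition Kmat :: "real \<Rightarrow> complex \<Rightarrow> cmat" where
  "Kmat t k = diag_mat (\<chi> j. exp (- (of_real t * (k * inverse (lam 1 $ j)))))"

lemma Emat_Kmat: "Emat t z = Kmat t (inverse z)"
proof -
  have "inverse (lam z $ j) = inverse z * inverse (lam 1 $ j)" for j by (subst lam_scale) simp
  then show ?thesis by (simp add: Emat_def Kmat_def)
qed

lemma Kmat_holomorphic: "(\<lambda>k. Kmat t k $ i $ j) holomorphic_on UNIV"
  by (cases "i = j") (auto simp: Kmat_def diag_mat_def intro!: holomorphic_intros)

lemma Kmat_0: "Kmat t 0 = mat 1"
  by (simp add: Kmat_def diag_mat_def mat_def cong: if_cong)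

text \<open>Diagonal matrices commute, so the right factor \<open>Emat\<close> turns the exponents
  of the jump at time 0 into those at time t.\<close>

lemma Emat_exp_conj: "Emat t z ** exp_conj (phase y t z) S = exp_conj (of_real y *s lam z) S ** Emat t z"
  by (simp add: vec_eq_iff exp_conj_def Emat_def phase_def diag_mat_mult_left diag_mat_mult_right mult_ac flip: exp_add)
    (simp add: exp_minus exp_add exp_diff field_simps)

text \<open>The left factor \<open>g (inverse z)\<close> is continuous across the contour away from
  0, so it drops out of jumps and residues, and its value 1 at infinity keeps the normalization; the
  right factor \<open>Emat\<close> changes the exponents. Only the limit at z = 0 is not automatic;
  it is a hypothesis where it is used.\<close>

locale rhp_gauge =
  fixes g :: "complex \<Rightarrow> cmat" and m :: "complex \<Rightarrow> cmat" and Z :: "complex set" and y t :: real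
  assumes g: "\<And>i j. (\<lambda>k. g k $ i $ j) holomorphic_on UNIV" and g_0: "g 0 = mat 1"
    and Z: "finite Z" "Z \<inter> Sigma_contour = {}"
    and m: "piecewise_holomorphic_off Z m"
begin

definition N :: "complex \<Rightarrow> cmat" where "N z = g (inverse z) ** (m z ** Emat t z)"

lemma N_entry: "N z $ i $ k = (\<Sum>b\<in>UNIV. g (inverse z) $ i $ b * m z $ b $ k) * exp (- (of_real t * inverse (lam z $ k)))"
  unfolding N_def matrix_mul_assoc Emat_def diag_mat_mult_right by (simp add: matrix_matrix_mult_def)

lemma holo_g: "(\<lambda>z. g (inverse z) $ i $ j) holomorphic_on - {0}"
proof -
  have "(inverse :: complex \<Rightarrow> complex) holomorphic_on - {0}" by (intro holomorphic_intros) auto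
  from holomorphic_on_compose[OF this holomorphic_on_subset[OF g]] show ?thesis by (simp add: o_def)
qed

lemma holo_exp: "(\<lambda>z. exp (- (of_real t * inverse (lam z $ k)))) holomorphic_on - {0}"
proof -
  have "(\<lambda>z. exp (- (of_real t * inverse (lam z $ k)))) = (\<lambda>z. exp (- (of_real t * inverse (z * lam 1 $ k))))"
    by (rule ext, subst lam_scale, rule refl)
  moreover have "(\<lambda>z. exp (- (of_real t * inverse (z * lam 1 $ k)))) holomorphic_on - {0}"
    by (intro holomorphic_intros) (auto simp: lam_1_nonzero)
  ultimately show ?thesis by (simp only:)
qed

lemma isCont_entry:
  assumes "z \<noteq> 0"
  shows "isCont (\<lambda>z. g (inverse z) $ i $ j) z" "isCont (\<lambda>z. exp (- (of_real t * inverse (lam z $ k)))) z"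
  using holomorphic_on_imp_continuous_on[OF holo_g] holomorphic_on_imp_continuous_on[OF holo_exp] assms
  by (auto simp: continuous_on_eq_continuous_at open_Compl)

lemma N_tendsto:
  assumes "z \<noteq> 0" "(m \<longlongrightarrow> L) (at z within S)"
  shows "(N \<longlongrightarrow> g (inverse z) ** (L ** Emat t z)) (at z within S)"
proof -
  have "((\<lambda>z. g (inverse z)) \<longlongrightarrow> g (inverse z)) (at z within S)"
    using isCont_entry(1)[OF assms(1)] by (intro cmat_tendstoI) (auto simp: isCont_def intro: tendsto_within_subset)
  moreover have "(Emat t \<longlongrightarrow> Emat t z) (at z within S)"
    using isCont_entry(2)[OF assms(1)]
    by (intro cmat_tendstoI) (auto simp: Emat_def diag_mat_def isCont_def intro: tendsto_within_subset)
  ultimately show ?thesis unfolding N_def using assms(2) by (intro mm.tendsto)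
qed

lemma N_piecewise_holomorphic_off:
  assumes "(N \<longlongrightarrow> L) (at 0 within - Sigma_contour)"
  shows "piecewise_holomorphic_off Z N"
  unfolding piecewise_holomorphic_off_def
proof (intro conjI allI ballI impI)
  fix i k
  have "- (Sigma_contour \<union> Z) \<subseteq> - {0}" using zero_in_Sigma by auto
  then show "(\<lambda>z. N z $ i $ k) holomorphic_on - (Sigma_contour \<union> Z)"
    unfolding N_entry using m unfolding piecewise_holomorphic_off_def
    by (intro holomorphic_intros holomorphic_on_subset[OF holo_g] holomorphic_on_subset[OF holo_exp]) auto
next
  fix d r assume d: "d \<in> directions" "(r::real) \<noteq> 0"
  then have nz: "d * of_real r \<noteq> 0" using directions_nonzero by auto
  show "\<exists>L. (N \<longlongrightarrow> L) (at (d * of_real r) within left_side d)" "\<exists>L. (N \<longlongrightarrow> L) (at (d * of_real r) within right_side d)"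
    using m d N_tendsto[OF nz] unfolding piecewise_holomorphic_off_def by blast+
qed (use assms in blast)

lemma N_jump:
  assumes "jump_condition m (\<lambda>z. exp_conj (of_real y *s lam z) (S z))"
  shows "jump_condition N (\<lambda>z. exp_conj (phase y t z) (S z))"
  unfolding jump_condition_def
proof (intro ballI allI impI)
  fix d r assume d: "d \<in> directions" "(r::real) \<noteq> 0"
  let ?z = "d * of_real r"
  have nz: "?z \<noteq> 0" using d directions_nonzero by auto
  obtain Mp Mm where M: "(m \<longlongrightarrow> Mp) (at ?z within left_side d)" "(m \<longlongrightarrow> Mm) (at ?z within right_side d)"
    "Mp = Mm ** exp_conj (of_real y *s lam ?z) (S ?z)"
    using assms d unfolding jump_condition_def by blast
  have "g (inverse ?z) ** (Mp ** Emat t ?z) = g (inverse ?z) ** (Mm ** Emat t ?z) ** exp_conj (phase y t ?z) (S ?z)"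
    unfolding M(3) matrix_mul_assoc[symmetric] Emat_exp_conj ..
  then show "\<exists>Np Nm. (N \<longlongrightarrow> Np) (at ?z within left_side d) \<and> (N \<longlongrightarrow> Nm) (at ?z within right_side d) \<and>
      Np = Nm ** exp_conj (phase y t ?z) (S ?z)"
    using N_tendsto[OF nz M(1)] N_tendsto[OF nz M(2)] by blast
qed

text \<open>All three factors are 1 + O(1/z), and the product is compared with 1 by changing one
  factor at a time. The constant c serves both as a radius and as a bound.\<close>

lemma N_bigo:
  assumes c: "c > 0" "\<And>z. z \<notin> Sigma_contour \<union> Z \<Longrightarrow> c \<le> norm z \<Longrightarrow> norm (m z - mat 1) \<le> c / norm z"
  shows "(\<lambda>z. N z $ i $ k - mat 1 $ i $ k) \<in> O[inf at_infinity (principal (- Sigma_contour))](\<lambda>z. 1 / z)"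
proof -
  obtain c1 where c1: "\<forall>\<^sub>F z in at_infinity. norm (g (inverse z) - mat 1) \<le> c1 / norm z"
    using holomorphic_cmat_at_infinity[OF g g_0] by blast
  obtain c2 where c2: "\<forall>\<^sub>F z in at_infinity. norm (Emat t z - mat 1) \<le> c2 / norm z"
    using holomorphic_cmat_at_infinity[OF Kmat_holomorphic Kmat_0] unfolding Emat_Kmat by blast
  obtain R where R: "\<And>p. p \<in> Z \<Longrightarrow> norm p \<le> R" using finite_imp_bounded[OF Z(1)] unfolding bounded_iff by blast
  have big: "\<forall>\<^sub>F z :: complex in at_infinity. norm z \<ge> 1 + c + \<bar>R\<bar>" unfolding eventually_at_infinity by blast
  define n where "n = norm (mat 1 :: cmat)"
  define C where "C = mmK * \<bar>c1\<bar> * (mmK * (n + c) * (n + \<bar>c2\<bar>)) + mmK * c * (n + \<bar>c2\<bar>) + \<bar>c2\<bar>"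
  have "\<forall>\<^sub>F z in at_infinity. z \<notin> Sigma_contour \<longrightarrow> norm (N z - mat 1) \<le> C / norm z"
    using c1 c2 big
  proof eventually_elim
    case (elim z)
    show ?case
    proof
      assume z: "z \<notin> Sigma_contour"
      have r: "norm z \<ge> 1" "norm z \<ge> c" "norm z > R" using elim(3) c(1) by linarith+
      then have "z \<notin> Z" using R by fastforce
      then have m1: "norm (m z - mat 1) \<le> c / norm z" using c(2) z r by blast
      have inv: "b / norm z \<le> b" if "b \<ge> 0" for b using that r(1) by (simp add: divide_le_eq mult_left_le mult_le_cancel_left1)
      have g1: "norm (g (inverse z) - mat 1) \<le> \<bar>c1\<bar> / norm z"
        by (rule order_trans[OF elim(1)]) (simp add: divide_right_mono)
      have E1: "norm (Emat t z - mat 1) \<le> \<bar>c2\<bar> / norm z"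
        by (rule order_trans[OF elim(2)]) (simp add: divide_right_mono)
      have m2: "norm (m z) \<le> n + c"
        using norm_triangle_sub[of "m z" "mat 1"] m1 inv[of c] c(1) by (simp add: n_def)
      have E2: "norm (Emat t z) \<le> n + \<bar>c2\<bar>"
        using norm_triangle_sub[of "Emat t z" "mat 1"] E1 inv[of "\<bar>c2\<bar>"] by (simp add: n_def)
      have eq: "N z - mat 1 = (g (inverse z) - mat 1) ** (m z ** Emat t z) + (m z - mat 1) ** Emat t z + (Emat t z - mat 1)"
        unfolding N_def by (simp add: mat_distribs)
      have "norm (N z - mat 1) \<le> norm ((g (inverse z) - mat 1) ** (m z ** Emat t z)) + norm ((m z - mat 1) ** Emat t z) + norm (Emat t z - mat 1)"
        unfolding eq by (rule norm_triangle_le, rule add_right_mono, rule norm_triangle_ineq)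
      also have "\<dots> \<le> mmK * (\<bar>c1\<bar> / norm z) * (mmK * (n + c) * (n + \<bar>c2\<bar>)) + mmK * (c / norm z) * (n + \<bar>c2\<bar>) + \<bar>c2\<bar> / norm z"
        by (intro add_mono norm_mult_le g1 m1 m2 E2 E1)
      also have "\<dots> = C / norm z" by (simp add: C_def add_divide_distrib)
      finally show "norm (N z - mat 1) \<le> C / norm z" .
    qed
  qed
  then have "\<forall>\<^sub>F z in inf at_infinity (principal (- Sigma_contour)). norm (N z $ i $ k - mat 1 $ i $ k) \<le> C * norm (1 / z)"
    unfolding eventually_inf_principal
  proof eventually_elim
    case (elim z)
    then show ?case using order_trans[OF norm_entry_le[of "N z - mat 1" i k]] by (auto simp: norm_divide)
  qed
  then show ?thesis by (rule bigoI)
qed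

text \<open>The left factor mixes rows and is regular at p, the right factor scales columns. So the
  proportionality of a residue to a column persists, with its constant multiplied by a quotient of
  two exponentials.\<close>

lemma N_residue:
  assumes p: "p \<in> Z" and neq: "j \<noteq> l"
    and res: "residue_condition m p l j (v * exp (of_real y * (lam p $ j - lam p $ l)))"
  shows "residue_condition N p l j (v * exp (of_real y * (lam p $ j - lam p $ l) + of_real t * (inverse (lam p $ j) - inverse (lam p $ l))))"
proof -
  have p0: "p \<noteq> 0" using p Z(2) zero_in_Sigma by auto
  define E where "E k z = exp (- (of_real t * inverse (lam z $ k)))" for k z
  define c where "c = v * exp (of_real y * (lam p $ j - lam p $ l))"
  have Et: "((\<lambda>z. E k z) \<longlongrightarrow> E k p) (at p)" for k using isCont_entry(2)[OF p0] by (simp add: isCont_def E_def)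
  have gt: "((\<lambda>z. g (inverse z) $ i $ b) \<longlongrightarrow> g (inverse p) $ i $ b) (at p)" for i b using isCont_entry(1)[OF p0] by (simp add: isCont_def)
  have op: "open (- (Sigma_contour \<union> (Z - {p})))"
    using closed_Sigma_contour Z(1) by (intro open_Compl closed_Un) (auto intro: finite_imp_closed)
  have pin: "p \<in> - (Sigma_contour \<union> (Z - {p}))" using p Z(2) by auto
  have sub: "- (Sigma_contour \<union> (Z - {p})) - {p} = - (Sigma_contour \<union> Z)" using p by auto
  have regular: "\<exists>L. ((\<lambda>z. m z $ b $ k) \<longlongrightarrow> L) (at p)" if "k \<noteq> l" for b k
    using res that unfolding residue_condition_def by blast
  have "\<exists>L. \<forall>b. ((\<lambda>z. m z $ b $ k) \<longlongrightarrow> L b) (at p)" if "k \<noteq> l" for k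
    using regular[OF that] by metis
  then obtain L where L: "\<And>k b. k \<noteq> l \<Longrightarrow> ((\<lambda>z. m z $ b $ k) \<longlongrightarrow> L k b) (at p)" by metis
  have "\<exists>r. ((\<lambda>z. (z - p) * m z $ b $ l) \<longlongrightarrow> r) (at p)" for b using res unfolding residue_condition_def by blast
  then obtain r where r: "\<And>b. ((\<lambda>z. (z - p) * m z $ b $ l) \<longlongrightarrow> r b) (at p)" by metis
  have hm: "(\<lambda>z. m z $ b $ l) holomorphic_on - (Sigma_contour \<union> (Z - {p})) - {p}" for b
    unfolding sub using m unfolding piecewise_holomorphic_off_def by blast
  have rL: "r b = L j b * c" for b
  proof -
    have "residue (\<lambda>z. m z $ b $ l) p = r b"
      by (rule residue_simple'[OF op pin hm]) (use r[of b] in \<open>simp add: mult.commute\<close>)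
    moreover have "Lim (at p) (\<lambda>z. m z $ b $ j) = L j b" using L[OF neq] by (intro tendsto_Lim) auto
    moreover have "residue (\<lambda>z. m z $ b $ l) p = Lim (at p) (\<lambda>z. m z $ b $ j) * c"
      using res unfolding residue_condition_def c_def by blast
    ultimately show ?thesis by simp
  qed
  have N1: "((\<lambda>z. N z $ i $ k) \<longlongrightarrow> (\<Sum>b\<in>UNIV. g (inverse p) $ i $ b * L k b) * E k p) (at p)" if "k \<noteq> l" for i k
    unfolding N_entry E_def[symmetric] by (rule tendsto_mult[OF tendsto_sum[OF tendsto_mult[OF gt L[OF that]]] Et])
  have N2: "((\<lambda>z. (z - p) * N z $ i $ l) \<longlongrightarrow> (\<Sum>b\<in>UNIV. g (inverse p) $ i $ b * r b) * E l p) (at p)" for i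
  proof -
    have "(z - p) * N z $ i $ l = (\<Sum>b\<in>UNIV. g (inverse z) $ i $ b * ((z - p) * m z $ b $ l)) * E l z" for z
      unfolding N_entry E_def[symmetric] by (simp add: sum_distrib_left mult_ac)
    then show ?thesis by (simp only:) (rule tendsto_mult[OF tendsto_sum[OF tendsto_mult[OF gt r]] Et])
  qed
  have hN: "(\<lambda>z. N z $ i $ l) holomorphic_on - (Sigma_contour \<union> (Z - {p})) - {p}" for i
  proof -
    have "- (Sigma_contour \<union> (Z - {p})) - {p} \<subseteq> - {0}" using zero_in_Sigma by auto
    then show ?thesis unfolding N_entry
      by (intro holomorphic_intros hm holomorphic_on_subset[OF holo_g] holomorphic_on_subset[OF holo_exp])
  qed
  have "c * E l p = E j p * (v * exp (of_real y * (lam p $ j - lam p $ l) + of_real t * (inverse (lam p $ j) - inverse (lam p $ l))))"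
    unfolding c_def E_def by (simp add: exp_add exp_diff exp_minus right_diff_distrib field_simps)
  moreover have "residue (\<lambda>z. N z $ i $ l) p = (\<Sum>b\<in>UNIV. g (inverse p) $ i $ b * r b) * E l p" for i
    by (rule residue_simple'[OF op pin hN]) (use N2[of i] in \<open>simp add: mult.commute\<close>)
  moreover have "Lim (at p) (\<lambda>z. N z $ i $ j) = (\<Sum>b\<in>UNIV. g (inverse p) $ i $ b * L j b) * E j p" for i
    using N1[OF neq] by (intro tendsto_Lim) auto
  moreover have "(\<Sum>b\<in>UNIV. g (inverse p) $ i $ b * r b) = (\<Sum>b\<in>UNIV. g (inverse p) $ i $ b * L j b) * c" for i
    by (simp add: rL sum_distrib_left mult_ac)
  ultimately have "residue (\<lambda>z. N z $ i $ l) p = Lim (at p) (\<lambda>z. N z $ i $ j) *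
      (v * exp (of_real y * (lam p $ j - lam p $ l) + of_real t * (inverse (lam p $ j) - inverse (lam p $ l))))" for i
    by (simp only: mult.assoc)
  then show ?thesis unfolding residue_condition_def using N1 N2 by blast
qed

end

context schwartz_data begin

lemma strip_exists:
  assumes T: "T \<ge> 0"
  shows "\<exists>w wy P Pt K. tzitzeica_strip a T K w wy P Pt \<and> (\<forall>y\<ge>a. w y 0 = Wf y \<and> wy y 0 = Wf1 y)"
proof -
  obtain C where C: "C \<ge> 0" "\<And>y. \<bar>Wf y\<bar> \<le> C / (1 + \<bar>y\<bar>) ^ 5" "\<And>y. \<bar>Wf1 y\<bar> \<le> C / (1 + \<bar>y\<bar>) ^ 5" by (rule Wf_decay) blast
  \<comment> \<open>The strip measures decay from its left end a; for y \<ge> a the two weights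
    compare by \<open>1 + y - a \<le> (1 + \<bar>a\<bar>) * (1 + \<bar>y\<bar>)\<close>.\<close>
  define b where "b = C * (1 + \<bar>a\<bar>) ^ 5"
  have b: "C / (1 + \<bar>y\<bar>) ^ 5 \<le> b / (1 + y - a) ^ 5" if "y \<ge> a" for y
  proof -
    have "1 + y - a \<le> (1 + \<bar>a\<bar>) * (1 + \<bar>y\<bar>)"
    proof -
      have "0 \<le> \<bar>a\<bar> * \<bar>y\<bar>" by simp
      moreover have "(1 + \<bar>a\<bar>) * (1 + \<bar>y\<bar>) = 1 + \<bar>a\<bar> + \<bar>y\<bar> + \<bar>a\<bar> * \<bar>y\<bar>" by (simp add: algebra_simps)
      ultimately show ?thesis by linarith
    qed
    then have "(1 + y - a) ^ 5 \<le> ((1 + \<bar>a\<bar>) * (1 + \<bar>y\<bar>)) ^ 5" using that by (intro power_mono) auto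
    then have "C * (1 + y - a) ^ 5 \<le> C * ((1 + \<bar>a\<bar>) * (1 + \<bar>y\<bar>)) ^ 5" using C(1) by (rule mult_left_mono)
    moreover have "(1 + y - a) ^ 5 > 0" "(1 + \<bar>y\<bar>) ^ 5 > 0" using that by (auto intro!: zero_less_power)
    ultimately show ?thesis by (simp add: b_def power_mult_distrib divide_le_eq pos_le_divide_eq mult_ac)
  qed
  show ?thesis
  proof (rule tzitzeica_strip_exists[OF T])
    show "(Wf has_real_derivative Wf1 y) (at y within {a..})" for y by (rule has_field_derivative_at_within[OF Wf_deriv])
    show "continuous_on {a..} Wf1" by (intro continuous_at_imp_continuous_on ballI DERIV_isCont[OF Wf1_deriv])
    show "\<bar>Wf y\<bar> \<le> b / (1 + y - a) ^ 5" "\<bar>Wf1 y\<bar> \<le> b / (1 + y - a) ^ 5" if "y \<ge> a" for y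
      using order_trans[OF C(2) b[OF that]] order_trans[OF C(3) b[OF that]] .
  qed
qed

text \<open>The dressed direct eigenfunctions solve the Riemann--Hilbert problem; uniqueness turns this
  into a formula for \<open>Mhat\<close> at \<open>z = 0\<close>.\<close>

lemma qhat_eq_exp:
  assumes strip: "tzitzeica_strip a T K w wy P Pt" and init: "\<And>y. y \<ge> a \<Longrightarrow> w y 0 = Wf y \<and> wy y 0 = Wf1 y"
    and data: "scattering_data u0 M S0 Z lc jc v"
    and unique: "is_unique_rhp_solution S0 Z lc jc v y t Mh"
    and lim: "(Mh \<longlongrightarrow> structure_mat qh) (at 0 within - Sigma_contour)"
    and y: "y \<ge> a" and t: "t \<in> {0..T}"
  shows "qh = exp (w y t)"
proof -
  interpret tzitzeica_strip a T K w wy P Pt by fact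
  have Z: "finite Z" "Z \<inter> Sigma_contour = {}"
    and direct: "\<And>z. z \<notin> Sigma_contour \<union> Z \<Longrightarrow> direct_solution u0 z (\<lambda>x. M x z)"
    and pw: "\<And>x. piecewise_holomorphic_off Z (M x)"
    and jump: "\<And>x. jump_condition (M x) (\<lambda>z. exp_conj (of_real (y_init u0 x) *s lam z) (S0 z))"
    and res: "\<And>c x. c \<in> Z \<Longrightarrow> jc c \<noteq> lc c \<and> residue_condition (M x) c (lc c) (jc c)
               (v c * exp (of_real (y_init u0 x) * (lam c $ jc c - lam c $ lc c)))"
    using data unfolding scattering_data_def by blast+
  obtain C where C: "C \<ge> 0" "\<And>y. \<bar>Wf y\<bar> \<le> C / (1 + \<bar>y\<bar>) ^ 5" "\<And>y. \<bar>Wf1 y\<bar> \<le> C / (1 + \<bar>y\<bar>) ^ 5"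
    "\<And>y. \<bar>Wf2 y\<bar> \<le> C / (1 + \<bar>y\<bar>) ^ 5" by (rule Wf_decay) blast
  have five: "2 + 3 = (5::nat)" by simp
  note C2 = C(2-4)[THEN order_trans, OF one_plus_abs_power_le[of C _ 3, unfolded five, OF C(1)]]
  obtain c where c: "c > 0" and small: "\<And>z m B y. z \<notin> Sigma_contour \<Longrightarrow> c * norm z \<le> 1 \<Longrightarrow>
      (\<And>y. (m has_vector_derivative mat z ** (dmat ** m y - m y ** dmat) + Wf1 y *\<^sub>R (cmat0 ** m y)) (at y)) \<Longrightarrow>
      (\<And>y. norm (m y) \<le> B) \<Longrightarrow> (\<And>l. ((\<lambda>y. m y $ l $ l) \<longlongrightarrow> 1) at_top) \<Longrightarrow>
      norm (Gmat (- Wf y) ** m y - mat 1) \<le> c * norm z"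
    using line_small_z[OF Wf_deriv C2(1)] by blast
  obtain c' where c': "c' > 0" and large: "\<And>z m B y. z \<notin> Sigma_contour \<Longrightarrow> c' \<le> norm z \<Longrightarrow>
      (\<And>y. (m has_vector_derivative mat z ** (dmat ** m y - m y ** dmat) + Wf1 y *\<^sub>R (cmat0 ** m y)) (at y)) \<Longrightarrow>
      (\<And>y. norm (m y) \<le> B) \<Longrightarrow> (\<And>l. ((\<lambda>y. m y $ l $ l) \<longlongrightarrow> 1) at_top) \<Longrightarrow>
      norm (m y - mat 1) \<le> c' / norm z"
    using line_large_z[OF Wf1_deriv C2(2,3)] by blast
  obtain r where r: "r > 0" "\<And>c. c \<in> Z \<Longrightarrow> r \<le> norm c"
  proof -
    obtain r where "r > 0" "\<forall>x\<in>Z. x \<noteq> 0 \<longrightarrow> r \<le> dist 0 x" using finite_set_avoid[OF Z(1), of 0] by blast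
    moreover have "0 \<notin> Z" using Z(2) zero_in_Sigma by blast
    ultimately show thesis using that by (metis dist_0_norm)
  qed
  \<comment> \<open>Within this radius there are no poles, and the condition
    \<open>c * norm z \<le> 1\<close> of the small-z estimate holds.\<close>
  define \<delta> where "\<delta> = min r (1 / c)"
  have \<delta>: "\<delta> > 0" using r(1) c by (simp add: \<delta>_def)
  have off: "z \<notin> Sigma_contour \<union> Z" "c * norm z \<le> 1" if "z \<notin> Sigma_contour" "norm z < \<delta>" for z
    using that r(2)[of z] c unfolding \<delta>_def by (auto simp: less_divide_eq mult.commute)
  \<comment> \<open>The eigenfunctions are taken at \<open>xi y\<close>, where \<open>y_init\<close>
    equals y, so their jump and residue conditions are those of the problem at (y, 0).\<close>
  interpret rhp_gauge "F y t" "M (xi y)" Z y t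
    by unfold_locales (use F_props[OF y] t Z pw in auto)
  have lim_N: "(N \<longlongrightarrow> Gmat (w y t)) (at 0 within - Sigma_contour)"
    unfolding N_def
  proof (rule dressed_limit[OF \<delta> _ _ _ _ y t, of "\<lambda>y. M (xi y)" c])
    fix y z assume y: "y \<ge> a" and z: "z \<notin> Sigma_contour" "norm z < \<delta>"
    note d = direct_solution_xi[OF direct[OF off(1)[OF z]]]
    show "((\<lambda>y. M (xi y) z) has_vector_derivative mat z ** (dmat ** M (xi y) z - M (xi y) z ** dmat) + wy y 0 *\<^sub>R (cmat0 ** M (xi y) z)) (at y within {a..})"
      using has_vector_derivative_at_within[OF d(1)] init[OF y] by simp
    obtain B where B: "\<And>y. norm (M (xi y) z) \<le> B" using d(2) by blast
    show "norm (Gmat (- w y 0) ** M (xi y) z - mat 1) \<le> c * norm z"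
      using small[OF z(1) off(2)[OF z] d(1) B d(3), of y] init[OF y] by simp
  next
    fix z l assume z: "z \<notin> Sigma_contour" "norm z < \<delta>"
    note d = direct_solution_xi[OF direct[OF off(1)[OF z]]]
    show "\<exists>B. \<forall>y\<ge>a. norm (M (xi y) z) \<le> B" using d(2) by blast
    show "((\<lambda>y. M (xi y) z $ l $ l) \<longlongrightarrow> 1) at_top" by (rule d(3))
  qed
  have large_z: "norm (M (xi y) z - mat 1) \<le> c' / norm z" if z: "z \<notin> Sigma_contour \<union> Z" "c' \<le> norm z" for z
  proof -
    note d = direct_solution_xi[OF direct[OF z(1)]]
    obtain B where B: "\<And>y. norm (M (xi y) z) \<le> B" using d(2) by blast
    show ?thesis using large[OF _ z(2) d(1) B d(3), of y] z(1) by simp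
  qed
  have "rhp_solution S0 Z lc jc v y t N"
    unfolding rhp_solution_def
  proof (intro conjI allI ballI)
    show "piecewise_holomorphic_off Z N" by (rule N_piecewise_holomorphic_off[OF lim_N])
    show "jump_condition N (\<lambda>z. exp_conj (phase y t z) (S0 z))"
      using jump[of "xi y"] by (intro N_jump) (simp add: y_init_xi)
    show "(\<lambda>z. N z $ i $ k - mat 1 $ i $ k) \<in> O[inf at_infinity (principal (- Sigma_contour))](\<lambda>z. 1 / z)" for i k
      by (rule N_bigo[OF c' large_z])
    show "residue_condition N z (lc z) (jc z)
               (v z * exp (of_real y * (lam z $ jc z - lam z $ lc z)
                         + of_real t * (inverse (lam z $ jc z) - inverse (lam z $ lc z))))" if "z \<in> Z" for z
      using res[OF that, of "xi y"] by (intro N_residue that) (simp_all add: y_init_xi)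
  qed
  then have eq: "N z = Mh z" if "z \<notin> Sigma_contour \<union> Z" for z
    using unique that unfolding is_unique_rhp_solution_def by blast
  have "\<forall>\<^sub>F z in at 0 within - Sigma_contour. N z = Mh z"
    unfolding eventually_at by (intro exI[of _ r] conjI r(1) ballI impI eq) (use r(2) in fastforce)
  with lim_N have "(Mh \<longlongrightarrow> Gmat (w y t)) (at 0 within - Sigma_contour)" by (rule Lim_transform_eventually)
  then have "structure_mat qh = Gmat (w y t)" by (rule tendsto_unique[OF at_0_off_Sigma_nontrivial lim])
  then show ?thesis unfolding Gmat_structure[symmetric] by (rule structure_mat_inj)
qed

end

section \<open>From the Goursat problem to the wave equation\<close>

text \<open>A substitute for joint differentiability, given joint continuity of the y-derivative.
  The slope g is attained at intermediate points that tend to y, so it converges; being a value of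
  \<open>fy\<close>, it also inherits positivity where \<open>fy\<close> is positive.\<close>

lemma mean_value_limit:
  fixes f fy :: "real \<Rightarrow> real \<Rightarrow> real" and c :: "real \<Rightarrow> real"
  assumes f: "\<And>y s. s \<ge> 0 \<Longrightarrow> ((\<lambda>y. f y s) has_real_derivative fy y s) (at y)"
    and fy: "continuous_on (UNIV \<times> {0..}) (\<lambda>(y, s). fy y s)"
    and c: "(c \<longlongrightarrow> y) (at t within {0..})" and t: "t \<ge> 0"
  shows "\<exists>g. (\<forall>s\<ge>0. f (c s) s - f y s = g s * (c s - y)) \<and> (g \<longlongrightarrow> fy y t) (at t within {0..}) \<and>
    (\<forall>s\<ge>0. \<exists>b. g s = fy b s)"
proof -
  have "\<exists>b. \<bar>b - y\<bar> \<le> \<bar>c s - y\<bar> \<and> (s \<ge> 0 \<longrightarrow> f (c s) s - f y s = fy b s * (c s - y))" for s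
  proof (cases "s \<ge> 0 \<and> c s \<noteq> y")
    case True
    then consider "y < c s" | "c s < y" by linarith
    then show ?thesis
    proof cases
      case 1
      from MVT2[OF this, of "\<lambda>y. f y s" "\<lambda>y. fy y s"] obtain b where "y < b" "b < c s" "f (c s) s - f y s = (c s - y) * fy b s"
        using f True by blast
      then show ?thesis by (intro exI[of _ b]) (simp add: mult.commute)
    next
      case 2
      from MVT2[OF this, of "\<lambda>y. f y s" "\<lambda>y. fy y s"] obtain b where "c s < b" "b < y" "f y s - f (c s) s = (y - c s) * fy b s"
        using f True by blast
      then show ?thesis by (intro exI[of _ b]) (auto simp: algebra_simps)
    qed
  qed (auto intro: exI[of _ y])
  from choice[OF allI[OF this]] obtain b
    where "\<forall>s. \<bar>b s - y\<bar> \<le> \<bar>c s - y\<bar> \<and> (s \<ge> 0 \<longrightarrow> f (c s) s - f y s = fy (b s) s * (c s - y))" ..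
  then have b: "\<And>s. \<bar>b s - y\<bar> \<le> \<bar>c s - y\<bar>" "\<And>s. s \<ge> 0 \<Longrightarrow> f (c s) s - f y s = fy (b s) s * (c s - y)"
    by simp_all
  have "((\<lambda>s. \<bar>c s - y\<bar>) \<longlongrightarrow> 0) (at t within {0..})" using c by (simp add: LIM_zero tendsto_rabs_zero)
  then have "((\<lambda>s. b s - y) \<longlongrightarrow> 0) (at t within {0..})"
    by (rule Lim_null_comparison[rotated]) (simp add: b(1))
  then have "(b \<longlongrightarrow> y) (at t within {0..})" by (simp add: LIM_zero_iff)
  then have "((\<lambda>s. (b s, s)) \<longlongrightarrow> (y, t)) (at t within {0..})" by (intro tendsto_intros)
  moreover have "\<forall>\<^sub>F s in at t within {0..}. (b s, s) \<in> UNIV \<times> {0..}" by (auto simp: eventually_at_filter)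
  ultimately have "((\<lambda>s. fy (b s) s) \<longlongrightarrow> fy y t) (at t within {0..})"
    using continuous_on_tendsto_compose[OF fy, of "\<lambda>s. (b s, s)" "(y, t)"] t by simp
  with b(2) show ?thesis by (intro exI[of _ "\<lambda>s. fy (b s) s"]) auto
qed

lemma has_real_derivative_along_curve:
  fixes f fy :: "real \<Rightarrow> real \<Rightarrow> real" and c :: "real \<Rightarrow> real"
  assumes f: "\<And>y s. s \<ge> 0 \<Longrightarrow> ((\<lambda>y. f y s) has_real_derivative fy y s) (at y)"
    and fy: "continuous_on (UNIV \<times> {0..}) (\<lambda>(y, s). fy y s)"
    and ft: "(f (c t) has_real_derivative ft) (at t within {0..})"
    and c: "(c has_real_derivative c') (at t within {0..})" and t: "t \<ge> 0"
  shows "((\<lambda>s. f (c s) s) has_real_derivative fy (c t) t * c' + ft) (at t within {0..})"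
proof -
  have "(c \<longlongrightarrow> c t) (at t within {0..})"
    using DERIV_continuous[OF c] by (simp add: continuous_within)
  from mean_value_limit[OF f fy this t] obtain g where "(\<forall>s\<ge>0. f (c s) s - f (c t) s = g s * (c s - c t)) \<and>
    (g \<longlongrightarrow> fy (c t) t) (at t within {0..}) \<and> (\<forall>s\<ge>0. \<exists>b. g s = fy b s)" ..
  then have g: "\<And>s. s \<ge> 0 \<Longrightarrow> f (c s) s - f (c t) s = g s * (c s - c t)" "(g \<longlongrightarrow> fy (c t) t) (at t within {0..})" by simp_all
  have "((\<lambda>s. g s * ((c s - c t) / (s - t)) + (f (c t) s - f (c t) t) / (s - t)) \<longlongrightarrow> fy (c t) t * c' + ft) (at t within {0..})"
    by (intro tendsto_intros g(2) c[unfolded has_field_derivative_iff] ft[unfolded has_field_derivative_iff])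
  moreover have "\<forall>\<^sub>F s in at t within {0..}. g s * ((c s - c t) / (s - t)) + (f (c t) s - f (c t) t) / (s - t) = (f (c s) s - f (c t) t) / (s - t)"
    unfolding eventually_at_filter
  proof (intro always_eventually allI impI)
    fix s :: real assume "s \<noteq> t" "s \<in> {0..}"
    then have "g s * (c s - c t) + (f (c t) s - f (c t) t) = f (c s) s - f (c t) t" using g(1)[of s] by simp
    then show "g s * ((c s - c t) / (s - t)) + (f (c t) s - f (c t) t) / (s - t) = (f (c s) s - f (c t) t) / (s - t)"
      by (simp flip: add_divide_distrib)
  qed
  ultimately show ?thesis unfolding has_field_derivative_iff by (rule Lim_transform_eventually)
qed

text \<open>Strict monotonicity in y first gives continuity of c. Then the mean value slope turns
  the equation \<open>f (c s) s = f (c t) t\<close> into a formula for the difference quotient of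
  c.\<close>

lemma implicit_function_derivative:
  fixes f fy :: "real \<Rightarrow> real \<Rightarrow> real" and c :: "real \<Rightarrow> real"
  assumes f: "\<And>y s. s \<ge> 0 \<Longrightarrow> ((\<lambda>y. f y s) has_real_derivative fy y s) (at y)"
    and fy: "continuous_on (UNIV \<times> {0..}) (\<lambda>(y, s). fy y s)" and pos: "\<And>y s. s \<ge> 0 \<Longrightarrow> fy y s > 0"
    and ft: "\<And>y. (f y has_real_derivative ft y) (at t within {0..})"
    and c: "\<And>s. s \<ge> 0 \<Longrightarrow> f (c s) s = x" and t: "t \<ge> 0"
  shows "(c has_real_derivative - ft (c t) / fy (c t) t) (at t within {0..})"
proof -
  have mono: "f y s < f z s \<longleftrightarrow> y < z" if "s \<ge> 0" for y z s
    by (rule strict_mono_less) (use DERIV_pos_imp_increasing[of _ _ "\<lambda>y. f y s"] f[OF that] pos[OF that] in \<open>unfold strict_mono_def, blast\<close>)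
  have ct: "(f y \<longlongrightarrow> f y t) (at t within {0..})" for y
    using DERIV_continuous[OF ft] by (simp add: continuous_within)
  have nonneg: "\<forall>\<^sub>F s in at t within {0..}. s \<ge> 0" by (simp add: eventually_at_filter)
  have "(c \<longlongrightarrow> c t) (at t within {0..})"
  proof (rule order_tendstoI)
    fix a assume "a < c t"
    then have "f a t < x" using mono[OF t] c[OF t] by metis
    from order_tendstoD(2)[OF ct this] nonneg show "\<forall>\<^sub>F s in at t within {0..}. a < c s"
      by eventually_elim (use mono c in metis)
  next
    fix a assume "a > c t"
    then have "f a t > x" using mono[OF t] c[OF t] by metis
    from order_tendstoD(1)[OF ct this] nonneg show "\<forall>\<^sub>F s in at t within {0..}. a > c s"
      by eventually_elim (use mono c in metis)
  qed
  from mean_value_limit[OF f fy this t] obtain g where "(\<forall>s\<ge>0. f (c s) s - f (c t) s = g s * (c s - c t)) \<and>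
    (g \<longlongrightarrow> fy (c t) t) (at t within {0..}) \<and> (\<forall>s\<ge>0. \<exists>b. g s = fy b s)" ..
  then have g: "\<And>s. s \<ge> 0 \<Longrightarrow> f (c s) s - f (c t) s = g s * (c s - c t)" "(g \<longlongrightarrow> fy (c t) t) (at t within {0..})"
    "\<And>s. s \<ge> 0 \<Longrightarrow> \<exists>b. g s = fy b s" by simp_all
  have g0: "g s > 0" if "s \<ge> 0" for s using g(3)[OF that] pos[OF that] by auto
  have "((\<lambda>s. - ((f (c t) s - f (c t) t) / (s - t)) / g s) \<longlongrightarrow> - ft (c t) / fy (c t) t) (at t within {0..})"
    by (intro tendsto_intros g(2) ft[unfolded has_field_derivative_iff]) (use pos[OF t, of "c t"] in simp)
  moreover have "\<forall>\<^sub>F s in at t within {0..}. - ((f (c t) s - f (c t) t) / (s - t)) / g s = (c s - c t) / (s - t)"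
    unfolding eventually_at_filter
  proof (intro always_eventually allI impI)
    fix s :: real assume s: "s \<noteq> t" "s \<in> {0..}"
    then have "g s * (c s - c t) = - (f (c t) s - f (c t) t)" using g(1)[of s] c[OF t] c[of s] by simp
    then have *: "c s - c t = - (f (c t) s - f (c t) t) / g s" using g0[of s] s by (simp add: eq_divide_eq mult.commute)
    show "- ((f (c t) s - f (c t) t) / (s - t)) / g s = (c s - c t) / (s - t)"
      unfolding * minus_divide_left divide_divide_eq_left by (simp add: mult.commute)
  qed
  ultimately show ?thesis unfolding has_field_derivative_iff by (rule Lim_transform_eventually)
qed

lemma real_derivative_unique_atLeast:
  fixes f :: "real \<Rightarrow> real"
  assumes "(f has_real_derivative a) (at t within {0..})" "(f has_real_derivative b) (at t within {0..})" "t \<ge> 0"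
  shows "a = b"
proof (rule vector_derivative_unique_within)
  have "at_right t \<le> at t within {0..}" by (rule at_le) (use assms(3) in auto)
  then show "at t within {0..} \<noteq> bot" using trivial_limit_at_right_real[of t] by (metis bot.extremum_uniqueI)
qed (use assms(1,2) in \<open>simp_all add: has_real_derivative_iff_has_vector_derivative\<close>)

text \<open>With u_xx = 1 - q^3 the left side of the wave equation is -3 q^2 times the left side of
  the transport equation q_t + (u q)_x = 0.\<close>

lemma transport_imp_short_wave_DP:
  assumes "transport_equation u q" "xx_relation u q"
  shows "short_wave_DP_equation u"
proof -
  obtain qt where qt: "\<And>x t. t \<ge> 0 \<Longrightarrow> (\<lambda>x. q x t) differentiable (at x)"
      "\<And>x t. t \<ge> 0 \<Longrightarrow> ((\<lambda>t. q x t) has_real_derivative qt x t) (at t within {0..})"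
      "\<And>x t. t \<ge> 0 \<Longrightarrow> ((\<lambda>x. u x t * q x t) has_real_derivative - qt x t) (at x)"
    using assms(1) unfolding transport_equation_def by blast
  obtain ux where ux: "\<And>x t. t \<ge> 0 \<Longrightarrow> ((\<lambda>x. u x t) has_real_derivative ux x t) (at x)"
      "\<And>x t. t \<ge> 0 \<Longrightarrow> ((\<lambda>x. ux x t) has_real_derivative (1 - q x t ^ 3)) (at x)"
    using assms(2) unfolding xx_relation_def by blast
  define qx where "qx x t = deriv (\<lambda>x. q x t) x" for x t
  have qx: "((\<lambda>x. q x t) has_real_derivative qx x t) (at x)" if "t \<ge> 0" for x t
    using qt(1)[OF that] by (simp add: qx_def DERIV_deriv_iff_real_differentiable)
  have eq: "- qt x t = ux x t * q x t + u x t * qx x t" if "t \<ge> 0" for x t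
    using DERIV_unique[OF qt(3)[OF that] DERIV_mult[OF ux(1)[OF that] qx[OF that]]] by (simp add: mult.commute)
  show ?thesis
    unfolding short_wave_DP_equation_def
  proof (intro exI allI impI conjI)
    fix x t :: real assume t: "t \<ge> 0"
    show "((\<lambda>x. u x t) has_real_derivative ux x t) (at x)"
      "((\<lambda>x. ux x t) has_real_derivative (1 - q x t ^ 3)) (at x)" by (rule ux[OF t])+
    show "((\<lambda>x. 1 - q x t ^ 3) has_real_derivative (- 3 * (q x t)\<^sup>2 * qx x t)) (at x)"
      using qx[OF t] by (auto intro!: derivative_eq_intros)
    show "((\<lambda>t. 1 - q x t ^ 3) has_real_derivative (- 3 * (q x t)\<^sup>2 * qt x t)) (at t within {0..})"
      using qt(2)[OF t] by (auto intro!: derivative_eq_intros)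
    have "- 3 * (q x t)\<^sup>2 * qt x t - 3 * ux x t + 3 * ux x t * (1 - q x t ^ 3) + u x t * (- 3 * (q x t)\<^sup>2 * qx x t)
        = 3 * (q x t)\<^sup>2 * (- qt x t - (ux x t * q x t + u x t * qx x t))"
      by (simp add: algebra_simps power2_eq_square power3_eq_cube)
    then show "- 3 * (q x t)\<^sup>2 * qt x t - 3 * ux x t + 3 * ux x t * (1 - q x t ^ 3) + u x t * (- 3 * (q x t)\<^sup>2 * qx x t) = 0"
      using eq[OF t] by simp
  qed
qed

text \<open>The differentiability of q has to be recovered from that of u_xx. Positivity makes q the
  cube root of 1 - u_xx, written as \<open>exp (ln (1 - uxx x t) / 3)\<close> so that the chain rule
  applies; after that one divides by 3 q^2.\<close>

lemma short_wave_DP_imp_transport: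
  assumes "short_wave_DP_equation u" "xx_relation u q" and pos: "\<And>x t. t \<ge> 0 \<Longrightarrow> q x t > 0"
  shows "transport_equation u q"
proof -
  obtain ux where ux: "\<And>x t. t \<ge> 0 \<Longrightarrow> ((\<lambda>x. u x t) has_real_derivative ux x t) (at x)"
      "\<And>x t. t \<ge> 0 \<Longrightarrow> ((\<lambda>x. ux x t) has_real_derivative (1 - q x t ^ 3)) (at x)"
    using assms(2) unfolding xx_relation_def by blast
  obtain vx uxx uxxx utxx where v: "\<And>x t. t \<ge> 0 \<Longrightarrow> ((\<lambda>x. u x t) has_real_derivative vx x t) (at x)"
        "\<And>x t. t \<ge> 0 \<Longrightarrow> ((\<lambda>x. vx x t) has_real_derivative uxx x t) (at x)"
        "\<And>x t. t \<ge> 0 \<Longrightarrow> ((\<lambda>x. uxx x t) has_real_derivative uxxx x t) (at x)"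
        "\<And>x t. t \<ge> 0 \<Longrightarrow> ((\<lambda>t. uxx x t) has_real_derivative utxx x t) (at t within {0..})"
        "\<And>x t. t \<ge> 0 \<Longrightarrow> utxx x t - 3 * vx x t + 3 * vx x t * uxx x t + u x t * uxxx x t = 0"
    using assms(1) unfolding short_wave_DP_equation_def by blast
  have vx: "vx x t = ux x t" if "t \<ge> 0" for x t by (rule DERIV_unique[OF v(1)[OF that] ux(1)[OF that]])
  then have "(\<lambda>x. vx x t) = (\<lambda>x. ux x t)" if "t \<ge> 0" for t using that by blast
  then have uxx: "uxx x t = 1 - q x t ^ 3" if "t \<ge> 0" for x t
    using DERIV_unique[OF v(2)[OF that]] ux(2)[OF that] that by metis
  have q_eq: "exp (ln (1 - uxx x t) / 3) = q x t" if "t \<ge> 0" for x t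
  proof -
    have "1 - uxx x t = q x t ^ 3" using uxx[OF that] by simp
    then show ?thesis using pos[OF that, of x] by (simp add: ln_realpow)
  qed
  have uxx_less: "1 - uxx x t > 0" if "t \<ge> 0" for x t using uxx[OF that, of x] pos[OF that, of x] by simp
  have root: "((\<lambda>s. exp (ln (1 - h s) / 3)) has_real_derivative exp (ln (1 - h s) / 3) * (- h' / (3 * (1 - h s)))) (at s within S)"
    if "(h has_real_derivative h') (at s within S)" "1 - h s > 0" for h h' s S
  proof -
    have "((\<lambda>s. ln (1 - h s)) has_real_derivative - h' / (1 - h s)) (at s within S)"
      using that by (auto intro!: derivative_eq_intros)
    from DERIV_chain2[OF DERIV_exp DERIV_cdivide[OF this, of 3]] show ?thesis by (simp add: mult.commute)
  qed
  have val: "q x t * (- h' / (3 * (1 - uxx x t))) = - h' / (3 * (q x t)\<^sup>2)" if "t \<ge> 0" for x t h'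
    using pos[OF that, of x] by (simp add: uxx[OF that] power2_eq_square power3_eq_cube)
  have qx: "((\<lambda>x. q x t) has_real_derivative - uxxx x t / (3 * (q x t)\<^sup>2)) (at x)" if "t \<ge> 0" for x t
    using root[OF v(3)[OF that] uxx_less[OF that], of x] by (simp only: q_eq[OF that] val[OF that])
  have qt: "((\<lambda>t. q x t) has_real_derivative - utxx x t / (3 * (q x t)\<^sup>2)) (at t within {0..})" if "t \<ge> 0" for x t
  proof (rule has_field_derivative_transform_within[where d=1])
    show "((\<lambda>s. exp (ln (1 - uxx x s) / 3)) has_real_derivative - utxx x t / (3 * (q x t)\<^sup>2)) (at t within {0..})"
      using root[OF v(4)[OF that] uxx_less[OF that], of x] by (simp only: q_eq[OF that] val[OF that])
  qed (use that q_eq in auto)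
  show ?thesis
    unfolding transport_equation_def
  proof (intro exI allI impI conjI)
    fix x t :: real assume t: "t \<ge> 0"
    show "(\<lambda>x. q x t) differentiable (at x)" using qx[OF t] by (auto simp: real_differentiable_def)
    show "((\<lambda>t. q x t) has_real_derivative - utxx x t / (3 * (q x t)\<^sup>2)) (at t within {0..})" by (rule qt[OF t])
    have q0: "q x t \<noteq> 0" using pos[OF t, of x] by simp
    have "utxx x t = 3 * ux x t * q x t ^ 3 - u x t * uxxx x t"
      using v(5)[OF t, of x] unfolding vx[OF t] uxx[OF t] by (simp add: algebra_simps)
    then have eq: "- (- utxx x t / (3 * (q x t)\<^sup>2)) = ux x t * q x t + u x t * (- uxxx x t / (3 * (q x t)\<^sup>2))"
      using q0 by (simp add: field_simps power2_eq_square power3_eq_cube)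
    show "((\<lambda>x. u x t * q x t) has_real_derivative - (- utxx x t / (3 * (q x t)\<^sup>2))) (at x)"
      unfolding eq by (rule DERIV_cong[OF DERIV_mult[OF ux(1)[OF t] qx[OF t]]]) (simp add: mult.commute)
  qed
qed

section \<open>One solution for all y and all t \<ge> 0\<close>

locale tzitzeica_global =
  fixes W Wy P :: "real \<Rightarrow> real \<Rightarrow> real"
  assumes W_y: "\<And>y t. t \<ge> 0 \<Longrightarrow> ((\<lambda>y. W y t) has_real_derivative Wy y t) (at y)"
    and W_t: "\<And>y t. t \<ge> 0 \<Longrightarrow> (W y has_real_derivative P y t) (at t within {0..})"
    and P_y: "\<And>y t. t \<ge> 0 \<Longrightarrow> ((\<lambda>y. P y t) has_real_derivative fpot (W y t)) (at y)"
    and Wy_t: "\<And>y t. t \<ge> 0 \<Longrightarrow> (Wy y has_real_derivative fpot (W y t)) (at t within {0..})"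
    and W_cont: "continuous_on (UNIV \<times> {0..}) (\<lambda>(y, t). W y t)"
    and Wy_cont: "continuous_on (UNIV \<times> {0..}) (\<lambda>(y, t). Wy y t)"
    and P_cont: "continuous_on (UNIV \<times> {0..}) (\<lambda>(y, t). P y t)"
    and decay: "\<exists>K. \<forall>y\<ge>0. \<forall>t\<in>{0..1}. \<bar>W y t\<bar> \<le> K \<and> \<bar>P y t\<bar> \<le> K / (1 + y) ^ 3"

context schwartz_data begin

text \<open>No gluing of strips is required: on each strip the solution is
  \<open>ln (qh y t)\<close>, which does not depend on the strip, and regularity is a local
  property.\<close>

lemma global_solution:
  assumes data: "scattering_data u0 M S0 Z lc jc v"
    and unique: "\<And>y t. t \<ge> 0 \<Longrightarrow> is_unique_rhp_solution S0 Z lc jc v y t (Mh y t)"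
    and lim: "\<And>y t. t \<ge> 0 \<Longrightarrow> (Mh y t \<longlongrightarrow> structure_mat (qh y t)) (at 0 within - Sigma_contour)"
  defines "W \<equiv> \<lambda>y t. ln (qh y t)"
  shows "\<exists>Wy P. tzitzeica_global W Wy P" and "W y 0 = Wf y"
proof -
  have strip: "\<exists>w wy p pt K. tzitzeica_strip a T K w wy p pt \<and> (\<forall>y\<ge>a. \<forall>t\<in>{0..T}. W y t = w y t) \<and> (\<forall>y\<ge>a. w y 0 = Wf y)"
    if T: "T \<ge> 0" for a T
  proof -
    obtain w wy p pt K where s: "tzitzeica_strip a T K w wy p pt" "\<forall>y\<ge>a. w y 0 = Wf y \<and> wy y 0 = Wf1 y"
      using strip_exists[OF T, of a] by (elim exE conjE)
    have "W y t = w y t" if "y \<ge> a" "t \<in> {0..T}" for y t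
      using qhat_eq_exp[OF s(1) _ data unique lim that] s(2) that by (simp add: W_def)
    with s show ?thesis by (intro exI[of _ w] exI[of _ wy] exI[of _ p] exI[of _ pt] exI[of _ K]) simp
  qed
  \<comment> \<open>Both functions are defined from W alone, so they do not depend on the strip in
    which they are computed; \<open>local\<close> identifies them with the data of any strip around
    the point.\<close>
  define Wy where "Wy y t = deriv (\<lambda>y. W y t) y" for y t
  define P where "P y t = vector_derivative (W y) (at t within {0..})" for y t
  have local: "((\<lambda>y. W y t) has_real_derivative wy y t) (at y) \<and> Wy y t = wy y t \<and>
      (W y has_real_derivative p y t) (at t within {0..}) \<and> P y t = p y t"
    if "tzitzeica_strip a T K w wy p pt" and W: "\<forall>y\<ge>a. \<forall>t\<in>{0..T}. W y t = w y t" and y: "y > a" and t: "t \<ge> 0" "t < T"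
    for a T K w wy p pt y t
  proof -
    interpret tzitzeica_strip a T K w wy p pt by fact
    have "at y within {a..} = at y" by (rule at_within_interior) (use y in simp)
    then have "((\<lambda>y. w y t) has_real_derivative wy y t) (at y)" using w_y[of y t] y t by simp
    then have 1: "((\<lambda>y. W y t) has_real_derivative wy y t) (at y)"
      by (rule has_field_derivative_transform_within_open[where S="{a<..}"]) (use W y t in auto)
    have "at t within {0..T} = at t within {0..}" by (rule at_within_nhd[of _ "{..<T}"]) (use t in auto)
    then have "(w y has_real_derivative p y t) (at t within {0..})" using w_t[of y t] y t by simp
    then have 2: "(W y has_real_derivative p y t) (at t within {0..})"
      by (rule has_field_derivative_transform_within[where d="T - t"]) (use W y t in \<open>auto simp: dist_real_def\<close>)
    then have "(W y has_vector_derivative p y t) (at t within {0..})" by (simp add: has_real_derivative_iff_has_vector_derivative)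
    moreover have "at t within {0..} \<noteq> bot"
      using at_le[of "{t<..}" "{0..}" t] trivial_limit_at_right_real[of t] t(1) by (metis bot.extremum_uniqueI atLeast_iff greaterThan_iff less_imp_le order_trans subsetI)
    ultimately have "P y t = p y t" unfolding P_def by (rule vector_derivative_within[rotated])
    with 1 2 DERIV_imp_deriv[OF 1] show ?thesis by (simp add: Wy_def)
  qed
  have cont: "continuous_on (UNIV \<times> {0..}) (\<lambda>(y, t). g y t)"
    if g: "\<And>y0 t0. t0 \<ge> 0 \<Longrightarrow> \<exists>h a T. a < y0 \<and> t0 < T \<and> continuous_on ({a..} \<times> {0..T}) (\<lambda>(y, t). h y t) \<and>
        (\<forall>y>a. \<forall>t. 0 \<le> t \<and> t < T \<longrightarrow> g y t = h y t)" for g :: "real \<Rightarrow> real \<Rightarrow> real"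
    unfolding continuous_on_eq_continuous_within
  proof (intro ballI)
    fix x :: "real \<times> real" assume "x \<in> UNIV \<times> {0..}"
    then obtain y0 t0 where x: "x = (y0, t0)" "t0 \<ge> 0" by auto
    obtain h a T where h: "a < y0" "t0 < T" "continuous_on ({a..} \<times> {0..T}) (\<lambda>(y, t). h y t)"
        "\<And>y t. y > a \<Longrightarrow> 0 \<le> t \<Longrightarrow> t < T \<Longrightarrow> g y t = h y t" using g[OF x(2), of y0] by (elim exE conjE) blast
    have "at x within UNIV \<times> {0..} = at x within {a..} \<times> {0..T}"
      by (rule at_within_nhd[of _ "{a<..} \<times> {..<T}"]) (use h x in \<open>auto intro: open_Times\<close>)
    moreover have "continuous (at x within {a..} \<times> {0..T}) (\<lambda>(y, t). h y t)"
      using h x by (auto simp: continuous_on_eq_continuous_within)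
    ultimately have "continuous (at x within UNIV \<times> {0..}) (\<lambda>(y, t). h y t)" by simp
    then have lim: "((\<lambda>(y, t). h y t) \<longlongrightarrow> (\<lambda>(y, t). h y t) x) (at x within UNIV \<times> {0..})"
      unfolding continuous_within .
    have "\<forall>\<^sub>F z in nhds x. z \<in> {a<..} \<times> {..<T}"
      by (rule eventually_nhds_in_open) (use h x in \<open>auto intro: open_Times\<close>)
    then have "\<forall>\<^sub>F z in at x within UNIV \<times> {0..}. (\<lambda>(y, t). h y t) z = (\<lambda>(y, t). g y t) z"
      unfolding eventually_at_filter by eventually_elim (auto simp: h(4))
    from Lim_transform_eventually[OF lim this]
    have "((\<lambda>(y, t). g y t) \<longlongrightarrow> (\<lambda>(y, t). h y t) x) (at x within UNIV \<times> {0..})" .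
    moreover have "(\<lambda>(y, t). h y t) x = (\<lambda>(y, t). g y t) x" using h(1,2) x h(4) by simp
    ultimately show "continuous (at x within UNIV \<times> {0..}) (\<lambda>(y, t). g y t)"
      unfolding continuous_within by simp
  qed
  have "tzitzeica_global W Wy P"
  proof
    fix y t :: real assume t: "t \<ge> 0"
    \<comment> \<open>The strip extends one unit to the left of y and one unit of time beyond t, so
      that derivatives within the strip are those in the full domain.\<close>
    have "t + 1 \<ge> 0" using t by simp
    from strip[OF this, of "y - 1"] obtain w wy p pt K where s: "tzitzeica_strip (y - 1) (t + 1) K w wy p pt"
      "\<forall>y'\<ge>y - 1. \<forall>s\<in>{0..t + 1}. W y' s = w y' s" by (elim exE conjE)
    note l = local[OF s]
    interpret tzitzeica_strip "y - 1" "t + 1" K w wy p pt by (rule s(1))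
    show "((\<lambda>y. W y t) has_real_derivative Wy y t) (at y)" "(W y has_real_derivative P y t) (at t within {0..})"
      using l[of y t] t by simp_all
    have W_eq: "W y t = w y t" using s(2) t by simp
    have "at y within {y - 1..} = at y" by (rule at_within_interior) simp
    then have "((\<lambda>y. p y t) has_real_derivative fpot (w y t)) (at y)" using P_y[of y t] t by simp
    then show "((\<lambda>y. P y t) has_real_derivative fpot (W y t)) (at y)"
      unfolding W_eq by (rule has_field_derivative_transform_within_open[where S="{y - 1<..}"]) (use l t in auto)
    have "at t within {0..t + 1} = at t within {0..}" by (rule at_within_nhd[of _ "{..<t + 1}"]) auto
    then have "(wy y has_real_derivative fpot (w y t)) (at t within {0..})" using wy_t[of y t] t by simp
    then show "(Wy y has_real_derivative fpot (W y t)) (at t within {0..})"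
      unfolding W_eq by (rule has_field_derivative_transform_within[where d=1]) (use l t in \<open>auto simp: dist_real_def\<close>)
  next
    have ex: "\<exists>w wy p a T. a < y0 \<and> t0 < T \<and> continuous_on ({a..} \<times> {0..T}) (\<lambda>(y, t). w y t) \<and>
        continuous_on ({a..} \<times> {0..T}) (\<lambda>(y, t). wy y t) \<and> continuous_on ({a..} \<times> {0..T}) (\<lambda>(y, t). p y t) \<and>
        (\<forall>y>a. \<forall>t. 0 \<le> t \<and> t < T \<longrightarrow> W y t = w y t \<and> Wy y t = wy y t \<and> P y t = p y t)" if t0: "t0 \<ge> 0" for y0 t0 :: real
    proof -
      have "t0 + 1 \<ge> 0" using t0 by simp
      from strip[OF this, of "y0 - 1"] obtain w wy p pt K where s: "tzitzeica_strip (y0 - 1) (t0 + 1) K w wy p pt"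
        "\<forall>y\<ge>y0 - 1. \<forall>t\<in>{0..t0 + 1}. W y t = w y t" by (elim exE conjE)
      interpret tzitzeica_strip "y0 - 1" "t0 + 1" K w wy p pt by (rule s(1))
      show ?thesis
        by (intro exI[of _ w] exI[of _ wy] exI[of _ p] exI[of _ "y0 - 1"] exI[of _ "t0 + 1"] conjI w_cont wy_cont P_cont allI impI)
          (use s(2) local[OF s] in auto)
    qed
    show "continuous_on (UNIV \<times> {0..}) (\<lambda>(y, t). W y t)" by (rule cont) (use ex in meson)
    show "continuous_on (UNIV \<times> {0..}) (\<lambda>(y, t). Wy y t)" by (rule cont) (use ex in meson)
    show "continuous_on (UNIV \<times> {0..}) (\<lambda>(y, t). P y t)" by (rule cont) (use ex in meson)
  next
    have "(2::real) \<ge> 0" by simp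
    from strip[OF this, of "- 1"] obtain w wy p pt K where s: "tzitzeica_strip (- 1) 2 K w wy p pt"
      "\<forall>y\<ge>- 1. \<forall>t\<in>{0..2}. W y t = w y t" by (elim exE conjE)
    interpret tzitzeica_strip "- 1" 2 K w wy p pt by (rule s(1))
    have "\<bar>W y t\<bar> \<le> K \<and> \<bar>P y t\<bar> \<le> K / (1 + y) ^ 3" if y: "y \<ge> 0" and t: "t \<in> {0..1}" for y t
    proof
      show "\<bar>W y t\<bar> \<le> K" using w_le_K[of y t] s(2) y t by simp
      have "\<bar>P y t\<bar> \<le> K / (1 + y - - 1) ^ 3" using P_bound[of y t] local[OF s, of y t] y t by simp
      also have "\<dots> \<le> K / (1 + y) ^ 3"
        using y K_nonneg by (intro divide_left_mono power_mono) auto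
      finally show "\<bar>P y t\<bar> \<le> K / (1 + y) ^ 3" .
    qed
    then show "\<exists>K. \<forall>y\<ge>0. \<forall>t\<in>{0..1}. \<bar>W y t\<bar> \<le> K \<and> \<bar>P y t\<bar> \<le> K / (1 + y) ^ 3" by blast
  qed
  then show "\<exists>Wy P. tzitzeica_global W Wy P" by blast
  show "W y 0 = Wf y" using strip[of 0 y] by fastforce
qed

end

section \<open>The reciprocal transformation from y to x\<close>

locale reciprocal_transformation = tzitzeica_global +
  fixes X Y u :: "real \<Rightarrow> real \<Rightarrow> real"
  assumes X_y: "\<And>y t. t \<ge> 0 \<Longrightarrow> ((\<lambda>y. X y t) has_real_derivative exp (- W y t)) (at y)"
    and X_lim: "\<And>t. t \<ge> 0 \<Longrightarrow> ((\<lambda>y. X y t - y) \<longlongrightarrow> 0) at_top"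
    and Y_X: "\<And>y t. t \<ge> 0 \<Longrightarrow> Y (X y t) t = y"
    and X_Y: "\<And>x t. t \<ge> 0 \<Longrightarrow> X (Y x t) t = x"
    and X_t_Y: "\<And>x t. t \<ge> 0 \<Longrightarrow> ((\<lambda>s. X (Y x t) s) has_real_derivative u x t) (at t within {0..})"
begin

lemma X_t: "t \<ge> 0 \<Longrightarrow> (X y has_real_derivative u (X y t) t) (at t within {0..})"
  using X_t_Y[of t "X y t"] by (simp add: Y_X)

lemma Y_x:
  assumes t: "t \<ge> 0"
  shows "((\<lambda>x. Y x t) has_real_derivative exp (W (Y x t) t)) (at x)"
proof -
  have "isCont (\<lambda>x. Y x t) (X (Y x t) t)"
    by (rule isCont_inverse_function[where f="\<lambda>y. X y t" and d=1]) (auto simp: Y_X[OF t] intro: DERIV_isCont[OF X_y[OF t]])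
  then have c: "isCont (\<lambda>x. Y x t) x" by (simp add: X_Y[OF t])
  have "((\<lambda>x. Y x t) has_real_derivative inverse (exp (- W (Y x t) t))) (at x)"
    by (rule DERIV_inverse_function[where f="\<lambda>y. X y t" and a="x - 1" and b="x + 1", OF X_y[OF t]])
      (use c in \<open>auto simp: X_Y[OF t]\<close>)
  then show ?thesis by (simp add: exp_minus)
qed

text \<open>The y-derivative of X_t is not given, only that of X. Integrating X_y from a base point
  b and differentiating that integral in t expresses u along X as an integral in y, which can then
  be differentiated.\<close>

lemma u_X_y:
  assumes t: "t \<ge> 0"
  shows "((\<lambda>y. u (X y t) t) has_real_derivative - P y t * exp (- W y t)) (at y)"
proof -
  define g where "g s \<eta> = - P \<eta> s * exp (- W \<eta> s)" for s \<eta>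
  define b where "b = y - 1"
  have gc: "continuous_on ({0..} \<times> UNIV) (\<lambda>(s, \<eta>). g s \<eta>)"
  proof -
    have "continuous_on (UNIV \<times> {0..}) (\<lambda>z. - (\<lambda>(y, t). P y t) z * exp (- (\<lambda>(y, t). W y t) z))"
      by (intro continuous_on_mult continuous_on_minus continuous_on_exp P_cont W_cont)
    then have "continuous_on ({0..} \<times> UNIV) ((\<lambda>z. - (\<lambda>(y, t). P y t) z * exp (- (\<lambda>(y, t). W y t) z)) \<circ> prod.swap)"
      by (intro continuous_on_compose continuous_on_swap) (simp add: product_swap)
    then show ?thesis by (simp add: o_def case_prod_unfold g_def)
  qed
  have int: "((\<lambda>\<eta>. exp (- W \<eta> s)) has_integral X z s - X b s) {b..z}" if "s \<ge> 0" "b \<le> z" for s z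
    using fundamental_theorem_of_calculus[of b z "\<lambda>y. X y s" "\<lambda>y. exp (- W y s)"] that X_y[OF that(1)]
    by (simp add: has_field_derivative_at_within flip: has_real_derivative_iff_has_vector_derivative)
  have diff: "u (X z t) t = u (X b t) t + integral {b..z} (g t)" if z: "z \<ge> b" for z
  proof -
    have "((\<lambda>s. integral (cbox b z) (\<lambda>\<eta>. exp (- W \<eta> s))) has_field_derivative integral (cbox b z) (g t)) (at t within {0..})"
    proof (rule leibniz_rule_field_derivative[where fx=g])
      show "((\<lambda>s. exp (- W \<eta> s)) has_field_derivative g s \<eta>) (at s within {0..})" if "s \<in> {0..}" for s \<eta>
        unfolding g_def using W_t[of s \<eta>] that by (auto intro!: derivative_eq_intros)
      show "(\<lambda>\<eta>. exp (- W \<eta> s)) integrable_on cbox b z" if "s \<in> {0..}" for s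
        using int[of s z] that z by (auto simp: integrable_on_def)
      show "continuous_on ({0..} \<times> cbox b z) (\<lambda>(s, \<eta>). g s \<eta>)" by (rule continuous_on_subset[OF gc]) auto
    qed (use t in auto)
    then have "((\<lambda>s. X z s - X b s) has_real_derivative integral (cbox b z) (g t)) (at t within {0..})"
      by (rule has_field_derivative_transform_within[where d=1]) (use t int[OF _ z] in \<open>auto simp: integral_unique\<close>)
    from real_derivative_unique_atLeast[OF this DERIV_diff[OF X_t[OF t] X_t[OF t]] t]
    show ?thesis by simp
  qed
  have gt: "continuous_on {b..y + 1} (g t)"
  proof -
    have "continuous_on {b..y + 1} ((\<lambda>(s, \<eta>). g s \<eta>) \<circ> Pair t)"
      by (rule continuous_on_compose) (auto intro!: continuous_intros continuous_on_subset[OF gc] simp: t)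
    then show ?thesis by (simp add: o_def)
  qed
  have "((\<lambda>z. integral {b..z} (g t)) has_real_derivative g t y) (at y within {b..y + 1})"
    by (rule integral_has_real_derivative[OF gt]) (simp add: b_def)
  moreover have "at y within {b..y + 1} = at y" by (rule at_within_interior) (simp add: b_def)
  ultimately have "((\<lambda>z. integral {b..z} (g t)) has_real_derivative g t y) (at y)" by simp
  from DERIV_add[OF DERIV_const this]
  have "((\<lambda>z. u (X b t) t + integral {b..z} (g t)) has_real_derivative g t y) (at y)" by simp
  then have "((\<lambda>z. u (X z t) t) has_real_derivative g t y) (at y)"
    by (rule has_field_derivative_transform_within_open[where S="{b<..}"]) (simp_all add: b_def, rule diff[symmetric, unfolded b_def], simp)
  then show ?thesis by (simp add: g_def)
qed

lemma u_x:
  assumes t: "t \<ge> 0"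
  shows "((\<lambda>x. u x t) has_real_derivative - P (Y x t) t) (at x)"
  using DERIV_chain2[OF u_X_y[OF t, of "Y x t"] Y_x[OF t, of x]] by (simp add: X_Y[OF t] mult.assoc flip: exp_add)

lemma u_xx:
  assumes t: "t \<ge> 0"
  shows "((\<lambda>x. - P (Y x t) t) has_real_derivative 1 - exp (W (Y x t) t) ^ 3) (at x)"
proof -
  have "((\<lambda>x. - P (Y x t) t) has_real_derivative - (fpot (W (Y x t) t) * exp (W (Y x t) t))) (at x)"
    by (rule DERIV_minus[OF DERIV_chain2[OF P_y[OF t] Y_x[OF t]]])
  \<comment> \<open>The factor \<open>exp w\<close> is dy/dx; it turns exp (2 w) - exp (- w) into
    q^3 - 1.\<close>
  moreover have "fpot w * exp w = exp w ^ 3 - 1" for w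
    by (simp add: fpot_def left_diff_distrib power3_eq_cube flip: exp_add)
  ultimately show ?thesis by simp
qed

lemma Y_t:
  assumes t: "t \<ge> 0"
  shows "((\<lambda>t. Y x t) has_real_derivative - u x t * exp (W (Y x t) t)) (at t within {0..})"
proof -
  have "continuous_on (UNIV \<times> {0..}) (\<lambda>z. exp (- (\<lambda>(y, t). W y t) z))"
    by (intro continuous_on_minus continuous_on_exp W_cont)
  then have "continuous_on (UNIV \<times> {0..}) (\<lambda>(y, t). exp (- W y t))" by (simp add: case_prod_unfold)
  from implicit_function_derivative[OF X_y this _ X_t[OF t] X_Y t]
  have "((\<lambda>t. Y x t) has_real_derivative - u (X (Y x t) t) t / exp (- W (Y x t) t)) (at t within {0..})" by simp
  then show ?thesis by (simp add: X_Y[OF t] exp_minus divide_inverse)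
qed

lemma xx_relation: "xx_relation u (\<lambda>x t. exp (W (Y x t) t))"
  unfolding xx_relation_def using u_x u_xx by (intro exI[of _ "\<lambda>x t. - P (Y x t) t"]) auto

lemma transport_equation: "transport_equation u (\<lambda>x t. exp (W (Y x t) t))"
proof -
  define q where "q x t = exp (W (Y x t) t)" for x t
  have qx: "((\<lambda>x. q x t) has_real_derivative q x t * (Wy (Y x t) t * q x t)) (at x)" if t: "t \<ge> 0" for x t
    unfolding q_def by (rule DERIV_chain2[OF DERIV_exp DERIV_chain2[OF W_y[OF t] Y_x[OF t]]])
  have qt: "((\<lambda>t. q x t) has_real_derivative q x t * (Wy (Y x t) t * (- u x t * q x t) + P (Y x t) t)) (at t within {0..})"
    if t: "t \<ge> 0" for x t
    unfolding q_def by (rule DERIV_chain2[OF DERIV_exp has_real_derivative_along_curve[OF W_y Wy_cont W_t[OF t] Y_t[OF t] t]])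
  have "transport_equation u q"
    unfolding transport_equation_def
  proof (intro exI allI impI conjI)
    fix x t :: real assume t: "t \<ge> 0"
    show "(\<lambda>x. q x t) differentiable (at x)" using qx[OF t] by (auto simp: real_differentiable_def)
    show "((\<lambda>t. q x t) has_real_derivative q x t * (Wy (Y x t) t * (- u x t * q x t) + P (Y x t) t)) (at t within {0..})"
      by (rule qt[OF t])
    show "((\<lambda>x. u x t * q x t) has_real_derivative - (q x t * (Wy (Y x t) t * (- u x t * q x t) + P (Y x t) t))) (at x)"
      by (rule DERIV_cong[OF DERIV_mult[OF u_x[OF t] qx[OF t]]]) (simp add: algebra_simps)
  qed
  then show ?thesis by (simp add: q_def[abs_def])
qed

text \<open>For each t the difference X - y vanishes at +infinity, but u is its t-derivative, so a
  rate linear in t is needed. The decay of \<open>P\<close> bounds the change of X_y in time, and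
  integration from +infinity gives \<open>C * t / (1 + y)\<^sup>2\<close>.\<close>

lemma u_X_at_top: "((\<lambda>y. u (X y 0) 0) \<longlongrightarrow> 0) at_top"
proof -
  obtain K where K: "\<And>y t. y \<ge> 0 \<Longrightarrow> t \<in> {0..1} \<Longrightarrow> \<bar>W y t\<bar> \<le> K" "\<And>y t. y \<ge> 0 \<Longrightarrow> t \<in> {0..1} \<Longrightarrow> \<bar>P y t\<bar> \<le> K / (1 + y) ^ 3"
    using decay by blast
  have K0: "K \<ge> 0" using K(1)[of 0 0] by simp
  define C where "C = exp K * K"
  have C0: "C \<ge> 0" using K0 by (simp add: C_def)
  have We: "\<bar>exp (- W y t) - exp (- W y 0)\<bar> \<le> C / (1 + y) ^ 3 * t" if y: "y \<ge> 0" and t: "t \<in> {0..1}" for y t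
  proof -
    have "\<bar>exp (- W y t) - exp (- W y 0)\<bar> \<le> C / (1 + y) ^ 3 * \<bar>t - 0\<bar>"
    proof (rule abs_diff_le_of_deriv_bound[where a=0 and b=1])
      fix s :: real assume s: "s \<in> {0..1}"
      have "(W y has_real_derivative P y s) (at s within {0..1})" by (rule DERIV_subset[OF W_t]) (use s in auto)
      then show "((\<lambda>t. exp (- W y t)) has_real_derivative exp (- W y s) * - P y s) (at s within {0..1})"
        by (auto intro!: derivative_eq_intros)
      have "\<bar>exp (- W y s) * - P y s\<bar> = exp (- W y s) * \<bar>P y s\<bar>" by (simp add: abs_mult)
      also have "\<dots> \<le> exp K * (K / (1 + y) ^ 3)" using K[OF y s] by (intro mult_mono) auto
      finally show "\<bar>exp (- W y s) * - P y s\<bar> \<le> C / (1 + y) ^ 3" by (simp add: C_def)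
    qed (use t in auto)
    then show ?thesis using t by simp
  qed
  have Xt: "\<bar>X y t - X y 0\<bar> \<le> C * t / (1 + y)\<^sup>2" if y: "y \<ge> 0" and t: "t \<in> {0..1}" for y t
  proof -
    define G where "G y = X y t - X y 0" for y
    have "((\<lambda>y. (X y t - y) - (X y 0 - y)) \<longlongrightarrow> 0 - 0) at_top" by (intro tendsto_diff X_lim) (use t in auto)
    then have G0: "(G \<longlongrightarrow> 0) at_top" by (simp add: G_def[abs_def])
    have Gb: "norm (G b - G y) \<le> C * t / (1 + y)\<^sup>2" if b: "b \<ge> y" for b
    proof -
      have "norm (G b - G y) \<le> - (C * t / 2) * (inverse (1 + b))\<^sup>2 - - (C * t / 2) * (inverse (1 + y))\<^sup>2"
      proof (rule norm_diff_le_antiderivative[OF b])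
        fix z assume z: "z \<in> {y..b}"
        have "((\<lambda>y. X y t - X y 0) has_real_derivative exp (- W z t) - exp (- W z 0)) (at z)"
          by (intro DERIV_diff X_y) (use t in auto)
        then show "(G has_vector_derivative (exp (- W z t) - exp (- W z 0))) (at z within {y..b})"
          unfolding G_def[abs_def] by (simp add: has_vector_derivative_at_within has_real_derivative_iff_has_vector_derivative)
        show "((\<lambda>y. - (C * t / 2) * (inverse (1 + y))\<^sup>2) has_real_derivative C * t * inverse (1 + z) ^ 3) (at z within {y..b})"
          using z y by (auto intro!: derivative_eq_intros simp: power2_eq_square power3_eq_cube)
        show "norm (exp (- W z t) - exp (- W z 0)) \<le> C * t * inverse (1 + z) ^ 3"
          using We[of z t] z y t by (simp add: divide_inverse power_inverse mult_ac)
      qed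
      also have "\<dots> \<le> C * t * (inverse (1 + y))\<^sup>2"
      proof -
        have "0 \<le> C * t * (inverse (1 + b))\<^sup>2" "0 \<le> C * t * (inverse (1 + y))\<^sup>2" using C0 t by auto
        moreover have "- (c / 2) * r - - (c / 2) * s \<le> c * s" if "0 \<le> c * r" "0 \<le> c * s" for c r s :: real
          using that by simp
        ultimately show ?thesis by blast
      qed
      also have "\<dots> = C * t / (1 + y)\<^sup>2" by (simp add: divide_inverse power_inverse)
      finally show ?thesis .
    qed
    have "((\<lambda>b. norm (G b - G y)) \<longlongrightarrow> norm (0 - G y)) at_top" by (intro tendsto_intros G0)
    moreover have "\<forall>\<^sub>F b in at_top. norm (G b - G y) \<le> C * t / (1 + y)\<^sup>2" using Gb by (auto simp: eventually_at_top_linorder)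
    ultimately have "norm (0 - G y) \<le> C * t / (1 + y)\<^sup>2" by (intro tendsto_upperbound) auto
    then show ?thesis by (simp add: G_def)
  qed
  \<comment> \<open>u at time 0 is the one-sided derivative of X in t, so the bound passes from the
    difference quotients to the limit.\<close>
  have ub: "\<bar>u (X y 0) 0\<bar> \<le> C / (1 + y)\<^sup>2" if y: "y \<ge> 0" for y
  proof -
    have "((\<lambda>t. (X y t - X y 0) / (t - 0)) \<longlongrightarrow> u (X y 0) 0) (at 0 within {0..})"
      using X_t[of 0 y] by (simp add: has_field_derivative_iff)
    then have "((\<lambda>t. \<bar>(X y t - X y 0) / (t - 0)\<bar>) \<longlongrightarrow> \<bar>u (X y 0) 0\<bar>) (at_right 0)"
      by (intro tendsto_rabs) (rule tendsto_within_subset, auto)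
    moreover have "\<forall>\<^sub>F t in at_right (0::real). t < 1" by (subst eventually_at_right[of 0 1]) (auto intro: exI[of _ 1])
    then have "\<forall>\<^sub>F t in at_right (0::real). \<bar>(X y t - X y 0) / (t - 0)\<bar> \<le> C / (1 + y)\<^sup>2"
      using eventually_at_right_less[of 0]
    proof eventually_elim
      case (elim t)
      then have "\<bar>X y t - X y 0\<bar> / t \<le> C * t / (1 + y)\<^sup>2 / t" using Xt[OF y, of t] by (intro divide_right_mono) auto
      moreover have "C * t / (1 + y)\<^sup>2 / t = C / (1 + y)\<^sup>2" using elim by simp
      ultimately show ?case using elim by (simp only: abs_divide diff_zero abs_of_pos)
    qed
    ultimately show ?thesis by (rule tendsto_upperbound) simp
  qed
  have "((\<lambda>y. C / (1 + y)\<^sup>2) \<longlongrightarrow> 0) at_top" by real_asymp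
  then show ?thesis
    by (rule Lim_null_comparison[rotated]) (use ub in \<open>auto simp: eventually_at_top_linorder intro: exI[of _ 0]\<close>)
qed

end

lemma transport_equation_cong:
  assumes "transport_equation u q" and eq: "\<And>x t. t \<ge> 0 \<Longrightarrow> p x t = q x t"
  shows "transport_equation u p"
proof -
  obtain qt where q: "\<And>x t. t \<ge> 0 \<Longrightarrow> (\<lambda>x. q x t) differentiable (at x)"
      "\<And>x t. t \<ge> 0 \<Longrightarrow> ((\<lambda>t. q x t) has_real_derivative qt x t) (at t within {0..})"
      "\<And>x t. t \<ge> 0 \<Longrightarrow> ((\<lambda>x. u x t * q x t) has_real_derivative - qt x t) (at x)"
    using assms(1) unfolding transport_equation_def by blast
  show ?thesis
    unfolding transport_equation_def
  proof (intro exI allI impI conjI)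
    fix x t :: real assume t: "t \<ge> 0"
    show "(\<lambda>x. p x t) differentiable (at x)" "((\<lambda>x. u x t * p x t) has_real_derivative - qt x t) (at x)"
      using q(1,3)[OF t] by (simp_all add: eq[OF t])
    show "((\<lambda>t. p x t) has_real_derivative qt x t) (at t within {0..})"
      by (rule has_field_derivative_transform_within[OF q(2)[OF t], of 1]) (use eq t in auto)
  qed
qed

section \<open>The initial value of u\<close>

lemma affine_tendsto_0_at_top:
  fixes c d :: real
  assumes "((\<lambda>x. c * x + d) \<longlongrightarrow> 0) at_top"
  shows "c = 0" "d = 0"
proof -
  have "((\<lambda>x. (c * (1 + x) + d) - (c * x + d)) \<longlongrightarrow> 0 - 0) at_top"
    by (intro tendsto_diff assms filterlim_compose[OF assms filterlim_tendsto_add_at_top[OF tendsto_const filterlim_ident]])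
  then have "((\<lambda>x::real. c) \<longlongrightarrow> 0) at_top" by (simp add: algebra_simps)
  then show "c = 0" by (simp add: tendsto_const_iff)
  with assms show "d = 0" by (simp add: tendsto_const_iff)
qed

context schwartz_data begin

lemma u0_at_top: "(u0 \<longlongrightarrow> 0) at_top"
proof -
  obtain C where C: "\<And>x. \<bar>D 0 x\<bar> \<le> C / (1 + \<bar>x\<bar>) ^ 1" using D_decay by blast
  have "((\<lambda>x. C / (1 + \<bar>x\<bar>) ^ 1) \<longlongrightarrow> 0) at_top" by real_asymp
  then show ?thesis by (rule Lim_null_comparison[rotated]) (use C in \<open>simp add: D_def\<close>)
qed

text \<open>At time 0 both u and u0 have the second derivative 1 - q^3, so they differ by an affine
  function; both vanish at +infinity, so the affine function is 0.\<close>

lemma initial_condition: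
  assumes "reciprocal_transformation W Wy P X Y u" and init: "\<And>y. W y 0 = Wf y"
  shows "u x 0 = u0 x"
proof -
  interpret reciprocal_transformation W Wy P X Y u by fact
  \<comment> \<open>Both functions have the derivative \<open>exp (- Wf y)\<close> and the same
    normalization at +infinity.\<close>
  have X_0: "X y 0 = xi y" for y
  proof -
    have "((\<lambda>y. X y 0 - xi y) has_real_derivative 0) (at z)" for z
      using DERIV_diff[OF X_y[of 0 z] xi_deriv[of z]] by (simp add: init Wf_def)
    then have const: "X z 0 - xi z = X y 0 - xi y" for z by (rule DERIV_isconst_all[OF allI])
    have "((\<lambda>y. (X y 0 - y) - (xi y - y)) \<longlongrightarrow> 0 - 0) at_top" by (intro tendsto_diff X_lim xi_limit) simp
    moreover have "(\<lambda>z. (X z 0 - z) - (xi z - z)) = (\<lambda>z. X y 0 - xi y)" using const by (intro ext) simp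
    ultimately have "((\<lambda>z::real. X y 0 - xi y) \<longlongrightarrow> 0) at_top" by simp
    then have "X y 0 - xi y = 0" by (rule tendsto_unique[OF trivial_limit_at_top_linorder tendsto_const])
    then show ?thesis by simp
  qed
  then have Y_0: "Y x 0 = y_init u0 x" for x using Y_X[of 0 "y_init u0 x"] by (simp add: xi_y_init)
  define h where "h x = u x 0 - u0 x" for x
  define h' where "h' x = - P (Y x 0) 0 - D 1 x" for x
  have h: "(h has_real_derivative h' x) (at x)" for x
    unfolding h_def h'_def by (intro DERIV_diff u_x) (use D_deriv[of 0] in \<open>simp_all add: D_def\<close>)
  have "(h' has_real_derivative 0) (at x)" for x
  proof -
    have "exp (W (Y x 0) 0) ^ 3 = 1 - D 2 x" by (simp add: Y_0 init Wf_def xi_y_init exp_w0(2) p_def)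
    then show ?thesis unfolding h'_def
      by (intro DERIV_cong[OF DERIV_diff[OF u_xx D_deriv]]) (simp_all add: numeral_2_eq_2)
  qed
  then have h'_const: "h' x = h' 0" for x by (rule DERIV_isconst_all[OF allI])
  have "((\<lambda>x. h x - h' 0 * x) has_real_derivative 0) (at x)" for x
    using DERIV_diff[OF h[of x] DERIV_cmult_Id[of "h' 0" x]] by (simp add: h'_const[of x])
  then have "h x - h' 0 * x = h 0 - h' 0 * 0" for x by (rule DERIV_isconst_all[OF allI])
  then obtain c d where affine: "\<And>x. h x = c * x + d" by (metis diff_eq_eq mult_zero_right diff_zero add.commute)
  have "filterlim (y_init u0) at_top at_top"
    using filterlim_tendsto_add_at_top[OF y_init_limit filterlim_ident] by simp
  from filterlim_compose[OF u_X_at_top this] have "((\<lambda>x. u x 0) \<longlongrightarrow> 0) at_top" by (simp add: X_0 xi_y_init)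
  from tendsto_diff[OF this u0_at_top] have "((\<lambda>x. c * x + d) \<longlongrightarrow> 0) at_top"
    by (simp add: affine flip: h_def)
  from affine_tendsto_0_at_top[OF this] affine[of x] show ?thesis by (simp add: h_def)
qed

end

theorem theorem2p2:
  fixes u0 :: "real \<Rightarrow> real"
    and M :: "real \<Rightarrow> complex \<Rightarrow> complex ^ 3 ^ 3"
    and S0 :: "complex \<Rightarrow> complex ^ 3 ^ 3"
    and Z :: "complex set"
    and lc jc :: "complex \<Rightarrow> 3"
    and v :: "complex \<Rightarrow> complex"
    and Mhat :: "real \<Rightarrow> real \<Rightarrow> complex \<Rightarrow> complex ^ 3 ^ 3"
    and qhat X Y u q :: "real \<Rightarrow> real \<Rightarrow> real"
  assumes "schwartz u0"
    and "\<And>x. - deriv (deriv u0) x + 1 > 0"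
    and "scattering_data u0 M S0 Z lc jc v"
    and "\<And>y t. t \<ge> 0 \<Longrightarrow> is_unique_rhp_solution S0 Z lc jc v y t (Mhat y t)"
    and "\<And>y t. t \<ge> 0 \<Longrightarrow> qhat y t > 0"
    and "\<And>y t. t \<ge> 0 \<Longrightarrow>
           (Mhat y t \<longlongrightarrow> structure_mat (qhat y t)) (at 0 within - Sigma_contour)"
    and "\<And>t. t \<ge> 0 \<Longrightarrow> ((\<lambda>y. qhat y t) \<longlongrightarrow> 1) at_top"
    and "\<And>y t. t \<ge> 0 \<Longrightarrow> ((\<lambda>y. X y t) has_real_derivative inverse (qhat y t)) (at y)"
    and "\<And>t. t \<ge> 0 \<Longrightarrow> ((\<lambda>y. X y t - y) \<longlongrightarrow> 0) at_top"
    and "\<And>y t. t \<ge> 0 \<Longrightarrow> Y (X y t) t = y"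
    and "\<And>x t. t \<ge> 0 \<Longrightarrow> X (Y x t) t = x"
    and "\<And>x t. t \<ge> 0 \<Longrightarrow>
           ((\<lambda>s. X (Y x t) s) has_real_derivative u x t) (at t within {0..})"
    and "\<And>x t. t \<ge> 0 \<Longrightarrow> q x t = qhat (Y x t) t"
  shows "q_hat_equation qhat \<and>
         (transport_equation u q \<and> xx_relation u q \<and> short_wave_DP_equation u \<and>
          (\<forall>w p. (\<forall>x. \<forall>t\<ge>0. p x t > 0) \<longrightarrow>
             (transport_equation w p \<and> xx_relation w p
                \<longleftrightarrow> short_wave_DP_equation w \<and> xx_relation w p))) \<and>
         (\<forall>x. u x 0 = u0 x)"
proof -
  interpret schwartz_data u0 by unfold_locales (use assms(1,2) in auto)
  define W where "W y t = ln (qhat y t)" for y t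
  have qhat_eq: "qhat y t = exp (W y t)" if "t \<ge> 0" for y t using assms(5)[OF that] by (simp add: W_def)
  have W_eq: "W = (\<lambda>y t. ln (qhat y t))" by (simp add: fun_eq_iff W_def)
  have init: "W y 0 = Wf y" for y
    unfolding W_eq by (rule global_solution(2)[OF assms(3) assms(4) assms(6)])
  have "\<exists>Wy P. tzitzeica_global W Wy P"
    unfolding W_eq by (rule global_solution(1)[OF assms(3) assms(4) assms(6)])
  then obtain Wy P where "tzitzeica_global W Wy P" by (elim exE)
  then interpret tzitzeica_global W Wy P .
  interpret reciprocal_transformation W Wy P X Y u
  proof
    show "((\<lambda>y. X y t) has_real_derivative exp (- W y t)) (at y)" if "t \<ge> 0" for y t
      using assms(8)[OF that] by (simp add: qhat_eq[OF that] exp_minus)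
  qed (use assms in auto)
  have q_eq: "q x t = exp (W (Y x t) t)" if "t \<ge> 0" for x t using assms(13)[OF that] by (simp add: qhat_eq[OF that])
  have "q_hat_equation qhat"
    unfolding q_hat_equation_def
  proof (intro exI allI impI conjI)
    fix y t :: real assume t: "t \<ge> 0"
    show "((\<lambda>y. qhat y t) has_real_derivative exp (W y t) * Wy y t) (at y)"
      unfolding qhat_eq[OF t] by (rule DERIV_chain2[OF DERIV_exp W_y[OF t]])
    \<comment> \<open>In terms of \<open>W\<close> the logarithmic derivative of \<open>qhat\<close>
      is \<open>Wy\<close>, and the right side of (i) is the nonlinearity.\<close>
    have "fpot (W y t) = (qhat y t)\<^sup>2 - 1 / qhat y t"
      by (simp add: fpot_def qhat_eq[OF t] exp_minus power2_eq_square divide_inverse flip: exp_add)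
    then have "(Wy y has_real_derivative (qhat y t)\<^sup>2 - 1 / qhat y t) (at t within {0..})" using Wy_t[OF t, of y] by simp
    then show "((\<lambda>t. exp (W y t) * Wy y t / qhat y t) has_real_derivative (qhat y t)\<^sup>2 - 1 / qhat y t) (at t within {0..})"
      by (rule has_field_derivative_transform_within[where d=1]) (use t in \<open>auto simp: qhat_eq\<close>)
  qed
  moreover have transport: "transport_equation u q" by (rule transport_equation_cong[OF transport_equation q_eq])
  moreover have xx: "xx_relation u q" using xx_relation unfolding xx_relation_def by (simp add: q_eq)
  moreover have "short_wave_DP_equation u" by (rule transport_imp_short_wave_DP[OF transport xx])
  moreover have "transport_equation w p \<and> xx_relation w p \<longleftrightarrow> short_wave_DP_equation w \<and> xx_relation w p"
    if "\<forall>x. \<forall>t\<ge>0. p x t > 0" for w p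
    using transport_imp_short_wave_DP short_wave_DP_imp_transport that by blast
  moreover have "u x 0 = u0 x" for x
    by (rule initial_condition[of W Wy P X Y u]) (unfold_locales, rule init)
  ultimately show ?thesis by blast
qed

end
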